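(* Let $\mathfrak{g}$ be a finite-dimensional complex simple Lie algebra, let $\lambda,\lambda'\in\mathfrak{h}^*$, $\mu,\mu'\in\Lambda^+\setminus\{0\}$ and $k,c,l,a,b,k',c',l',a',b'\in\mathbb{C}$ with $0\le\mathrm{Re}\,a<1$ and $0\le\mathrm{Re}\,a'<1$. Then $L_{\lambda,l,k,c}^{\mu,a,b}\cong L_{\lambda',l',k',c'}^{\mu',a',b'}$ as $\mathfrak{L(g)}$-modules if and only if $(\lambda,l,k,c,\mu,a,b)=(\lambda',l',k',c',\mu',a',b')$.
   Context: All vector spaces are over $\mathbb{C}$; $\mathbb{N}$ denotes the positive integers, $\mathbb{Z}_+$ the nonnegative integers. $\mathfrak{g}$ is a finite-dimensional complex simple Lie algebra with Cartan subalgebra $\mathfrak{h}$, positive roots $\Delta_+$, triangular decomposition $\mathfrak{g}=\mathfrak{n}_-\oplus\mathfrak{h}\oplus\mathfrak{n}_+$, and invariant form $(\cdot\mid\cdot)$ (Killing form normalized so that $(\theta\mid\theta)=2$ for the highest root $\theta$). $\Lambda^+$ is the set of dominant integral weights of $\mathfrak{g}$. The affine-Virasoro algebra $\mathfrak{L(g)}=\bigoplus_{n\in\mathbb{Z}}\mathfrak{g}(n)\oplus\bigoplus_{n\in\mathbb{Z}}\mathbb{C}d_n\oplus\mathbb{C}\mathbf{k}\oplus\mathbb{C}\mathbf{c}$, where $\mathfrak{g}(n)=\{x(n):x\in\mathfrak{g}\}$ is a copy of $\mathfrak{g}$ ($x(n)=x\otimes t^n$, $x(0)$ identified with $x$), has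 brackets $[x(m),y(n)]=[x,y](m+n)+m(x\mid y)\delta_{m+n,0}\mathbf{k}$, $[d_m,d_n]=(n-m)d_{m+n}+\delta_{m+n,0}\frac{m^3-m}{12}\mathbf{c}$, $[d_n,x(m)]=m\,x(m+n)$, with $\mathbf{k},\mathbf{c}$ central. Put $\mathcal{H}=\mathfrak{h}+\mathbb{C}d_0+\mathbb{C}\mathbf{k}+\mathbb{C}\mathbf{c}$, $\mathfrak{L(g)}_+=\mathfrak{n}_+\oplus\bigoplus_{n\in\mathbb{N}}(\mathfrak{g}(n)\oplus\mathbb{C}d_n)$, $\mathfrak{L(g)}_-=\mathfrak{n}_-\oplus\bigoplus_{n\in\mathbb{N}}(\mathfrak{g}(-n)\oplus\mathbb{C}d_{-n})$. An element $P\in U(\mathfrak{L(g)})$ is homogeneous of degree $\deg(P)=m$ if $[d_0,P]=mP$. For $\lambda\in\mathfrak{h}^*$, $l,k,c\in\mathbb{C}$, the Verma module $M(\lambda,l,k,c)$ is induced from the one-dimensional $\mathcal{H}\oplus\mathfrak{L(g)}_+$-module $\mathbb{C}u$ with $hu=\lambda(h)u$ ($h\in\mathfrak{h}$), $d_0u=lu$, $\mathbf{k}u=ku$, $\mathbf{c}u=cu$, $\mathfrak{L(g)}_+u=0$. $L(\lambda,l,k,c)$ is its unique irreducible quotient, with highest weight vector $\bar u$ (the image of $u$). $L(\mu)$ is the finite-dimensional irreducible $\mathfrak{g}$-module with highest weight $\mu\in\Lambda^+$. For $a,b\in\mathbb{C}$, $L_{\lambda,l,k,c}^{\mu,a,b}$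 is the vector space $L(\lambda,l,k,c)\otimes L(\mu)\otimes\mathbb{C}[t^{\pm1}]$ with $\mathfrak{L(g)}$-action $d_m(P\bar u\otimes v\otimes t^n)=\big((d_m+a+n-\deg(P)+bm)P\bar u\big)\otimes v\otimes t^{m+n}$, $x(m)(P\bar u\otimes v\otimes t^n)=\big(x(m)P\bar u\otimes v+P\bar u\otimes xv\big)\otimes t^{m+n}$, with $\mathbf{k},\mathbf{c}$ acting as the scalars $k,c$, for $x\in\mathfrak{g}$, $v\in L(\mu)$, $m,n\in\mathbb{Z}$ and homogeneous $P\in U(\mathfrak{L(g)}_-)$. This is an $\mathfrak{L(g)}$-module, isomorphic via $P\bar u\otimes v\otimes t^n\mapsto P\bar u\otimes v\otimes t^{n+\deg(P)}$ to the tensor product of $L(\lambda,l,k,c)$ with the loop module $L_{a,b}(\mu)=L(\mu)\otimes\mathbb{C}[t^{\pm1}]$, on which $d_m(v\otimes t^n)=(a+bm+n)v\otimes t^{m+n}$, $x(m)(v\otimes t^n)=(xv)\otimes t^{m+n}$, $\mathbf{k}=\mathbf{c}=0$. *)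

theory Defs
  imports
    Complex_Main
    "HOL-Library.FuncSet"
    "HOL-Library.Poly_Mapping"
    "HOL-Library.Product_Plus"
    "HOL-Algebra.AbelCoset"
    "HOL-Algebra.Module"
begin

section \<open>Lie algebras and their modules\<close>

locale lie_algebra = vector_space scale
  for scale :: "complex \<Rightarrow> 'l::ab_group_add \<Rightarrow> 'l" +
  fixes bracket :: "'l \<Rightarrow> 'l \<Rightarrow> 'l"
  assumes bracket_add_left: "bracket (x + y) z = bracket x z + bracket y z"
    and bracket_add_right: "bracket x (y + z) = bracket x y + bracket x z"
    and bracket_scale_left: "bracket (scale r x) y = scale r (bracket x y)"
    and bracket_scale_right: "bracket x (scale r y) = scale r (bracket x y)"
    and bracket_self: "bracket x x = 0"
    and jacobi: "bracket x (bracket y z) + bracket y (bracket z x) + bracket z (bracket x y) = 0"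

definition complex_field :: "complex ring" where
  "complex_field = \<lparr>carrier = UNIV, mult = (*), one = 1, zero = 0, add = (+)\<rparr>"

text \<open>A module over a Lie algebra of type \<open>'l\<close> is a complex vector space, in the sense of
  \<open>HOL-Algebra\<close>, with an action.  The fields \<open>mult\<close> and \<open>one\<close>, which module records inherit
  from ring records, carry no meaning.\<close>

record ('l, 'v) lie_rep = "(complex, 'v) module" +
  act :: "'l \<Rightarrow> 'v \<Rightarrow> 'v"

definition lie_module ::
  "(complex \<Rightarrow> 'l \<Rightarrow> 'l) \<Rightarrow> ('l \<Rightarrow> 'l \<Rightarrow> 'l) \<Rightarrow> ('l::ab_group_add, 'v) lie_rep \<Rightarrow> bool" where
  "lie_module scale bracket M \<longleftrightarrow>
     Module.module complex_field M \<and>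
     (\<forall>x. \<forall>v\<in>carrier M. act M x v \<in> carrier M) \<and>
     (\<forall>x. \<forall>v\<in>carrier M. \<forall>w\<in>carrier M. act M x (v \<oplus>\<^bsub>M\<^esub> w) = act M x v \<oplus>\<^bsub>M\<^esub> act M x w) \<and>
     (\<forall>x r. \<forall>v\<in>carrier M. act M x (r \<odot>\<^bsub>M\<^esub> v) = r \<odot>\<^bsub>M\<^esub> act M x v) \<and>
     (\<forall>x y. \<forall>v\<in>carrier M. act M (x + y) v = act M x v \<oplus>\<^bsub>M\<^esub> act M y v) \<and>
     (\<forall>x r. \<forall>v\<in>carrier M. act M (scale r x) v = r \<odot>\<^bsub>M\<^esub> act M x v) \<and>
     (\<forall>x y. \<forall>v\<in>carrier M.
        act M (bracket x y) v = act M x (act M y v) \<ominus>\<^bsub>M\<^esub> act M y (act M x v))"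

definition lie_submodule :: "'v set \<Rightarrow> ('l, 'v) lie_rep \<Rightarrow> bool" where
  "lie_submodule N M \<longleftrightarrow>
     submodule N complex_field M \<and> (\<forall>x. \<forall>v\<in>N. act M x v \<in> N)"

definition irreducible_rep :: "('l, 'v) lie_rep \<Rightarrow> bool" where
  "irreducible_rep M \<longleftrightarrow>
     carrier M \<noteq> {\<zero>\<^bsub>M\<^esub>} \<and> (\<forall>N. lie_submodule N M \<longrightarrow> N = {\<zero>\<^bsub>M\<^esub>} \<or> N = carrier M)"

definition finite_dim_rep :: "('l, 'v) lie_rep \<Rightarrow> bool" where
  "finite_dim_rep M \<longleftrightarrow>
     (\<exists>S. finite S \<and> S \<subseteq> carrier M \<and>
        (\<forall>v\<in>carrier M. \<exists>r. v = (\<Oplus>\<^bsub>M\<^esub>s\<in>S. r s \<odot>\<^bsub>M\<^esub> s)))"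

definition isomorphic_reps :: "('l, 'v) lie_rep \<Rightarrow> ('l, 'w) lie_rep \<Rightarrow> bool" where
  "isomorphic_reps M N \<longleftrightarrow>
     (\<exists>\<phi>. bij_betw \<phi> (carrier M) (carrier N) \<and>
        (\<forall>v\<in>carrier M. \<forall>w\<in>carrier M. \<phi> (v \<oplus>\<^bsub>M\<^esub> w) = \<phi> v \<oplus>\<^bsub>N\<^esub> \<phi> w) \<and>
        (\<forall>r. \<forall>v\<in>carrier M. \<phi> (r \<odot>\<^bsub>M\<^esub> v) = r \<odot>\<^bsub>N\<^esub> \<phi> v) \<and>
        (\<forall>x. \<forall>v\<in>carrier M. \<phi> (act M x v) = act N x (\<phi> v)))"

definition quotient_rep :: "('l, 'v) lie_rep \<Rightarrow> 'v set \<Rightarrow> ('l, 'v set) lie_rep" where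
  "quotient_rep M N =
     \<lparr>carrier = a_rcosets\<^bsub>M\<^esub> N, mult = undefined, one = undefined,
      zero = N, add = set_add M,
      smult = (\<lambda>r X. \<Union>v\<in>X. N +>\<^bsub>M\<^esub> (r \<odot>\<^bsub>M\<^esub> v)),
      act = (\<lambda>x X. \<Union>v\<in>X. N +>\<^bsub>M\<^esub> act M x v)\<rparr>"

definition irreducible_quotient :: "('l, 'v) lie_rep \<Rightarrow> ('l, 'v set) lie_rep" where
  "irreducible_quotient M =
     quotient_rep M (THE N. lie_submodule N M \<and> irreducible_rep (quotient_rep M N))"


section \<open>Free vector spaces\<close>

definition fscale :: "complex \<Rightarrow> ('i \<Rightarrow>\<^sub>0 complex) \<Rightarrow> 'i \<Rightarrow>\<^sub>0 complex" where
  "fscale r f = Poly_Mapping.map ((*) r) f"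

lemma lookup_fscale [simp]:
  "Poly_Mapping.lookup (fscale r f) i = r * Poly_Mapping.lookup f i"
  by (simp add: fscale_def Poly_Mapping.map.rep_eq when_def)

global_interpretation free_vs: vector_space "fscale :: complex \<Rightarrow> ('i \<Rightarrow>\<^sub>0 complex) \<Rightarrow> _"
  defines free_span = free_vs.span
  by unfold_locales
    (auto intro!: poly_mapping_eqI simp: lookup_add algebra_simps)

abbreviation basis_vec :: "'i \<Rightarrow> 'i \<Rightarrow>\<^sub>0 complex" where
  "basis_vec i \<equiv> Poly_Mapping.single i 1"

definition lin_ext :: "('i \<Rightarrow> 'j \<Rightarrow>\<^sub>0 complex) \<Rightarrow> ('i \<Rightarrow>\<^sub>0 complex) \<Rightarrow> 'j \<Rightarrow>\<^sub>0 complex" where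
  "lin_ext \<alpha> f = (\<Sum>i\<in>Poly_Mapping.keys f. fscale (Poly_Mapping.lookup f i) (\<alpha> i))"

text \<open>The free vector space on the set \<open>A\<close>, where \<open>x\<close> acts by the linear extension of \<open>\<alpha> x\<close>.
  In general this is not a module; the quotients of it that are used below are.\<close>

definition free_rep ::
  "'i set \<Rightarrow> ('l \<Rightarrow> 'i \<Rightarrow> 'i \<Rightarrow>\<^sub>0 complex) \<Rightarrow> ('l, 'i \<Rightarrow>\<^sub>0 complex) lie_rep" where
  "free_rep A \<alpha> =
     \<lparr>carrier = {f. Poly_Mapping.keys f \<subseteq> A}, mult = undefined, one = undefined,
      zero = 0, add = (+), smult = fscale, act = (\<lambda>x. lin_ext (\<alpha> x))\<rparr>"


section \<open>Enveloping algebras and induction from a character\<close>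

text \<open>The universal enveloping algebra is the free associative algebra (the free vector space on
  words) modulo the span of \<open>enveloping_relations\<close>, which is a two-sided ideal.\<close>

inductive_set enveloping_relations ::
    "(complex \<Rightarrow> 'l::ab_group_add \<Rightarrow> 'l) \<Rightarrow> ('l \<Rightarrow> 'l \<Rightarrow> 'l) \<Rightarrow> ('l list \<Rightarrow>\<^sub>0 complex) set"
  for scale :: "complex \<Rightarrow> 'l::ab_group_add \<Rightarrow> 'l" and bracket :: "'l \<Rightarrow> 'l \<Rightarrow> 'l"
where
  env_add: "basis_vec (u @ [x + y] @ w) - basis_vec (u @ [x] @ w) - basis_vec (u @ [y] @ w)
      \<in> enveloping_relations scale bracket"
| env_scale: "basis_vec (u @ [scale r x] @ w) - fscale r (basis_vec (u @ [x] @ w))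
      \<in> enveloping_relations scale bracket"
| env_bracket:
    "basis_vec (u @ [x, y] @ w) - basis_vec (u @ [y, x] @ w) - basis_vec (u @ [bracket x y] @ w)
      \<in> enveloping_relations scale bracket"

text \<open>\<open>induced_rep scale bracket \<chi>\<close> is the module induced from a one-dimensional module
  \<open>\<complex>u\<close> of a subalgebra \<open>\<bb>\<close>, where \<open>\<chi>\<close> is the graph of the character of \<open>\<bb>\<close> on \<open>\<complex>u\<close>:
  the relation \<open>P b \<otimes> u = P \<otimes> b u\<close> reads \<open>P b = \<chi>(b) P\<close> when \<open>P \<otimes> u\<close> is identified
  with \<open>P\<close>.  The vector \<open>1 \<otimes> u\<close> is the class of the empty word.\<close>

definition induced_relations :: "('l \<times> complex) set \<Rightarrow> ('l list \<Rightarrow>\<^sub>0 complex) set" where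
  "induced_relations \<chi> =
     {basis_vec (w @ [b]) - fscale r (basis_vec w) | w b r. (b, r) \<in> \<chi>}"

definition induced_rep ::
  "(complex \<Rightarrow> 'l \<Rightarrow> 'l) \<Rightarrow> ('l \<Rightarrow> 'l \<Rightarrow> 'l) \<Rightarrow> ('l \<times> complex) set \<Rightarrow>
     ('l::ab_group_add, ('l list \<Rightarrow>\<^sub>0 complex) set) lie_rep" where
  "induced_rep scale bracket \<chi> =
     quotient_rep (free_rep UNIV (\<lambda>x w. basis_vec (x # w)))
       (free_span (enveloping_relations scale bracket \<union> induced_relations \<chi>))"


section \<open>Finite-dimensional simple Lie algebras\<close>

text \<open>A Lie algebra on the type \<open>'g\<close> with a subalgebra (the Cartan subalgebra), a set of simple
  roots (which determines the positive roots) and a bilinear form.\<close>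

record 'g lie_data =
  scl :: "complex \<Rightarrow> 'g \<Rightarrow> 'g"
  brk :: "'g \<Rightarrow> 'g \<Rightarrow> 'g"
  csa :: "'g set"
  simple_roots :: "('g \<Rightarrow> complex) set"
  form :: "'g \<Rightarrow> 'g \<Rightarrow> complex"

abbreviation gspan :: "'g::ab_group_add lie_data \<Rightarrow> 'g set \<Rightarrow> 'g set" where
  "gspan G \<equiv> module.span (scl G)"

definition finite_dimensional :: "'g::ab_group_add lie_data \<Rightarrow> bool" where
  "finite_dimensional G \<longleftrightarrow> (\<exists>B. finite B \<and> gspan G B = UNIV)"

definition simple_lie_algebra :: "'g::ab_group_add lie_data \<Rightarrow> bool" where
  "simple_lie_algebra G \<longleftrightarrow>
     lie_algebra (scl G) (brk G) \<and> (\<exists>x y. brk G x y \<noteq> 0) \<and>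
     (\<forall>I. module.subspace (scl G) I \<and> (\<forall>x. \<forall>y\<in>I. brk G x y \<in> I) \<longrightarrow> I = {0} \<or> I = UNIV)"

fun lower_central_series :: "'g::ab_group_add lie_data \<Rightarrow> 'g set \<Rightarrow> nat \<Rightarrow> 'g set" where
  "lower_central_series G K 0 = K"
| "lower_central_series G K (Suc n) =
     gspan G {brk G x y | x y. x \<in> K \<and> y \<in> lower_central_series G K n}"

definition cartan_subalgebra :: "'g::ab_group_add lie_data \<Rightarrow> bool" where
  "cartan_subalgebra G \<longleftrightarrow>
     module.subspace (scl G) (csa G) \<and>
     (\<forall>x\<in>csa G. \<forall>y\<in>csa G. brk G x y \<in> csa G) \<and>
     (\<exists>n. lower_central_series G (csa G) n = {0}) \<and>
     {x. \<forall>y\<in>csa G. brk G x y \<in> csa G} = csa G"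

text \<open>Functionals on the Cartan subalgebra are \<^const>\<open>extensional\<close>, so that equality of
  functionals is equality in HOL.\<close>

definition csa_dual :: "'g::ab_group_add lie_data \<Rightarrow> ('g \<Rightarrow> complex) set" where
  "csa_dual G =
     {f \<in> extensional (csa G).
        (\<forall>x\<in>csa G. \<forall>y\<in>csa G. f (x + y) = f x + f y) \<and>
        (\<forall>r. \<forall>x\<in>csa G. f (scl G r x) = r * f x)}"

definition zero_weight :: "'g::ab_group_add lie_data \<Rightarrow> 'g \<Rightarrow> complex" where
  "zero_weight G = (\<lambda>x\<in>csa G. 0)"

definition neg_weight :: "'g::ab_group_add lie_data \<Rightarrow> ('g \<Rightarrow> complex) \<Rightarrow> 'g \<Rightarrow> complex" where
  "neg_weight G \<alpha> = (\<lambda>x\<in>csa G. - \<alpha> x)"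

definition root_space :: "'g::ab_group_add lie_data \<Rightarrow> ('g \<Rightarrow> complex) \<Rightarrow> 'g set" where
  "root_space G \<alpha> = {x. \<forall>h\<in>csa G. brk G h x = scl G (\<alpha> h) x}"

definition roots :: "'g::ab_group_add lie_data \<Rightarrow> ('g \<Rightarrow> complex) set" where
  "roots G = {\<alpha> \<in> csa_dual G - {zero_weight G}. root_space G \<alpha> \<noteq> {0}}"

definition simple_sum ::
  "'g::ab_group_add lie_data \<Rightarrow> (('g \<Rightarrow> complex) \<Rightarrow> complex) \<Rightarrow> 'g \<Rightarrow> complex" where
  "simple_sum G r = (\<lambda>x\<in>csa G. \<Sum>\<alpha>\<in>simple_roots G. r \<alpha> * \<alpha> x)"

definition nonneg_sums :: "'g::ab_group_add lie_data \<Rightarrow> ('g \<Rightarrow> complex) set" where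
  "nonneg_sums G = {simple_sum G (\<lambda>\<alpha>. of_nat (n \<alpha>)) | n :: ('g \<Rightarrow> complex) \<Rightarrow> nat. True}"

definition simple_root_system :: "'g::ab_group_add lie_data \<Rightarrow> bool" where
  "simple_root_system G \<longleftrightarrow>
     finite (simple_roots G) \<and> simple_roots G \<subseteq> roots G \<and>
     (\<forall>r. simple_sum G r = zero_weight G \<longrightarrow> (\<forall>\<alpha>\<in>simple_roots G. r \<alpha> = 0)) \<and>
     (\<forall>\<beta>\<in>roots G. \<beta> \<in> nonneg_sums G \<or> neg_weight G \<beta> \<in> nonneg_sums G)"

definition positive_roots :: "'g::ab_group_add lie_data \<Rightarrow> ('g \<Rightarrow> complex) set" where
  "positive_roots G = roots G \<inter> nonneg_sums G"

definition nil_pos :: "'g::ab_group_add lie_data \<Rightarrow> 'g set" where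
  "nil_pos G = gspan G (\<Union>\<alpha>\<in>positive_roots G. root_space G \<alpha>)"

definition nil_neg :: "'g::ab_group_add lie_data \<Rightarrow> 'g set" where
  "nil_neg G = gspan G (\<Union>\<alpha>\<in>positive_roots G. root_space G (neg_weight G \<alpha>))"

definition triangular_decomposition :: "'g::ab_group_add lie_data \<Rightarrow> bool" where
  "triangular_decomposition G \<longleftrightarrow>
     (\<forall>x. \<exists>!(y, h, z). y \<in> nil_neg G \<and> h \<in> csa G \<and> z \<in> nil_pos G \<and> x = y + h + z)"

text \<open>The trace is computed in an arbitrary basis, on which it does not depend.\<close>

definition trace :: "'g::ab_group_add lie_data \<Rightarrow> ('g \<Rightarrow> 'g) \<Rightarrow> complex" where
  "trace G f =
     (let B = (SOME B. \<not> module.dependent (scl G) B \<and> gspan G B = UNIV)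
      in \<Sum>b\<in>B. module.representation (scl G) B (f b) b)"

definition killing_form :: "'g::ab_group_add lie_data \<Rightarrow> 'g \<Rightarrow> 'g \<Rightarrow> complex" where
  "killing_form G x y = trace G (\<lambda>z. brk G x (brk G y z))"

text \<open>The form on the dual of the Cartan subalgebra which is induced by \<^const>\<open>form\<close>.\<close>

definition weight_vector :: "'g::ab_group_add lie_data \<Rightarrow> ('g \<Rightarrow> complex) \<Rightarrow> 'g" where
  "weight_vector G \<alpha> = (THE t. t \<in> csa G \<and> (\<forall>h\<in>csa G. form G t h = \<alpha> h))"

definition weight_form ::
  "'g::ab_group_add lie_data \<Rightarrow> ('g \<Rightarrow> complex) \<Rightarrow> ('g \<Rightarrow> complex) \<Rightarrow> complex" where
  "weight_form G \<alpha> \<beta> = form G (weight_vector G \<alpha>) (weight_vector G \<beta>)"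

definition highest_root :: "'g::ab_group_add lie_data \<Rightarrow> ('g \<Rightarrow> complex) \<Rightarrow> bool" where
  "highest_root G \<theta> \<longleftrightarrow>
     \<theta> \<in> roots G \<and> (\<forall>\<beta>\<in>roots G. (\<lambda>x\<in>csa G. \<theta> x - \<beta> x) \<in> nonneg_sums G)"

definition normalized_killing_form :: "'g::ab_group_add lie_data \<Rightarrow> bool" where
  "normalized_killing_form G \<longleftrightarrow>
     (\<exists>r. \<forall>x y. form G x y = r * killing_form G x y) \<and>
     (\<exists>\<theta>. highest_root G \<theta> \<and> weight_form G \<theta> \<theta> = 2)"

definition dominant_integral_weights :: "'g::ab_group_add lie_data \<Rightarrow> ('g \<Rightarrow> complex) set" where
  "dominant_integral_weights G =
     {\<mu> \<in> csa_dual G. \<forall>\<alpha>\<in>positive_roots G. 2 * weight_form G \<mu> \<alpha> / weight_form G \<alpha> \<alpha> \<in> \<nat>}"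

text \<open>\<open>W\<close> is (a realization of) the finite-dimensional irreducible module \<open>L(\<mu>)\<close>.\<close>

definition is_fd_irreducible ::
  "'g::ab_group_add lie_data \<Rightarrow> ('g \<Rightarrow> complex) \<Rightarrow> ('g, 'w) lie_rep \<Rightarrow> bool" where
  "is_fd_irreducible G \<mu> W \<longleftrightarrow>
     lie_module (scl G) (brk G) W \<and> finite_dim_rep W \<and> irreducible_rep W \<and>
     (\<exists>w\<in>carrier W. w \<noteq> \<zero>\<^bsub>W\<^esub> \<and>
        (\<forall>x\<in>nil_pos G. act W x w = \<zero>\<^bsub>W\<^esub>) \<and>
        (\<forall>h\<in>csa G. act W h w = \<mu> h \<odot>\<^bsub>W\<^esub> w))"


section \<open>The affine-Virasoro algebra\<close>

text \<open>The components of \<open>(f, p, \<kappa>, \<gamma>)\<close> are the coefficients of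
  \<open>\<Sum>\<^sub>m (f m)(m) + \<Sum>\<^sub>m p m \<cdot> d\<^sub>m + \<kappa> \<cdot> \<k> + \<gamma> \<cdot> \<c>\<close>.\<close>

type_synonym 'g affvir = "(int \<Rightarrow>\<^sub>0 'g) \<times> (int \<Rightarrow>\<^sub>0 complex) \<times> complex \<times> complex"

definition cur :: "int \<Rightarrow> 'g::ab_group_add \<Rightarrow> 'g affvir" where
  "cur m x = (Poly_Mapping.single m x, 0, 0, 0)"

definition vir :: "int \<Rightarrow> 'g::ab_group_add affvir" where
  "vir m = (0, Poly_Mapping.single m 1, 0, 0)"

definition cen_k :: "'g::ab_group_add affvir" where
  "cen_k = (0, 0, 1, 0)"

definition cen_c :: "'g::ab_group_add affvir" where
  "cen_c = (0, 0, 0, 1)"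

definition av_scale :: "'g::ab_group_add lie_data \<Rightarrow> complex \<Rightarrow> 'g affvir \<Rightarrow> 'g affvir" where
  "av_scale G r = (\<lambda>(f, p, \<kappa>, \<gamma>). (Poly_Mapping.map (scl G r) f, fscale r p, r * \<kappa>, r * \<gamma>))"

definition av_bracket :: "'g::ab_group_add lie_data \<Rightarrow> 'g affvir \<Rightarrow> 'g affvir \<Rightarrow> 'g affvir" where
  "av_bracket G = (\<lambda>(f, p, _, _) (f', p', _, _).
     let F = Poly_Mapping.lookup f; F' = Poly_Mapping.lookup f';
         Q = Poly_Mapping.lookup p; Q' = Poly_Mapping.lookup p';
         A = Poly_Mapping.keys f; A' = Poly_Mapping.keys f';
         B = Poly_Mapping.keys p; B' = Poly_Mapping.keys p'
     in ((\<Sum>m\<in>A. \<Sum>n\<in>A'. Poly_Mapping.single (m + n) (brk G (F m) (F' n)))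
           + (\<Sum>n\<in>B. \<Sum>m\<in>A'. Poly_Mapping.single (m + n) (scl G (of_int m * Q n) (F' m)))
           - (\<Sum>n\<in>B'. \<Sum>m\<in>A. Poly_Mapping.single (m + n) (scl G (of_int m * Q' n) (F m))),
         \<Sum>m\<in>B. \<Sum>n\<in>B'. Poly_Mapping.single (m + n) (of_int (n - m) * Q m * Q' n),
         \<Sum>m\<in>A. of_int m * form G (F m) (F' (- m)),
         \<Sum>m\<in>B. of_int (m ^ 3 - m) / 12 * Q m * Q' (- m)))"

lemma av_bracket_cur_cur:
  assumes "lie_algebra (scl G) (brk G)" "form G x 0 = 0" "form G 0 y = 0"
  shows "av_bracket G (cur m x) (cur n y) =
     cur (m + n) (brk G x y) + (if m + n = 0 then (0, 0, of_int m * form G x y, 0) else 0)"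
proof -
  interpret lie_algebra "scl G" "brk G" by fact
  have "brk G z 0 = 0" "brk G 0 z = 0" for z
    using bracket_add_left[of 0 0 z] bracket_add_right[of z 0 0] by auto
  moreover have "n = - m \<longleftrightarrow> m + n = 0" by auto
  ultimately show ?thesis
    using assms(2,3)
    by (cases "x = 0"; cases "y = 0") (auto simp: av_bracket_def cur_def zero_prod_def lookup_single when_def)
qed

lemma av_bracket_vir_vir:
  "av_bracket G (vir m) (vir n) =
     (0, Poly_Mapping.single (m + n) (of_int (n - m)), 0,
      if m + n = 0 then of_int (m ^ 3 - m) / 12 else 0)"
  by (auto simp: av_bracket_def vir_def lookup_single when_def Let_def)

lemma av_bracket_vir_cur:
  assumes "lie_algebra (scl G) (brk G)"
  shows "av_bracket G (vir n) (cur m x) = cur (m + n) (scl G (of_int m) x)"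
proof -
  interpret lie_algebra "scl G" "brk G" by fact
  show ?thesis
    by (cases "x = 0") (auto simp: av_bracket_def vir_def cur_def Let_def)
qed

definition av_pos :: "'g::ab_group_add lie_data \<Rightarrow> 'g affvir set" where
  "av_pos G =
     {(f, p, 0, 0) | f p.
        Poly_Mapping.lookup f 0 \<in> nil_pos G \<and> Poly_Mapping.keys f \<subseteq> {0..} \<and>
        Poly_Mapping.keys p \<subseteq> {1..}}"

definition av_borel_character ::
  "'g::ab_group_add lie_data \<Rightarrow> ('g \<Rightarrow> complex) \<Rightarrow> complex \<Rightarrow> complex \<Rightarrow> complex \<Rightarrow>
     ('g affvir \<times> complex) set" where
  "av_borel_character G lam l k c =
     {(cur 0 h + av_scale G \<delta> (vir 0) + av_scale G \<kappa> cen_k + av_scale G \<gamma> cen_c + z,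
       lam h + \<delta> * l + \<kappa> * k + \<gamma> * c) | h \<delta> \<kappa> \<gamma> z. h \<in> csa G \<and> z \<in> av_pos G}"

definition av_verma ::
  "'g::ab_group_add lie_data \<Rightarrow> ('g \<Rightarrow> complex) \<Rightarrow> complex \<Rightarrow> complex \<Rightarrow> complex \<Rightarrow>
     ('g affvir, ('g affvir list \<Rightarrow>\<^sub>0 complex) set) lie_rep" where
  "av_verma G lam l k c = induced_rep (av_scale G) (av_bracket G) (av_borel_character G lam l k c)"

definition av_irreducible ::
  "'g::ab_group_add lie_data \<Rightarrow> ('g \<Rightarrow> complex) \<Rightarrow> complex \<Rightarrow> complex \<Rightarrow> complex \<Rightarrow>
     ('g affvir, ('g affvir list \<Rightarrow>\<^sub>0 complex) set set) lie_rep" where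
  "av_irreducible G lam l k c = irreducible_quotient (av_verma G lam l k c)"


text \<open>The degree in \<open>U(\<LL>(\<gg>))\<close>: \<open>homogeneous G m P\<close> states \<open>[d\<^sub>0, P] = m P\<close> for the class of \<open>P\<close>.\<close>

definition homogeneous ::
  "'g::ab_group_add lie_data \<Rightarrow> int \<Rightarrow> ('g affvir list \<Rightarrow>\<^sub>0 complex) \<Rightarrow> bool" where
  "homogeneous G m P \<longleftrightarrow>
     lin_ext (\<lambda>w. basis_vec (vir 0 # w)) P - lin_ext (\<lambda>w. basis_vec (w @ [vir 0])) P
       - fscale (of_int m) P
     \<in> free_span (enveloping_relations (av_scale G) (av_bracket G))"

lemma lin_ext_superset:
  assumes "finite A" "Poly_Mapping.keys f \<subseteq> A"
  shows "lin_ext \<alpha> f = (\<Sum>i\<in>A. fscale (Poly_Mapping.lookup f i) (\<alpha> i))"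
  unfolding lin_ext_def
  by (rule sum.mono_neutral_left) (use assms in \<open>auto simp: in_keys_iff\<close>)

lemma lin_ext_add: "lin_ext \<alpha> (f + g) = lin_ext \<alpha> f + lin_ext \<alpha> g"
proof -
  let ?A = "Poly_Mapping.keys f \<union> Poly_Mapping.keys g"
  have "lin_ext \<alpha> h = (\<Sum>i\<in>?A. fscale (Poly_Mapping.lookup h i) (\<alpha> i))"
    if "h \<in> {f, g, f + g}" for h
    using that Poly_Mapping.keys_add[of f g] by (intro lin_ext_superset) auto
  then show ?thesis
    by (simp add: lookup_add free_vs.scale_left_distrib sum.distrib)
qed

lemma lin_ext_scale: "lin_ext \<alpha> (fscale r f) = fscale r (lin_ext \<alpha> f)"
proof -
  have "Poly_Mapping.keys (fscale r f) \<subseteq> Poly_Mapping.keys f"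
    by (auto simp: in_keys_iff)
  then have "lin_ext \<alpha> (fscale r f) =
      (\<Sum>i\<in>Poly_Mapping.keys f. fscale (Poly_Mapping.lookup (fscale r f) i) (\<alpha> i))"
    by (intro lin_ext_superset) auto
  then show ?thesis
    by (simp add: lin_ext_def free_vs.scale_sum_right)
qed

lemma lin_ext_diff: "lin_ext \<alpha> (f - g) = lin_ext \<alpha> f - lin_ext \<alpha> g"
  using lin_ext_add[of \<alpha> "f - g" g] by (simp add: algebra_simps)

lemma lin_ext_basis [simp]: "lin_ext \<alpha> (basis_vec i) = \<alpha> i"
  by (simp add: lin_ext_def)

lemma lin_ext_basis_vec: "lin_ext basis_vec f = f"
proof (rule poly_mapping_eqI)
  fix i
  have "Poly_Mapping.lookup (lin_ext basis_vec f) i =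
      (\<Sum>j\<in>Poly_Mapping.keys f. Poly_Mapping.lookup f j * (1 when j = i))"
    by (simp add: lin_ext_def lookup_sum lookup_single)
  also have "\<dots> = Poly_Mapping.lookup f i"
    by (simp add: when_def if_distrib in_keys_iff cong: if_cong)
  finally show "Poly_Mapping.lookup (lin_ext basis_vec f) i = Poly_Mapping.lookup f i" .
qed

lemma left_mult_relations:
  fixes \<chi> :: "('l::ab_group_add \<times> complex) set"
  assumes "f \<in> free_span (enveloping_relations sc br \<union> induced_relations \<chi>)"
  shows "lin_ext (\<lambda>w. basis_vec (x # w)) f
    \<in> free_span (enveloping_relations sc br \<union> induced_relations \<chi>)"
  using assms
proof (induction rule: free_vs.span_induct_alt)
  case base
  then show ?case by (simp add: lin_ext_def free_vs.span_zero)
next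
  case (step r g h)
  have "lin_ext (\<lambda>w. basis_vec (x # w)) g \<in> enveloping_relations sc br \<union> induced_relations \<chi>"
    using step(1)
  proof
    assume "g \<in> enveloping_relations sc br"
    then show ?thesis
    proof cases
      case (env_add u y z w)
      then show ?thesis
        using enveloping_relations.env_add[of "x # u" y z w sc br] by (simp add: lin_ext_diff)
    next
      case (env_scale u s y w)
      then show ?thesis
        using enveloping_relations.env_scale[of "x # u" sc s y w br]
        by (simp add: lin_ext_diff lin_ext_scale)
    next
      case (env_bracket u y z w)
      then show ?thesis
        using enveloping_relations.env_bracket[of "x # u" y z w br sc] by (simp add: lin_ext_diff)
    qed
  next
    assume "g \<in> induced_relations \<chi>"
    then obtain w b s where g: "g = basis_vec (w @ [b]) - fscale s (basis_vec w)" "(b, s) \<in> \<chi>"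
      by (auto simp: induced_relations_def)
    then have "lin_ext (\<lambda>w. basis_vec (x # w)) g =
        basis_vec ((x # w) @ [b]) - fscale s (basis_vec (x # w))"
      by (simp add: lin_ext_diff lin_ext_scale)
    with g(2) show ?thesis unfolding induced_relations_def by blast
  qed
  then show ?case
    using step(2) by (auto simp: lin_ext_add lin_ext_scale intro: free_vs.span_add
        free_vs.span_scale free_vs.span_base)
qed

lemma quotient_free_rep_simps:
  fixes S :: "('i \<Rightarrow>\<^sub>0 complex) set"
  assumes S: "free_vs.subspace S" and \<alpha>: "\<And>f. f \<in> S \<Longrightarrow> lin_ext (\<alpha> x) f \<in> S"
  defines "M \<equiv> free_rep UNIV \<alpha>"
  shows "S +>\<^bsub>M\<^esub> f = S +>\<^bsub>M\<^esub> g \<longleftrightarrow> f - g \<in> S"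
    and "act (quotient_rep M S) x (S +>\<^bsub>M\<^esub> f) = S +>\<^bsub>M\<^esub> lin_ext (\<alpha> x) f"
    and "r \<odot>\<^bsub>quotient_rep M S\<^esub> (S +>\<^bsub>M\<^esub> f) = S +>\<^bsub>M\<^esub> fscale r f"
proof -
  have coset: "S +>\<^bsub>M\<^esub> f = {s + f | s. s \<in> S}" for f
    by (auto simp: M_def a_r_coset_def r_coset_def free_rep_def)
  have eq: "S +>\<^bsub>M\<^esub> f = S +>\<^bsub>M\<^esub> g \<longleftrightarrow> f - g \<in> S" for f g
  proof
    assume "S +>\<^bsub>M\<^esub> f = S +>\<^bsub>M\<^esub> g"
    moreover have "f \<in> S +>\<^bsub>M\<^esub> f"
      unfolding coset using free_vs.subspace_0[OF S] by force
    ultimately show "f - g \<in> S" unfolding coset by auto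
  next
    assume fg: "f - g \<in> S"
    have "s + f \<in> S +>\<^bsub>M\<^esub> g" "s + g \<in> S +>\<^bsub>M\<^esub> f" if "s \<in> S" for s
    proof -
      have "s + (f - g) \<in> S" "s - (f - g) \<in> S"
        using free_vs.subspace_add[OF S that fg] free_vs.subspace_diff[OF S that fg] by auto
      moreover have "s + f = (s + (f - g)) + g" "s + g = (s - (f - g)) + f" by auto
      ultimately show "s + f \<in> S +>\<^bsub>M\<^esub> g" "s + g \<in> S +>\<^bsub>M\<^esub> f" unfolding coset by blast+
    qed
    then show "S +>\<^bsub>M\<^esub> f = S +>\<^bsub>M\<^esub> g" by (auto simp: coset)
  qed
  have mem: "v - f \<in> S" if "v \<in> S +>\<^bsub>M\<^esub> f" for v
    using that by (auto simp: coset)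
  have self: "f \<in> S +>\<^bsub>M\<^esub> f"
    unfolding coset using free_vs.subspace_0[OF S] by force
  show "S +>\<^bsub>M\<^esub> f = S +>\<^bsub>M\<^esub> g \<longleftrightarrow> f - g \<in> S" by (rule eq)
  have "S +>\<^bsub>M\<^esub> lin_ext (\<alpha> x) v = S +>\<^bsub>M\<^esub> lin_ext (\<alpha> x) f" if "v \<in> S +>\<^bsub>M\<^esub> f" for v
    unfolding eq lin_ext_diff[symmetric] by (rule \<alpha>[OF mem[OF that]])
  then have "(\<Union>v\<in>S +>\<^bsub>M\<^esub> f. S +>\<^bsub>M\<^esub> lin_ext (\<alpha> x) v) = S +>\<^bsub>M\<^esub> lin_ext (\<alpha> x) f"
    using self by blast
  moreover have "act (quotient_rep M S) x X = (\<Union>v\<in>X. S +>\<^bsub>M\<^esub> lin_ext (\<alpha> x) v)" for X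
    by (simp add: quotient_rep_def M_def free_rep_def)
  ultimately show "act (quotient_rep M S) x (S +>\<^bsub>M\<^esub> f) = S +>\<^bsub>M\<^esub> lin_ext (\<alpha> x) f"
    by simp
  have "S +>\<^bsub>M\<^esub> fscale r v = S +>\<^bsub>M\<^esub> fscale r f" if "v \<in> S +>\<^bsub>M\<^esub> f" for v
    unfolding eq free_vs.scale_right_diff_distrib[symmetric]
    by (rule free_vs.subspace_scale[OF S mem[OF that]])
  then have "(\<Union>v\<in>S +>\<^bsub>M\<^esub> f. S +>\<^bsub>M\<^esub> fscale r v) = S +>\<^bsub>M\<^esub> fscale r f"
    using self by blast
  moreover have "r \<odot>\<^bsub>quotient_rep M S\<^esub> X = (\<Union>v\<in>X. S +>\<^bsub>M\<^esub> fscale r v)" for X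
    by (simp add: quotient_rep_def M_def free_rep_def)
  ultimately show "r \<odot>\<^bsub>quotient_rep M S\<^esub> (S +>\<^bsub>M\<^esub> f) = S +>\<^bsub>M\<^esub> fscale r f"
    by simp
qed

text \<open>\<open>av_verma_vector G lam l k c P\<close> is \<open>P u\<close>.\<close>

definition av_verma_vector ::
  "'g::ab_group_add lie_data \<Rightarrow> ('g \<Rightarrow> complex) \<Rightarrow> complex \<Rightarrow> complex \<Rightarrow> complex \<Rightarrow>
     ('g affvir list \<Rightarrow>\<^sub>0 complex) \<Rightarrow> ('g affvir list \<Rightarrow>\<^sub>0 complex) set" where
  "av_verma_vector G lam l k c P =
     free_span (enveloping_relations (av_scale G) (av_bracket G) \<union>
         induced_relations (av_borel_character G lam l k c))
       +>\<^bsub>free_rep UNIV (\<lambda>(x::'g affvir) w. basis_vec (x # w))\<^esub> P"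

lemma av_verma_degree:
  fixes G :: "'g::ab_group_add lie_data"
  assumes G: "lie_algebra (scl G) (brk G)" and H: "module.subspace (scl G) (csa G)"
    and lam: "lam \<in> csa_dual G" and P: "homogeneous G m P"
  shows "act (av_verma G lam l k c) (vir 0) (av_verma_vector G lam l k c P) =
    (l + of_int m) \<odot>\<^bsub>av_verma G lam l k c\<^esub> av_verma_vector G lam l k c P"
proof -
  interpret g: lie_algebra "scl G" "brk G" by fact
  let ?E = "enveloping_relations (av_scale G) (av_bracket G)"
  let ?R = "induced_relations (av_borel_character G lam l k c)"
  let ?L = "lin_ext (\<lambda>w. basis_vec (vir 0 # w)) P" and ?Q = "lin_ext (\<lambda>w. basis_vec (w @ [vir 0])) P"
  have zero_csa: "0 \<in> csa G" using H by (rule g.subspace_0)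
  have "lam (scl G 0 0) = 0 * lam 0"
    using lam zero_csa unfolding csa_dual_def by blast
  then have lam0: "lam 0 = 0" by simp
  have zero_pos: "0 \<in> av_pos G"
    by (auto simp: av_pos_def zero_prod_def nil_pos_def g.span_zero)
  have map0: "Poly_Mapping.map g 0 = 0" for g :: "'g \<Rightarrow> 'g"
    by (rule poly_mapping_eqI) (simp add: Poly_Mapping.map.rep_eq when_def)
  have "(vir 0, l) = (cur 0 0 + av_scale G 1 (vir 0) + av_scale G 0 cen_k + av_scale G 0 cen_c + 0,
       lam 0 + 1 * l + 0 * k + 0 * c)"
    by (simp add: lam0 cur_def vir_def cen_k_def cen_c_def av_scale_def zero_prod_def map0)
  then have d0: "(vir 0, l) \<in> av_borel_character G lam l k c"
    unfolding av_borel_character_def using zero_csa zero_pos by blast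
  have "?Q - fscale l P \<in> free_span ?R"
  proof -
    have "?Q - fscale l P = ?Q - fscale l (lin_ext basis_vec P)"
      by (simp only: lin_ext_basis_vec)
    also have "\<dots> = (\<Sum>w\<in>Poly_Mapping.keys P. fscale (Poly_Mapping.lookup P w)
        (basis_vec (w @ [vir 0]) - fscale l (basis_vec w)))"
      by (simp add: lin_ext_def free_vs.scale_right_diff_distrib sum_subtractf
          free_vs.scale_sum_right mult.commute)
    also have "\<dots> \<in> free_span ?R"
      unfolding induced_relations_def
      using d0 by (intro free_vs.span_sum free_vs.span_scale free_vs.span_base) blast
    finally show ?thesis .
  qed
  then have "?Q - fscale l P \<in> free_span (?E \<union> ?R)"
    using free_vs.span_mono[of ?R "?E \<union> ?R"] by blast
  moreover have "?L - ?Q - fscale (of_int m) P \<in> free_span (?E \<union> ?R)"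
    using P free_vs.span_mono[of ?E "?E \<union> ?R"] unfolding homogeneous_def by blast
  ultimately have "(?Q - fscale l P) + (?L - ?Q - fscale (of_int m) P) \<in> free_span (?E \<union> ?R)"
    by (rule free_vs.span_add)
  then have "?L - fscale (l + of_int m) P \<in> free_span (?E \<union> ?R)"
    by (simp add: free_vs.scale_left_distrib algebra_simps)
  then show ?thesis
    unfolding av_verma_def induced_rep_def av_verma_vector_def
    by (simp add: quotient_free_rep_simps left_mult_relations)
qed


section \<open>The tensor product modules\<close>

text \<open>\<open>V \<otimes> W \<otimes> \<complex>[t\<^sup>\<plusminus>\<^sup>1]\<close> is the free vector space on the triples \<open>(v, w, n)\<close>, which stand for
  \<open>v \<otimes> w \<otimes> t\<^sup>n\<close>, modulo bilinearity in \<open>v\<close> and \<open>w\<close>.\<close>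

definition tensor_relations ::
  "('l, 'v) lie_rep \<Rightarrow> ('m, 'w) lie_rep \<Rightarrow> ('v \<times> 'w \<times> int \<Rightarrow>\<^sub>0 complex) set" where
  "tensor_relations V W =
     {basis_vec (v \<oplus>\<^bsub>V\<^esub> v', w, n) - basis_vec (v, w, n) - basis_vec (v', w, n) | v v' w n.
        v \<in> carrier V \<and> v' \<in> carrier V \<and> w \<in> carrier W} \<union>
     {basis_vec (r \<odot>\<^bsub>V\<^esub> v, w, n) - fscale r (basis_vec (v, w, n)) | r v w n.
        v \<in> carrier V \<and> w \<in> carrier W} \<union>
     {basis_vec (v, w \<oplus>\<^bsub>W\<^esub> w', n) - basis_vec (v, w, n) - basis_vec (v, w', n) | v w w' n.
        v \<in> carrier V \<and> w \<in> carrier W \<and> w' \<in> carrier W} \<union>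
     {basis_vec (v, r \<odot>\<^bsub>W\<^esub> w, n) - fscale r (basis_vec (v, w, n)) | r v w n.
        v \<in> carrier V \<and> w \<in> carrier W}"

text \<open>For homogeneous \<open>P\<close> one has \<open>d\<^sub>0 P u = (l + deg P) P u\<close> in the Verma module (see
  \<open>av_verma_degree\<close>), hence in its quotients, so the linear operator with
  \<open>P u \<mapsto> deg(P) P u\<close> is \<open>d\<^sub>0 - l\<close>.\<close>

definition degree_op :: "('g::ab_group_add affvir, 'v) lie_rep \<Rightarrow> complex \<Rightarrow> 'v \<Rightarrow> 'v" where
  "degree_op V l v = act V (vir 0) v \<ominus>\<^bsub>V\<^esub> l \<odot>\<^bsub>V\<^esub> v"

definition vir_action ::
  "('g::ab_group_add affvir, 'v) lie_rep \<Rightarrow> complex \<Rightarrow> complex \<Rightarrow> complex \<Rightarrow>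
     int \<Rightarrow> 'v \<times> 'w \<times> int \<Rightarrow> 'v \<times> 'w \<times> int \<Rightarrow>\<^sub>0 complex" where
  "vir_action V l a b m = (\<lambda>(v, w, n).
     basis_vec
       ((act V (vir m) v \<oplus>\<^bsub>V\<^esub> (a + of_int n + b * of_int m) \<odot>\<^bsub>V\<^esub> v) \<ominus>\<^bsub>V\<^esub> degree_op V l v,
        w, m + n))"

definition cur_action ::
  "('g::ab_group_add affvir, 'v) lie_rep \<Rightarrow> ('g, 'w) lie_rep \<Rightarrow>
     int \<Rightarrow> 'g \<Rightarrow> 'v \<times> 'w \<times> int \<Rightarrow> 'v \<times> 'w \<times> int \<Rightarrow>\<^sub>0 complex" where
  "cur_action V W m x = (\<lambda>(v, w, n).
     basis_vec (act V (cur m x) v, w, m + n) + basis_vec (v, act W x w, m + n))"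

definition tensor_action ::
  "('g::ab_group_add affvir, 'v) lie_rep \<Rightarrow> ('g, 'w) lie_rep \<Rightarrow>
     complex \<Rightarrow> complex \<Rightarrow> complex \<Rightarrow> complex \<Rightarrow> complex \<Rightarrow>
     'g affvir \<Rightarrow> 'v \<times> 'w \<times> int \<Rightarrow> 'v \<times> 'w \<times> int \<Rightarrow>\<^sub>0 complex" where
  "tensor_action V W l k c a b = (\<lambda>(f, p, \<kappa>, \<gamma>) e.
     (\<Sum>m\<in>Poly_Mapping.keys f. cur_action V W m (Poly_Mapping.lookup f m) e) +
     (\<Sum>m\<in>Poly_Mapping.keys p. fscale (Poly_Mapping.lookup p m) (vir_action V l a b m e)) +
     fscale (\<kappa> * k + \<gamma> * c) (basis_vec e))"

definition tensor_rep ::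
  "'g::ab_group_add lie_data \<Rightarrow> ('g \<Rightarrow> complex) \<Rightarrow> complex \<Rightarrow> complex \<Rightarrow> complex \<Rightarrow>
     ('g, 'w) lie_rep \<Rightarrow> complex \<Rightarrow> complex \<Rightarrow>
     ('g affvir, (('g affvir list \<Rightarrow>\<^sub>0 complex) set set \<times> 'w \<times> int \<Rightarrow>\<^sub>0 complex) set) lie_rep" where
  "tensor_rep G lam l k c W a b =
     (let V = av_irreducible G lam l k c
      in quotient_rep
           (free_rep (carrier V \<times> carrier W \<times> UNIV) (tensor_action V W l k c a b))
           (free_span (tensor_relations V W)))"

end

theory Submission
  imports Defs
begin

text \<open>
  Write \<open>V = L(\<lambda>, l, k, c)\<close>, \<open>W = L(\<mu>)\<close>, with highest weight vectors \<open>u\<close> and \<open>w\<^sub>0\<close>, and use primes for the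
  second set of parameters. All parameters can be read off from the tensor product because its two
  factors react differently to modes of large degree. The eigenvalues of \<open>d\<^sub>0\<close> on \<open>V\<close> are among
  \<open>l, l - 1, l - 2, \<dots>\<close> (\<open>eigenvalue_in_spectrum\<close>), so on a given vector of \<open>V\<close> the operators \<open>x(m)\<close>
  and \<open>d\<^sub>m\<close> vanish once \<open>m\<close> is large (\<open>locally_nilpotent\<close>). Hence on a given vector of the tensor
  product \<open>x(m)\<close>, for large \<open>m\<close>, acts as \<open>x\<close> on the factor \<open>W\<close> alone and shifts the power of \<open>t\<close>
  (\<open>tcoord_large\<close>).

  Let \<open>\<Phi>\<close> be an isomorphism. For \<open>x\<close> in \<open>\<nn>\<^sub>+\<close> and large \<open>m\<close>, \<open>x(m)\<close> kills \<open>u \<otimes> w\<^sub>0 \<otimes> t\<^sup>n\<close> and hence its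
  image, so every \<open>W'\<close>-coordinate of the image is a multiple of \<open>w\<^sub>0'\<close>. Comparison of \<open>d\<^sub>0\<close>-eigenvalues
  leaves a single power of \<open>t\<close>. The image is therefore \<open>y\<^sub>n \<otimes> w\<^sub>0' \<otimes> t\<^bsup>n+s\<^esup>\<close> with an integer \<open>s\<close> such that
  \<open>l + a = l' + a' + s\<close> (\<open>image_vacuum\<close>). Applying \<open>h(m)\<close> for \<open>h\<close> in the Cartan subalgebra and large \<open>m\<close>
  gives \<open>\<mu>(h) y\<^bsub>m+n\<^esub> = \<mu>'(h) y\<^sub>n\<close>. As \<open>\<mu> \<noteq> 0\<close>, all \<open>y\<^sub>n\<close> coincide with one vector \<open>y\<close>, and then
  \<open>\<mu> = \<mu>'\<close>. Applying \<open>h(0)\<close>, \<open>\<nn>\<^sub>+\<close>, \<open>d\<^sub>m\<close> for large \<open>m\<close> and the central elements shows that \<open>y\<close> has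
  weight \<open>\<lambda>\<close>, is killed by \<open>\<nn>\<^sub>+\<close>, satisfies \<open>d\<^sub>0 y = l y\<close>, and that \<open>b = b'\<close>, \<open>k = k'\<close>, \<open>c = c'\<close>
  (\<open>parameters_determined\<close>). So \<open>l\<close> is one of \<open>l', l' - 1, \<dots>\<close>, and by symmetry \<open>l = l'\<close>. Then
  \<open>a - a' = s\<close> is an integer and the condition on the real parts gives \<open>a = a'\<close>. Finally \<open>y\<close> lies in
  the top \<open>d\<^sub>0\<close>-eigenspace of \<open>V'\<close>, so it is killed by \<open>\<LL>(\<gg>)\<^sub>+\<close>, hence is a multiple of \<open>u'\<close>, and
  \<open>\<lambda> = \<lambda>'\<close> (\<open>parameters_equal\<close>).

  Conversely, when the parameters agree the two modules differ only in the realization of \<open>L(\<mu>)\<close>,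
  which is unique up to isomorphism (\<open>same_highest_weight_isomorphic\<close>, \<open>tensor_pair_isomorphic\<close>).

  Two general facts carry this. First, \<open>V\<close> has a nonzero highest weight vector. Since the Verma
  module is given by generators and relations, this is a part of the
  Poincare-Birkhoff-Witt theorem; it is obtained by straightening words (\<open>straighten_commute\<close>,
  \<open>induced_rep_nonzero\<close>). Second, in an irreducible highest weight module the singular vectors are
  the multiples of the highest weight vector, and irreducible modules with equal highest weights are
  isomorphic (\<open>singular_vector\<close>, \<open>irreducible_highest_weight_unique\<close>). Both are proved once for graded
  Lie algebras and used for \<open>\<gg>\<close>, graded by the height of roots, and for \<open>\<LL>(\<gg>)\<close>, graded by height
  and degree combined (\<open>graded_av\<close>).
\<close>

section \<open>Straightening words in a Lie algebra\<close>

text \<open>The letters in the basis \<open>E\<close> are ordered by \<open>less\<close>, and a word is normal if no letter is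
  directly followed by a smaller one. The values \<open>normal_value\<close> prescribed on normal words will be
  extended to all words in such a way that exchanging two neighbours costs their bracket.\<close>

locale straightening = lie_algebra sc br
  for sc :: "complex \<Rightarrow> 'l::ab_group_add \<Rightarrow> 'l" and br :: "'l \<Rightarrow> 'l \<Rightarrow> 'l" +
  fixes E :: "'l set" and less :: "'l \<Rightarrow> 'l \<Rightarrow> bool" and normal_value :: "'l list \<Rightarrow> complex"
  assumes indep: "independent E" and spans: "span E = UNIV"
    and less_irrefl: "\<not> less x x"
    and less_trans: "less x y \<Longrightarrow> less y z \<Longrightarrow> less x z"
    and less_total: "x \<noteq> y \<Longrightarrow> less x y \<or> less y x"
begin

text \<open>The linear map that agrees with \<open>g\<close> on \<open>E\<close>.\<close>

definition expand :: "('l \<Rightarrow> complex) \<Rightarrow> 'l \<Rightarrow> complex" where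
  "expand g z = (\<Sum>e | representation E z e \<noteq> 0. representation E z e * g e)"

lemma in_span_E [simp]: "z \<in> span E"
  by (simp add: spans)

lemma expand_superset:
  assumes "finite S" "{e. representation E z e \<noteq> 0} \<subseteq> S"
  shows "expand g z = (\<Sum>e\<in>S. representation E z e * g e)"
  unfolding expand_def by (rule sum.mono_neutral_left) (use assms in auto)

lemma expand_add: "expand g (x + y) = expand g x + expand g y"
proof -
  let ?S = "{e. representation E x e \<noteq> 0} \<union> {e. representation E y e \<noteq> 0}"
  have f: "finite ?S" by (simp add: finite_representation)
  have "{e. representation E (x + y) e \<noteq> 0} \<subseteq> ?S"
    by (auto simp: representation_add[OF indep])
  then show ?thesis
    using expand_superset[OF f, of x g] expand_superset[OF f, of y g] expand_superset[OF f, of "x + y" g]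
    by (simp add: representation_add[OF indep] algebra_simps sum.distrib)
qed

lemma expand_scale: "expand g (sc r x) = r * expand g x"
proof -
  let ?S = "{e. representation E x e \<noteq> 0}"
  have f: "finite ?S" by (simp add: finite_representation)
  have "{e. representation E (sc r x) e \<noteq> 0} \<subseteq> ?S"
    by (auto simp: representation_scale[OF indep])
  then show ?thesis
    using expand_superset[OF f, of x g] expand_superset[OF f, of "sc r x" g]
    by (simp add: representation_scale[OF indep] algebra_simps sum_distrib_left)
qed

lemma expand_minus: "expand g (- x) = - expand g x"
  using expand_scale[of g "-1" x] by simp

lemma expand_diff: "expand g (x - y) = expand g x - expand g y"
  using expand_add[of g x "- y"] by (simp add: expand_minus)

lemma expand_zero [simp]: "expand g 0 = 0"
  using expand_scale[of g 0 0] by simp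

lemma expand_basis: "e \<in> E \<Longrightarrow> expand g e = g e"
  by (subst expand_superset[of "{e}"]) (auto simp: representation_basis[OF indep])

lemma expand_fun_add: "expand (\<lambda>e. f e + g e) z = expand f z + expand g z"
  by (simp add: expand_def algebra_simps sum.distrib)

lemma expand_fun_diff: "expand (\<lambda>e. f e - g e) z = expand f z - expand g z"
  by (simp add: expand_def algebra_simps sum_subtractf)

lemma expand_fun_mult: "expand (\<lambda>e. r * f e) z = r * expand f z"
  by (simp add: expand_def algebra_simps sum_distrib_left)

lemma expand_cong: "(\<And>e. e \<in> E \<Longrightarrow> f e = g e) \<Longrightarrow> expand f z = expand g z"
  unfolding expand_def by (intro sum.cong) (auto simp: representation_ne_zero)

lemma expand_swap: "expand (\<lambda>e. expand (\<lambda>f. g e f) z) y = expand (\<lambda>f. expand (\<lambda>e. g e f) y) z"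
  unfolding expand_def sum_distrib_left by (subst sum.swap) (simp add: algebra_simps)

lemma expand_linear_unique:
  assumes "\<And>x y. h (x + y) = h x + h y" "\<And>r x. h (sc r x) = r * h x"
  shows "h z = expand h z"
proof -
  have "z \<in> span E" by simp
  then show ?thesis
  proof (induction rule: span_induct_alt)
    case base
    show ?case using assms(2)[of 0 0] by simp
  next
    case (step c x y)
    then show ?case by (simp add: assms expand_add expand_scale expand_basis)
  qed
qed

fun split_descent :: "'l list \<Rightarrow> ('l list \<times> 'l \<times> 'l \<times> 'l list) option" where
  "split_descent (y # x # v) = (if less x y then Some ([], y, x, v)
     else map_option (\<lambda>(u, r). (y # u, r)) (split_descent (x # v)))"
| "split_descent _ = None"

fun inversions :: "'l list \<Rightarrow> nat" where
  "inversions [] = 0"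
| "inversions (x # w) = length (filter (\<lambda>y. less y x) w) + inversions w"

lemma inversions_swap: "less x y \<Longrightarrow> inversions (u @ x # y # v) < inversions (u @ y # x # v)"
  using less_irrefl less_trans by (induction u) auto

lemma split_descent_SomeD:
  "split_descent w = Some (u, y, x, v) \<Longrightarrow> w = u @ y # x # v \<and> less x y"
  by (induction w arbitrary: u y x v rule: split_descent.induct) (auto split: if_splits)

text \<open>A descent is the leftmost one, or it shares a letter with the leftmost one, or it lies
  strictly to the right of it. These are the configurations that the diamond lemma has to resolve.\<close>

lemma split_descent_cases:
  assumes "less x y"
  obtains "split_descent (u @ y # x # v) = Some (u, y, x, v)"
  | u1 y1 where "u = u1 @ [y1]" "less y y1" "split_descent (u @ y # x # v) = Some (u1, y1, y, x # v)"
  | u1 y1 x1 u2 where "u = u1 @ y1 # x1 # u2" "less x1 y1"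
      "split_descent (u @ y # x # v) = Some (u1, y1, x1, u2 @ y # x # v)"
proof -
  have "split_descent (u @ y # x # v) = Some (u, y, x, v) \<or>
    (\<exists>u1 y1. u = u1 @ [y1] \<and> less y y1 \<and> split_descent (u @ y # x # v) = Some (u1, y1, y, x # v)) \<or>
    (\<exists>u1 y1 x1 u2. u = u1 @ y1 # x1 # u2 \<and> less x1 y1 \<and>
      split_descent (u @ y # x # v) = Some (u1, y1, x1, u2 @ y # x # v))"
  proof (induction u rule: split_descent.induct)
    case (1 b a u)
    show ?case
    proof (cases "less a b")
      case False
      then show ?thesis using 1 by (fastforce simp: Cons_eq_append_conv)
    qed auto
  next
    case ("2_2" a)
    then show ?case using assms by auto
  qed (use assms in auto)
  then show ?thesis using that by blast
qed

lemma split_descent_None: "split_descent w = None \<Longrightarrow> sorted_wrt (\<lambda>a b. \<not> less b a) w"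
proof (induction w rule: split_descent.induct)
  case (1 y x v)
  then have xy: "\<not> less x y" and s: "sorted_wrt (\<lambda>a b. \<not> less b a) (x # v)"
    by (auto split: if_splits)
  moreover have "\<not> less z y" if "\<not> less z x" for z
    using that xy less_trans less_total by metis
  ultimately show ?case by auto
qed auto

lemma sorted_split_descent: "sorted_wrt (\<lambda>a b. \<not> less b a) w \<Longrightarrow> split_descent w = None"
  by (induction w rule: split_descent.induct) auto

text \<open>Rewriting takes place at the leftmost descent. The bracket terms are shorter, and the exchanged
  word has the same length and fewer inversions.\<close>

function straighten :: "'l list \<Rightarrow> complex" where
  "straighten w = (case split_descent w of None \<Rightarrow> normal_value w
     | Some (u, y, x, v) \<Rightarrow> straighten (u @ x # y # v) +
        (\<Sum>e | representation E (br y x) e \<noteq> 0. representation E (br y x) e * straighten (u @ e # v)))"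
  by pat_completeness auto
termination
  by (relation "inv_image (less_than <*lex*> less_than) (\<lambda>w. (length w, inversions w))")
    (auto dest!: split_descent_SomeD simp: inversions_swap)

declare straighten.simps [simp del]

lemma straighten_split:
  "split_descent w = Some (u, y, x, v) \<Longrightarrow>
     straighten w = straighten (u @ x # y # v) + expand (\<lambda>e. straighten (u @ e # v)) (br y x)"
  by (subst straighten.simps) (simp add: expand_def)

lemma br_0 [simp]: "br 0 z = 0" "br z 0 = 0"
  using bracket_add_left[of 0 0 z] bracket_add_right[of z 0 0] by auto

lemma br_antisym: "br x y = - br y x"
proof -
  have "br (x + y) (x + y) = br x y + br y x"
    by (simp only: bracket_add_left bracket_add_right) (simp add: bracket_self)
  then have "br x y + br y x = 0" by (metis bracket_self)
  then show ?thesis by (simp add: eq_neg_iff_add_eq_0)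
qed

lemma br_neg: "br (- x) y = - br x y" "br x (- y) = - br x y"
  using bracket_scale_left[of "-1" x y] bracket_scale_right[of x "-1" y] by auto

text \<open>The value does not depend on the descent that is rewritten first (the diamond lemma). For two
  disjoint descents the two orders of rewriting produce the same words. For three letters in
  decreasing order, rewritten to increasing order from the left or from the right, the two results
  differ by iterated brackets whose sum vanishes by the Jacobi identity.\<close>

lemma straighten_descent:
  assumes "less x y"
  shows "straighten (u @ y # x # v) = straighten (u @ x # y # v) + expand (\<lambda>e. straighten (u @ e # v)) (br y x)"
  using assms
proof (induction "u @ y # x # v" arbitrary: u y x v
    rule: wf_induct_rule[OF wf_inv_image[OF wf_lex_prod[OF wf_less_than wf_less_than], of "\<lambda>w. (length w, inversions w)"]])
  case less_hyp: (1 u y x v)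
  define F where "F = straighten"
  have IH: "F (u' @ y' # x' # v') = F (u' @ x' # y' # v') + expand (\<lambda>e. F (u' @ e # v')) (br y' x')"
    if "less x' y'" "length u' + length v' < length u + length v \<or>
       (length u' + length v' = length u + length v \<and> inversions (u' @ y' # x' # v') < inversions (u @ y # x # v))"
    for u' y' x' v'
    unfolding F_def by (rule less_hyp.hyps) (use that in auto)
  \<comment> \<open>On shorter words the exchange rule is available for letters in any order.\<close>
  have comm: "F (u' @ f # e # v') = F (u' @ e # f # v') + expand (\<lambda>e. F (u' @ e # v')) (br f e)"
    if "length u' + length v' < length u + length v" for u' e f v'
  proof -
    consider "e = f" | "less e f" | "less f e" using less_total by blast
    then show ?thesis
    proof cases
      case 3
      then show ?thesis using IH[OF 3, of u' v'] that
        by (simp add: br_antisym[of f e] expand_minus)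
    qed (use IH[of e f u' v'] that in \<open>auto simp: bracket_self\<close>)
  qed
  note xy = \<open>less x y\<close>
  show ?case
    unfolding F_def[symmetric]
  proof (rule split_descent_cases[OF xy, of u v])
    assume "split_descent (u @ y # x # v) = Some (u, y, x, v)"
    then show "F (u @ y # x # v) = F (u @ x # y # v) + expand (\<lambda>e. F (u @ e # v)) (br y x)"
      unfolding F_def by (rule straighten_split)
  next
    fix u1 z assume u: "u = u1 @ [z]" and yz: "less y z"
      and split: "split_descent (u @ y # x # v) = Some (u1, z, y, x # v)"
    have i1: "inversions (u1 @ y # z # x # v) < inversions (u @ y # x # v)"
      using inversions_swap[OF yz, of u1 "x # v"] u by simp
    have xz: "less x z" using xy yz less_trans by blast
    have i2: "inversions (u1 @ y # x # z # v) < inversions (u @ y # x # v)"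
      using inversions_swap[OF xz, of "u1 @ [y]" v] i1 by simp
    have i3: "inversions (u1 @ z # x # y # v) < inversions (u @ y # x # v)"
      using inversions_swap[OF xy, of "u1 @ [z]" v] u by simp
    have i4: "inversions (u1 @ x # z # y # v) < inversions (u @ y # x # v)"
      using inversions_swap[OF xz, of "u1" "y # v"] i3 u by simp
    \<comment> \<open>\<open>z y x\<close> is rewritten to \<open>x y z\<close> along the two possible routes, with results 1 and 2;
      \<open>B\<close> collects the bracket terms.\<close>
    define B where "B a z b = expand (\<lambda>e. F (u1 @ a @ e # b @ v)) z" for a z b
    have "F (u @ y # x # v) = F (u1 @ y # z # x # v) + B [] (br z y) [x]"
      using straighten_split[OF split] unfolding F_def B_def by simp
    also have "F (u1 @ y # z # x # v) = F (u1 @ y # x # z # v) + B [y] (br z x) []"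
      using IH[OF xz, of "u1 @ [y]" v] i1 u by (simp add: B_def)
    also have "F (u1 @ y # x # z # v) = F (u1 @ x # y # z # v) + B [] (br y x) [z]"
      using IH[OF xy, of "u1" "z # v"] i2 u by (simp add: B_def)
    finally have 1: "F (u @ y # x # v) = F (u1 @ x # y # z # v) + B [] (br y x) [z] + B [y] (br z x) [] + B [] (br z y) [x]" .
    have "F (u @ x # y # v) = F (u1 @ x # z # y # v) + B [] (br z x) [y]"
      using IH[OF xz, of "u1" "y # v"] i3 u by (simp add: B_def)
    also have "F (u1 @ x # z # y # v) = F (u1 @ x # y # z # v) + B [x] (br z y) []"
      using IH[OF yz, of "u1 @ [x]" v] i4 u by (simp add: B_def)
    finally have 2: "F (u @ x # y # v) = F (u1 @ x # y # z # v) + B [x] (br z y) [] + B [] (br z x) [y]" .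
    have move: "B [] t [s] - B [s] t [] = B [] (br t s) []" for s t
    proof -
      have "expand (\<lambda>e. F (u1 @ e # s # v) - F (u1 @ s # e # v)) t = expand (\<lambda>e. expand (\<lambda>f. F (u1 @ f # v)) (br e s)) t"
      proof (rule expand_cong)
        fix e
        show "F (u1 @ e # s # v) - F (u1 @ s # e # v) = expand (\<lambda>f. F (u1 @ f # v)) (br e s)"
          using comm[of u1 v e s] u by simp
      qed
      also have "\<dots> = expand (\<lambda>f. F (u1 @ f # v)) (br t s)"
        by (rule expand_linear_unique[symmetric])
          (simp_all add: expand_add expand_scale bracket_add_left bracket_scale_left)
      finally show ?thesis by (simp add: B_def expand_fun_diff)
    qed
    have 3: "B [z] (br y x) [] = expand (\<lambda>e. F (u @ e # v)) (br y x)"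
      using u by (simp add: B_def)
    have "B [] t [] + B [] t' [] + B [] t'' [] = B [] (t + t' + t'') []" for t t' t''
      by (simp add: B_def expand_add)
    then have "B [] (br (br y x) z) [] - B [] (br (br z x) y) [] + B [] (br (br z y) x) [] =
        B [] (br (br y x) z - br (br z x) y + br (br z y) x) []"
      by (simp add: B_def expand_add expand_diff)
    also have "br (br y x) z - br (br z x) y + br (br z y) x = 0"
    proof -
      have "br z (br y x) + br y (br x z) + br x (br z y) = 0" by (rule jacobi)
      moreover have "br (br y x) z = - br z (br y x)" by (rule br_antisym)
      moreover have "br (br z x) y = br y (br x z)"
        by (metis br_antisym br_neg(2))
      moreover have "br (br z y) x = - br x (br z y)" by (rule br_antisym)
      ultimately have "br (br y x) z - br (br z x) y + br (br z y) x =
          - (br z (br y x) + br y (br x z) + br x (br z y))"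
        by (metis add_uminus_conv_diff minus_add_distrib)
      then show ?thesis by (simp only: jacobi) simp
    qed
    finally have "B [] (br (br y x) z) [] - B [] (br (br z x) y) [] + B [] (br (br z y) x) [] = 0"
      by (simp add: B_def)
    then have J: "B [] (br (br y x) z) [] = B [] (br (br z x) y) [] - B [] (br (br z y) x) []"
      by (simp add: algebra_simps)
    have m1: "B [] (br y x) [z] = B [z] (br y x) [] + B [] (br (br y x) z) []"
      using move[of "br y x" z] by (simp add: algebra_simps)
    have m2: "B [] (br z x) [y] = B [y] (br z x) [] + B [] (br (br z x) y) []"
      using move[of "br z x" y] by (simp add: algebra_simps)
    have m3: "B [] (br z y) [x] = B [x] (br z y) [] + B [] (br (br z y) x) []"
      using move[of "br z y" x] by (simp add: algebra_simps)
    show "F (u @ y # x # v) = F (u @ x # y # v) + expand (\<lambda>e. F (u @ e # v)) (br y x)"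
      unfolding 1 2 3[symmetric] m1 m2 m3 J by simp
  next
    fix u1 b a u2 assume u: "u = u1 @ b # a # u2" and ab: "less a b"
      and split: "split_descent (u @ y # x # v) = Some (u1, b, a, u2 @ y # x # v)"
    have i1: "inversions (u1 @ a # b # u2 @ y # x # v) < inversions (u @ y # x # v)"
      using inversions_swap[OF ab, of u1 "u2 @ y # x # v"] u by simp
    have i2: "inversions (u1 @ b # a # u2 @ x # y # v) < inversions (u @ y # x # v)"
      using inversions_swap[OF xy, of "u1 @ b # a # u2" v] u by simp
    have "F (u @ y # x # v) = F (u1 @ a # b # u2 @ y # x # v) + expand (\<lambda>e. F (u1 @ e # u2 @ y # x # v)) (br b a)"
      using straighten_split[OF split] unfolding F_def by simp
    also have "F (u1 @ a # b # u2 @ y # x # v) = F (u1 @ a # b # u2 @ x # y # v) + expand (\<lambda>f. F (u1 @ a # b # u2 @ f # v)) (br y x)"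
      using IH[OF xy, of "u1 @ a # b # u2" v] i1 u by simp
    also have "expand (\<lambda>e. F (u1 @ e # u2 @ y # x # v)) (br b a) =
        expand (\<lambda>e. F (u1 @ e # u2 @ x # y # v) + expand (\<lambda>f. F (u1 @ e # u2 @ f # v)) (br y x)) (br b a)"
    proof (rule expand_cong)
      fix e
      show "F (u1 @ e # u2 @ y # x # v) = F (u1 @ e # u2 @ x # y # v) + expand (\<lambda>f. F (u1 @ e # u2 @ f # v)) (br y x)"
        using IH[OF xy, of "u1 @ e # u2" v] u by simp
    qed
    finally have 1: "F (u @ y # x # v) = F (u1 @ a # b # u2 @ x # y # v) + expand (\<lambda>f. F (u1 @ a # b # u2 @ f # v)) (br y x)
        + (expand (\<lambda>e. F (u1 @ e # u2 @ x # y # v)) (br b a) + expand (\<lambda>e. expand (\<lambda>f. F (u1 @ e # u2 @ f # v)) (br y x)) (br b a))"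
      by (simp add: expand_fun_add)
    have 2: "F (u @ x # y # v) = F (u1 @ a # b # u2 @ x # y # v) + expand (\<lambda>e. F (u1 @ e # u2 @ x # y # v)) (br b a)"
      using IH[OF ab, of "u1" "u2 @ x # y # v"] i2 u by simp
    have "expand (\<lambda>f. F (u @ f # v)) (br y x) =
        expand (\<lambda>f. F (u1 @ a # b # u2 @ f # v) + expand (\<lambda>e. F (u1 @ e # u2 @ f # v)) (br b a)) (br y x)"
    proof (rule expand_cong)
      fix f
      show "F (u @ f # v) = F (u1 @ a # b # u2 @ f # v) + expand (\<lambda>e. F (u1 @ e # u2 @ f # v)) (br b a)"
        using IH[OF ab, of "u1" "u2 @ f # v"] u by simp
    qed
    then have 3: "expand (\<lambda>f. F (u @ f # v)) (br y x) = expand (\<lambda>f. F (u1 @ a # b # u2 @ f # v)) (br y x)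
        + expand (\<lambda>f. expand (\<lambda>e. F (u1 @ e # u2 @ f # v)) (br b a)) (br y x)"
      by (simp add: expand_fun_add)
    show "F (u @ y # x # v) = F (u @ x # y # v) + expand (\<lambda>e. F (u @ e # v)) (br y x)"
      using 1 2 3 expand_swap[of "\<lambda>e f. F (u1 @ e # u2 @ f # v)" "br y x" "br b a"] by simp
  qed
qed

lemma straighten_commute:
  "straighten (u @ y # x # v) = straighten (u @ x # y # v) + expand (\<lambda>e. straighten (u @ e # v)) (br y x)"
proof -
  consider "x = y" | "less x y" | "less y x" using less_total by blast
  then show ?thesis
  proof cases
    case 3
    then show ?thesis using straighten_descent[OF 3, of u v]
      by (simp add: br_antisym[of y x] expand_minus)
  qed (use straighten_descent[of x y u v] in \<open>auto simp: bracket_self\<close>)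
qed

text \<open>The multilinear extension of \<^const>\<open>straighten\<close> to words in arbitrary elements; the letters
  of \<open>u\<close> have been expanded already.\<close>

fun multilinear :: "'l list \<Rightarrow> 'l list \<Rightarrow> complex" where
  "multilinear u [] = straighten u"
| "multilinear u (z # w) = expand (\<lambda>e. multilinear (u @ [e]) w) z"

lemma multilinear_add:
  "multilinear u (v @ (x + y) # w) = multilinear u (v @ x # w) + multilinear u (v @ y # w)"
  by (induction v arbitrary: u) (simp_all add: expand_add expand_fun_add)

lemma multilinear_scale:
  "multilinear u (v @ sc r x # w) = r * multilinear u (v @ x # w)"
proof (induction v arbitrary: u)
  case Nil
  show ?case by (simp add: expand_scale)
next
  case (Cons a v)
  show ?case by (simp only: append_Cons multilinear.simps Cons expand_fun_mult)
qed

lemma multilinear_commute_basis: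
  "multilinear (u @ y # x # v) w = multilinear (u @ x # y # v) w + expand (\<lambda>e. multilinear (u @ e # v) w) (br y x)"
proof (induction w arbitrary: v)
  case Nil
  show ?case by (simp only: multilinear.simps) (rule straighten_commute)
next
  case (Cons z w)
  show ?case
  proof -
    have "expand (\<lambda>f. multilinear (u @ y # x # v @ [f]) w) z =
        expand (\<lambda>f. multilinear (u @ x # y # v @ [f]) w + expand (\<lambda>e. multilinear (u @ e # v @ [f]) w) (br y x)) z"
      by (rule expand_cong) (rule Cons)
    also have "\<dots> = expand (\<lambda>f. multilinear (u @ x # y # v @ [f]) w) z +
        expand (\<lambda>e. expand (\<lambda>f. multilinear (u @ e # v @ [f]) w) z) (br y x)"
      using expand_swap[of "\<lambda>f e. multilinear (u @ e # v @ [f]) w" "br y x" z] by (simp only: expand_fun_add)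
    finally show ?thesis by simp
  qed
qed

text \<open>With \<open>straighten_commute\<close> extended to arbitrary elements, \<open>multilinear []\<close> becomes a linear
  functional on words that respects the defining relations of the enveloping algebra.\<close>

lemma multilinear_commute:
  "multilinear u (v @ y # x # w) = multilinear u (v @ x # y # w) + multilinear u (v @ br y x # w)"
proof (induction v arbitrary: u)
  case Nil
  have "multilinear u (y # x # w) = expand (\<lambda>e. expand (\<lambda>f. multilinear (u @ [e, f]) w) x) y"
    by simp
  also have "\<dots> = expand (\<lambda>e. expand (\<lambda>f. multilinear (u @ [f, e]) w + expand (\<lambda>g. multilinear (u @ [g]) w) (br e f)) x) y"
    by (intro expand_cong, rule multilinear_commute_basis[of u _ _ "[]" w, simplified])
  also have "\<dots> = expand (\<lambda>e. expand (\<lambda>f. multilinear (u @ [f, e]) w) x) y +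
      expand (\<lambda>e. expand (\<lambda>f. expand (\<lambda>g. multilinear (u @ [g]) w) (br e f)) x) y"
    by (simp add: expand_fun_add)
  also have "(\<lambda>e. expand (\<lambda>f. expand (\<lambda>g. multilinear (u @ [g]) w) (br e f)) x) = (\<lambda>e. expand (\<lambda>g. multilinear (u @ [g]) w) (br e x))"
    by (intro ext expand_linear_unique[symmetric]) (simp_all add: expand_add expand_scale bracket_add_right bracket_scale_right)
  also have "expand \<dots> y = expand (\<lambda>g. multilinear (u @ [g]) w) (br y x)"
    by (intro expand_linear_unique[symmetric]) (simp_all add: expand_add expand_scale bracket_add_left bracket_scale_left)
  also have "expand (\<lambda>e. expand (\<lambda>f. multilinear (u @ [f, e]) w) x) y = multilinear u (x # y # w)"
    by (subst expand_swap) simp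
  finally show ?case by simp
next
  case (Cons a v)
  then show ?case by (simp add: expand_fun_add)
qed

end

section \<open>Modules induced from a character\<close>

text \<open>A functional separates the empty word from the relations. A basis of \<open>B\<close> is extended to a basis
  of the Lie algebra in which the elements from \<open>B\<close> come last. A normal word gets the value
  of \<open>\<chi>\<close> on its letters, multiplied, if all of them lie in \<open>B\<close>, and 0 otherwise. The straightened
  functional respects the relations of the enveloping algebra, and appending an element \<open>b\<close> of \<open>B\<close> on
  the right multiplies it by \<open>\<chi> b\<close>.\<close>

lemma induced_rep_nonzero:
  fixes sc :: "complex \<Rightarrow> 'l::ab_group_add \<Rightarrow> 'l" and \<chi> :: "'l \<Rightarrow> complex"
  assumes L: "lie_algebra sc br" and B: "module.subspace sc B"
    and B_br: "\<And>x y. x \<in> B \<Longrightarrow> y \<in> B \<Longrightarrow> br x y \<in> B"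
    and \<chi>_add: "\<And>x y. x \<in> B \<Longrightarrow> y \<in> B \<Longrightarrow> \<chi> (x + y) = \<chi> x + \<chi> y"
    and \<chi>_scale: "\<And>r x. x \<in> B \<Longrightarrow> \<chi> (sc r x) = r * \<chi> x"
    and \<chi>_br: "\<And>x y. x \<in> B \<Longrightarrow> y \<in> B \<Longrightarrow> \<chi> (br x y) = 0"
  shows "basis_vec [] \<notin> free_span (enveloping_relations sc br \<union> induced_relations {(b, \<chi> b) | b. b \<in> B})"
proof -
  interpret lie_algebra sc br by (rule L)
  obtain EB where EB: "EB \<subseteq> B" "independent EB" "B \<subseteq> span EB"
    by (rule maximal_independent_subset[of B])
  define E where "E = extend_basis EB"
  have E: "EB \<subseteq> E" "independent E" "span E = UNIV"
    using extend_basis_superset[OF EB(2)] independent_extend_basis[OF EB(2)] span_extend_basis[OF EB(2)]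
    by (auto simp: E_def)
  have EB_span: "B = span EB"
    using EB span_minimal[OF EB(1) B] by blast
  obtain r :: "'l rel" where r: "well_order_on UNIV r" using well_order_on by blast
  have r_lin: "trans r" "antisym r" "total r" "refl r"
    using r by (auto simp: well_order_on_def linear_order_on_def partial_order_on_def preorder_on_def)
  define less where "less x y \<longleftrightarrow> x \<notin> EB \<and> y \<in> EB \<or> (x \<in> EB \<longleftrightarrow> y \<in> EB) \<and> (x, y) \<in> r \<and> x \<noteq> y" for x y
  define nv where "nv w = (if set w \<subseteq> EB then prod_list (map \<chi> w) else 0)" for w
  interpret straightening sc br E less nv
  proof
    show "less x y \<Longrightarrow> less y z \<Longrightarrow> less x z" for x y z
      using r_lin(1,2) unfolding less_def trans_def antisym_def by blast
    show "x \<noteq> y \<Longrightarrow> less x y \<or> less y x" for x y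
      using r_lin(3) unfolding less_def total_on_def by blast
  qed (use E in \<open>auto simp: less_def\<close>)
  have expand_B: "expand g z = expand h z" if "z \<in> B" "\<And>e. e \<in> EB \<Longrightarrow> g e = h e" for g h z
  proof -
    have "z \<in> span EB" using that(1) EB_span by simp
    then show ?thesis
    proof (induction rule: span_induct_alt)
      case (step c x y)
      then have "x \<in> E" using E by auto
      with step show ?case by (simp add: that(2) expand_add expand_scale expand_basis)
    qed simp
  qed
  have \<chi>0: "\<chi> 0 = 0" using \<chi>_scale[of 0 0] B by (simp add: subspace_0)
  have expand_\<chi>: "expand \<chi> z = \<chi> z" if "z \<in> B" for z
  proof -
    have "z \<in> span EB" using that EB_span by simp
    then have "z \<in> B \<and> expand \<chi> z = \<chi> z"
    proof (induction rule: span_induct_alt)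
      case (step c x y)
      then have "x \<in> E" "x \<in> B" using E EB by auto
      with step show ?case
        using B by (simp add: \<chi>_add \<chi>_scale expand_add expand_scale expand_basis subspace_add subspace_scale)
    qed (simp add: \<chi>0 subspace_0[OF B])
    then show ?thesis by simp
  qed
  \<comment> \<open>The letters of \<open>n\<close> need not be ordered: exchanging two of them costs a bracket, on which \<open>\<chi>\<close> vanishes.\<close>
  have normal: "straighten (m @ n) = (if m = [] then prod_list (map \<chi> n) else 0)"
    if "set m \<inter> EB = {}" "sorted_wrt (\<lambda>a b. \<not> less b a) m" "set n \<subseteq> EB" for m n
    using that(3)
  proof (induction n rule: wf_induct_rule[OF wf_inv_image[OF wf_lex_prod[OF wf_less_than wf_less_than], of "\<lambda>w. (length w, inversions w)"]])
    case (1 n)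
    show ?case
    proof (cases "split_descent n")
      case None
      have "\<forall>x\<in>set m. \<forall>y\<in>set n. \<not> less y x"
        using that(1) 1(2) by (auto simp: less_def)
      then have "sorted_wrt (\<lambda>a b. \<not> less b a) (m @ n)"
        using split_descent_None[OF None] that(2) by (simp add: sorted_wrt_append)
      then have "straighten (m @ n) = nv (m @ n)"
        by (subst straighten.simps) (simp add: sorted_split_descent)
      also have "\<dots> = (if m = [] then prod_list (map \<chi> n) else 0)"
        using that(1) 1(2) by (cases m) (auto simp: nv_def)
      finally show ?thesis .
    next
      case (Some t)
      then obtain u y x v where "split_descent n = Some (u, y, x, v)" by (metis prod_cases4)
      then have n: "n = u @ y # x # v" and xy: "less x y" using split_descent_SomeD by auto
      have mem: "x \<in> B" "y \<in> B" using 1(2) n EB by auto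
      have "straighten (m @ n) = straighten (m @ u @ x # y # v) + expand (\<lambda>e. straighten (m @ u @ e # v)) (br y x)"
        using straighten_commute[of "m @ u" y x v] n by simp
      also have "straighten (m @ u @ x # y # v) = (if m = [] then prod_list (map \<chi> n) else 0)"
        by (subst 1(1)) (use 1(2) n inversions_swap[OF xy] in \<open>auto simp: mult_ac\<close>)
      also have "expand (\<lambda>e. straighten (m @ u @ e # v)) (br y x) =
          expand (\<lambda>e. (if m = [] then prod_list (map \<chi> u) * prod_list (map \<chi> v) else 0) * \<chi> e) (br y x)"
      proof (rule expand_B)
        show "br y x \<in> B" using mem by (simp add: B_br)
        fix e assume "e \<in> EB"
        then show "straighten (m @ u @ e # v) = (if m = [] then prod_list (map \<chi> u) * prod_list (map \<chi> v) else 0) * \<chi> e"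
          by (subst 1(1)) (use 1(2) n in \<open>auto simp: mult_ac\<close>)
      qed
      also have "\<dots> = 0"
        using mem by (simp only: expand_fun_mult) (simp add: expand_\<chi> B_br \<chi>_br)
      finally show ?thesis by simp
    qed
  qed
  have right: "straighten (w @ [b]) = \<chi> b * straighten w" if b: "b \<in> EB" for w b
  proof (induction w rule: wf_induct_rule[OF wf_inv_image[OF wf_lex_prod[OF wf_less_than wf_less_than], of "\<lambda>w. (length w, inversions w)"]])
    case (1 w)
    show ?case
    proof (cases "split_descent w")
      case None
      define m where "m = filter (\<lambda>x. x \<notin> EB) w"
      define n where "n = filter (\<lambda>x. x \<in> EB) w"
      have s: "sorted_wrt (\<lambda>a b. \<not> less b a) w" by (rule split_descent_None[OF None])
      then have "w = m @ n"
        unfolding m_def n_def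
        by (induction w) (auto simp: less_def filter_empty_conv)
      moreover have "sorted_wrt (\<lambda>a b. \<not> less b a) m"
        using s by (simp add: m_def sorted_wrt_filter)
      moreover have "set m \<inter> EB = {}" "set n \<subseteq> EB" by (auto simp: m_def n_def)
      ultimately show ?thesis
        using normal[of m n] normal[of m "n @ [b]"] b by auto
    next
      case (Some t)
      then obtain u y x v where "split_descent w = Some (u, y, x, v)" by (metis prod_cases4)
      then have w: "w = u @ y # x # v" and xy: "less x y" using split_descent_SomeD by auto
      have "straighten (w @ [b]) = straighten ((u @ x # y # v) @ [b]) + expand (\<lambda>e. straighten ((u @ e # v) @ [b])) (br y x)"
        using straighten_commute[of u y x "v @ [b]"] w by simp
      also have "straighten ((u @ x # y # v) @ [b]) = \<chi> b * straighten (u @ x # y # v)"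
        by (rule 1) (use w inversions_swap[OF xy] in auto)
      also have "(\<lambda>e. straighten ((u @ e # v) @ [b])) = (\<lambda>e. \<chi> b * straighten (u @ e # v))"
        by (rule ext, rule 1) (use w in auto)
      finally show ?thesis
        using straighten_commute[of u y x v] w by (simp add: expand_fun_mult algebra_simps)
    qed
  qed
  have right_multilinear: "multilinear u (w @ [b]) = \<chi> b * multilinear u w" if b: "b \<in> B" for u w b
  proof (induction w arbitrary: u)
    case Nil
    have "expand (\<lambda>e. straighten (u @ [e])) b = expand (\<lambda>e. straighten u * \<chi> e) b"
      by (rule expand_B[OF b]) (simp add: right mult.commute)
    then show ?case by (simp add: expand_fun_mult expand_\<chi>[OF b])
  qed (simp add: expand_fun_mult)
  define F where "F f = (\<Sum>w\<in>Poly_Mapping.keys f. Poly_Mapping.lookup f w * multilinear [] w)" for f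
  have F_superset: "F f = (\<Sum>w\<in>S. Poly_Mapping.lookup f w * multilinear [] w)"
    if "finite S" "Poly_Mapping.keys f \<subseteq> S" for f S
    unfolding F_def by (rule sum.mono_neutral_left) (use that in \<open>auto simp: in_keys_iff\<close>)
  have F_add: "F (f + g) = F f + F g" for f g
  proof -
    have fin: "finite (Poly_Mapping.keys f \<union> Poly_Mapping.keys g)" by simp
    show ?thesis
      using F_superset[OF fin, of f] F_superset[OF fin, of g] F_superset[OF fin, of "f + g"] Poly_Mapping.keys_add[of f g]
      by (simp add: lookup_add algebra_simps sum.distrib)
  qed
  have F_scale: "F (fscale r f) = r * F f" for f r
  proof -
    have "Poly_Mapping.keys (fscale r f) \<subseteq> Poly_Mapping.keys f" by (auto simp: in_keys_iff)
    then show ?thesis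
      using F_superset[of "Poly_Mapping.keys f" f] F_superset[of "Poly_Mapping.keys f" "fscale r f"]
      by (simp add: algebra_simps sum_distrib_left)
  qed
  have F_diff: "F (f - g) = F f - F g" for f g
    using F_add[of "f - g" g] by simp
  have F_basis: "F (basis_vec w) = multilinear [] w" for w
    by (simp add: F_def)
  have "F f = 0" if "f \<in> free_span (enveloping_relations sc br \<union> induced_relations {(b, \<chi> b) | b. b \<in> B})" for f
    using that
  proof (induction rule: free_vs.span_induct_alt)
    case base
    show ?case by (simp add: F_def)
  next
    case (step c g h)
    have "F g = 0"
      using step(1)
    proof
      assume "g \<in> enveloping_relations sc br"
      then show ?thesis
      proof cases
        case (env_bracket u x y w)
        show ?thesis
          unfolding env_bracket F_diff F_basis append_Cons append_Nil multilinear_commute[of "[]" u x y w] by simp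
      qed (simp_all add: F_diff F_scale F_basis multilinear_add multilinear_scale)
    next
      assume "g \<in> induced_relations {(b, \<chi> b) | b. b \<in> B}"
      then show ?thesis
        by (auto simp: induced_relations_def F_diff F_scale F_basis right_multilinear)
    qed
    with step show ?case by (simp add: F_add F_scale)
  qed
  moreover have "F (basis_vec []) = 1"
    using normal[of "[]" "[]"] by (simp add: F_basis)
  ultimately show ?thesis by fastforce
qed

section \<open>Highest weight modules over graded Lie algebras\<close>

text \<open>The module is a subspace \<open>X\<close> of an ambient vector space, so that submodules and direct sums are
  again sets to which the same locale applies.\<close>

locale lie_action = L: lie_algebra lsc br + vector_space sc
  for lsc :: "complex \<Rightarrow> 'l::ab_group_add \<Rightarrow> 'l" and br :: "'l \<Rightarrow> 'l \<Rightarrow> 'l"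
    and sc :: "complex \<Rightarrow> 'v::ab_group_add \<Rightarrow> 'v" +
  fixes X :: "'v set" and \<rho> :: "'l \<Rightarrow> 'v \<Rightarrow> 'v"
  assumes X: "subspace X"
    and act_closed: "v \<in> X \<Longrightarrow> \<rho> x v \<in> X"
    and act_add: "v \<in> X \<Longrightarrow> w \<in> X \<Longrightarrow> \<rho> x (v + w) = \<rho> x v + \<rho> x w"
    and act_scale: "v \<in> X \<Longrightarrow> \<rho> x (sc r v) = sc r (\<rho> x v)"
    and add_act: "v \<in> X \<Longrightarrow> \<rho> (x + y) v = \<rho> x v + \<rho> y v"
    and scale_act: "v \<in> X \<Longrightarrow> \<rho> (lsc r x) v = sc r (\<rho> x v)"
    and act_br: "v \<in> X \<Longrightarrow> \<rho> (br x y) v = \<rho> x (\<rho> y v) - \<rho> y (\<rho> x v)"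
begin

definition invariant :: "'v set \<Rightarrow> bool" where
  "invariant N \<longleftrightarrow> subspace N \<and> N \<subseteq> X \<and> (\<forall>x. \<forall>v\<in>N. \<rho> x v \<in> N)"

definition irreducible :: bool where
  "irreducible \<longleftrightarrow> (\<forall>N. invariant N \<longrightarrow> N = {0} \<or> N = X)"

lemma act_0 [simp]: "\<rho> x 0 = 0"
  using act_scale[OF subspace_0[OF X], of x 0] by simp

lemma zero_act: "v \<in> X \<Longrightarrow> \<rho> 0 v = 0"
  using scale_act[of v 0 0] by simp

lemma act_diff: "v \<in> X \<Longrightarrow> w \<in> X \<Longrightarrow> \<rho> x (v - w) = \<rho> x v - \<rho> x w"
  using act_add[of "v - w" w x] X by (simp add: subspace_diff)

lemma act_sum: "(\<And>j. j \<in> J \<Longrightarrow> v j \<in> X) \<Longrightarrow> \<rho> x (\<Sum>j\<in>J. v j) = (\<Sum>j\<in>J. \<rho> x (v j))"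
proof (induction J rule: infinite_finite_induct)
  case (insert j J)
  then have "(\<Sum>j\<in>J. v j) \<in> X" by (intro subspace_sum[OF X]) auto
  with insert show ?case by (simp add: act_add)
qed auto

lemma act_swap: "v \<in> X \<Longrightarrow> \<rho> x (\<rho> y v) = \<rho> y (\<rho> x v) + \<rho> (br x y) v"
  by (simp add: act_br)

text \<open>Applying \<open>D - c i\<close> to the sum removes the term \<open>v i\<close> and multiplies the other ones by nonzero
  scalars, so that induction applies.\<close>

lemma eigen_component:
  assumes "subspace N" "\<And>v. v \<in> N \<Longrightarrow> \<rho> D v \<in> N" "finite J" "inj_on c J"
    "\<And>j. j \<in> J \<Longrightarrow> v j \<in> X" "\<And>j. j \<in> J \<Longrightarrow> \<rho> D (v j) = sc (c j) (v j)"
    "(\<Sum>j\<in>J. v j) \<in> N" "j \<in> J"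
  shows "v j \<in> N"
  using assms(3-)
proof (induction J arbitrary: v j rule: finite_induct)
  case (insert i J)
  have vX: "(\<Sum>j\<in>J. v j) \<in> X" by (intro subspace_sum[OF X]) (use insert in auto)
  let ?s = "\<Sum>j\<in>insert i J. v j"
  have "\<rho> D ?s - sc (c i) ?s \<in> N"
    using insert.prems assms(1,2) by (intro subspace_diff subspace_scale) auto
  also have "\<rho> D ?s - sc (c i) ?s = (\<Sum>j\<in>J. sc (c j - c i) (v j))"
    using insert vX
    by (simp add: act_add act_sum scale_sum_right scale_right_distrib scale_left_diff_distrib sum_subtractf)
  finally have *: "(\<Sum>j\<in>J. sc (c j - c i) (v j)) \<in> N" .
  have J: "v j \<in> N" if j: "j \<in> J" for j
  proof -
    have "sc (c j - c i) (v j) \<in> N"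
      by (rule insert.IH[of "\<lambda>j. sc (c j - c i) (v j)"])
        (use insert.prems * j in \<open>auto simp: act_scale subspace_scale[OF X] mult.commute\<close>)
    then have "sc (1 / (c j - c i)) (sc (c j - c i) (v j)) \<in> N"
      using assms(1) by (rule subspace_scale[rotated])
    moreover have "c j \<noteq> c i" using insert.prems(1) insert.hyps(2) j unfolding inj_on_def by blast
    ultimately show ?thesis by simp
  qed
  then have "?s - (\<Sum>j\<in>J. v j) \<in> N"
    by (intro subspace_diff[OF assms(1) insert.prems(4)] subspace_sum[OF assms(1)])
  then have "v i \<in> N" using insert by simp
  with J insert.prems show ?case by auto
qed auto

lemma eigen_sum_zero:
  assumes "finite J" "inj_on c J" "\<And>j. j \<in> J \<Longrightarrow> v j \<in> X"
    "\<And>j. j \<in> J \<Longrightarrow> \<rho> D (v j) = sc (c j) (v j)" "(\<Sum>j\<in>J. v j) = 0" "j \<in> J"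
  shows "v j = 0"
  using eigen_component[of "{0}" D J c v j] assms by (auto simp: subspace_def)

definition eigenspan :: "'l \<Rightarrow> complex set \<Rightarrow> 'v set" where
  "eigenspan D C = span {v \<in> X. \<exists>c\<in>C. \<rho> D v = sc c v}"

lemma eigenspan_sub: "eigenspan D C \<subseteq> X"
  unfolding eigenspan_def by (rule span_minimal[OF _ X]) auto

lemma eigenspan_sum:
  assumes "w \<in> eigenspan D C"
  obtains J v where "finite J" "J \<subseteq> C" "w = (\<Sum>j\<in>J. v j)"
    "\<forall>j. v j \<in> X" "\<forall>j. \<rho> D (v j) = sc j (v j)"
proof -
  have "\<exists>J v. finite J \<and> J \<subseteq> C \<and> w = (\<Sum>j\<in>J. v j) \<and> (\<forall>j. v j \<in> X) \<and> (\<forall>j. \<rho> D (v j) = sc j (v j))"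
    using assms unfolding eigenspan_def
  proof (induction rule: span_induct_alt)
    case base
    show ?case by (rule exI[of _ "{}"], rule exI[of _ "\<lambda>_. 0"]) (simp add: subspace_0[OF X])
  next
    case (step r x y)
    then obtain J v where J: "finite J" "J \<subseteq> C" "y = (\<Sum>j\<in>J. v j)" "\<forall>j. v j \<in> X" "\<forall>j. \<rho> D (v j) = sc j (v j)"
      by blast
    obtain c where c: "c \<in> C" "\<rho> D x = sc c x" "x \<in> X" using step by auto
    define v0 where "v0 = (\<lambda>j. if j \<in> J then v j else 0)"
    define v' where "v' = v0(c := v0 c + sc r x)"
    have v0: "v0 j \<in> X" "\<rho> D (v0 j) = sc j (v0 j)" for j
      using J by (auto simp: v0_def subspace_0[OF X])
    have "(\<Sum>j\<in>insert c J. v' j) = (\<Sum>j\<in>insert c J. v0 j + (if j = c then sc r x else 0))"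
      by (intro sum.cong) (auto simp: v'_def)
    also have "\<dots> = (\<Sum>j\<in>insert c J. v0 j) + sc r x"
      using J(1) by (simp add: sum.distrib)
    also have "(\<Sum>j\<in>insert c J. v0 j) = y"
      unfolding J(3) using J(1) by (intro sum.mono_neutral_cong_right) (auto simp: v0_def)
    finally have "sc r x + y = (\<Sum>j\<in>insert c J. v' j)" by (simp add: add.commute)
    moreover have "v' j \<in> X \<and> \<rho> D (v' j) = sc j (v' j)" for j
      using v0 c by (auto simp: v'_def subspace_add[OF X] subspace_scale[OF X] act_add act_scale
          scale_right_distrib mult.commute)
    ultimately show ?case using J(1,2) c(1)
      by (intro exI[of _ "insert c J"] exI[of _ v']) auto
  qed
  then show ?thesis using that by blast
qed

lemma eigen_component_plus:
  assumes N: "subspace N" "\<And>v. v \<in> N \<Longrightarrow> \<rho> D v \<in> N"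
    and z: "z \<in> X" "\<rho> D z = sc c z" and w: "w \<in> eigenspan D C" "c \<notin> C" and sum: "z + w \<in> N"
  shows "z \<in> N"
proof -
  obtain J v where J': "finite J" "J \<subseteq> C" "w = (\<Sum>j\<in>J. v j)" "\<forall>j. v j \<in> X" "\<forall>j. \<rho> D (v j) = sc j (v j)"
    using w(1) by (rule eigenspan_sum)
  note J = J'(1-3) J'(4,5)[rule_format]
  have cJ: "c \<notin> J" using J(2) w(2) by auto
  define v' where "v' = v(c := z)"
  have "w = (\<Sum>j\<in>J. v' j)" unfolding J(3) by (rule sum.cong) (use cJ in \<open>auto simp: v'_def\<close>)
  then have "(\<Sum>j\<in>insert c J. v' j) \<in> N" using J(1) cJ sum by (simp add: v'_def)
  then have "v' c \<in> N"
    using eigen_component[OF N, of "insert c J" id v' c] J z by (auto simp: v'_def)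
  then show ?thesis by (simp add: v'_def)
qed

lemma eigenvector_in_eigenspan:
  assumes "z \<in> eigenspan D C" "\<rho> D z = sc c z" "c \<notin> C"
  shows "z = 0"
proof -
  have "- z \<in> eigenspan D C" using assms(1) by (simp add: eigenspan_def span_neg)
  then have "z \<in> {0}"
    using assms eigenspan_sub by (intro eigen_component_plus[of "{0}" D z c "- z" C]) (auto simp: subspace_def)
  then show ?thesis by simp
qed

lemma act_span_A:
  assumes "v \<in> X" "subspace S" "\<And>a. a \<in> A \<Longrightarrow> \<rho> a v \<in> S" "x \<in> L.span A"
  shows "\<rho> x v \<in> S"
  using assms(4)
proof (induction rule: L.span_induct_alt)
  case base
  then show ?case using assms by (simp add: zero_act subspace_0)
next
  case (step c x y)
  then show ?case using assms by (simp add: add_act scale_act subspace_add subspace_scale)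
qed

lemma invariantI:
  assumes "subspace N" "N \<subseteq> X" "N = span S" "\<And>x v. v \<in> S \<Longrightarrow> \<rho> x v \<in> N"
  shows "invariant N"
proof -
  have "v \<in> X \<and> \<rho> x v \<in> N" if "v \<in> span S" for x v
    using that
  proof (induction rule: span_induct_alt)
    case base
    then show ?case by (simp add: assms(1) subspace_0 subspace_0[OF X])
  next
    case (step c w y)
    then have "w \<in> X" "\<rho> x w \<in> N" using assms by (auto simp: span_base)
    with step assms(1) show ?case
      by (simp add: act_add act_scale subspace_scale[OF X] subspace_add[OF X] subspace_add subspace_scale)
  qed
  with assms show ?thesis by (simp add: invariant_def)
qed

lemma invariantD: "invariant N \<Longrightarrow> subspace N" "invariant N \<Longrightarrow> N \<subseteq> X"
    "invariant N \<Longrightarrow> v \<in> N \<Longrightarrow> \<rho> x v \<in> N"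
  by (auto simp: invariant_def)

end

text \<open>A spanning set of eigenvectors of \<open>ad D\<close> takes the place of a full decomposition into
  eigenspaces. The condition on letters of degree 0 makes the vectors killed by all letters of
  positive degree stable under the letters of degree 0.\<close>

locale graded_lie_algebra = lie_algebra lsc br
  for lsc :: "complex \<Rightarrow> 'l::ab_group_add \<Rightarrow> 'l" and br :: "'l \<Rightarrow> 'l \<Rightarrow> 'l" +
  fixes D :: 'l and A :: "'l set" and deg :: "'l \<Rightarrow> int"
  assumes span_A: "span A = UNIV"
    and deg_A: "a \<in> A \<Longrightarrow> br D a = lsc (of_int (deg a)) a"
    and deg0_A: "h \<in> A \<Longrightarrow> a \<in> A \<Longrightarrow> deg h = 0 \<Longrightarrow> deg a > 0 \<Longrightarrow> \<exists>r. br h a = lsc r a"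

locale graded_action = lie_action lsc br sc X \<rho> + L: graded_lie_algebra lsc br D A deg
  for lsc :: "complex \<Rightarrow> 'l::ab_group_add \<Rightarrow> 'l" and br :: "'l \<Rightarrow> 'l \<Rightarrow> 'l"
    and sc :: "complex \<Rightarrow> 'v::ab_group_add \<Rightarrow> 'v" and X \<rho> D A deg
begin

inductive_set lowered :: "'v set \<Rightarrow> 'v set" for Z :: "'v set" where
  base: "z \<in> Z \<Longrightarrow> z \<in> lowered Z"
| step: "a \<in> A \<Longrightarrow> deg a < 0 \<Longrightarrow> v \<in> lowered Z \<Longrightarrow> \<rho> a v \<in> lowered Z"

lemma lowered_sub: "Z \<subseteq> X \<Longrightarrow> lowered Z \<subseteq> X"
proof
  fix v assume "Z \<subseteq> X" "v \<in> lowered Z"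
  from this(2,1) show "v \<in> X" by induction (auto simp: act_closed)
qed

text \<open>The role of the triangular decomposition: a letter of nonnegative degree is moved to the right
  past the lowering letters, which costs brackets applied to shorter products, until it meets \<open>Z\<close>.\<close>

lemma invariant_lowered:
  assumes Z: "Z \<subseteq> X" and nonneg: "\<And>a z. a \<in> A \<Longrightarrow> deg a \<ge> 0 \<Longrightarrow> z \<in> Z \<Longrightarrow> \<rho> a z \<in> span Z"
  shows "invariant (span (lowered Z))"
proof (rule invariantI)
  let ?N = "span (lowered Z)"
  show "subspace ?N" by simp
  show N: "?N \<subseteq> X" by (rule span_minimal[OF lowered_sub[OF Z] X])
  have neg: "\<rho> a v \<in> ?N" if "a \<in> A" "deg a < 0" "v \<in> ?N" for a v
  proof -
    from that(3) have "v \<in> X \<and> \<rho> a v \<in> ?N"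
    proof (induction rule: span_induct_alt)
    case base
    then show ?case by (simp add: span_zero subspace_0[OF X])
  next
    case (step c w y)
    then have "w \<in> X" using N lowered_sub[OF Z] by auto
    moreover have "\<rho> a w \<in> ?N" using step that by (intro span_base lowered.step)
    ultimately show ?case using step
      by (simp add: act_add act_scale subspace_scale[OF X] subspace_add[OF X] span_add span_scale)
    qed
    then show ?thesis by simp
  qed
  show "\<rho> x v \<in> ?N" if "v \<in> lowered Z" for x v
    using that
  proof (induction arbitrary: x)
    case (base z)
    have gen: "\<rho> a z \<in> ?N" if "a \<in> A" for a
    proof (cases "deg a < 0")
      case True
      then show ?thesis using that base by (intro span_base lowered.intros)
    next
      case False
      moreover have "span Z \<subseteq> ?N" by (intro span_mono) (auto intro: lowered.base)
      ultimately show ?thesis using nonneg[of a z] that base by auto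
    qed
    show ?case
      by (rule act_span_A[of z _ A]) (use gen base Z in \<open>auto simp: L.span_A\<close>)
  next
    case (step b v)
    then have v: "v \<in> X" using lowered_sub[OF Z] by auto
    have gen: "\<rho> a (\<rho> b v) \<in> ?N" if "a \<in> A" for a
      using act_swap[OF v, of a b] neg[OF step(1,2) step.IH[of a]] step.IH[of "br a b"]
      by (simp add: span_add)
    show ?case
      by (rule act_span_A[of "\<rho> b v" _ A]) (use gen v in \<open>auto simp: L.span_A act_closed\<close>)
  qed
qed simp

abbreviation below :: "complex \<Rightarrow> complex set" where
  "below d \<equiv> {d - of_nat n | n. n > 0}"

lemma lowered_eigen:
  assumes Z: "Z \<subseteq> {z \<in> X. \<rho> D z = sc d z}" and v: "v \<in> lowered Z"
  shows "v \<in> Z \<or> (\<exists>c \<in> below d. \<rho> D v = sc c v)"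
  using v
proof induction
  case (step a v)
  have vX: "v \<in> X" using step lowered_sub[of Z] Z by auto
  obtain n where n: "\<rho> D v = sc (d - of_nat n) v"
  proof (cases "v \<in> Z")
    case True
    then show ?thesis using Z by (intro that[of 0]) auto
  qed (use step.IH in \<open>auto intro: that\<close>)
  have "\<rho> D (\<rho> a v) = sc (d - of_nat (n + nat (- deg a))) (\<rho> a v)"
  proof -
    have "\<rho> D (\<rho> a v) = sc (d - of_nat n) (\<rho> a v) + sc (of_int (deg a)) (\<rho> a v)"
      using act_swap[OF vX, of D a] step(1) vX by (simp only: n act_scale L.deg_A scale_act)
    also have "\<dots> = sc (d - of_nat n + of_int (deg a)) (\<rho> a v)"
      by (simp only: scale_left_distrib)
    also have "d - of_nat n + of_int (deg a) = d - of_nat (n + nat (- deg a))"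
      using step(2) by simp
    finally show ?thesis .
  qed
  moreover have "n + nat (- deg a) > 0" using step by auto
  ultimately show ?case by blast
qed simp

lemma span_lowered:
  assumes Z: "Z \<subseteq> {z \<in> X. \<rho> D z = sc d z}" and v: "v \<in> span (lowered Z)"
  obtains z w where "z \<in> span Z" "w \<in> eigenspan D (below d)" "v = z + w"
proof -
  have "lowered Z \<subseteq> Z \<union> {v \<in> X. \<exists>c \<in> below d. \<rho> D v = sc c v}"
    using lowered_eigen[OF Z] lowered_sub[of Z] Z by auto
  then have "v \<in> span (Z \<union> {v \<in> X. \<exists>c \<in> below d. \<rho> D v = sc c v})"
    using v span_mono by blast
  then show ?thesis using that by (auto simp: span_Un eigenspan_def)
qed

lemma span_eigen:
  assumes "Z \<subseteq> {z \<in> X. \<rho> D z = sc d z}" "z \<in> span Z"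
  shows "z \<in> X" "\<rho> D z = sc d z"
proof -
  have "subspace {z \<in> X. \<rho> D z = sc d z}"
    using X by (auto simp: subspace_def act_add act_scale scale_right_distrib mult.commute)
  then show "z \<in> X" "\<rho> D z = sc d z" using span_minimal[OF assms(1)] assms(2) by auto
qed

lemma not_below: "d \<notin> below d" by auto

end

locale highest_weight_action = graded_action lsc br sc X \<rho> D A deg
  for lsc :: "complex \<Rightarrow> 'l::ab_group_add \<Rightarrow> 'l" and br :: "'l \<Rightarrow> 'l \<Rightarrow> 'l"
    and sc :: "complex \<Rightarrow> 'v::ab_group_add \<Rightarrow> 'v" and X \<rho> D A deg +
  fixes u :: 'v and d :: complex
  assumes u: "u \<in> X" "u \<noteq> 0" and D_u: "\<rho> D u = sc d u"
    and deg0_u: "a \<in> A \<Longrightarrow> deg a = 0 \<Longrightarrow> \<rho> a u \<in> span {u}"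
    and pos_u: "a \<in> A \<Longrightarrow> deg a > 0 \<Longrightarrow> \<rho> a u = 0"
    and cyclic: "invariant N \<Longrightarrow> u \<in> N \<Longrightarrow> N = X"
begin

lemma u_eigen: "{u} \<subseteq> {z \<in> X. \<rho> D z = sc d z}"
  using u D_u by simp

lemma X_lowered: "X = span (lowered {u})"
proof (rule cyclic[symmetric])
  show "invariant (span (lowered {u}))"
  proof (rule invariant_lowered)
    show "\<rho> a z \<in> span {u}" if "a \<in> A" "deg a \<ge> 0" "z \<in> {u}" for a z
      using that by (cases "deg a = 0") (auto simp: pos_u deg0_u span_zero)
  qed (use u in simp)
  show "u \<in> span (lowered {u})" by (intro span_base lowered.base) simp
qed

lemma decompose:
  assumes "v \<in> X"
  obtains r w where "w \<in> eigenspan D (below d)" "v = sc r u + w"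
proof -
  have "v \<in> span (lowered {u})" using assms by (simp only: X_lowered[symmetric])
  then obtain z w where "z \<in> span {u}" "w \<in> eigenspan D (below d)" "v = z + w"
    by (rule span_lowered[OF u_eigen])
  then show ?thesis using that by (auto simp: span_singleton)
qed

text \<open>The multiples of \<open>u\<close> are the whole \<open>d\<close>-eigenspace, so an invariant subspace that contains a vector
  with nonzero component along \<open>u\<close> contains \<open>u\<close>.\<close>

lemma proper_invariant_below:
  assumes N: "invariant N" "u \<notin> N"
  shows "N \<subseteq> eigenspan D (below d)"
proof
  fix v assume v: "v \<in> N"
  then have "v \<in> X" using invariantD[OF N(1)] by auto
  then obtain r w where w: "w \<in> eigenspan D (below d)" "v = sc r u + w" by (rule decompose)
  have "sc r u \<in> N"
    by (rule eigen_component_plus[where N = N and c = d, OF _ _ _ _ w(1)])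
      (use invariantD[OF N(1)] u D_u v w in \<open>auto simp: act_scale subspace_scale[OF X] mult.commute\<close>)
  moreover have "u = sc (1 / r) (sc r u)" if "r \<noteq> 0" using that by simp
  ultimately have "r = 0" using N invariantD(1)[OF N(1)] by (metis subspace_scale)
  with w show "v \<in> eigenspan D (below d)" by simp
qed

lemma u_not_below: "u \<notin> eigenspan D (below d)"
  using eigenvector_in_eigenspan[OF _ D_u not_below] u by auto

text \<open>No invariant subspace avoiding \<open>u\<close> has a component along \<open>u\<close>; hence neither has their sum.\<close>

lemma largest_proper_invariant:
  obtains N0 where "invariant N0" "u \<notin> N0" "\<And>N. invariant N \<Longrightarrow> u \<notin> N \<Longrightarrow> N \<subseteq> N0"
proof -
  define N0 where "N0 = span (\<Union>{N. invariant N \<and> u \<notin> N})"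
  have "N0 \<subseteq> eigenspan D (below d)"
    unfolding N0_def by (rule span_minimal) (use proper_invariant_below in \<open>auto simp: eigenspan_def\<close>)
  moreover from this have "N0 \<subseteq> X" using eigenspan_sub by auto
  then have "invariant N0"
  proof (intro invariantI[of N0 "\<Union>{N. invariant N \<and> u \<notin> N}"])
    show "\<rho> x v \<in> N0" if "v \<in> \<Union> {N. invariant N \<and> u \<notin> N}" for x v
      using that unfolding N0_def by (intro span_base) (auto dest: invariantD(3))
  qed (simp_all add: N0_def)
  moreover have "N \<subseteq> N0" if "invariant N" "u \<notin> N" for N
    using that unfolding N0_def by (auto intro: span_base)
  ultimately show ?thesis using u_not_below by (intro that[of N0]) auto
qed

text \<open>A singular vector with an eigenvalue \<open>j\<close> strictly below \<open>d\<close> would generate an invariant subspace on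
  which only the eigenvalues \<open>j, j - 1, \<dots>\<close> occur, hence a proper one.\<close>

lemma singular_vector:
  assumes irr: irreducible and v: "v \<in> X" and kill: "\<And>a. a \<in> A \<Longrightarrow> deg a > 0 \<Longrightarrow> \<rho> a v = 0"
  shows "\<exists>r. v = sc r u"
proof -
  obtain r w where w: "w \<in> eigenspan D (below d)" "v = sc r u + w" using v by (rule decompose)
  obtain J f where J': "finite J" "J \<subseteq> below d" "w = (\<Sum>j\<in>J. f j)"
      "\<forall>j. f j \<in> X" "\<forall>j. \<rho> D (f j) = sc j (f j)"
    using w(1) by (rule eigenspan_sum)
  note J = J'(1-3) J'(4,5)[rule_format]
  have killf: "\<rho> a (f j) = 0" if a: "a \<in> A" "deg a > 0" and j: "j \<in> J" for a j
  proof (rule eigen_sum_zero[of J "\<lambda>j. j + of_int (deg a)" "\<lambda>j. \<rho> a (f j)" D j])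
    have "0 = \<rho> a (sc r u + w)" using kill[OF a] w by simp
    also have "\<dots> = sc r (\<rho> a u) + \<rho> a w"
      using u w eigenspan_sub by (subst act_add) (auto simp: act_scale subspace_scale[OF X])
    also have "\<dots> = (\<Sum>j\<in>J. \<rho> a (f j))" using a J by (simp add: pos_u act_sum)
    finally show "(\<Sum>j\<in>J. \<rho> a (f j)) = 0" by simp
    show "\<rho> D (\<rho> a (f j)) = sc (j + of_int (deg a)) (\<rho> a (f j))" for j
      using act_swap[OF J(4), of D a j] a J
      by (simp add: L.deg_A scale_act act_scale scale_left_distrib)
  qed (use J j in \<open>auto simp: act_closed inj_on_def\<close>)
  have "f j = 0" if j: "j \<in> J" for j
  proof (rule ccontr)
    assume nz: "f j \<noteq> 0"
    \<comment> \<open>All singular vectors of eigenvalue \<open>j\<close> are taken together, since \<open>f j\<close> alone need not be stable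
      under the letters of degree 0.\<close>
    define Z where "Z = {z \<in> X. \<rho> D z = sc j z \<and> (\<forall>a\<in>A. deg a > 0 \<longrightarrow> \<rho> a z = 0)}"
    have Z: "Z \<subseteq> {z \<in> X. \<rho> D z = sc j z}" by (auto simp: Z_def)
    have "invariant (span (lowered Z))"
    proof (rule invariant_lowered)
      fix a z assume a: "a \<in> A" "deg a \<ge> 0" and z: "z \<in> Z"
      show "\<rho> a z \<in> span Z"
      proof (cases "deg a = 0")
        case True
        have zX: "z \<in> X" using z Z by auto
        have "\<rho> D (\<rho> a z) = sc j (\<rho> a z)"
          using act_swap[OF zX, of D a] a True z by (simp add: L.deg_A zero_act zX Z_def act_scale)
        moreover have "\<rho> b (\<rho> a z) = 0" if b: "b \<in> A" "deg b > 0" for b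
        proof -
          obtain r where "br a b = lsc r b" using L.deg0_A[OF a(1) b(1) True b(2)] by blast
          then show ?thesis using act_swap[OF zX, of a b] z b zX by (simp add: Z_def scale_act)
        qed
        ultimately have "\<rho> a z \<in> Z" using zX by (simp add: Z_def act_closed)
        then show ?thesis by (rule span_base)
      qed (use a z in \<open>auto simp: Z_def span_zero\<close>)
    qed (use Z in auto)
    moreover have "f j \<in> span (lowered Z)"
      using J killf[OF _ _ j] by (intro span_base lowered.base) (auto simp: Z_def)
    ultimately have "u \<in> span (lowered Z)" using irr nz u by (auto simp: irreducible_def)
    moreover have "span (lowered Z) \<subseteq> eigenspan D (below d)"
      unfolding eigenspan_def
    proof (rule span_mono, rule subsetI)
      fix v assume v: "v \<in> lowered Z"
      obtain n where n: "j = d - of_nat n" "n > 0" using J(2) j by auto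
      have "\<exists>m. \<rho> D v = sc (j - of_nat m) v"
      proof (cases "v \<in> Z")
        case True
        then show ?thesis by (intro exI[of _ 0]) (simp add: Z_def)
      qed (use lowered_eigen[OF Z v] in auto)
      then obtain m where "\<rho> D v = sc (d - of_nat (n + m)) v" using n by (auto simp: algebra_simps)
      moreover have "n + m > 0" using n by simp
      ultimately show "v \<in> {v \<in> X. \<exists>c\<in>below d. \<rho> D v = sc c v}"
        using v lowered_sub[of Z] Z by blast
    qed
    ultimately show False using u_not_below by auto
  qed
  then have "w = 0" unfolding J(3) by simp
  with w show ?thesis by auto
qed

end

text \<open>The invariant subspace \<open>N\<close> of the direct sum generated by \<open>(u1, u2)\<close> is the graph of an
  isomorphism. Its \<open>d\<close>-eigenspace is spanned by \<open>(u1, u2)\<close>, so \<open>N\<close> contains neither \<open>(u1, 0)\<close> nor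
  \<open>(0, u2)\<close>, and by irreducibility it meets both summands trivially.\<close>

lemma irreducible_highest_weight_unique:
  fixes lsc :: "complex \<Rightarrow> 'l::ab_group_add \<Rightarrow> 'l"
    and s1 :: "complex \<Rightarrow> 'v::ab_group_add \<Rightarrow> 'v" and s2 :: "complex \<Rightarrow> 'w::ab_group_add \<Rightarrow> 'w"
  assumes M1: "highest_weight_action lsc br s1 X1 \<rho>1 D A deg u1 d" "lie_action.irreducible s1 X1 \<rho>1"
    and M2: "highest_weight_action lsc br s2 X2 \<rho>2 D A deg u2 d" "lie_action.irreducible s2 X2 \<rho>2"
    and same: "\<And>a. a \<in> A \<Longrightarrow> deg a = 0 \<Longrightarrow> \<exists>r. \<rho>1 a u1 = s1 r u1 \<and> \<rho>2 a u2 = s2 r u2"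
  shows "\<exists>\<theta>. bij_betw \<theta> X1 X2 \<and> (\<forall>v\<in>X1. \<forall>w\<in>X1. \<theta> (v + w) = \<theta> v + \<theta> w) \<and>
     (\<forall>r. \<forall>v\<in>X1. \<theta> (s1 r v) = s2 r (\<theta> v)) \<and> (\<forall>x. \<forall>v\<in>X1. \<theta> (\<rho>1 x v) = \<rho>2 x (\<theta> v))"
proof -
  interpret M1: highest_weight_action lsc br s1 X1 \<rho>1 D A deg u1 d by (rule M1)
  interpret M2: highest_weight_action lsc br s2 X2 \<rho>2 D A deg u2 d by (rule M2)
  define s where "s r p = (s1 r (fst p), s2 r (snd p))" for r p
  define \<rho> where "\<rho> x p = (\<rho>1 x (fst p), \<rho>2 x (snd p))" for x p
  interpret P: vector_space s
    by unfold_locales (auto simp: s_def M1.scale_right_distrib M2.scale_right_distrib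
        M1.scale_left_distrib M2.scale_left_distrib)
  interpret P: graded_action lsc br s "X1 \<times> X2" \<rho> D A deg
  proof
    show "P.subspace (X1 \<times> X2)"
      using M1.X M2.X by (auto simp: P.subspace_def M1.subspace_def M2.subspace_def s_def zero_prod_def)
  qed (auto simp: \<rho>_def s_def M1.act_closed M2.act_closed M1.act_add M2.act_add M1.act_scale M2.act_scale
      M1.add_act M2.add_act M1.scale_act M2.scale_act M1.act_br M2.act_br)
  let ?u = "(u1, u2)"
  define N where "N = P.span (P.lowered {?u})"
  have u_eigen: "{?u} \<subseteq> {z \<in> X1 \<times> X2. \<rho> D z = s d z}"
    using M1.u M2.u M1.D_u M2.D_u by (simp add: \<rho>_def s_def)
  have inv: "P.invariant N"
    unfolding N_def
  proof (rule P.invariant_lowered)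
    fix a z assume a: "a \<in> A" "deg a \<ge> 0" and z: "z \<in> {?u}"
    show "\<rho> a z \<in> P.span {?u}"
    proof (cases "deg a = 0")
      case True
      obtain r where "\<rho>1 a u1 = s1 r u1" "\<rho>2 a u2 = s2 r u2" using same[OF a(1) True] by blast
      then have "\<rho> a z = s r ?u" using z by (simp add: \<rho>_def s_def)
      then show ?thesis by (simp add: P.span_base P.span_scale)
    next
      case False
      then have "\<rho> a z = 0" using a z M1.pos_u M2.pos_u by (simp add: \<rho>_def zero_prod_def)
      then show ?thesis by (simp add: P.span_zero)
    qed
  qed (use u_eigen in auto)
  note N = P.invariantD[OF inv]
  have uN: "?u \<in> N" unfolding N_def by (intro P.span_base P.lowered.base) simp
  have top: "\<exists>r. p = s r ?u" if p: "p \<in> N" "\<rho> D p = s d p" for p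
  proof -
    obtain z w where zw: "z \<in> P.span {?u}" "w \<in> P.eigenspan D (P.below d)" "p = z + w"
      using P.span_lowered[OF u_eigen] p(1) unfolding N_def by blast
    have z: "z \<in> X1 \<times> X2" "\<rho> D z = s d z" using P.span_eigen[OF u_eigen zw(1)] by auto
    have pX: "p \<in> X1 \<times> X2" using N(2) p(1) by auto
    have w: "w = p - z" using zw by simp
    have "\<rho> D w = s d w" unfolding w using P.act_diff[OF pX z(1)] z p(2) by (simp add: P.scale_right_diff_distrib)
    then have "w = 0" using P.eigenvector_in_eigenspan[OF zw(2) _ P.not_below] by simp
    then show ?thesis using zw by (auto simp: P.span_singleton)
  qed
  have N_add: "(v + v', w + w') \<in> N" if "(v, w) \<in> N" "(v', w') \<in> N" for v w v' w'
    using P.subspace_add[OF N(1) that] by simp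
  have N_scale: "(s1 r v, s2 r w) \<in> N" if "(v, w) \<in> N" for r v w
    using P.subspace_scale[OF N(1) that, of r] by (simp add: s_def)
  have N_act: "(\<rho>1 x v, \<rho>2 x w) \<in> N" if "(v, w) \<in> N" for x v w
    using N(3)[OF that, of x] by (simp add: \<rho>_def)
  have N_0: "(0, 0) \<in> N" using P.subspace_0[OF N(1)] by (simp add: zero_prod_def)
  have N_X: "v \<in> X1 \<and> w \<in> X2" if "(v, w) \<in> N" for v w using N(2) that by auto
  have total1: "\<exists>w. (v, w) \<in> N" if "v \<in> X1" for v
  proof -
    have "M1.invariant {v. \<exists>w. (v, w) \<in> N}"
      unfolding M1.invariant_def M1.subspace_def mem_Collect_eq subset_eq
      using N_add N_scale N_act N_0 N_X by blast
    then show ?thesis using M1.cyclic uN that by blast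
  qed
  have total2: "\<exists>v. (v, w) \<in> N" if "w \<in> X2" for w
  proof -
    have "M2.invariant {w. \<exists>v. (v, w) \<in> N}"
      unfolding M2.invariant_def M2.subspace_def mem_Collect_eq subset_eq
      using N_add N_scale N_act N_0 N_X by blast
    then show ?thesis using M2.cyclic uN that by blast
  qed
  have inj1: "v = 0" if "(v, 0) \<in> N" for v
  proof -
    have "M1.invariant {v. (v, 0) \<in> N}"
      using N_add[of _ 0 _ 0] N_scale[of _ 0] N_act[of _ 0] N_0 N_X by (auto simp: M1.invariant_def M1.subspace_def)
    moreover have "{v. (v, 0) \<in> N} \<noteq> X1"
    proof
      assume "{v. (v, 0) \<in> N} = X1"
      then have "(u1, 0) \<in> N" using M1.u by auto
      then obtain r where "(u1, 0) = s r ?u" using top[of "(u1, 0)"] M1.D_u by (auto simp: \<rho>_def s_def)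
      then show False using M1.u M2.u by (auto simp: s_def)
    qed
    ultimately show ?thesis using M1(2) that unfolding M1.irreducible_def by blast
  qed
  have inj2: "w = 0" if "(0, w) \<in> N" for w
  proof -
    have "M2.invariant {w. (0, w) \<in> N}"
      using N_add[of 0 _ 0 _] N_scale[of 0] N_act[of 0] N_0 N_X by (auto simp: M2.invariant_def M2.subspace_def)
    moreover have "{w. (0, w) \<in> N} \<noteq> X2"
    proof
      assume "{w. (0, w) \<in> N} = X2"
      then have "(0, u2) \<in> N" using M2.u by auto
      then obtain r where "(0, u2) = s r ?u" using top[of "(0, u2)"] M2.D_u by (auto simp: \<rho>_def s_def)
      then show False using M1.u M2.u by (auto simp: s_def)
    qed
    ultimately show ?thesis using M2(2) that unfolding M2.irreducible_def by blast
  qed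
  have uniq2: "w = w'" if "(v, w) \<in> N" "(v, w') \<in> N" for v w w'
    using P.subspace_diff[OF N(1) that] inj2[of "w - w'"] by simp
  have uniq1: "v = v'" if "(v, w) \<in> N" "(v', w) \<in> N" for v v' w
    using P.subspace_diff[OF N(1) that] inj1[of "v - v'"] by simp
  define \<theta> where "\<theta> v = (THE w. (v, w) \<in> N)" for v
  have \<theta>I: "\<theta> v = w" if "(v, w) \<in> N" for v w
    unfolding \<theta>_def using that uniq2 by blast
  have \<theta>N: "(v, \<theta> v) \<in> N" if "v \<in> X1" for v using total1[OF that] \<theta>I by auto
  have "bij_betw \<theta> X1 X2"
  proof (rule bij_betw_imageI)
    show "inj_on \<theta> X1"
      by (rule inj_onI) (metis \<theta>N uniq1)
    show "\<theta> ` X1 = X2"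
      using \<theta>N \<theta>I N_X total2 by blast
  qed
  moreover have "\<theta> (v + w) = \<theta> v + \<theta> w" if "v \<in> X1" "w \<in> X1" for v w
    using \<theta>I[OF N_add[OF \<theta>N \<theta>N]] that by simp
  moreover have "\<theta> (s1 r v) = s2 r (\<theta> v)" if "v \<in> X1" for r v using \<theta>I[OF N_scale[OF \<theta>N]] that by simp
  moreover have "\<theta> (\<rho>1 x v) = \<rho>2 x (\<theta> v)" if "v \<in> X1" for x v using \<theta>I[OF N_act[OF \<theta>N]] that by simp
  ultimately show ?thesis by blast
qed

section \<open>Module records\<close>

lemma complex_field_simps [simp]:
  "carrier complex_field = UNIV" "x \<otimes>\<^bsub>complex_field\<^esub> y = x * y" "\<one>\<^bsub>complex_field\<^esub> = 1"
  "\<zero>\<^bsub>complex_field\<^esub> = 0" "x \<oplus>\<^bsub>complex_field\<^esub> y = x + y"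
  by (simp_all add: complex_field_def)

lemma cring_complex_field: "cring complex_field"
proof (rule cringI)
  show "abelian_group complex_field"
  proof (rule abelian_groupI)
    fix x :: complex
    show "\<exists>y\<in>carrier complex_field. y \<oplus>\<^bsub>complex_field\<^esub> x = \<zero>\<^bsub>complex_field\<^esub>"
      by (rule bexI[of _ "- x"]) auto
  qed (auto simp: algebra_simps)
  show "Group.comm_monoid complex_field"
    by (rule comm_monoidI) (auto simp: algebra_simps)
qed (auto simp: algebra_simps)

lemma complex_moduleI:
  assumes "abelian_group M"
    "\<And>r v. v \<in> carrier M \<Longrightarrow> r \<odot>\<^bsub>M\<^esub> v \<in> carrier M"
    "\<And>r s v. v \<in> carrier M \<Longrightarrow> (r + s) \<odot>\<^bsub>M\<^esub> v = r \<odot>\<^bsub>M\<^esub> v \<oplus>\<^bsub>M\<^esub> s \<odot>\<^bsub>M\<^esub> v"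
    "\<And>r v w. v \<in> carrier M \<Longrightarrow> w \<in> carrier M \<Longrightarrow> r \<odot>\<^bsub>M\<^esub> (v \<oplus>\<^bsub>M\<^esub> w) = r \<odot>\<^bsub>M\<^esub> v \<oplus>\<^bsub>M\<^esub> r \<odot>\<^bsub>M\<^esub> w"
    "\<And>r s v. v \<in> carrier M \<Longrightarrow> (r * s) \<odot>\<^bsub>M\<^esub> v = r \<odot>\<^bsub>M\<^esub> (s \<odot>\<^bsub>M\<^esub> v)"
    "\<And>v. v \<in> carrier M \<Longrightarrow> 1 \<odot>\<^bsub>M\<^esub> v = v"
  shows "Module.module complex_field M"
  using assms by (intro Module.module.intro Module.module_axioms.intro cring_complex_field) simp_all

lemma (in vector_space) projection_along:
  assumes S: "subspace S"
  obtains p where "\<forall>f g. p (f + g) = p f + p g" "\<forall>r f. p (r *s f) = r *s p f"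
    "\<forall>f. p f = 0 \<longleftrightarrow> f \<in> S"
proof -
  interpret P: vector_space_pair scale scale ..
  have "Vector_Spaces.linear scale scale id" by unfold_locales auto
  then obtain g where g: "g ` UNIV \<subseteq> S" "Vector_Spaces.linear scale scale g" "\<forall>v\<in>S. g (id v) = v"
    using P.linear_exists_left_inverse_on[of id S] S by auto
  interpret g: Vector_Spaces.linear scale scale g by (rule g(2))
  show ?thesis
  proof (rule that[of "\<lambda>f. f - g f"])
    have "g f \<in> S" for f using g(1) by auto
    then show "\<forall>f. f - g f = 0 \<longleftrightarrow> f \<in> S" using g(3) by (metis id_apply eq_iff_diff_eq_0)
  qed (auto simp: g.add g.scale scale_right_diff_distrib)
qed

text \<open>The carrier of a module record is a subset of a type without algebraic structure. Summation gives
  a linear surjection \<open>q\<close> from the free vector space on the carrier, and projecting along the kernel of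
  \<open>q\<close> identifies the module with a subspace of that free vector space.\<close>

lemma module_embedding:
  fixes M :: "('l, 'v) lie_rep"
  assumes "Module.module complex_field M"
  obtains \<iota> :: "'v \<Rightarrow> 'v \<Rightarrow>\<^sub>0 complex"
    where "inj_on \<iota> (carrier M)" "\<forall>v\<in>carrier M. \<forall>w\<in>carrier M. \<iota> (v \<oplus>\<^bsub>M\<^esub> w) = \<iota> v + \<iota> w"
      "\<forall>r. \<forall>v\<in>carrier M. \<iota> (r \<odot>\<^bsub>M\<^esub> v) = fscale r (\<iota> v)"
proof -
  interpret M: Module.module complex_field M by (rule assms)
  define e where "e v = (if v \<in> carrier M then v else \<zero>\<^bsub>M\<^esub>)" for v
  have e: "e v \<in> carrier M" for v by (simp add: e_def)
  have zero_scale: "0 \<odot>\<^bsub>M\<^esub> v = \<zero>\<^bsub>M\<^esub>" if "v \<in> carrier M" for v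
    using M.smult_l_null[OF that] by simp
  define q where "q f = (\<Oplus>\<^bsub>M\<^esub>v\<in>Poly_Mapping.keys f. Poly_Mapping.lookup f v \<odot>\<^bsub>M\<^esub> e v)" for f
  have q_superset: "q f = (\<Oplus>\<^bsub>M\<^esub>v\<in>A. Poly_Mapping.lookup f v \<odot>\<^bsub>M\<^esub> e v)"
    if "finite A" "Poly_Mapping.keys f \<subseteq> A" for f A
    unfolding q_def using that e
    by (intro M.add.finprod_mono_neutral_cong_left) (auto simp: in_keys_iff zero_scale)
  have q_add: "q (f + g) = q f \<oplus>\<^bsub>M\<^esub> q g" for f g
  proof -
    let ?A = "Poly_Mapping.keys f \<union> Poly_Mapping.keys g"
    have fin: "finite ?A" by simp
    have "q (f + g) = (\<Oplus>\<^bsub>M\<^esub>v\<in>?A. Poly_Mapping.lookup f v \<odot>\<^bsub>M\<^esub> e v \<oplus>\<^bsub>M\<^esub> Poly_Mapping.lookup g v \<odot>\<^bsub>M\<^esub> e v)"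
      unfolding q_superset[OF fin Poly_Mapping.keys_add] lookup_add
      using e by (intro M.finsum_cong') (auto simp: M.smult_l_distr[simplified])
    also have "\<dots> = q f \<oplus>\<^bsub>M\<^esub> q g"
      using e q_superset[OF fin, of f] q_superset[OF fin, of g] by (subst M.finsum_addf) auto
    finally show ?thesis .
  qed
  have q_scale: "q (fscale r f) = r \<odot>\<^bsub>M\<^esub> q f" for r f
  proof -
    have "Poly_Mapping.keys (fscale r f) \<subseteq> Poly_Mapping.keys f" by (auto simp: in_keys_iff)
    then have "q (fscale r f) = (\<Oplus>\<^bsub>M\<^esub>v\<in>Poly_Mapping.keys f. r \<odot>\<^bsub>M\<^esub> (Poly_Mapping.lookup f v \<odot>\<^bsub>M\<^esub> e v))"
      using e by (subst q_superset[of "Poly_Mapping.keys f"])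
        (auto intro!: M.finsum_cong' simp: M.smult_assoc1[simplified])
    also have "\<dots> = r \<odot>\<^bsub>M\<^esub> q f"
      unfolding q_def using e by (subst M.finsum_smult_ldistr) auto
    finally show ?thesis .
  qed
  have q_basis: "q (basis_vec v) = v" if "v \<in> carrier M" for v
    using M.smult_one[simplified] that by (simp add: q_def e_def M.add.finprod_singleton)
  have q_closed: "q f \<in> carrier M" for f unfolding q_def using e by auto
  define S where "S = {f. q f = \<zero>\<^bsub>M\<^esub>}"
  have q0: "q 0 = \<zero>\<^bsub>M\<^esub>" by (simp add: q_def)
  have S: "free_vs.subspace S"
    unfolding S_def free_vs.subspace_def using q0 q_add q_scale by auto
  obtain p :: "('v \<Rightarrow>\<^sub>0 complex) \<Rightarrow> 'v \<Rightarrow>\<^sub>0 complex" where p': "\<forall>f g. p (f + g) = p f + p g" "\<forall>r f. p (fscale r f) = fscale r (p f)"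
    "\<forall>f. p f = 0 \<longleftrightarrow> f \<in> S"
    by (rule free_vs.projection_along[OF S])
  note p = p'[rule_format]
  have p_diff: "p (f - g) = p f - p g" for f g using p(1)[of "f - g" g] by simp
  have p_eq: "p f = p g \<longleftrightarrow> q f = q g" for f g
  proof -
    have "q (f - g) \<oplus>\<^bsub>M\<^esub> q g = q f" using q_add[of "f - g" g] by simp
    then have "q (f - g) = \<zero>\<^bsub>M\<^esub> \<longleftrightarrow> q f = q g"
      using q_closed by (metis M.add.l_cancel_one M.add.r_cancel_one')
    then show ?thesis using p(3)[of "f - g"] p_diff[of f g] by (auto simp: S_def)
  qed
  show ?thesis
  proof (rule that[of "\<lambda>v. p (basis_vec v)"])
    show "inj_on (\<lambda>v. p (basis_vec v)) (carrier M)"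
      by (rule inj_onI) (simp add: p_eq q_basis)
    show "\<forall>v\<in>carrier M. \<forall>w\<in>carrier M. p (basis_vec (v \<oplus>\<^bsub>M\<^esub> w)) = p (basis_vec v) + p (basis_vec w)"
      unfolding p(1)[symmetric] p_eq by (simp add: q_add q_basis)
    show "\<forall>r. \<forall>v\<in>carrier M. p (basis_vec (r \<odot>\<^bsub>M\<^esub> v)) = fscale r (p (basis_vec v))"
      unfolding p(2)[symmetric] p_eq by (simp add: q_scale q_basis)
  qed
qed

text \<open>Such an embedding turns a module record into a \<open>lie_action\<close>, and the theory of graded Lie algebras
  becomes applicable to it.\<close>

locale embedded_module =
  fixes lsc :: "complex \<Rightarrow> 'l::ab_group_add \<Rightarrow> 'l" and br :: "'l \<Rightarrow> 'l \<Rightarrow> 'l"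
    and M :: "('l, 'v) lie_rep" and \<iota> :: "'v \<Rightarrow> 'v \<Rightarrow>\<^sub>0 complex"
  assumes alg: "lie_algebra lsc br" and lie_mod: "lie_module lsc br M"
    and inj: "inj_on \<iota> (carrier M)"
    and emb_add: "v \<in> carrier M \<Longrightarrow> w \<in> carrier M \<Longrightarrow> \<iota> (v \<oplus>\<^bsub>M\<^esub> w) = \<iota> v + \<iota> w"
    and emb_scale: "v \<in> carrier M \<Longrightarrow> \<iota> (r \<odot>\<^bsub>M\<^esub> v) = fscale r (\<iota> v)"
begin

sublocale M: Module.module complex_field M
  using lie_mod by (simp add: lie_module_def)

abbreviation "image_space \<equiv> \<iota> ` carrier M"

definition image_act :: "'l \<Rightarrow> ('v \<Rightarrow>\<^sub>0 complex) \<Rightarrow> 'v \<Rightarrow>\<^sub>0 complex" where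
  "image_act x y = \<iota> (act M x (the_inv_into (carrier M) \<iota> y))"

lemma act_in [simp]: "v \<in> carrier M \<Longrightarrow> act M x v \<in> carrier M"
  using lie_mod by (simp add: lie_module_def)

lemma image_act [simp]: "v \<in> carrier M \<Longrightarrow> image_act x (\<iota> v) = \<iota> (act M x v)"
  by (simp add: image_act_def the_inv_into_f_f[OF inj])

lemma emb_zero [simp]: "\<iota> \<zero>\<^bsub>M\<^esub> = 0"
  using emb_add[of "\<zero>\<^bsub>M\<^esub>" "\<zero>\<^bsub>M\<^esub>"] by simp

lemma emb_minus: "v \<in> carrier M \<Longrightarrow> \<iota> (\<ominus>\<^bsub>M\<^esub> v) = - \<iota> v"
  using emb_add[of "\<ominus>\<^bsub>M\<^esub> v" v] by (simp add: M.l_neg eq_neg_iff_add_eq_0)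

lemma emb_diff: "v \<in> carrier M \<Longrightarrow> w \<in> carrier M \<Longrightarrow> \<iota> (v \<ominus>\<^bsub>M\<^esub> w) = \<iota> v - \<iota> w"
  by (simp add: a_minus_def emb_add emb_minus)

lemma emb_eq_iff: "v \<in> carrier M \<Longrightarrow> w \<in> carrier M \<Longrightarrow> \<iota> v = \<iota> w \<longleftrightarrow> v = w"
  using inj by (auto dest: inj_onD)

lemma emb_eq_0_iff: "v \<in> carrier M \<Longrightarrow> \<iota> v = 0 \<longleftrightarrow> v = \<zero>\<^bsub>M\<^esub>"
  using emb_eq_iff[of v "\<zero>\<^bsub>M\<^esub>"] by simp

lemma smult_in [simp]: "v \<in> carrier M \<Longrightarrow> r \<odot>\<^bsub>M\<^esub> v \<in> carrier M"
  by simp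

lemma lie_mod_axioms:
  assumes "v \<in> carrier M"
  shows "w \<in> carrier M \<Longrightarrow> act M x (v \<oplus>\<^bsub>M\<^esub> w) = act M x v \<oplus>\<^bsub>M\<^esub> act M x w"
    "act M x (r \<odot>\<^bsub>M\<^esub> v) = r \<odot>\<^bsub>M\<^esub> act M x v"
    "act M (x + y) v = act M x v \<oplus>\<^bsub>M\<^esub> act M y v"
    "act M (lsc r x) v = r \<odot>\<^bsub>M\<^esub> act M x v"
    "act M (br x y) v = act M x (act M y v) \<ominus>\<^bsub>M\<^esub> act M y (act M x v)"
  using lie_mod assms unfolding lie_module_def by auto

lemma subspace_image_space: "free_vs.subspace image_space"
  unfolding free_vs.subspace_def
proof (intro conjI ballI allI)
  show "0 \<in> image_space" using emb_zero by force
qed (auto simp flip: emb_add emb_scale)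

sublocale lie_action lsc br fscale image_space image_act
proof -
  interpret L: lie_algebra lsc br by (rule alg)
  show "lie_action lsc br fscale image_space image_act"
  proof
  qed (use subspace_image_space in \<open>auto simp: lie_mod_axioms emb_add emb_scale emb_diff simp flip: emb_add emb_scale\<close>)
qed

lemma submodule_iff_invariant:
  assumes N: "N \<subseteq> carrier M"
  shows "lie_submodule N M \<longleftrightarrow> invariant (\<iota> ` N)"
proof
  assume l: "lie_submodule N M"
  then have sub: "submodule N complex_field M" by (simp add: lie_submodule_def)
  note s = M.submoduleE[OF sub]
  have "\<zero>\<^bsub>M\<^esub> \<in> N" using sub subgroup.one_closed[OF submodule.axioms(1)] by fastforce
  then have "0 \<in> \<iota> ` N" using emb_zero by force
  moreover have "\<iota> v + \<iota> w \<in> \<iota> ` N" if "v \<in> N" "w \<in> N" for v w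
    using s(5)[OF that] that N by (auto simp: subset_iff simp flip: emb_add)
  moreover have "fscale r (\<iota> v) \<in> \<iota> ` N" if "v \<in> N" for r v
    using s(4)[of r v] that N by (auto simp: subset_iff simp flip: emb_scale)
  moreover have "image_act x (\<iota> v) \<in> \<iota> ` N" if "v \<in> N" for x v
    using l that N by (auto simp: lie_submodule_def subset_iff)
  ultimately show "invariant (\<iota> ` N)"
    using N unfolding invariant_def free_vs.subspace_def by auto
next
  assume i: "invariant (\<iota> ` N)"
  note i = invariantD[OF i]
  have mem: "v \<in> N" if "\<iota> v \<in> \<iota> ` N" "v \<in> carrier M" for v
    using that N by (metis emb_eq_iff imageE subsetD)
  have "submodule N complex_field M"
  proof (rule M.submoduleI)
    show "\<zero>\<^bsub>M\<^esub> \<in> N" by (rule mem) (use free_vs.subspace_0[OF i(1)] in auto)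
    show "\<ominus>\<^bsub>M\<^esub> v \<in> N" if "v \<in> N" for v
      by (rule mem) (use free_vs.subspace_neg[OF i(1)] that N in \<open>auto simp: subset_iff emb_minus\<close>)
    show "v \<oplus>\<^bsub>M\<^esub> w \<in> N" if "v \<in> N" "w \<in> N" for v w
      by (rule mem) (use free_vs.subspace_add[OF i(1)] that N in \<open>auto simp: subset_iff emb_add\<close>)
    show "r \<odot>\<^bsub>M\<^esub> v \<in> N" if "v \<in> N" for r v
      by (rule mem) (use free_vs.subspace_scale[OF i(1)] that N in \<open>auto simp: subset_iff emb_scale\<close>)
  qed (rule N)
  moreover have "act M x v \<in> N" if "v \<in> N" for x v
    by (rule mem) (use i(3)[of "\<iota> v" x] that N in \<open>auto simp: subset_iff\<close>)
  ultimately show "lie_submodule N M" by (simp add: lie_submodule_def)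
qed

lemma lie_submodule_sub: "lie_submodule N M \<Longrightarrow> N \<subseteq> carrier M"
  unfolding lie_submodule_def using M.submoduleE(1) by blast

lemma irreducible_iff: "irreducible_rep M \<longleftrightarrow> image_space \<noteq> {0} \<and> irreducible"
proof -
  have 1: "carrier M = {\<zero>\<^bsub>M\<^esub>} \<longleftrightarrow> image_space = {0}"
    using emb_eq_0_iff M.zero_closed by (auto simp: set_eq_iff image_iff)
  have "(\<forall>N. lie_submodule N M \<longrightarrow> N = {\<zero>\<^bsub>M\<^esub>} \<or> N = carrier M) \<longleftrightarrow> irreducible"
  proof (intro iffI allI impI)
    assume h: "\<forall>N. lie_submodule N M \<longrightarrow> N = {\<zero>\<^bsub>M\<^esub>} \<or> N = carrier M"
    show irreducible
      unfolding irreducible_def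
    proof (intro allI impI)
      fix N' assume i: "invariant N'"
      then obtain N where N: "N' = \<iota> ` N" "N \<subseteq> carrier M"
        by (meson invariantD(2) subset_imageE)
      then have "lie_submodule N M" using i submodule_iff_invariant by blast
      then have "N = {\<zero>\<^bsub>M\<^esub>} \<or> N = carrier M" using h by blast
      then show "N' = {0} \<or> N' = image_space" using N by auto
    qed
  next
    fix N assume h: irreducible and l: "lie_submodule N M"
    note N = lie_submodule_sub[OF l]
    then have "invariant (\<iota> ` N)" using submodule_iff_invariant l by blast
    then have "\<iota> ` N = \<iota> ` {\<zero>\<^bsub>M\<^esub>} \<or> \<iota> ` N = image_space" using h unfolding irreducible_def by auto
    then show "N = {\<zero>\<^bsub>M\<^esub>} \<or> N = carrier M"
      using inj_on_image_eq_iff[OF inj N, of "{\<zero>\<^bsub>M\<^esub>}"] inj_on_image_eq_iff[OF inj N, of "carrier M"] by auto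
  qed
  with 1 show ?thesis by (auto simp: irreducible_rep_def)
qed

end

lemma embedded_module_exists:
  fixes M :: "('l::ab_group_add, 'v) lie_rep"
  assumes "lie_algebra lsc br" "lie_module lsc br M"
  obtains \<iota> where "embedded_module lsc br M \<iota>"
proof -
  have "Module.module complex_field M" using assms(2) by (simp add: lie_module_def)
  then obtain \<iota> :: "'v \<Rightarrow> 'v \<Rightarrow>\<^sub>0 complex" where "inj_on \<iota> (carrier M)"
    "\<forall>v\<in>carrier M. \<forall>w\<in>carrier M. \<iota> (v \<oplus>\<^bsub>M\<^esub> w) = \<iota> v + \<iota> w"
    "\<forall>r. \<forall>v\<in>carrier M. \<iota> (r \<odot>\<^bsub>M\<^esub> v) = fscale r (\<iota> v)"
    by (rule module_embedding)
  then show ?thesis using assms by (intro that[of \<iota>]) (simp add: embedded_module_def)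
qed

section \<open>Quotients of module records\<close>

locale module_quotient = M: Module.module complex_field M
  for M :: "('l::ab_group_add, 'v) lie_rep" +
  fixes N :: "'v set"
  assumes N: "submodule N complex_field M"
begin

abbreviation coset :: "'v \<Rightarrow> 'v set" where "coset v \<equiv> N +>\<^bsub>M\<^esub> v"

lemma N_sub: "N \<subseteq> carrier M" and N_neg: "v \<in> N \<Longrightarrow> \<ominus>\<^bsub>M\<^esub> v \<in> N"
  and N_scale: "v \<in> N \<Longrightarrow> r \<odot>\<^bsub>M\<^esub> v \<in> N" and N_add: "v \<in> N \<Longrightarrow> w \<in> N \<Longrightarrow> v \<oplus>\<^bsub>M\<^esub> w \<in> N"
  using M.submoduleE[OF N] by auto

lemma N_zero: "\<zero>\<^bsub>M\<^esub> \<in> N"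
  using subgroup.one_closed[OF submodule.axioms(1)[OF N]] by simp

lemma coset_iff: "w \<in> coset v \<longleftrightarrow> (\<exists>n\<in>N. w = n \<oplus>\<^bsub>M\<^esub> v)"
  by (auto simp: a_r_coset_def')

lemma coset_iff_diff:
  assumes "v \<in> carrier M"
  shows "w \<in> coset v \<longleftrightarrow> w \<in> carrier M \<and> w \<ominus>\<^bsub>M\<^esub> v \<in> N"
proof
  assume "w \<in> coset v"
  then obtain n where n: "n \<in> N" "w = n \<oplus>\<^bsub>M\<^esub> v" by (auto simp: coset_iff)
  then have "n \<in> carrier M" using N_sub by auto
  with n assms show "w \<in> carrier M \<and> w \<ominus>\<^bsub>M\<^esub> v \<in> N"
    by (simp add: a_minus_def M.a_assoc M.r_neg)
next
  assume w: "w \<in> carrier M \<and> w \<ominus>\<^bsub>M\<^esub> v \<in> N"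
  then have "w = (w \<ominus>\<^bsub>M\<^esub> v) \<oplus>\<^bsub>M\<^esub> v"
    using assms by (simp add: a_minus_def M.a_assoc M.l_neg)
  with w show "w \<in> coset v" by (auto simp: coset_iff)
qed

lemma coset_self: "v \<in> carrier M \<Longrightarrow> v \<in> coset v"
  using N_zero by (force simp: coset_iff)

lemma coset_eq:
  assumes "v \<in> carrier M" "w \<in> carrier M"
  shows "coset v = coset w \<longleftrightarrow> v \<ominus>\<^bsub>M\<^esub> w \<in> N"
proof
  show "v \<ominus>\<^bsub>M\<^esub> w \<in> N" if "coset v = coset w"
    using coset_self[OF assms(1)] coset_iff_diff[OF assms(2)] that by auto
next
  assume vw: "v \<ominus>\<^bsub>M\<^esub> w \<in> N"
  have "x \<ominus>\<^bsub>M\<^esub> v \<in> N \<longleftrightarrow> x \<ominus>\<^bsub>M\<^esub> w \<in> N" if "x \<in> carrier M" for x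
  proof -
    have split: "x \<ominus>\<^bsub>M\<^esub> z = (x \<ominus>\<^bsub>M\<^esub> y) \<oplus>\<^bsub>M\<^esub> (y \<ominus>\<^bsub>M\<^esub> z)"
      if "y \<in> carrier M" "z \<in> carrier M" for y z
      using that \<open>x \<in> carrier M\<close> by (simp add: a_minus_def M.a_assoc M.r_neg1)
    have "\<ominus>\<^bsub>M\<^esub> (v \<ominus>\<^bsub>M\<^esub> w) = w \<ominus>\<^bsub>M\<^esub> v"
      using assms by (simp add: a_minus_def M.minus_add M.a_comm)
    then have "w \<ominus>\<^bsub>M\<^esub> v \<in> N" using N_neg[OF vw] by simp
    then show ?thesis using split[of v w] split[of w v] vw assms N_add by metis
  qed
  then show "coset v = coset w" using assms by (auto simp: coset_iff_diff)
qed

lemma quotient_carrier: "carrier (quotient_rep M N) = coset ` carrier M"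
  by (auto simp: quotient_rep_def A_RCOSETS_def')

lemma quotient_zero: "\<zero>\<^bsub>quotient_rep M N\<^esub> = coset \<zero>\<^bsub>M\<^esub>"
  using N_sub by (auto simp: quotient_rep_def coset_iff)

lemma quotient_add:
  assumes "v \<in> carrier M" "w \<in> carrier M"
  shows "coset v \<oplus>\<^bsub>quotient_rep M N\<^esub> coset w = coset (v \<oplus>\<^bsub>M\<^esub> w)"
proof -
  have 1: "(n \<oplus>\<^bsub>M\<^esub> v) \<oplus>\<^bsub>M\<^esub> (n' \<oplus>\<^bsub>M\<^esub> w) = (n \<oplus>\<^bsub>M\<^esub> n') \<oplus>\<^bsub>M\<^esub> (v \<oplus>\<^bsub>M\<^esub> w)" if "n \<in> N" "n' \<in> N" for n n'
    using that assms N_sub by (simp add: subset_iff M.a_ac)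
  have 2: "n \<oplus>\<^bsub>M\<^esub> (v \<oplus>\<^bsub>M\<^esub> w) = (n \<oplus>\<^bsub>M\<^esub> v) \<oplus>\<^bsub>M\<^esub> (\<zero>\<^bsub>M\<^esub> \<oplus>\<^bsub>M\<^esub> w)" if "n \<in> N" for n
    using that assms N_sub by (simp add: subset_iff M.a_ac)
  have mem: "x \<in> set_add M (coset v) (coset w) \<longleftrightarrow>
      (\<exists>n\<in>N. \<exists>n'\<in>N. x = (n \<oplus>\<^bsub>M\<^esub> v) \<oplus>\<^bsub>M\<^esub> (n' \<oplus>\<^bsub>M\<^esub> w))" for x
    by (auto simp: set_add_def' a_r_coset_def')
  have "set_add M (coset v) (coset w) = coset (v \<oplus>\<^bsub>M\<^esub> w)"
  proof (intro Set.set_eqI iffI)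
    fix x assume "x \<in> set_add M (coset v) (coset w)"
    then show "x \<in> coset (v \<oplus>\<^bsub>M\<^esub> w)" unfolding mem coset_iff using 1 N_add by metis
  next
    fix x assume "x \<in> coset (v \<oplus>\<^bsub>M\<^esub> w)"
    then show "x \<in> set_add M (coset v) (coset w)" unfolding mem coset_iff using 2 N_zero by metis
  qed
  then show ?thesis by (simp add: quotient_rep_def)
qed

text \<open>The operations of a quotient record are unions over representatives. For an additive map that
  preserves \<open>N\<close> every representative contributes the same coset.\<close>

lemma union_cosets:
  assumes v: "v \<in> carrier M" and f: "\<And>v. v \<in> carrier M \<Longrightarrow> f v \<in> carrier M"
    "\<And>v w. v \<in> carrier M \<Longrightarrow> w \<in> carrier M \<Longrightarrow> f (v \<oplus>\<^bsub>M\<^esub> w) = f v \<oplus>\<^bsub>M\<^esub> f w"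
    "\<And>v. v \<in> N \<Longrightarrow> f v \<in> N"
  shows "(\<Union>w\<in>coset v. coset (f w)) = coset (f v)"
proof -
  have "coset (f w) = coset (f v)" if w: "w \<in> coset v" for w
  proof -
    obtain n where n: "n \<in> N" "w = n \<oplus>\<^bsub>M\<^esub> v" using w by (auto simp: coset_iff)
    have nc: "n \<in> carrier M" using n N_sub by auto
    then have "f w = f n \<oplus>\<^bsub>M\<^esub> f v" using n v f by simp
    then have "f w \<in> coset (f v)" using f(3)[OF n(1)] by (auto simp: coset_iff)
    then show ?thesis using v f coset_eq coset_iff_diff by simp
  qed
  then show ?thesis using coset_self[OF v] by blast
qed

lemma quotient_smult:
  assumes "v \<in> carrier M"
  shows "r \<odot>\<^bsub>quotient_rep M N\<^esub> coset v = coset (r \<odot>\<^bsub>M\<^esub> v)"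
  using union_cosets[OF assms, of "\<lambda>v. r \<odot>\<^bsub>M\<^esub> v"] N_scale M.smult_r_distr
  by (simp add: quotient_rep_def)

lemma quotient_act:
  assumes "v \<in> carrier M" "\<And>v. v \<in> carrier M \<Longrightarrow> act M x v \<in> carrier M"
    "\<And>v w. v \<in> carrier M \<Longrightarrow> w \<in> carrier M \<Longrightarrow> act M x (v \<oplus>\<^bsub>M\<^esub> w) = act M x v \<oplus>\<^bsub>M\<^esub> act M x w"
    "\<And>v. v \<in> N \<Longrightarrow> act M x v \<in> N"
  shows "act (quotient_rep M N) x (coset v) = coset (act M x v)"
  using union_cosets[OF assms] by (simp add: quotient_rep_def)

lemma quotient_module: "Module.module complex_field (quotient_rep M N)"
proof (rule complex_moduleI)
  show "abelian_group (quotient_rep M N)"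
  proof (rule abelian_groupI)
    fix X assume "X \<in> carrier (quotient_rep M N)"
    then obtain v where v: "v \<in> carrier M" "X = coset v" by (auto simp: quotient_carrier)
    then show "\<exists>Y\<in>carrier (quotient_rep M N). Y \<oplus>\<^bsub>quotient_rep M N\<^esub> X = \<zero>\<^bsub>quotient_rep M N\<^esub>"
      by (intro bexI[of _ "coset (\<ominus>\<^bsub>M\<^esub> v)"]) (auto simp: quotient_add quotient_zero M.l_neg quotient_carrier)
  qed (auto simp: quotient_carrier quotient_add quotient_zero M.a_ac)
qed (auto simp: quotient_carrier quotient_add quotient_smult M.smult_l_distr[simplified]
    M.smult_r_distr[simplified] M.smult_assoc1[simplified] M.smult_one[simplified])

lemma quotient_diff:
  assumes "v \<in> carrier M" "w \<in> carrier M"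
  shows "coset v \<ominus>\<^bsub>quotient_rep M N\<^esub> coset w = coset (v \<ominus>\<^bsub>M\<^esub> w)"
proof -
  interpret Q: Module.module complex_field "quotient_rep M N" by (rule quotient_module)
  have "coset (\<ominus>\<^bsub>M\<^esub> w) \<oplus>\<^bsub>quotient_rep M N\<^esub> coset w = \<zero>\<^bsub>quotient_rep M N\<^esub>"
    using assms by (simp add: quotient_add quotient_zero M.l_neg)
  then have "\<ominus>\<^bsub>quotient_rep M N\<^esub> coset w = coset (\<ominus>\<^bsub>M\<^esub> w)"
    using assms by (intro Q.minus_equality) (auto simp: quotient_carrier)
  then show ?thesis using assms by (simp add: a_minus_def quotient_add)
qed

text \<open>The laws that involve the Lie algebra operations are required on \<open>M\<close> only up to elements of \<open>N\<close>. The
  free vector space on words satisfies them modulo the relations of an induced module.\<close>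

lemma quotient_lie_module:
  assumes closed: "\<And>x v. v \<in> carrier M \<Longrightarrow> act M x v \<in> carrier M"
    and add: "\<And>x v w. v \<in> carrier M \<Longrightarrow> w \<in> carrier M \<Longrightarrow> act M x (v \<oplus>\<^bsub>M\<^esub> w) = act M x v \<oplus>\<^bsub>M\<^esub> act M x w"
    and scale: "\<And>x r v. v \<in> carrier M \<Longrightarrow> act M x (r \<odot>\<^bsub>M\<^esub> v) = r \<odot>\<^bsub>M\<^esub> act M x v"
    and stable: "\<And>x v. v \<in> N \<Longrightarrow> act M x v \<in> N"
    and ax: "\<And>x y v. v \<in> carrier M \<Longrightarrow> act M (x + y) v \<ominus>\<^bsub>M\<^esub> (act M x v \<oplus>\<^bsub>M\<^esub> act M y v) \<in> N"
      "\<And>r x v. v \<in> carrier M \<Longrightarrow> act M (lsc r x) v \<ominus>\<^bsub>M\<^esub> r \<odot>\<^bsub>M\<^esub> act M x v \<in> N"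
      "\<And>x y v. v \<in> carrier M \<Longrightarrow>
        act M (br x y) v \<ominus>\<^bsub>M\<^esub> (act M x (act M y v) \<ominus>\<^bsub>M\<^esub> act M y (act M x v)) \<in> N"
  shows "lie_module lsc br (quotient_rep M N)"
proof -
  have qa: "act (quotient_rep M N) x (coset v) = coset (act M x v)" if "v \<in> carrier M" for x v
    using that by (intro quotient_act closed add stable) auto
  show ?thesis
    unfolding lie_module_def quotient_carrier
    by (intro conjI quotient_module)
      (auto simp: qa quotient_add quotient_smult quotient_diff closed add scale ax coset_eq)
qed

end

lemma module_quotientI:
  assumes "lie_module lsc br M" "lie_submodule N M"
  shows "module_quotient M N"
  using assms by (simp add: module_quotient_def module_quotient_axioms_def lie_module_def lie_submodule_def)

context embedded_module
begin

lemma lie_module_quotient: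
  assumes "lie_submodule N M"
  shows "lie_module lsc br (quotient_rep M N)"
proof -
  interpret Q: module_quotient M N by (rule module_quotientI[OF lie_mod assms])
  have zero: "v \<ominus>\<^bsub>M\<^esub> v \<in> N" if "v \<in> carrier M" for v
    using that Q.N_zero by (simp add: a_minus_def M.r_neg)
  show ?thesis
    by (rule Q.quotient_lie_module)
      (use assms in \<open>auto simp: lie_mod_axioms zero lie_submodule_def\<close>)
qed

lemma quotient_irreducible_iff:
  assumes N: "lie_submodule N M"
  shows "irreducible_rep (quotient_rep M N) \<longleftrightarrow>
    N \<noteq> carrier M \<and> (\<forall>P. lie_submodule P M \<and> N \<subseteq> P \<longrightarrow> P = N \<or> P = carrier M)"
proof -
  let ?Q = "quotient_rep M N"
  interpret Q: module_quotient M N by (rule module_quotientI[OF lie_mod N])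
  interpret QM: Module.module complex_field ?Q by (rule Q.quotient_module)
  have act: "act ?Q x (Q.coset v) = Q.coset (act M x v)" if "v \<in> carrier M" for x v
    using N that by (intro Q.quotient_act) (auto simp: lie_mod_axioms lie_submodule_def)
  have coset_zero: "Q.coset v = \<zero>\<^bsub>?Q\<^esub> \<longleftrightarrow> v \<in> N" if "v \<in> carrier M" for v
  proof -
    have "v \<ominus>\<^bsub>M\<^esub> \<zero>\<^bsub>M\<^esub> = v"
      using that by (metis M.a_inv_closed M.minus_eq M.r_zero M.l_neg M.zero_closed)
    then show ?thesis using that by (simp add: Q.quotient_zero Q.coset_eq)
  qed
  have triv: "carrier ?Q = {\<zero>\<^bsub>?Q\<^esub>} \<longleftrightarrow> N = carrier M"
  proof
    assume "carrier ?Q = {\<zero>\<^bsub>?Q\<^esub>}"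
    then have "v \<in> N" if "v \<in> carrier M" for v
      using coset_zero[OF that] that unfolding Q.quotient_carrier by blast
    then show "N = carrier M" using Q.N_sub by auto
  next
    assume "N = carrier M"
    then show "carrier ?Q = {\<zero>\<^bsub>?Q\<^esub>}"
      using coset_zero M.zero_closed unfolding Q.quotient_carrier by blast
  qed
  have up: "lie_submodule (Q.coset ` P) ?Q" if P: "lie_submodule P M" for P
  proof -
    note PM = lie_submodule_sub[OF P]
    have sP: "submodule P complex_field M" using P by (simp add: lie_submodule_def)
    note P' = M.submoduleE[OF sP]
    have P0: "\<zero>\<^bsub>M\<^esub> \<in> P" using subgroup.one_closed[OF submodule.axioms(1)[OF sP]] by simp
    have "submodule (Q.coset ` P) complex_field ?Q"
    proof (rule QM.submoduleI)
      fix X assume "X \<in> Q.coset ` P"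
      then obtain v where v: "v \<in> P" "v \<in> carrier M" "X = Q.coset v" using PM by auto
      have "Q.coset (\<ominus>\<^bsub>M\<^esub> v) \<oplus>\<^bsub>?Q\<^esub> X = \<zero>\<^bsub>?Q\<^esub>"
        using v by (simp add: Q.quotient_add Q.quotient_zero M.l_neg)
      then have "\<ominus>\<^bsub>?Q\<^esub> X = Q.coset (\<ominus>\<^bsub>M\<^esub> v)"
        using v by (intro QM.minus_equality) (auto simp: Q.quotient_carrier)
      then show "\<ominus>\<^bsub>?Q\<^esub> X \<in> Q.coset ` P" using P'(3)[OF v(1)] by auto
    next
      fix X Y assume "X \<in> Q.coset ` P" "Y \<in> Q.coset ` P"
      then show "X \<oplus>\<^bsub>?Q\<^esub> Y \<in> Q.coset ` P" using P'(5) PM by (auto simp: Q.quotient_add subset_iff)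
    next
      fix r X assume "X \<in> Q.coset ` P"
      then show "r \<odot>\<^bsub>?Q\<^esub> X \<in> Q.coset ` P" using P'(4)[of r] PM by (auto simp: Q.quotient_smult subset_iff)
    qed (use PM P0 in \<open>auto simp: Q.quotient_carrier Q.quotient_zero\<close>)
    then show ?thesis
      using P PM by (auto simp: lie_submodule_def act subset_iff)
  qed
  have down: "lie_submodule {v \<in> carrier M. Q.coset v \<in> P} M" if P: "lie_submodule P ?Q" for P
  proof -
    have sP: "submodule P complex_field ?Q" using P by (simp add: lie_submodule_def)
    note P' = QM.submoduleE[OF sP]
    have P0: "\<zero>\<^bsub>?Q\<^esub> \<in> P" using subgroup.one_closed[OF submodule.axioms(1)[OF sP]] by simp
    have "submodule {v \<in> carrier M. Q.coset v \<in> P} complex_field M"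
    proof (rule M.submoduleI)
      fix v assume v: "v \<in> {v \<in> carrier M. Q.coset v \<in> P}"
      then have "Q.coset (\<ominus>\<^bsub>M\<^esub> v) \<oplus>\<^bsub>?Q\<^esub> Q.coset v = \<zero>\<^bsub>?Q\<^esub>"
        by (simp add: Q.quotient_add Q.quotient_zero M.l_neg)
      then have "\<ominus>\<^bsub>?Q\<^esub> Q.coset v = Q.coset (\<ominus>\<^bsub>M\<^esub> v)"
        using v by (intro QM.minus_equality) (auto simp: Q.quotient_carrier)
      then show "\<ominus>\<^bsub>M\<^esub> v \<in> {v \<in> carrier M. Q.coset v \<in> P}" using P'(3)[of "Q.coset v"] v by auto
    next
      fix v w assume "v \<in> {v \<in> carrier M. Q.coset v \<in> P}" "w \<in> {v \<in> carrier M. Q.coset v \<in> P}"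
      then show "v \<oplus>\<^bsub>M\<^esub> w \<in> {v \<in> carrier M. Q.coset v \<in> P}"
        using P'(5)[of "Q.coset v" "Q.coset w"] by (auto simp: Q.quotient_add)
    next
      fix r v assume "v \<in> {v \<in> carrier M. Q.coset v \<in> P}"
      then show "r \<odot>\<^bsub>M\<^esub> v \<in> {v \<in> carrier M. Q.coset v \<in> P}"
        using P'(4)[of r "Q.coset v"] by (auto simp: Q.quotient_smult)
    qed (use P0 in \<open>auto simp: Q.quotient_zero\<close>)
    then show ?thesis
      using P by (auto simp: lie_submodule_def simp flip: act)
  qed
  have "(\<forall>P. lie_submodule P ?Q \<longrightarrow> P = {\<zero>\<^bsub>?Q\<^esub>} \<or> P = carrier ?Q) \<longleftrightarrow>
    (\<forall>P. lie_submodule P M \<and> N \<subseteq> P \<longrightarrow> P = N \<or> P = carrier M)" (is "?A \<longleftrightarrow> ?B")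
  proof (intro iffI allI impI)
    fix P assume h: ?A and P: "lie_submodule P M \<and> N \<subseteq> P"
    have PM: "P \<subseteq> carrier M" using P lie_submodule_sub by blast
    have mem: "v \<in> P" if v: "Q.coset v \<in> Q.coset ` P" "v \<in> carrier M" for v
    proof -
      obtain w where w: "w \<in> P" "Q.coset v = Q.coset w" using v(1) by blast
      then have "v \<in> Q.coset w" using Q.coset_self[OF v(2)] by simp
      then obtain n where "n \<in> N" "v = n \<oplus>\<^bsub>M\<^esub> w" by (auto simp: Q.coset_iff)
      then show ?thesis using P w(1) M.submoduleE(5)[of P n w] by (auto simp: lie_submodule_def)
    qed
    have "Q.coset ` P = {\<zero>\<^bsub>?Q\<^esub>} \<or> Q.coset ` P = carrier ?Q" using h up P by blast
    then show "P = N \<or> P = carrier M"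
    proof
      assume "Q.coset ` P = {\<zero>\<^bsub>?Q\<^esub>}"
      then have "v \<in> N" if "v \<in> P" for v
        using coset_zero[of v] that PM by blast
      then have "P \<subseteq> N" by blast
      then show ?thesis using P by auto
    next
      assume all: "Q.coset ` P = carrier ?Q"
      have "v \<in> P" if v: "v \<in> carrier M" for v
        by (rule mem[OF _ v]) (simp only: all Q.quotient_carrier imageI v)
      then have "carrier M \<subseteq> P" by blast
      then show ?thesis using PM by auto
    qed
  next
    fix P assume h: ?B and P: "lie_submodule P ?Q"
    have sP: "submodule P complex_field ?Q" using P by (simp add: lie_submodule_def)
    have P0: "\<zero>\<^bsub>?Q\<^esub> \<in> P" using subgroup.one_closed[OF submodule.axioms(1)[OF sP]] by simp
    have PQ: "P \<subseteq> carrier ?Q" using QM.submoduleE(1)[OF sP] .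
    let ?P = "{v \<in> carrier M. Q.coset v \<in> P}"
    have "N \<subseteq> ?P"
    proof
      fix v assume v: "v \<in> N"
      then have "v \<in> carrier M" using Q.N_sub by auto
      then show "v \<in> ?P" using coset_zero[of v] v P0 by simp
    qed
    then have "?P = N \<or> ?P = carrier M" using h down[OF P] by blast
    then show "P = {\<zero>\<^bsub>?Q\<^esub>} \<or> P = carrier ?Q"
    proof
      assume "?P = N"
      then have "P \<subseteq> {\<zero>\<^bsub>?Q\<^esub>}" using PQ coset_zero unfolding Q.quotient_carrier by blast
      then show ?thesis using P0 by auto
    next
      assume "?P = carrier M"
      then have "carrier ?Q \<subseteq> P" by (auto simp: Q.quotient_carrier)
      then show ?thesis using PQ by auto
    qed
  qed
  with triv show ?thesis by (simp add: irreducible_rep_def)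
qed

end

text \<open>\<open>M\<close> and \<open>M'\<close> need not be Lie modules themselves, so this applies to the free vector spaces
  underlying the tensor products.\<close>

lemma isomorphic_quotients:
  fixes M :: "('l, 'v) lie_rep" and M' :: "('l, 'w) lie_rep"
  assumes bij: "bij_betw \<Phi> (carrier M) (carrier M')" and N: "N \<subseteq> carrier M" "\<Phi> ` N = N'"
    and closed: "\<And>v w. v \<in> carrier M \<Longrightarrow> w \<in> carrier M \<Longrightarrow> v \<oplus>\<^bsub>M\<^esub> w \<in> carrier M"
      "\<And>r v. v \<in> carrier M \<Longrightarrow> r \<odot>\<^bsub>M\<^esub> v \<in> carrier M" "\<And>x v. v \<in> carrier M \<Longrightarrow> act M x v \<in> carrier M"
    and hom: "\<And>v w. v \<in> carrier M \<Longrightarrow> w \<in> carrier M \<Longrightarrow> \<Phi> (v \<oplus>\<^bsub>M\<^esub> w) = \<Phi> v \<oplus>\<^bsub>M'\<^esub> \<Phi> w"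
      "\<And>r v. v \<in> carrier M \<Longrightarrow> \<Phi> (r \<odot>\<^bsub>M\<^esub> v) = r \<odot>\<^bsub>M'\<^esub> \<Phi> v"
      "\<And>x v. v \<in> carrier M \<Longrightarrow> \<Phi> (act M x v) = act M' x (\<Phi> v)"
  shows "isomorphic_reps (quotient_rep M N) (quotient_rep M' N')"
proof -
  have coset: "\<Phi> ` (N +>\<^bsub>M\<^esub> v) = N' +>\<^bsub>M'\<^esub> \<Phi> v" if "v \<in> carrier M" for v
    using that N hom(1) by (auto simp: a_r_coset_def' subset_iff image_UN)
  have sub: "N +>\<^bsub>M\<^esub> v \<subseteq> carrier M" if "v \<in> carrier M" for v
    using that N closed(1) by (auto simp: a_r_coset_def')
  have carrier: "carrier (quotient_rep M N) = (\<lambda>v. N +>\<^bsub>M\<^esub> v) ` carrier M"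
    "carrier (quotient_rep M' N') = (\<lambda>v. N' +>\<^bsub>M'\<^esub> v) ` carrier M'"
    by (auto simp: quotient_rep_def A_RCOSETS_def')
  have inj: "inj_on \<Phi> (carrier M)" and im: "\<Phi> ` carrier M = carrier M'"
    using bij by (auto simp: bij_betw_def)
  have "inj_on ((`) \<Phi>) (carrier (quotient_rep M N))"
    by (rule inj_onI) (use sub inj_on_image_eq_iff[OF inj] in \<open>auto simp: carrier\<close>)
  moreover have "(`) \<Phi> ` carrier (quotient_rep M N) = carrier (quotient_rep M' N')"
    unfolding carrier im[symmetric] image_image by (rule image_cong) (auto simp: coset)
  ultimately have 1: "bij_betw ((`) \<Phi>) (carrier (quotient_rep M N)) (carrier (quotient_rep M' N'))"
    by (simp add: bij_betw_def)
  have 2: "\<Phi> ` (X \<oplus>\<^bsub>quotient_rep M N\<^esub> Y) = \<Phi> ` X \<oplus>\<^bsub>quotient_rep M' N'\<^esub> \<Phi> ` Y"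
    if "X \<in> carrier (quotient_rep M N)" "Y \<in> carrier (quotient_rep M N)" for X Y
  proof -
    have "X \<subseteq> carrier M" "Y \<subseteq> carrier M" using that sub by (auto simp: carrier)
    then show ?thesis using hom(1) by (auto simp: quotient_rep_def set_add_def' image_UN subset_iff)
  qed
  have 3: "\<Phi> ` (r \<odot>\<^bsub>quotient_rep M N\<^esub> X) = r \<odot>\<^bsub>quotient_rep M' N'\<^esub> \<Phi> ` X"
    if "X \<in> carrier (quotient_rep M N)" for r X
  proof -
    have "X \<subseteq> carrier M" using that sub by (auto simp: carrier)
    then show ?thesis using hom(2) closed(2) coset by (auto simp: quotient_rep_def image_UN subset_iff)
  qed
  have 4: "\<Phi> ` (act (quotient_rep M N) x X) = act (quotient_rep M' N') x (\<Phi> ` X)"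
    if "X \<in> carrier (quotient_rep M N)" for x X
  proof -
    have "X \<subseteq> carrier M" using that sub by (auto simp: carrier)
    then show ?thesis using hom(3) closed(3) coset by (auto simp: quotient_rep_def image_UN subset_iff)
  qed
  show ?thesis
    unfolding isomorphic_reps_def
    by (intro exI[of _ "(`) \<Phi>"] conjI ballI allI 1 2 3 4)
qed

section \<open>Structure of the simple Lie algebra\<close>

lemma (in vector_space) dual_vectors:
  fixes S :: "('b \<Rightarrow> 'a) set"
  assumes "finite S" and H: "subspace H"
    and "\<And>\<alpha> x y. \<alpha> \<in> S \<Longrightarrow> x \<in> H \<Longrightarrow> y \<in> H \<Longrightarrow> \<alpha> (x + y) = \<alpha> x + \<alpha> y"
    and "\<And>\<alpha> r x. \<alpha> \<in> S \<Longrightarrow> x \<in> H \<Longrightarrow> \<alpha> (r *s x) = r * \<alpha> x"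
    and "\<And>r. \<forall>x\<in>H. (\<Sum>\<alpha>\<in>S. r \<alpha> * \<alpha> x) = 0 \<Longrightarrow> \<forall>\<alpha>\<in>S. r \<alpha> = 0"
  shows "\<exists>h\<in>H. \<forall>\<alpha>\<in>S. \<alpha> h = c \<alpha>"
  using assms(1,3-)
proof (induction S arbitrary: c rule: finite_induct)
  case empty
  then show ?case using subspace_0[OF H] by auto
next
  case (insert \<beta> S)
  note add = insert.prems(1) and scale = insert.prems(2) and ind = insert.prems(3)
  have indS: "\<forall>\<alpha>\<in>S. r \<alpha> = 0" if "\<forall>x\<in>H. (\<Sum>\<alpha>\<in>S. r \<alpha> * \<alpha> x) = 0" for r
  proof -
    have eq: "(\<Sum>\<alpha>\<in>insert \<beta> S. (if \<alpha> = \<beta> then 0 else r \<alpha>) * \<alpha> x) = (\<Sum>\<alpha>\<in>S. r \<alpha> * \<alpha> x)" for x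
      using insert.hyps by (simp, intro sum.cong) auto
    have "\<forall>\<alpha>\<in>insert \<beta> S. (if \<alpha> = \<beta> then 0 else r \<alpha>) = 0"
      by (rule ind) (use that in \<open>simp only: eq\<close>)
    then show ?thesis using insert.hyps by (auto split: if_splits)
  qed
  have dual: "\<exists>h\<in>H. \<forall>\<alpha>\<in>S. \<alpha> h = c \<alpha>" for c
    by (rule insert.IH) (use add scale indS in auto)
  have "\<exists>h\<in>H. (\<forall>\<alpha>\<in>S. \<alpha> h = 0) \<and> \<beta> h \<noteq> 0"
  proof (rule ccontr)
    assume no: "\<not> ?thesis"
    have "\<exists>h. h \<in> H \<and> (\<forall>\<alpha>'\<in>S. \<alpha>' h = (if \<alpha>' = \<alpha> then 1 else 0))" for \<alpha>
      using dual[of "\<lambda>\<alpha>'. if \<alpha>' = \<alpha> then 1 else 0"] by blast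
    then obtain e where e: "\<And>\<alpha>. e \<alpha> \<in> H" "\<And>\<alpha> \<alpha>'. \<alpha>' \<in> S \<Longrightarrow> \<alpha>' (e \<alpha>) = (if \<alpha>' = \<alpha> then 1 else 0)"
      by metis
    have ev: "\<gamma> (\<Sum>\<alpha>\<in>T. r \<alpha> *s e \<alpha>) = (\<Sum>\<alpha>\<in>T. r \<alpha> * \<gamma> (e \<alpha>))"
      if "finite T" "\<gamma> \<in> insert \<beta> S" for T r \<gamma>
      using that(1)
    proof (induction T rule: finite_induct)
      case empty
      show ?case using scale[OF that(2) subspace_0[OF H], of 0] by simp
    next
      case (insert \<alpha> T)
      have sH: "(\<Sum>\<alpha>\<in>T. r \<alpha> *s e \<alpha>) \<in> H" by (intro subspace_sum[OF H] subspace_scale[OF H] e)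
      show ?case
        using insert add[OF that(2) subspace_scale[OF H e(1)[of \<alpha>], of "r \<alpha>"] sH]
          scale[OF that(2) e(1)[of \<alpha>], of "r \<alpha>"] by simp
    qed
    have "(\<Sum>\<alpha>\<in>insert \<beta> S. (if \<alpha> = \<beta> then - 1 else \<beta> (e \<alpha>)) * \<alpha> x) = 0" if x: "x \<in> H" for x
    proof -
      define s where "s = (\<Sum>\<alpha>\<in>S. \<alpha> x *s e \<alpha>)"
      have s: "s \<in> H" unfolding s_def by (intro subspace_sum[OF H] subspace_scale[OF H] e)
      have ms: "- 1 *s s \<in> H" using s H by (simp only: subspace_scale)
      have split: "\<gamma> (x + - 1 *s s) = \<gamma> x - \<gamma> s" if "\<gamma> \<in> insert \<beta> S" for \<gamma>
        using add[OF that x ms] scale[OF that s, of "- 1"] by simp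
      have "\<gamma> (x + - 1 *s s) = 0" if \<gamma>: "\<gamma> \<in> S" for \<gamma>
      proof -
        have "\<gamma> s = (\<Sum>\<alpha>\<in>S. \<alpha> x * \<gamma> (e \<alpha>))"
          unfolding s_def by (rule ev) (use \<gamma> insert.hyps in auto)
        also have "\<dots> = (\<Sum>\<alpha>\<in>S. if \<gamma> = \<alpha> then \<alpha> x else 0)"
          by (intro sum.cong) (auto simp: e(2)[OF \<gamma>])
        also have "\<dots> = \<gamma> x" using \<gamma> insert.hyps(1) by simp
        finally show ?thesis using split[of \<gamma>] \<gamma> by simp
      qed
      then have "\<beta> (x + - 1 *s s) = 0" using no s x ms subspace_add[OF H] by blast
      then have "\<beta> x = \<beta> s" using split[of \<beta>] by simp
      also have "\<dots> = (\<Sum>\<alpha>\<in>S. \<alpha> x * \<beta> (e \<alpha>))" unfolding s_def by (rule ev) (use insert.hyps in auto)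
      finally have bx: "\<beta> x = (\<Sum>\<alpha>\<in>S. \<alpha> x * \<beta> (e \<alpha>))" .
      have "(\<Sum>\<alpha>\<in>S. (if \<alpha> = \<beta> then - 1 else \<beta> (e \<alpha>)) * \<alpha> x) = (\<Sum>\<alpha>\<in>S. \<alpha> x * \<beta> (e \<alpha>))"
        using insert.hyps by (intro sum.cong) (auto simp: mult.commute)
      then show ?thesis using insert.hyps bx by simp
    qed
    then have "\<forall>\<alpha>\<in>insert \<beta> S. (if \<alpha> = \<beta> then - 1 else \<beta> (e \<alpha>)) = 0" by (intro ind) blast
    then show False by auto
  qed
  then obtain h where h: "h \<in> H" "\<forall>\<alpha>\<in>S. \<alpha> h = 0" "\<beta> h \<noteq> 0" by blast
  obtain h1 where h1: "h1 \<in> H" "\<forall>\<alpha>\<in>S. \<alpha> h1 = c \<alpha>" using dual by blast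
  let ?r = "(c \<beta> - \<beta> h1) / \<beta> h"
  have rh: "?r *s h \<in> H" using h(1) by (rule subspace_scale[OF H])
  have "\<alpha> (h1 + ?r *s h) = c \<alpha>" if "\<alpha> \<in> insert \<beta> S" for \<alpha>
  proof -
    have "\<alpha> (h1 + ?r *s h) = \<alpha> h1 + ?r * \<alpha> h" using add[OF that h1(1) rh] scale[OF that h(1)] by simp
    then show ?thesis using that h h1 by auto
  qed
  moreover have "h1 + ?r *s h \<in> H" using h1(1) rh by (rule subspace_add[OF H])
  ultimately show ?case by blast
qed

locale simple_lie_data =
  fixes G :: "'g::ab_group_add lie_data"
  assumes simple: "simple_lie_algebra G" and findim: "finite_dimensional G"
    and cartan: "cartan_subalgebra G" and simple_roots: "simple_root_system G"
    and triangular: "triangular_decomposition G" and normalized: "normalized_killing_form G"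
begin

sublocale g: lie_algebra "scl G" "brk G"
  using simple by (simp add: simple_lie_algebra_def)

lemma brk_0 [simp]: "brk G 0 z = 0" "brk G z 0 = 0"
  using g.bracket_add_left[of 0 0 z] g.bracket_add_right[of z 0 0] by auto

lemma brk_antisym: "brk G x y = - brk G y x"
proof -
  have "brk G (x + y) (x + y) = brk G x y + brk G y x"
    by (simp only: g.bracket_add_left g.bracket_add_right) (simp add: g.bracket_self)
  then have "brk G x y + brk G y x = 0" by (metis g.bracket_self)
  then show ?thesis by (simp add: eq_neg_iff_add_eq_0)
qed

lemma brk_minus: "brk G (- x) y = - brk G x y" "brk G x (- y) = - brk G x y"
  using g.bracket_scale_left[of "-1" x y] g.bracket_scale_right[of x "-1" y] by auto

lemma brk_diff: "brk G (x - y) z = brk G x z - brk G y z" "brk G x (y - z) = brk G x y - brk G x z"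
  using g.bracket_add_left[of x "- y" z] g.bracket_add_right[of x y "- z"] by (simp_all add: brk_minus)

lemma brk_brk: "brk G (brk G x y) z = brk G x (brk G y z) - brk G y (brk G x z)"
proof -
  have "brk G x (brk G y z) + brk G y (brk G z x) + brk G z (brk G x y) = 0" by (rule g.jacobi)
  moreover have "brk G z (brk G x y) = - brk G (brk G x y) z" by (rule brk_antisym)
  moreover have "brk G y (brk G z x) = - brk G y (brk G x z)" by (metis brk_antisym brk_minus(2))
  ultimately show ?thesis by (simp add: algebra_simps)
qed

lemma csa_subspace: "g.subspace (csa G)" and csa_brk: "x \<in> csa G \<Longrightarrow> y \<in> csa G \<Longrightarrow> brk G x y \<in> csa G"
  and csa_nilpotent: "\<exists>n. lower_central_series G (csa G) n = {0}"
  using cartan by (auto simp: cartan_subalgebra_def)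

lemma csa_dualD:
  assumes "\<alpha> \<in> csa_dual G"
  shows "x \<in> csa G \<Longrightarrow> y \<in> csa G \<Longrightarrow> \<alpha> (x + y) = \<alpha> x + \<alpha> y" "x \<in> csa G \<Longrightarrow> \<alpha> (scl G r x) = r * \<alpha> x"
    "x \<notin> csa G \<Longrightarrow> \<alpha> x = undefined" "\<alpha> 0 = 0"
proof -
  show s: "x \<in> csa G \<Longrightarrow> \<alpha> (scl G r x) = r * \<alpha> x" for x r using assms by (auto simp: csa_dual_def)
  show "\<alpha> 0 = 0" using s[of 0 0] g.subspace_0[OF csa_subspace] by simp
qed (use assms in \<open>auto simp: csa_dual_def extensional_def\<close>)

lemma csa_dual_eqI:
  assumes "\<alpha> \<in> csa_dual G" "\<beta> \<in> csa_dual G" "\<And>x. x \<in> csa G \<Longrightarrow> \<alpha> x = \<beta> x"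
  shows "\<alpha> = \<beta>"
  using assms csa_dualD(3) by (metis ext)

lemma zero_weight_dual: "zero_weight G \<in> csa_dual G"
  using g.subspace_add[OF csa_subspace] g.subspace_scale[OF csa_subspace]
  by (auto simp: csa_dual_def zero_weight_def)

lemma root_dual: "\<alpha> \<in> roots G \<Longrightarrow> \<alpha> \<in> csa_dual G"
  by (simp add: roots_def)

lemma principal_element:
  obtains h0 where "h0 \<in> csa G" "\<forall>\<alpha>\<in>simple_roots G. \<alpha> h0 = 1"
proof -
  have "\<exists>h\<in>csa G. \<forall>\<alpha>\<in>simple_roots G. \<alpha> h = 1"
  proof (rule g.dual_vectors[where c = "\<lambda>_. 1"])
    show "finite (simple_roots G)" using simple_roots by (simp add: simple_root_system_def)
    have d: "\<alpha> \<in> csa_dual G" if "\<alpha> \<in> simple_roots G" for \<alpha>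
      using simple_roots that root_dual by (auto simp: simple_root_system_def)
    show "\<alpha> (x + y) = \<alpha> x + \<alpha> y" if "\<alpha> \<in> simple_roots G" "x \<in> csa G" "y \<in> csa G" for \<alpha> x y
      using csa_dualD(1)[OF d] that by blast
    show "\<alpha> (scl G r x) = r * \<alpha> x" if "\<alpha> \<in> simple_roots G" "x \<in> csa G" for \<alpha> r x
      using csa_dualD(2)[OF d] that by blast
    show "\<forall>\<alpha>\<in>simple_roots G. r \<alpha> = 0" if "\<forall>x\<in>csa G. (\<Sum>\<alpha>\<in>simple_roots G. r \<alpha> * \<alpha> x) = 0" for r
    proof -
      have "simple_sum G r = zero_weight G"
        unfolding simple_sum_def zero_weight_def using that by (intro restrict_ext) auto
      then show ?thesis using simple_roots by (simp add: simple_root_system_def)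
    qed
  qed (rule csa_subspace)
  then show ?thesis using that by blast
qed

text \<open>The principal element: its adjoint eigenvalue on a root vector is the height of the root.\<close>

definition h0 :: 'g where
  "h0 = (SOME h. h \<in> csa G \<and> (\<forall>\<alpha>\<in>simple_roots G. \<alpha> h = 1))"

lemma h0: "h0 \<in> csa G" "\<alpha> \<in> simple_roots G \<Longrightarrow> \<alpha> h0 = 1"
proof -
  have "\<exists>h. h \<in> csa G \<and> (\<forall>\<alpha>\<in>simple_roots G. \<alpha> h = 1)" using principal_element by metis
  from someI_ex[OF this] show "h0 \<in> csa G" "\<alpha> \<in> simple_roots G \<Longrightarrow> \<alpha> h0 = 1"
    by (auto simp: h0_def)
qed

lemma positive_root_height:
  assumes "\<beta> \<in> positive_roots G"
  obtains n :: nat where "n > 0" "\<beta> h0 = of_nat n"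
proof -
  have \<beta>: "\<beta> \<in> roots G" "\<beta> \<in> nonneg_sums G" using assms by (auto simp: positive_roots_def)
  then obtain n :: "('g \<Rightarrow> complex) \<Rightarrow> nat" where n: "\<beta> = simple_sum G (\<lambda>\<alpha>. of_nat (n \<alpha>))"
    by (auto simp: nonneg_sums_def)
  have fin: "finite (simple_roots G)" using simple_roots by (simp add: simple_root_system_def)
  have "\<beta> h0 = of_nat (\<Sum>\<alpha>\<in>simple_roots G. n \<alpha>)"
    unfolding n simple_sum_def using h0(1) by (simp add: h0(2) cong: sum.cong)
  moreover have "(\<Sum>\<alpha>\<in>simple_roots G. n \<alpha>) \<noteq> 0"
  proof
    assume "(\<Sum>\<alpha>\<in>simple_roots G. n \<alpha>) = 0"
    then have "\<forall>\<alpha>\<in>simple_roots G. n \<alpha> = 0" using fin by simp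
    then have "\<beta> = zero_weight G"
      unfolding n simple_sum_def zero_weight_def by (intro restrict_ext) simp
    then show False using \<beta>(1) by (simp add: roots_def)
  qed
  ultimately show ?thesis by (intro that[of "\<Sum>\<alpha>\<in>simple_roots G. n \<alpha>"]) auto
qed

abbreviation "pos_vectors \<equiv> \<Union>\<alpha>\<in>positive_roots G. root_space G \<alpha>"
abbreviation "neg_vectors \<equiv> \<Union>\<alpha>\<in>positive_roots G. root_space G (neg_weight G \<alpha>)"

lemma root_vector_weight:
  assumes "x \<in> pos_vectors \<union> neg_vectors" "h \<in> csa G"
  obtains s where "brk G h x = scl G s x"
  using assms by (auto simp: root_space_def)

lemma span_homogeneous: "g.span (csa G \<union> pos_vectors \<union> neg_vectors) = UNIV"
proof -
  have "x \<in> g.span (csa G \<union> pos_vectors \<union> neg_vectors)" for x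
  proof -
    have "\<exists>t. case t of (y, h, z) \<Rightarrow> y \<in> nil_neg G \<and> h \<in> csa G \<and> z \<in> nil_pos G \<and> x = y + h + z"
      using triangular unfolding triangular_decomposition_def by (blast intro: ex1_implies_ex)
    then obtain y h z where "y \<in> nil_neg G" "h \<in> csa G" "z \<in> nil_pos G" "x = y + h + z"
      by auto
    moreover have "nil_neg G \<subseteq> g.span (csa G \<union> pos_vectors \<union> neg_vectors)"
      unfolding nil_neg_def by (rule g.span_mono) blast
    moreover have "nil_pos G \<subseteq> g.span (csa G \<union> pos_vectors \<union> neg_vectors)"
      unfolding nil_pos_def by (rule g.span_mono) blast
    moreover have "csa G \<subseteq> g.span (csa G \<union> pos_vectors \<union> neg_vectors)"
      using g.span_base by (simp add: subset_iff)
    ultimately show ?thesis by (simp add: g.span_add subset_iff)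
  qed
  then show ?thesis by auto
qed

text \<open>The elements of the Cartan subalgebra that commute with all root vectors form an ideal. It is not
  the whole algebra, which is not nilpotent, so it is zero by simplicity. It contains \<open>[h, h']\<close> because
  \<open>h\<close> and \<open>h'\<close> act on each root vector by scalars.\<close>

lemma csa_abelian:
  assumes "h \<in> csa G" "h' \<in> csa G"
  shows "brk G h h' = 0"
proof -
  let ?R = "pos_vectors \<union> neg_vectors"
  define C where "C = {h \<in> csa G. \<forall>x\<in>?R. brk G h x = 0}"
  have C_sub: "g.subspace C"
    using csa_subspace unfolding C_def g.subspace_def
    by (auto simp: g.bracket_add_left g.bracket_scale_left)
  have ideal: "brk G x y \<in> C" if y: "y \<in> C" for x y
  proof -
    have "x \<in> g.span (csa G \<union> pos_vectors \<union> neg_vectors)" by (simp add: span_homogeneous)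
    then show ?thesis
    proof (induction rule: g.span_induct_alt)
      case base
      show ?case using g.subspace_0[OF C_sub] by simp
    next
      case (step c x z)
      have "brk G x y \<in> C"
      proof (cases "x \<in> csa G")
        case True
        have "brk G (brk G x y) e = 0" if e: "e \<in> ?R" for e
        proof -
          obtain s where "brk G x e = scl G s e" using root_vector_weight[OF e True] .
          moreover have "brk G y e = 0" using y e by (auto simp: C_def)
          ultimately show ?thesis by (simp add: brk_brk g.bracket_scale_right)
        qed
        then show ?thesis using True y csa_brk by (auto simp: C_def)
      next
        case False
        then have "x \<in> ?R" using step by auto
        then have "brk G y x = 0" using y by (auto simp: C_def)
        then show ?thesis using brk_antisym[of x y] g.subspace_0[OF C_sub] by simp
      qed
      then show ?case using step C_sub
        by (simp add: g.bracket_add_left g.bracket_scale_left g.subspace_add g.subspace_scale)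
    qed
  qed
  have ideals: "I = {0} \<or> I = UNIV" if "g.subspace I" "\<And>x y. y \<in> I \<Longrightarrow> brk G x y \<in> I" for I
    using simple that unfolding simple_lie_algebra_def by blast
  obtain a b where ab: "brk G a b \<noteq> 0" using simple by (auto simp: simple_lie_algebra_def)
  have "C \<noteq> UNIV"
  proof
    assume "C = UNIV"
    then have U: "csa G = UNIV" by (auto simp: C_def)
    have DU: "g.span {brk G x y | x y. x \<in> UNIV \<and> y \<in> UNIV} = UNIV" (is "?D = UNIV")
    proof -
      have "brk G x y \<in> ?D" if "y \<in> ?D" for x y by (rule g.span_base) auto
      moreover have "?D \<noteq> {0}" using g.span_base[of "brk G a b" "{brk G x y | x y. x \<in> UNIV \<and> y \<in> UNIV}"] ab by auto
      ultimately show ?thesis using ideals[of ?D] by auto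
    qed
    have "lower_central_series G UNIV n = UNIV" for n
      by (induction n) (use DU in auto)
    then show False using csa_nilpotent U ab by auto
  qed
  then have C0: "C = {0}" using ideals[OF C_sub ideal] by auto
  have "brk G (brk G h h') e = 0" if e: "e \<in> ?R" for e
  proof -
    obtain s where s: "brk G h e = scl G s e" using root_vector_weight[OF e assms(1)] .
    obtain s' where s': "brk G h' e = scl G s' e" using root_vector_weight[OF e assms(2)] .
    show ?thesis using s s' by (simp add: brk_brk g.bracket_scale_right mult.commute)
  qed
  then have "brk G h h' \<in> C" using assms csa_brk by (auto simp: C_def)
  then show ?thesis using C0 by simp
qed

lemma homogeneous_height:
  assumes "x \<in> csa G \<union> pos_vectors \<union> neg_vectors"
  shows "\<exists>n::int. brk G h0 x = scl G (of_int n) x \<and> (n = 0 \<longrightarrow> x \<in> csa G) \<and> (n > 0 \<longrightarrow> x \<in> nil_pos G)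
     \<and> (\<forall>h\<in>csa G. \<exists>s. brk G h x = scl G s x)"
proof -
  consider "x \<in> csa G" | "x \<in> pos_vectors" | "x \<in> neg_vectors" using assms by blast
  then show ?thesis
  proof cases
    case 1
    then show ?thesis using csa_abelian h0 by (intro exI[of _ 0]) (auto intro!: exI[of _ 0])
  next
    case 2
    then obtain \<alpha> where \<alpha>: "\<alpha> \<in> positive_roots G" "x \<in> root_space G \<alpha>" by blast
    obtain n :: nat where n: "n > 0" "\<alpha> h0 = of_nat n" using positive_root_height[OF \<alpha>(1)] .
    have "x \<in> nil_pos G" unfolding nil_pos_def using 2 by (intro g.span_base)
    then show ?thesis using \<alpha> n h0 by (intro exI[of _ "int n"]) (auto simp: root_space_def)
  next
    case 3
    then obtain \<alpha> where \<alpha>: "\<alpha> \<in> positive_roots G" "x \<in> root_space G (neg_weight G \<alpha>)" by blast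
    obtain n :: nat where n: "n > 0" "\<alpha> h0 = of_nat n" using positive_root_height[OF \<alpha>(1)] .
    have "neg_weight G \<alpha> h0 = - of_nat n" using h0 n by (simp add: neg_weight_def)
    then show ?thesis using \<alpha> n h0 by (intro exI[of _ "- int n"]) (auto simp: root_space_def)
  qed
qed

text \<open>Finiteness is used to bound the heights in the definition of \<open>level_weight\<close>.\<close>

lemma homogeneous_basis:
  obtains R where "finite R" "g.span R = UNIV" "R \<subseteq> csa G \<union> pos_vectors \<union> neg_vectors" "0 \<notin> R"
proof -
  obtain R where R: "R \<subseteq> csa G \<union> pos_vectors \<union> neg_vectors" "g.independent R"
      "csa G \<union> pos_vectors \<union> neg_vectors \<subseteq> g.span R"
    by (rule g.maximal_independent_subset)
  obtain B where "finite B" "g.span B = UNIV" using findim by (auto simp: finite_dimensional_def)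
  then have "finite R" using g.independent_span_bound[OF _ R(2)] by auto
  moreover have "g.span R = UNIV" using g.span_minimal[OF R(3)] span_homogeneous by auto
  ultimately show ?thesis using R that g.dependent_zero by blast
qed

definition R :: "'g set" where
  "R = (SOME R. finite R \<and> g.span R = UNIV \<and> R \<subseteq> csa G \<union> pos_vectors \<union> neg_vectors \<and> 0 \<notin> R)"

lemma R: "finite R" "g.span R = UNIV" "R \<subseteq> csa G \<union> pos_vectors \<union> neg_vectors" "0 \<notin> R"
proof -
  have "\<exists>R. finite R \<and> g.span R = UNIV \<and> R \<subseteq> csa G \<union> pos_vectors \<union> neg_vectors \<and> 0 \<notin> R"
    using homogeneous_basis by metis
  from someI_ex[OF this] show "finite R" "g.span R = UNIV" "R \<subseteq> csa G \<union> pos_vectors \<union> neg_vectors" "0 \<notin> R"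
    by (auto simp: R_def)
qed

definition height :: "'g \<Rightarrow> int" where
  "height r = (SOME n. brk G h0 r = scl G (of_int n) r \<and> (n = 0 \<longrightarrow> r \<in> csa G) \<and> (n > 0 \<longrightarrow> r \<in> nil_pos G))"

lemma height:
  assumes "r \<in> R"
  shows "brk G h0 r = scl G (of_int (height r)) r" "height r = 0 \<Longrightarrow> r \<in> csa G"
    "height r > 0 \<Longrightarrow> r \<in> nil_pos G" "h \<in> csa G \<Longrightarrow> \<exists>s. brk G h r = scl G s r"
proof -
  have r: "r \<in> csa G \<union> pos_vectors \<union> neg_vectors" using assms R(3) by auto
  have "\<exists>n::int. brk G h0 r = scl G (of_int n) r \<and> (n = 0 \<longrightarrow> r \<in> csa G) \<and> (n > 0 \<longrightarrow> r \<in> nil_pos G)"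
    using homogeneous_height[OF r] by blast
  from someI_ex[OF this] show "brk G h0 r = scl G (of_int (height r)) r" "height r = 0 \<Longrightarrow> r \<in> csa G"
    "height r > 0 \<Longrightarrow> r \<in> nil_pos G" by (auto simp: height_def)
  show "h \<in> csa G \<Longrightarrow> \<exists>s. brk G h r = scl G s r" using homogeneous_height[OF r] by blast
qed

lemma nil_pos_0: "0 \<in> nil_pos G" by (simp add: nil_pos_def g.span_zero)
lemma nil_pos_subspace: "g.subspace (nil_pos G)" by (simp add: nil_pos_def)

lemma csa_nil_pos_unique:
  assumes "h + z = h' + z'" "h \<in> csa G" "h' \<in> csa G" "z \<in> nil_pos G" "z' \<in> nil_pos G"
  shows "h = h'" "z = z'"
proof -
  have 0: "0 \<in> nil_neg G" by (simp add: nil_neg_def g.span_zero)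
  define P where "P = (\<lambda>(y, k, w). y \<in> nil_neg G \<and> k \<in> csa G \<and> w \<in> nil_pos G \<and> h + z = y + k + w)"
  have "\<exists>!t. P t"
    using triangular unfolding triangular_decomposition_def P_def by (rule spec)
  moreover have "P (0, h, z)" "P (0, h', z')" using assms 0 by (auto simp: P_def)
  ultimately have "(0::'g, h, z) = (0, h', z')" by blast
  then show "h = h'" "z = z'" by auto
qed

lemma brk_csa_nil_pos:
  assumes "h \<in> csa G" "z \<in> nil_pos G"
  shows "brk G h z \<in> nil_pos G"
  using assms(2) unfolding nil_pos_def
proof (induction rule: g.span_induct_alt)
  case (step c x y)
  obtain s where "brk G h x = scl G s x" using root_vector_weight[of x h] step assms by blast
  then have "brk G h x \<in> g.span pos_vectors" using step by (simp add: g.span_base g.span_scale)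
  then show ?case using step by (simp add: g.bracket_add_right g.bracket_scale_right g.span_add g.span_scale)
qed (simp add: g.span_zero)

text \<open>The bracket is zero or a root vector for the sum of the two roots, which is again a nonnegative
  combination of simple roots.\<close>

lemma brk_pos_vectors:
  assumes "x \<in> root_space G \<alpha>" "\<alpha> \<in> positive_roots G" "y \<in> root_space G \<beta>" "\<beta> \<in> positive_roots G"
  shows "brk G x y \<in> nil_pos G"
proof (cases "brk G x y = 0")
  case True
  then show ?thesis by (simp add: nil_pos_0)
next
  case False
  define \<gamma> where "\<gamma> = (\<lambda>h\<in>csa G. \<alpha> h + \<beta> h)"
  have d: "\<alpha> \<in> csa_dual G" "\<beta> \<in> csa_dual G" using assms root_dual by (auto simp: positive_roots_def)
  have "brk G h (brk G x y) = scl G (\<gamma> h) (brk G x y)" if "h \<in> csa G" for h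
  proof -
    have xy: "brk G h x = scl G (\<alpha> h) x" "brk G h y = scl G (\<beta> h) y"
      using assms that by (auto simp: root_space_def)
    have "brk G h (brk G x y) = brk G (brk G h x) y + brk G x (brk G h y)"
      by (simp add: brk_brk)
    then show ?thesis using that
      by (simp add: \<gamma>_def xy g.bracket_scale_left g.bracket_scale_right g.scale_left_distrib)
  qed
  then have rs: "brk G x y \<in> root_space G \<gamma>" by (simp add: root_space_def)
  have \<gamma>_dual: "\<gamma> \<in> csa_dual G"
    using g.subspace_add[OF csa_subspace] g.subspace_scale[OF csa_subspace] csa_dualD[OF d(1)] csa_dualD[OF d(2)]
    by (auto simp: csa_dual_def \<gamma>_def algebra_simps)
  obtain n m :: nat where "n > 0" "\<alpha> h0 = of_nat n" "\<beta> h0 = of_nat m"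
    using positive_root_height[OF assms(2)] positive_root_height[OF assms(4)] by metis
  then have "\<gamma> h0 = of_nat (n + m)" "n + m > 0" using h0 by (auto simp: \<gamma>_def)
  then have "\<gamma> h0 \<noteq> 0" by (metis of_nat_eq_0_iff less_irrefl)
  then have "\<gamma> \<noteq> zero_weight G" using h0 by (auto simp: zero_weight_def)
  then have "\<gamma> \<in> roots G" using \<gamma>_dual rs False by (auto simp: roots_def)
  moreover have "\<gamma> \<in> nonneg_sums G"
  proof -
    obtain n m :: "('g \<Rightarrow> complex) \<Rightarrow> nat" where
      "\<alpha> = simple_sum G (\<lambda>\<alpha>. of_nat (n \<alpha>))" "\<beta> = simple_sum G (\<lambda>\<alpha>. of_nat (m \<alpha>))"
      using assms by (auto simp: positive_roots_def nonneg_sums_def)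
    then have "\<gamma> = simple_sum G (\<lambda>\<alpha>. of_nat (n \<alpha> + m \<alpha>))"
      unfolding \<gamma>_def simple_sum_def by (intro restrict_ext) (simp add: sum.distrib algebra_simps)
    then show ?thesis unfolding nonneg_sums_def by (auto intro!: exI[of _ "\<lambda>\<alpha>. n \<alpha> + m \<alpha>"])
  qed
  ultimately show ?thesis using rs unfolding nil_pos_def positive_roots_def by (intro g.span_base) blast
qed

lemma brk_nil_pos:
  assumes "x \<in> nil_pos G" "y \<in> nil_pos G"
  shows "brk G x y \<in> nil_pos G"
proof -
  have 1: "brk G x y \<in> nil_pos G" if "x \<in> pos_vectors" for x
    using assms(2) unfolding nil_pos_def
  proof (induction rule: g.span_induct_alt)
    case (step c e y)
    have "brk G x e \<in> nil_pos G" using brk_pos_vectors step that by blast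
    then show ?case using step unfolding nil_pos_def
      by (simp add: g.bracket_add_right g.bracket_scale_right g.span_add g.span_scale)
  qed (simp add: g.span_zero)
  show ?thesis
    using assms(1) unfolding nil_pos_def
  proof (induction rule: g.span_induct_alt)
    case (step c e x)
    then show ?case using 1[of e] unfolding nil_pos_def
      by (simp add: g.bracket_add_left g.bracket_scale_left g.span_add g.span_scale)
  qed (simp add: g.span_zero)
qed

subsection \<open>The invariant form\<close>

definition trace_basis :: "'g set" where
  "trace_basis = (SOME B. \<not> module.dependent (scl G) B \<and> gspan G B = UNIV)"

lemma trace_basis: "g.independent trace_basis" "g.span trace_basis = UNIV" "finite trace_basis"
proof -
  have "\<exists>B. \<not> module.dependent (scl G) B \<and> gspan G B = UNIV"
    using g.independent_extend_basis[OF g.independent_empty] g.span_extend_basis[OF g.independent_empty] by blast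
  from someI_ex[OF this] show *: "g.independent trace_basis" "g.span trace_basis = UNIV"
    by (auto simp: trace_basis_def)
  obtain B where "finite B" "g.span B = UNIV" using findim by (auto simp: finite_dimensional_def)
  then show "finite trace_basis" using g.independent_span_bound[OF _ *(1)] by auto
qed

abbreviation coord :: "'g \<Rightarrow> 'g \<Rightarrow> complex" where "coord \<equiv> g.representation trace_basis"

lemma coord_add: "coord (x + y) b = coord x b + coord y b"
  and coord_scale: "coord (scl G r x) b = r * coord x b"
  using trace_basis by (simp_all add: g.representation_add g.representation_scale)

lemma coord_sum: "coord (\<Sum>i\<in>I. f i) b = (\<Sum>i\<in>I. coord (f i) b)"
  using coord_scale[of 0 0 b] by (induction I rule: infinite_finite_induct) (auto simp: coord_add)

lemma trace_eq: "trace G f = (\<Sum>b\<in>trace_basis. coord (f b) b)"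
  by (simp add: trace_def trace_basis_def Let_def)

lemma coord_expand: "(\<Sum>b\<in>trace_basis. scl G (coord x b) b) = x"
  using g.sum_representation_eq[OF trace_basis(1) _ trace_basis(3)] trace_basis(2) by auto

lemma trace_swap:
  assumes f: "\<And>x y. f (x + y) = f x + f y" "\<And>r x. f (scl G r x) = scl G r (f x)"
    and h: "\<And>x y. h (x + y) = h x + h y" "\<And>r x. h (scl G r x) = scl G r (h x)"
  shows "trace G (\<lambda>z. f (h z)) = trace G (\<lambda>z. h (f z))"
proof -
  have expand: "coord (p (q b)) b = (\<Sum>c\<in>trace_basis. coord (q b) c * coord (p c) b)"
    if p: "\<And>x y. p (x + y) = p x + p y" "\<And>r x. p (scl G r x) = scl G r (p x)" for p q b
  proof -
    have p0: "p 0 = 0" using p(2)[of 0 0] by simp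
    have "p (\<Sum>c\<in>T. scl G (coord (q b) c) c) = (\<Sum>c\<in>T. scl G (coord (q b) c) (p c))" for T
      by (induction T rule: infinite_finite_induct) (auto simp: p p0)
    then have "p (q b) = (\<Sum>c\<in>trace_basis. scl G (coord (q b) c) (p c))"
      using coord_expand[of "q b"] by metis
    then show ?thesis by (simp add: coord_sum coord_scale)
  qed
  have "trace G (\<lambda>z. f (h z)) = (\<Sum>b\<in>trace_basis. \<Sum>c\<in>trace_basis. coord (h b) c * coord (f c) b)"
    unfolding trace_eq by (intro sum.cong refl expand[OF f])
  also have "\<dots> = (\<Sum>c\<in>trace_basis. \<Sum>b\<in>trace_basis. coord (f c) b * coord (h b) c)"
    by (subst sum.swap) (simp add: mult.commute)
  also have "\<dots> = trace G (\<lambda>z. h (f z))"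
    unfolding trace_eq by (intro sum.cong refl expand[OF h, symmetric])
  finally show ?thesis .
qed

lemma trace_add: "trace G (\<lambda>z. f z + h z) = trace G f + trace G h"
  by (simp add: trace_eq coord_add sum.distrib)

lemma trace_scale: "trace G (\<lambda>z. scl G r (f z)) = r * trace G f"
  by (simp add: trace_eq coord_scale sum_distrib_left)

lemma trace_diff: "trace G (\<lambda>z. f z - h z) = trace G f - trace G h"
  using trace_add[of "\<lambda>z. f z - h z" h] by simp

lemma form_add: "form G (x + x') y = form G x y + form G x' y" "form G x (y + y') = form G x y + form G x y'"
  and form_scale: "form G (scl G r x) y = r * form G x y" "form G x (scl G r y) = r * form G x y"
  and form_sym: "form G x y = form G y x"
  and form_invariant: "form G (brk G x y) z = form G x (brk G y z)"
proof -
  obtain s where s: "\<forall>x y. form G x y = s * killing_form G x y"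
    using normalized by (auto simp: normalized_killing_form_def)
  show "form G (x + x') y = form G x y + form G x' y" "form G x (y + y') = form G x y + form G x y'"
    by (simp_all add: s killing_form_def g.bracket_add_left g.bracket_add_right trace_add algebra_simps)
  show "form G (scl G r x) y = r * form G x y" "form G x (scl G r y) = r * form G x y"
    by (simp_all add: s killing_form_def g.bracket_scale_left g.bracket_scale_right trace_scale algebra_simps)
  show "form G x y = form G y x"
    using trace_swap[of "brk G x" "brk G y"] by (simp add: s killing_form_def g.bracket_add_right g.bracket_scale_right)
  have "trace G (\<lambda>w. brk G y (brk G x (brk G z w))) = trace G (\<lambda>w. brk G x (brk G z (brk G y w)))"
    using trace_swap[of "brk G y" "\<lambda>w. brk G x (brk G z w)"] by (simp add: g.bracket_add_right g.bracket_scale_right)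
  then show "form G (brk G x y) z = form G x (brk G y z)"
    by (simp add: s killing_form_def brk_brk trace_diff brk_diff)
qed

lemma form_0 [simp]: "form G 0 y = 0" "form G x 0 = 0"
  using form_scale[of 0 0 y] form_scale(2)[of x 0 0] by auto

end

section \<open>The affine-Virasoro algebra\<close>

lemma sum_single_lookup: "(\<Sum>m\<in>Poly_Mapping.keys f. Poly_Mapping.single m (Poly_Mapping.lookup f m)) = f"
  by (rule poly_mapping_eqI) (simp add: lookup_sum lookup_single when_def in_keys_iff)

definition biadditive_sum ::
  "(int \<Rightarrow> int \<Rightarrow> 'a::zero \<Rightarrow> 'b::zero \<Rightarrow> 'c::comm_monoid_add) \<Rightarrow> (int \<Rightarrow>\<^sub>0 'a) \<Rightarrow> (int \<Rightarrow>\<^sub>0 'b) \<Rightarrow> 'c" where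
  "biadditive_sum \<beta> f g = (\<Sum>m\<in>Poly_Mapping.keys f. \<Sum>n\<in>Poly_Mapping.keys g.
     \<beta> m n (Poly_Mapping.lookup f m) (Poly_Mapping.lookup g n))"

text \<open>The bracket of the affine-Virasoro algebra is assembled from five sums of this kind, so additivity
  and compatibility with scalars need to be proved only once.\<close>

locale biadditive =
  fixes \<beta> :: "int \<Rightarrow> int \<Rightarrow> 'a::ab_group_add \<Rightarrow> 'b::ab_group_add \<Rightarrow> 'c::ab_group_add"
  assumes add_left: "\<beta> m n (x + x') y = \<beta> m n x y + \<beta> m n x' y"
    and add_right: "\<beta> m n x (y + y') = \<beta> m n x y + \<beta> m n x y'"
begin

lemma zero [simp]: "\<beta> m n 0 y = 0" "\<beta> m n x 0 = 0"
  using add_left[of m n 0 0 y] add_right[of m n x 0 0] by auto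

lemma superset:
  assumes "finite A" "Poly_Mapping.keys f \<subseteq> A" "finite B" "Poly_Mapping.keys g \<subseteq> B"
  shows "biadditive_sum \<beta> f g = (\<Sum>m\<in>A. \<Sum>n\<in>B. \<beta> m n (Poly_Mapping.lookup f m) (Poly_Mapping.lookup g n))"
proof -
  have "(\<Sum>n\<in>Poly_Mapping.keys g. \<beta> m n x (Poly_Mapping.lookup g n)) = (\<Sum>n\<in>B. \<beta> m n x (Poly_Mapping.lookup g n))" for m x
    using assms by (intro sum.mono_neutral_left) (auto simp: in_keys_iff)
  then show ?thesis
    unfolding biadditive_sum_def using assms by (simp, intro sum.mono_neutral_left) (auto simp: in_keys_iff)
qed

lemma sum_add_left: "biadditive_sum \<beta> (f + f') g = biadditive_sum \<beta> f g + biadditive_sum \<beta> f' g"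
proof -
  let ?A = "Poly_Mapping.keys f \<union> Poly_Mapping.keys f'" and ?B = "Poly_Mapping.keys g"
  have "biadditive_sum \<beta> h g = (\<Sum>m\<in>?A. \<Sum>n\<in>?B. \<beta> m n (Poly_Mapping.lookup h m) (Poly_Mapping.lookup g n))"
    if "h \<in> {f, f', f + f'}" for h
    using that Poly_Mapping.keys_add[of f f'] by (intro superset) auto
  then show ?thesis by (simp add: lookup_add add_left sum.distrib)
qed

lemma sum_add_right: "biadditive_sum \<beta> f (g + g') = biadditive_sum \<beta> f g + biadditive_sum \<beta> f g'"
proof -
  let ?A = "Poly_Mapping.keys f" and ?B = "Poly_Mapping.keys g \<union> Poly_Mapping.keys g'"
  have "biadditive_sum \<beta> f h = (\<Sum>m\<in>?A. \<Sum>n\<in>?B. \<beta> m n (Poly_Mapping.lookup f m) (Poly_Mapping.lookup h n))"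
    if "h \<in> {g, g', g + g'}" for h
    using that Poly_Mapping.keys_add[of g g'] by (intro superset) auto
  then show ?thesis by (simp add: lookup_add add_right sum.distrib)
qed

lemma sum_single: "biadditive_sum \<beta> (Poly_Mapping.single m x) (Poly_Mapping.single n y) = \<beta> m n x y"
  by (subst superset[of "{m}" _ "{n}"]) auto

lemma sum_zero [simp]: "biadditive_sum \<beta> 0 g = 0" "biadditive_sum \<beta> f 0 = 0"
  by (simp_all add: biadditive_sum_def)

lemma sum_scale:
  assumes T: "\<And>x y. T (x + y) = T x + T y"
    and f': "\<And>m n y. \<beta> m n (Poly_Mapping.lookup f' m) y = T (\<beta> m n (Poly_Mapping.lookup f m) y)"
      "Poly_Mapping.keys f' \<subseteq> Poly_Mapping.keys f"
  shows "biadditive_sum \<beta> f' g = T (biadditive_sum \<beta> f g)"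
proof -
  have T0: "T 0 = 0" using T[of 0 0] by simp
  have T_sum: "T (\<Sum>i\<in>I. h i) = (\<Sum>i\<in>I. T (h i))" for h and I :: "int set"
    by (induction I rule: infinite_finite_induct) (auto simp: T T0)
  show ?thesis
    using superset[of "Poly_Mapping.keys f" f' "Poly_Mapping.keys g" g] f'(2)
    by (simp add: f'(1) T_sum biadditive_sum_def)
qed

lemma sum_scale_right:
  assumes T: "\<And>x y. T (x + y) = T x + T y"
    and g': "\<And>m n x. \<beta> m n x (Poly_Mapping.lookup g' n) = T (\<beta> m n x (Poly_Mapping.lookup g n))"
      "Poly_Mapping.keys g' \<subseteq> Poly_Mapping.keys g"
  shows "biadditive_sum \<beta> f g' = T (biadditive_sum \<beta> f g)"
proof -
  have T0: "T 0 = 0" using T[of 0 0] by simp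
  have T_sum: "T (\<Sum>i\<in>I. h i) = (\<Sum>i\<in>I. T (h i))" for h and I :: "int set"
    by (induction I rule: infinite_finite_induct) (auto simp: T T0)
  show ?thesis
    using superset[of "Poly_Mapping.keys f" f "Poly_Mapping.keys g" g'] g'(2)
    by (simp add: g'(1) T_sum biadditive_sum_def)
qed

end

context simple_lie_data
begin

definition \<beta>_brk :: "int \<Rightarrow> int \<Rightarrow> 'g \<Rightarrow> 'g \<Rightarrow> int \<Rightarrow>\<^sub>0 'g" where
  "\<beta>_brk m n x y = Poly_Mapping.single (m + n) (brk G x y)"

definition \<beta>_der :: "int \<Rightarrow> int \<Rightarrow> complex \<Rightarrow> 'g \<Rightarrow> int \<Rightarrow>\<^sub>0 'g" where
  "\<beta>_der n m a x = Poly_Mapping.single (m + n) (scl G (of_int m * a) x)"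

definition \<beta>_vir :: "int \<Rightarrow> int \<Rightarrow> complex \<Rightarrow> complex \<Rightarrow> int \<Rightarrow>\<^sub>0 complex" where
  "\<beta>_vir m n a b = Poly_Mapping.single (m + n) (of_int (n - m) * a * b)"

definition \<beta>_form :: "int \<Rightarrow> int \<Rightarrow> 'g \<Rightarrow> 'g \<Rightarrow> complex" where
  "\<beta>_form m n x y = (if n = - m then of_int m * form G x y else 0)"

definition \<beta>_cocycle :: "int \<Rightarrow> int \<Rightarrow> complex \<Rightarrow> complex \<Rightarrow> complex" where
  "\<beta>_cocycle m n a b = (if n = - m then of_int (m ^ 3 - m) / 12 * a * b else 0)"

sublocale brk: biadditive \<beta>_brk
  by unfold_locales (simp_all add: \<beta>_brk_def g.bracket_add_left g.bracket_add_right single_add)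
sublocale der: biadditive \<beta>_der
  by unfold_locales (simp_all add: \<beta>_der_def g.scale_left_distrib g.scale_right_distrib single_add distrib_left)
sublocale vir: biadditive \<beta>_vir
  by unfold_locales (simp_all add: \<beta>_vir_def single_add[symmetric] distrib_left distrib_right)
sublocale form: biadditive \<beta>_form
  by unfold_locales (simp_all add: \<beta>_form_def form_add distrib_left)
sublocale cocycle: biadditive \<beta>_cocycle
  by unfold_locales (simp_all add: \<beta>_cocycle_def distrib_left distrib_right)

lemma av_bracket_eq:
  "av_bracket G (f, p, \<kappa>, \<gamma>) (f', p', \<kappa>', \<gamma>') =
    (biadditive_sum \<beta>_brk f f' + biadditive_sum \<beta>_der p f' - biadditive_sum \<beta>_der p' f,
     biadditive_sum \<beta>_vir p p', biadditive_sum \<beta>_form f f', biadditive_sum \<beta>_cocycle p p')"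
proof -
  have "(\<Sum>n\<in>Poly_Mapping.keys f'. if n = - m then of_int m * form G x (Poly_Mapping.lookup f' n) else 0) =
      of_int m * form G x (Poly_Mapping.lookup f' (- m))" for m x
    by (simp add: in_keys_iff)
  moreover have "(\<Sum>n\<in>Poly_Mapping.keys p'. if n = - m then of_int (m ^ 3 - m) / 12 * x * Poly_Mapping.lookup p' n else 0) =
      of_int (m ^ 3 - m) / 12 * x * Poly_Mapping.lookup p' (- m)" for m x
    by (simp add: in_keys_iff)
  ultimately show ?thesis
    unfolding av_bracket_def biadditive_sum_def \<beta>_brk_def \<beta>_der_def \<beta>_vir_def \<beta>_form_def \<beta>_cocycle_def
    by (simp only: Let_def case_prod_conv)
qed

lemma lookup_map_scl: "Poly_Mapping.lookup (Poly_Mapping.map (scl G r) f) m = scl G r (Poly_Mapping.lookup f m)"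
  by (simp add: Poly_Mapping.map.rep_eq when_def)

lemma keys_map_scl: "Poly_Mapping.keys (Poly_Mapping.map (scl G r) f) \<subseteq> Poly_Mapping.keys f"
  by (auto simp: in_keys_iff lookup_map_scl)

lemma keys_fscale: "Poly_Mapping.keys (fscale r f) \<subseteq> Poly_Mapping.keys f"
  by (auto simp: in_keys_iff)

lemma map_scl_single [simp]: "Poly_Mapping.map (scl G r) (Poly_Mapping.single m x) = Poly_Mapping.single m (scl G r x)"
  by (rule poly_mapping_eqI) (simp add: lookup_map_scl lookup_single when_def)

lemma fscale_single [simp]: "fscale r (Poly_Mapping.single m a) = Poly_Mapping.single m (r * a)"
  by (rule poly_mapping_eqI) (simp add: lookup_single when_def)

lemma map_scl_0 [simp]: "Poly_Mapping.map (scl G r) 0 = 0"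
  by (rule poly_mapping_eqI) (simp add: lookup_map_scl)

lemma av_scale_eq: "av_scale G r (f, p, \<kappa>, \<gamma>) = (Poly_Mapping.map (scl G r) f, fscale r p, r * \<kappa>, r * \<gamma>)"
  by (simp add: av_scale_def)

lemma map_scl_add: "Poly_Mapping.map (scl G r) (f + h) = Poly_Mapping.map (scl G r) f + Poly_Mapping.map (scl G r) h"
  by (rule poly_mapping_eqI) (simp add: lookup_map_scl lookup_add g.scale_right_distrib)

lemma map_scl_diff: "Poly_Mapping.map (scl G r) (f - h) = Poly_Mapping.map (scl G r) f - Poly_Mapping.map (scl G r) h"
  by (rule poly_mapping_eqI) (simp add: lookup_map_scl lookup_minus g.scale_right_diff_distrib)

lemma fscale_add: "fscale r (f + h) = fscale r f + fscale r h"
  by (rule free_vs.scale_right_distrib)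

sublocale av: vector_space "av_scale G"
proof
  fix a b :: complex and x y :: "'g affvir"
  obtain f p \<kappa> \<gamma> where x: "x = (f, p, \<kappa>, \<gamma>)" by (metis prod_cases4)
  obtain f' p' \<kappa>' \<gamma>' where y: "y = (f', p', \<kappa>', \<gamma>')" by (metis prod_cases4)
  show "av_scale G a (x + y) = av_scale G a x + av_scale G a y"
    by (simp add: x y av_scale_eq map_scl_add fscale_add algebra_simps)
  show "av_scale G (a + b) x = av_scale G a x + av_scale G b x"
    by (auto simp: x av_scale_eq algebra_simps lookup_map_scl lookup_add g.scale_left_distrib intro!: poly_mapping_eqI)
  show "av_scale G a (av_scale G b x) = av_scale G (a * b) x"
    by (auto simp: x av_scale_eq algebra_simps lookup_map_scl intro!: poly_mapping_eqI)
  show "av_scale G 1 x = x"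
    by (auto simp: x av_scale_eq lookup_map_scl intro!: poly_mapping_eqI)
qed

lemma av_bracket_add_left: "av_bracket G (x + y) z = av_bracket G x z + av_bracket G y z"
  by (cases x; cases y; cases z)
    (simp add: av_bracket_eq brk.sum_add_left der.sum_add_left der.sum_add_right vir.sum_add_left form.sum_add_left
      cocycle.sum_add_left algebra_simps)

lemma av_bracket_add_right: "av_bracket G x (y + z) = av_bracket G x y + av_bracket G x z"
  by (cases x; cases y; cases z)
    (simp add: av_bracket_eq brk.sum_add_right der.sum_add_left der.sum_add_right vir.sum_add_right form.sum_add_right
      cocycle.sum_add_right algebra_simps)

lemma biadditive_scale:
  "biadditive_sum \<beta>_brk (Poly_Mapping.map (scl G r) f) h = Poly_Mapping.map (scl G r) (biadditive_sum \<beta>_brk f h)"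
  "biadditive_sum \<beta>_brk f (Poly_Mapping.map (scl G r) h) = Poly_Mapping.map (scl G r) (biadditive_sum \<beta>_brk f h)"
  "biadditive_sum \<beta>_der (fscale r p) h = Poly_Mapping.map (scl G r) (biadditive_sum \<beta>_der p h)"
  "biadditive_sum \<beta>_der p (Poly_Mapping.map (scl G r) h) = Poly_Mapping.map (scl G r) (biadditive_sum \<beta>_der p h)"
  "biadditive_sum \<beta>_vir (fscale r p) q = fscale r (biadditive_sum \<beta>_vir p q)"
  "biadditive_sum \<beta>_vir p (fscale r q) = fscale r (biadditive_sum \<beta>_vir p q)"
  "biadditive_sum \<beta>_form (Poly_Mapping.map (scl G r) f) h = r * biadditive_sum \<beta>_form f h"
  "biadditive_sum \<beta>_form f (Poly_Mapping.map (scl G r) h) = r * biadditive_sum \<beta>_form f h"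
  "biadditive_sum \<beta>_cocycle (fscale r p) q = r * biadditive_sum \<beta>_cocycle p q"
  "biadditive_sum \<beta>_cocycle p (fscale r q) = r * biadditive_sum \<beta>_cocycle p q"
  by (rule brk.sum_scale brk.sum_scale_right der.sum_scale der.sum_scale_right vir.sum_scale vir.sum_scale_right
      form.sum_scale form.sum_scale_right cocycle.sum_scale cocycle.sum_scale_right;
    simp add: map_scl_add fscale_add lookup_map_scl keys_map_scl keys_fscale
      g.bracket_scale_left g.bracket_scale_right form_scale distrib_left
      \<beta>_brk_def \<beta>_der_def \<beta>_vir_def \<beta>_form_def \<beta>_cocycle_def mult_ac)+

lemma av_bracket_scale_left: "av_bracket G (av_scale G r x) y = av_scale G r (av_bracket G x y)"
  by (cases x; cases y) (simp add: av_bracket_eq av_scale_eq biadditive_scale map_scl_add map_scl_diff)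

lemma av_bracket_scale_right: "av_bracket G x (av_scale G r y) = av_scale G r (av_bracket G x y)"
  by (cases x; cases y) (simp add: av_bracket_eq av_scale_eq biadditive_scale map_scl_add map_scl_diff)

lemma av_bracket_homogeneous:
  "av_bracket G (Poly_Mapping.single m x, 0, \<kappa>, \<gamma>) (Poly_Mapping.single n y, 0, \<kappa>', \<gamma>') =
    (Poly_Mapping.single (m + n) (brk G x y), 0, if n = - m then of_int m * form G x y else 0, 0)"
  "av_bracket G (0, Poly_Mapping.single n a, \<kappa>, \<gamma>) (Poly_Mapping.single m x, 0, \<kappa>', \<gamma>') =
    (Poly_Mapping.single (m + n) (scl G (of_int m * a) x), 0, 0, 0)"
  "av_bracket G (Poly_Mapping.single m x, 0, \<kappa>, \<gamma>) (0, Poly_Mapping.single n a, \<kappa>', \<gamma>') =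
    (Poly_Mapping.single (m + n) (scl G (- of_int m * a) x), 0, 0, 0)"
  "av_bracket G (0, Poly_Mapping.single m a, \<kappa>, \<gamma>) (0, Poly_Mapping.single n b, \<kappa>', \<gamma>') =
    (0, Poly_Mapping.single (m + n) (of_int (n - m) * a * b), 0,
      if n = - m then of_int (m ^ 3 - m) / 12 * a * b else 0)"
  "av_bracket G (0, 0, \<kappa>, \<gamma>) z = 0" "av_bracket G z (0, 0, \<kappa>, \<gamma>) = 0"
  by (simp_all add: av_bracket_eq brk.sum_single der.sum_single vir.sum_single form.sum_single cocycle.sum_single
      \<beta>_brk_def \<beta>_der_def \<beta>_vir_def \<beta>_form_def \<beta>_cocycle_def single_uminus)
    (cases z; simp add: av_bracket_eq zero_prod_def)+

lemma av_bracket_0: "av_bracket G 0 z = 0" "av_bracket G z 0 = 0"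
  using av_bracket_homogeneous(5,6)[where \<kappa> = 0 and \<gamma> = 0 and z = z] by (simp_all add: zero_prod_def)

abbreviation generators :: "'g affvir set" where
  "generators \<equiv> {(Poly_Mapping.single m x, 0, 0, 0) | m x. True} \<union>
     {(0, Poly_Mapping.single m a, 0, 0) | m a. True} \<union> {(0, 0, \<kappa>, \<gamma>) | \<kappa> \<gamma>. True}"

lemma span_generators: "av.span generators = UNIV"
proof -
  have f: "(f, 0, 0, 0) \<in> av.span generators" for f
  proof -
    have "(\<Sum>m\<in>A. (Poly_Mapping.single m (Poly_Mapping.lookup f m), 0, 0, 0) :: 'g affvir) =
        ((\<Sum>m\<in>A. Poly_Mapping.single m (Poly_Mapping.lookup f m)), 0, 0, 0)" for A
      by (induction A rule: infinite_finite_induct) (auto simp: zero_prod_def)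
    then have "((f, 0, 0, 0) :: 'g affvir) = (\<Sum>m\<in>Poly_Mapping.keys f. (Poly_Mapping.single m (Poly_Mapping.lookup f m), 0, 0, 0))"
      by (simp add: sum_single_lookup)
    also have "\<dots> \<in> av.span generators"
      by (intro av.span_sum av.span_base) blast
    finally show ?thesis .
  qed
  have p: "(0, p, 0, 0) \<in> av.span generators" for p
  proof -
    have "(\<Sum>m\<in>A. (0, Poly_Mapping.single m (Poly_Mapping.lookup p m), 0, 0) :: 'g affvir) =
        (0, (\<Sum>m\<in>A. Poly_Mapping.single m (Poly_Mapping.lookup p m)), 0, 0)" for A
      by (induction A rule: infinite_finite_induct) (auto simp: zero_prod_def)
    then have "((0, p, 0, 0) :: 'g affvir) = (\<Sum>m\<in>Poly_Mapping.keys p. (0, Poly_Mapping.single m (Poly_Mapping.lookup p m), 0, 0))"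
      by (simp add: sum_single_lookup)
    also have "\<dots> \<in> av.span generators"
      by (intro av.span_sum av.span_base) blast
    finally show ?thesis .
  qed
  have "(f, p, \<kappa>, \<gamma>) \<in> av.span generators" for f p \<kappa> \<gamma>
  proof -
    have "(0, 0, \<kappa>, \<gamma>) \<in> av.span generators" by (intro av.span_base) auto
    then have "(f, 0, 0, 0) + (0, p, 0, 0) + (0, 0, \<kappa>, \<gamma>) \<in> av.span generators"
      by (intro av.span_add f p)
    then show ?thesis by simp
  qed
  then show ?thesis by auto
qed

lemma generator_cases:
  assumes "x \<in> generators"
  obtains m y where "x = (Poly_Mapping.single m y, 0, 0, 0)" | m a where "x = (0, Poly_Mapping.single m a, 0, 0)"
    | \<kappa> \<gamma> where "x = (0, 0, \<kappa>, \<gamma>)"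
  using assms by blast

lemma av_antisym: "av_bracket G x y = - av_bracket G y x"
proof -
  have gen: "av_bracket G x y = - av_bracket G y x" if "x \<in> generators" "y \<in> generators" for x y
    using that(1)
  proof (cases rule: generator_cases)
    case x: (1 m x)
    from that(2) show ?thesis
    proof (cases rule: generator_cases)
      case (1 n y)
      then show ?thesis using brk_antisym[of "x" y] form_sym[of x y] x
        by (auto simp: av_bracket_homogeneous add.commute single_uminus)
    qed (auto simp: x av_bracket_homogeneous zero_prod_def single_uminus[symmetric])
  next
    case x: (2 m a)
    from that(2) show ?thesis
    proof (cases rule: generator_cases)
      case (2 n b)
      then show ?thesis using x
        by (auto simp: av_bracket_homogeneous add.commute single_uminus[symmetric] field_simps)
    qed (auto simp: x av_bracket_homogeneous zero_prod_def single_uminus[symmetric])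
  qed (simp add: av_bracket_homogeneous)
  have gen': "av_bracket G x y = - av_bracket G y x" if y: "y \<in> generators" for x y
  proof -
    have "x \<in> av.span generators" by (simp only: span_generators UNIV_I)
    then show ?thesis
    proof (induction rule: av.span_induct_alt)
      case base
      show ?case using av_bracket_scale_left[of 0 0 y] av_bracket_scale_right[of y 0 0] by simp
    next
      case (step c x z)
      then show ?case using gen[OF step(1) y]
        by (simp add: av_bracket_add_left av_bracket_add_right av_bracket_scale_left av_bracket_scale_right)
    qed
  qed
  have "y \<in> av.span generators" by (simp only: span_generators UNIV_I)
  then show ?thesis
  proof (induction rule: av.span_induct_alt)
    case base
    show ?case using av_bracket_scale_left[of 0 0 x] av_bracket_scale_right[of x 0 0] by simp
  next
    case (step c y z)
    then show ?case using gen'[OF step(1), of x]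
      by (simp add: av_bracket_add_left av_bracket_add_right av_bracket_scale_left av_bracket_scale_right)
  qed
qed

lemma av_self: "av_bracket G x x = 0"
proof -
  have "av_bracket G x x + av_bracket G x x = 0" using av_antisym[of x x] by (metis add.right_inverse)
  then have "av_scale G 2 (av_bracket G x x) = 0"
    using av.scale_left_distrib[of 1 1 "av_bracket G x x"] by simp
  then show ?thesis by simp
qed

definition jacobiator :: "'g affvir \<Rightarrow> 'g affvir \<Rightarrow> 'g affvir \<Rightarrow> 'g affvir" where
  "jacobiator x y z = av_bracket G x (av_bracket G y z) + av_bracket G y (av_bracket G z x) + av_bracket G z (av_bracket G x y)"

lemma jacobiator_cycle: "jacobiator x y z = jacobiator y z x"
  by (simp add: jacobiator_def add_ac)

lemma jacobiator_linear:
  "jacobiator (x + x') y z = jacobiator x y z + jacobiator x' y z"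
  "jacobiator (av_scale G r x) y z = av_scale G r (jacobiator x y z)"
  by (simp_all add: jacobiator_def av_bracket_add_left av_bracket_add_right av_bracket_scale_left
      av_bracket_scale_right av.scale_right_distrib add_ac)

lemma single_add3:
  "Poly_Mapping.single k a + Poly_Mapping.single k b + Poly_Mapping.single k c = Poly_Mapping.single k (a + b + c)"
  by (simp add: single_add)

text \<open>The central terms cancel by the invariance of the form.\<close>

lemma jacobiator_ccc:
  "jacobiator (Poly_Mapping.single m x, 0, 0, 0) (Poly_Mapping.single n y, 0, 0, 0) (Poly_Mapping.single l z, 0, 0, 0) = 0"
proof -
  let ?k = "m + n + l" and ?F = "form G x (brk G y z)"
  have keys: "m + (n + l) = ?k" "n + (l + m) = ?k" "l + (m + n) = ?k" by simp_all
  have cond: "n + l = - m \<longleftrightarrow> ?k = 0" "l + m = - n \<longleftrightarrow> ?k = 0" "m + n = - l \<longleftrightarrow> ?k = 0" by auto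
  have f: "form G y (brk G z x) = ?F" "form G z (brk G x y) = ?F"
    by (metis form_sym form_invariant)+
  have "(if ?k = 0 then of_int m * ?F else 0) + (if ?k = 0 then of_int n * ?F else 0) + (if ?k = 0 then of_int l * ?F else 0) = 0"
  proof (cases "?k = 0")
    case True
    have "of_int m * ?F + of_int n * ?F + of_int l * ?F = of_int ?k * ?F" by (simp add: algebra_simps)
    then show ?thesis unfolding True by simp
  qed simp
  then show ?thesis
    unfolding jacobiator_def av_bracket_homogeneous keys cond f
    by (simp only: add_Pair single_add3 g.jacobi single_zero add_0_left add_0_right zero_prod_def)
qed

lemma jacobiator_ccv:
  "jacobiator (Poly_Mapping.single m x, 0, 0, 0) (Poly_Mapping.single n y, 0, 0, 0) (0, Poly_Mapping.single l a, 0, 0) = 0"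
proof -
  let ?k = "m + n + l"
  have keys: "m + (n + l) = ?k" "n + (m + l) = ?k" by simp_all
  have cond: "n + l = - m \<longleftrightarrow> ?k = 0" "m + l = - n \<longleftrightarrow> ?k = 0" by auto
  have b: "brk G y x = - brk G x y" by (rule brk_antisym)
  have 1: "brk G x (scl G (- of_int n * a) y) + brk G y (scl G (of_int m * a) x) + scl G (of_int (m + n) * a) (brk G x y)
      = scl G (- of_int n * a + - (of_int m * a) + of_int (m + n) * a) (brk G x y)"
    by (simp only: g.bracket_scale_right b g.scale_left_distrib g.scale_minus_left g.scale_minus_right)
  also have "- of_int n * a + - (of_int m * a) + of_int (m + n) * a = 0" by (simp add: algebra_simps)
  finally have 1: "brk G x (scl G (- of_int n * a) y) + brk G y (scl G (of_int m * a) x) + scl G (of_int (m + n) * a) (brk G x y) = 0"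
    by simp
  have "(if ?k = 0 then of_int m * form G x (scl G (- of_int n * a) y) else 0) +
      (if ?k = 0 then of_int n * form G y (scl G (of_int m * a) x) else 0) + (0::complex) = 0"
    by (simp only: form_scale form_sym[of y x]) (simp add: algebra_simps)
  then show ?thesis
    unfolding jacobiator_def av_bracket_homogeneous keys cond
    by (simp only: add_Pair single_add3 1 single_zero add_0_left add_0_right zero_prod_def)
qed

lemma jacobiator_cvv:
  "jacobiator (Poly_Mapping.single m x, 0, 0, 0) (0, Poly_Mapping.single p a, 0, 0) (0, Poly_Mapping.single q b, 0, 0) = 0"
proof -
  let ?k = "m + (p + q)"
  have keys: "m + q + p = ?k" "m + p + q = ?k" by simp_all
  have 1: "scl G (- of_int m * (of_int (q - p) * a * b)) x + scl G (of_int (m + q) * a) (scl G (of_int m * b) x) +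
      scl G (of_int (m + p) * b) (scl G (- of_int m * a) x) =
      scl G (- of_int m * (of_int (q - p) * a * b) + of_int (m + q) * a * (of_int m * b) + of_int (m + p) * b * (- of_int m * a)) x"
    by (simp only: g.scale_scale g.scale_left_distrib)
  also have "- of_int m * (of_int (q - p) * a * b) + of_int (m + q) * a * (of_int m * b) + of_int (m + p) * b * (- of_int m * a) = 0"
    by (simp add: algebra_simps)
  finally have 1: "scl G (- of_int m * (of_int (q - p) * a * b)) x + scl G (of_int (m + q) * a) (scl G (of_int m * b) x) +
      scl G (of_int (m + p) * b) (scl G (- of_int m * a) x) = 0" by simp
  show ?thesis
    unfolding jacobiator_def av_bracket_homogeneous keys
    by (simp only: add_Pair single_add3 1 single_zero add_0_left add_0_right zero_prod_def)
qed

lemma jacobiator_vvv: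
  "jacobiator (0, Poly_Mapping.single m a, 0, 0) (0, Poly_Mapping.single n b, 0, 0) (0, Poly_Mapping.single l c, 0, 0) = 0"
proof -
  let ?k = "m + n + l"
  have keys: "m + (n + l) = ?k" "n + (l + m) = ?k" "l + (m + n) = ?k" by simp_all
  have cond: "n + l = - m \<longleftrightarrow> ?k = 0" "l + m = - n \<longleftrightarrow> ?k = 0" "m + n = - l \<longleftrightarrow> ?k = 0" by auto
  have 1: "of_int (n + l - m) * a * (of_int (l - n) * b * c) + of_int (l + m - n) * b * (of_int (m - l) * c * a) +
      of_int (m + n - l) * c * (of_int (n - m) * a * b) = (0::complex)"
    by (simp add: algebra_simps)
  have "(if ?k = 0 then of_int (m ^ 3 - m) / 12 * a * (of_int (l - n) * b * c) else 0) +
      (if ?k = 0 then of_int (n ^ 3 - n) / 12 * b * (of_int (m - l) * c * a) else 0) +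
      (if ?k = 0 then of_int (l ^ 3 - l) / 12 * c * (of_int (n - m) * a * b) else 0) = 0"
  proof (cases "?k = 0")
    case True
    then have l: "l = - m - n" by simp
    show ?thesis unfolding l by (simp add: field_simps power3_eq_cube)
  qed simp
  then show ?thesis
    unfolding jacobiator_def av_bracket_homogeneous keys cond
    by (simp only: add_Pair single_add3 1 single_zero add_0_left add_0_right zero_prod_def)
qed

lemma jacobiator_generators:
  assumes "x \<in> generators" "y \<in> generators" "z \<in> generators"
  shows "jacobiator x y z = 0"
proof -
  have central: "jacobiator (0, 0, \<kappa>, \<gamma>) y z = 0" for \<kappa> \<gamma> y z
    by (simp add: jacobiator_def av_bracket_homogeneous av_bracket_0)
  have central': "jacobiator y (0, 0, \<kappa>, \<gamma>) z = 0" "jacobiator y z (0, 0, \<kappa>, \<gamma>) = 0" for \<kappa> \<gamma> y z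
    by (metis central jacobiator_cycle)+
  note [simp] = central central' jacobiator_ccc jacobiator_ccv jacobiator_cvv jacobiator_vvv
  have [simp]: "jacobiator (0, Poly_Mapping.single l a, 0, 0) (Poly_Mapping.single m x, 0, 0, 0) (Poly_Mapping.single n y, 0, 0, 0) = 0"
    "jacobiator (Poly_Mapping.single n y, 0, 0, 0) (0, Poly_Mapping.single l a, 0, 0) (Poly_Mapping.single m x, 0, 0, 0) = 0"
    "jacobiator (0, Poly_Mapping.single q b, 0, 0) (Poly_Mapping.single m x, 0, 0, 0) (0, Poly_Mapping.single l a, 0, 0) = 0"
    "jacobiator (0, Poly_Mapping.single q b, 0, 0) (0, Poly_Mapping.single l a, 0, 0) (Poly_Mapping.single m x, 0, 0, 0) = 0"
    for l q m n a b x y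
    by (metis jacobiator_ccv jacobiator_cvv jacobiator_cycle)+
  show ?thesis
    by (rule generator_cases[OF assms(1)]; rule generator_cases[OF assms(2)]; rule generator_cases[OF assms(3)]) simp_all
qed

text \<open>By linearity in each argument, which follows from linearity in the first one and cyclic symmetry,
  homogeneous elements suffice.\<close>

lemma jacobiator_zero: "jacobiator x y z = 0"
proof -
  have lin: "jacobiator x y z = 0" if "\<And>x. x \<in> generators \<Longrightarrow> jacobiator x y z = 0" for x y z
  proof -
    have "x \<in> av.span generators" by (simp only: span_generators UNIV_I)
    then show ?thesis
    proof (induction rule: av.span_induct_alt)
      case base
      show ?case using jacobiator_linear(2)[of 0 0 y z] by simp
    qed (simp add: jacobiator_linear that)
  qed
  show ?thesis
  proof (rule lin)
    fix x assume x: "x \<in> generators"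
    have "jacobiator y z x = 0"
    proof (rule lin)
      fix y assume y: "y \<in> generators"
      have "jacobiator z x y = 0"
        by (rule lin) (rule jacobiator_generators[OF _ x y])
      then show "jacobiator y z x = 0" by (simp only: jacobiator_cycle[of y z x])
    qed
    then show "jacobiator x y z = 0" by (simp only: jacobiator_cycle[of x y z])
  qed
qed

sublocale av: lie_algebra "av_scale G" "av_bracket G"
  by unfold_locales (simp_all add: av_bracket_add_left av_bracket_add_right av_bracket_scale_left
      av_bracket_scale_right av_self jacobiator_zero[unfolded jacobiator_def])

section \<open>The principal gradation\<close>

text \<open>On \<open>x(m)\<close> with \<open>x\<close> of height \<open>j\<close>, the element \<open>h0 + N d\<^sub>0\<close> has the adjoint eigenvalue \<open>j + N m\<close>. If \<open>N\<close>
  exceeds all heights, its sign is that of \<open>m\<close>, or that of \<open>j\<close> when \<open>m = 0\<close>. For this grading the letters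
  of positive degree lie in \<open>\<LL>(\<gg>)\<^sub>+\<close> and those of degree 0 in \<open>\<hh> + \<complex>d\<^sub>0 + \<complex>k + \<complex>c\<close>.\<close>

definition level_weight :: int where
  "level_weight = 1 + Max (insert 0 ((\<lambda>r. \<bar>height r\<bar>) ` R))"

lemma level_weight: "r \<in> R \<Longrightarrow> \<bar>height r\<bar> < level_weight" "level_weight > 0"
proof -
  have fin: "finite (insert 0 ((\<lambda>r. \<bar>height r\<bar>) ` R))" using R(1) by simp
  show "r \<in> R \<Longrightarrow> \<bar>height r\<bar> < level_weight"
    using Max_ge[OF fin, of "\<bar>height r\<bar>"] by (auto simp: level_weight_def)
  show "level_weight > 0" using Max_ge[OF fin, of 0] by (simp add: level_weight_def)
qed

definition av_grading :: "'g affvir" where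
  "av_grading = (Poly_Mapping.single 0 h0, Poly_Mapping.single 0 (of_int level_weight), 0, 0)"

definition av_letters :: "'g affvir set" where
  "av_letters = {cur m r | m r. r \<in> R} \<union> range vir \<union> {cen_k, cen_c}"

definition av_degree :: "'g affvir \<Rightarrow> int" where
  "av_degree a = (SOME j. av_bracket G av_grading a = av_scale G (of_int j) a)"

lemma av_grading_eigen:
  "r \<in> R \<Longrightarrow> av_bracket G av_grading (cur m r) = av_scale G (of_int (height r + level_weight * m)) (cur m r)"
  "av_bracket G av_grading (vir m) = av_scale G (of_int (level_weight * m)) (vir m)"
  "av_bracket G av_grading cen_k = av_scale G (of_int 0) cen_k"
  "av_bracket G av_grading cen_c = av_scale G (of_int 0) cen_c"
proof -
  have split: "av_grading = (Poly_Mapping.single 0 h0, 0, 0, 0) + (0, Poly_Mapping.single 0 (of_int level_weight), 0, 0)"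
    by (simp add: av_grading_def)
  show "av_bracket G av_grading (cur m r) = av_scale G (of_int (height r + level_weight * m)) (cur m r)" if "r \<in> R"
    unfolding split av_bracket_add_left cur_def av_bracket_homogeneous av_scale_eq using height(1)[OF that]
    by (simp add: single_add[symmetric] mult.commute flip: g.scale_left_distrib)
  show "av_bracket G av_grading (vir m) = av_scale G (of_int (level_weight * m)) (vir m)"
    unfolding split av_bracket_add_left vir_def av_bracket_homogeneous av_scale_eq
    by (simp add: mult.commute)
  show "av_bracket G av_grading cen_k = av_scale G (of_int 0) cen_k"
    "av_bracket G av_grading cen_c = av_scale G (of_int 0) cen_c"
    unfolding cen_k_def cen_c_def av_bracket_homogeneous by simp_all
qed

lemma av_degree_eq:
  assumes "a \<noteq> 0" "av_bracket G av_grading a = av_scale G (of_int j) a"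
  shows "av_degree a = j"
  unfolding av_degree_def
proof (rule some_equality)
  fix i assume "av_bracket G av_grading a = av_scale G (of_int i) a"
  then have "av_scale G (of_int i - of_int j) a = 0" using assms(2) by (metis av.scale_left_diff_distrib diff_self)
  then have "of_int i - of_int j = (0::complex)" using assms(1) unfolding av.scale_eq_0_iff by blast
  then show "i = j" by simp
qed (rule assms(2))

lemma cur_nonzero: "r \<noteq> 0 \<Longrightarrow> cur m r \<noteq> 0"
  and vir_nonzero: "vir m \<noteq> 0" and cen_nonzero: "cen_k \<noteq> 0" "cen_c \<noteq> 0"
  by (auto simp: cur_def vir_def cen_k_def cen_c_def zero_prod_def) (metis lookup_single_eq lookup_zero zero_neq_one)+

lemma av_degree:
  "r \<in> R \<Longrightarrow> av_degree (cur m r) = height r + level_weight * m"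
  "av_degree (vir m) = level_weight * m" "av_degree cen_k = 0" "av_degree cen_c = 0"
proof -
  show "av_degree (cur m r) = height r + level_weight * m" if "r \<in> R"
    using that R(4) by (intro av_degree_eq cur_nonzero av_grading_eigen) auto
qed (intro av_degree_eq vir_nonzero cen_nonzero av_grading_eigen)+

lemma av_letters_cases:
  assumes "a \<in> av_letters"
  obtains m r where "r \<in> R" "a = cur m r" | m where "a = vir m" | "a = cen_k" | "a = cen_c"
  using assms unfolding av_letters_def by blast

lemma level_weight_sign:
  assumes "r \<in> R"
  shows "height r + level_weight * m > 0 \<longleftrightarrow> m > 0 \<or> m = 0 \<and> height r > 0"
    "height r + level_weight * m = 0 \<longleftrightarrow> m = 0 \<and> height r = 0"
proof -
  have w: "\<bar>height r\<bar> < level_weight" using level_weight(1)[OF assms] .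
  have "level_weight * m \<ge> level_weight * 1" if "m > 0" using that level_weight(2) by (intro mult_left_mono) auto
  moreover have "level_weight * m \<le> level_weight * (-1)" if "m < 0" using that level_weight(2) by (intro mult_left_mono) auto
  ultimately show "height r + level_weight * m > 0 \<longleftrightarrow> m > 0 \<or> m = 0 \<and> height r > 0"
    "height r + level_weight * m = 0 \<longleftrightarrow> m = 0 \<and> height r = 0"
    using w by (cases m "0::int" rule: linorder_cases; auto)+
qed

lemma av_positive_letter:
  assumes "a \<in> av_letters" "av_degree a > 0"
  shows "a \<in> av_pos G"
  using assms(1)
proof (cases rule: av_letters_cases)
  case (1 m r)
  then have "m > 0 \<or> m = 0 \<and> r \<in> nil_pos G"
    using assms(2) level_weight_sign(1)[OF 1(1), of m] height(3)[OF 1(1)] by (auto simp: av_degree)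
  then show ?thesis using nil_pos_0 1(2) by (auto simp: av_pos_def cur_def lookup_single when_def)
next
  case (2 m)
  then have "m > 0" using assms(2) level_weight(2) by (simp add: av_degree zero_less_mult_iff)
  then show ?thesis using 2 nil_pos_0 by (auto simp: av_pos_def vir_def)
qed (use assms(2) in \<open>auto simp: av_degree\<close>)

lemma av_zero_letter:
  assumes "a \<in> av_letters" "av_degree a = 0"
  obtains r where "r \<in> csa G" "a = cur 0 r" | "a = vir 0" | "a = cen_k" | "a = cen_c"
  using assms(1)
proof (cases rule: av_letters_cases)
  case (1 m r)
  then show ?thesis using assms(2) level_weight_sign(2)[OF 1(1), of m] height(2)[OF 1(1)] that
    by (auto simp: av_degree)
next
  case (2 m)
  then have "m = 0" using assms(2) level_weight(2) by (simp add: av_degree)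
  then show ?thesis using 2 that by auto
qed (use that in auto)

lemma graded_av: "graded_lie_algebra (av_scale G) (av_bracket G) av_grading av_letters av_degree"
proof
  have c: "cur m x \<in> av.span av_letters" for m x
  proof -
    have "x \<in> g.span R" by (simp add: R(2))
    then show ?thesis
    proof (induction rule: g.span_induct_alt)
      case base
      show ?case using av.span_zero[of av_letters] by (simp add: cur_def zero_prod_def)
    next
      case (step s r y)
      have "cur m (scl G s r + y) = av_scale G s (cur m r) + cur m y"
        by (simp add: cur_def av_scale_eq single_add)
      moreover have "cur m r \<in> av.span av_letters" using step by (intro av.span_base) (auto simp: av_letters_def)
      ultimately show ?case using step by (simp add: av.span_add av.span_scale)
    qed
  qed
  have base: "vir m \<in> av.span av_letters" "cen_k \<in> av.span av_letters" "cen_c \<in> av.span av_letters" for m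
    by (intro av.span_base; simp add: av_letters_def)+
  have "x \<in> av.span av_letters" if "x \<in> generators" for x
    using that
  proof (cases rule: generator_cases)
    case (1 m y)
    then show ?thesis using c[of m y] by (simp add: cur_def)
  next
    case (2 m a)
    have "x = av_scale G a (vir m)" by (simp add: 2 vir_def av_scale_eq)
    then show ?thesis using base by (simp add: av.span_scale)
  next
    case (3 \<kappa> \<gamma>)
    have "x = av_scale G \<kappa> cen_k + av_scale G \<gamma> cen_c" by (simp add: 3 cen_k_def cen_c_def av_scale_eq)
    then show ?thesis using base by (simp add: av.span_scale av.span_add)
  qed
  then have "generators \<subseteq> av.span av_letters" by (rule subsetI)
  then have "av.span generators \<subseteq> av.span av_letters" by (rule av.span_minimal[OF _ av.subspace_span])
  then show "av.span av_letters = UNIV" using span_generators by auto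
next
  fix a assume "a \<in> av_letters"
  then show "av_bracket G av_grading a = av_scale G (of_int (av_degree a)) a"
    by (cases rule: av_letters_cases) (simp_all only: av_degree av_grading_eigen)
next
  fix h a assume h: "h \<in> av_letters" "av_degree h = 0" and a: "a \<in> av_letters" "av_degree a > 0"
  from h show "\<exists>r. av_bracket G h a = av_scale G r a"
  proof (cases rule: av_zero_letter)
    case h: (1 h')
    from a(1) show ?thesis
    proof (cases rule: av_letters_cases)
      case (1 m r)
      obtain s where s: "brk G h' r = scl G s r" using height(4)[OF 1(1) h(1)] by blast
      show ?thesis
        by (rule exI[of _ s]) (simp add: h 1 cur_def av_bracket_homogeneous av_scale_eq s)
    next
      case (2 m)
      show ?thesis by (rule exI[of _ 0]) (simp add: h 2 cur_def vir_def av_bracket_homogeneous zero_prod_def)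
    qed (rule exI[of _ 0], simp add: av_bracket_homogeneous cen_k_def cen_c_def)+
  next
    case h: 2
    from a(1) show ?thesis
    proof (cases rule: av_letters_cases)
      case (1 m r)
      show ?thesis
        by (rule exI[of _ "of_int m"]) (simp add: h 1 cur_def vir_def av_bracket_homogeneous av_scale_eq del: single_one)
    next
      case (2 m)
      show ?thesis by (rule exI[of _ "of_int m"]) (simp add: h 2 cur_def vir_def av_bracket_homogeneous av_scale_eq del: single_one)
    qed (rule exI[of _ 0], simp add: av_bracket_homogeneous cen_k_def cen_c_def)+
  qed (rule exI[of _ 0], simp add: av_bracket_homogeneous cen_k_def cen_c_def)+
qed

lemma graded_g: "graded_lie_algebra (scl G) (brk G) h0 R height"
  by unfold_locales (use R height in auto)

section \<open>The Borel character\<close>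

definition csa_part :: "'g \<Rightarrow> 'g" where
  "csa_part x = (THE h. h \<in> csa G \<and> (\<exists>z\<in>nil_pos G. x = h + z))"

lemma csa_part: "h \<in> csa G \<Longrightarrow> z \<in> nil_pos G \<Longrightarrow> csa_part (h + z) = h"
  unfolding csa_part_def using csa_nil_pos_unique(1) by (intro the_equality) blast+

definition borel :: "'g affvir set" where
  "borel = {(f, p, \<kappa>, \<gamma>) | f p \<kappa> \<gamma>. (\<exists>h\<in>csa G. \<exists>z\<in>nil_pos G. Poly_Mapping.lookup f 0 = h + z) \<and>
     Poly_Mapping.keys f \<subseteq> {0..} \<and> Poly_Mapping.keys p \<subseteq> {0..}}"

definition borel_char :: "('g \<Rightarrow> complex) \<Rightarrow> complex \<Rightarrow> complex \<Rightarrow> complex \<Rightarrow> 'g affvir \<Rightarrow> complex" where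
  "borel_char lam l k c = (\<lambda>(f, p, \<kappa>, \<gamma>).
     lam (csa_part (Poly_Mapping.lookup f 0)) + Poly_Mapping.lookup p 0 * l + \<kappa> * k + \<gamma> * c)"

lemma keys_plus: "Poly_Mapping.keys f \<subseteq> A \<Longrightarrow> Poly_Mapping.keys g \<subseteq> A \<Longrightarrow> Poly_Mapping.keys (f + g) \<subseteq> A"
  using Poly_Mapping.keys_add[of f g] by auto

lemma keys_minus: "Poly_Mapping.keys f \<subseteq> A \<Longrightarrow> Poly_Mapping.keys g \<subseteq> A \<Longrightarrow> Poly_Mapping.keys (f - g) \<subseteq> A"
  for f g :: "'x \<Rightarrow>\<^sub>0 'y::ab_group_add"
  using keys_plus[of f A "- g"] by simp

text \<open>The relations that define the Verma module are the graph of a linear functional on a subspace,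
  the form required by \<open>induced_rep_nonzero\<close>.\<close>

lemma borel_character_graph: "av_borel_character G lam l k c = {(b, borel_char lam l k c b) | b. b \<in> borel}"
proof (intro Set.set_eqI iffI)
  fix t assume "t \<in> av_borel_character G lam l k c"
  then obtain h \<delta> \<kappa> \<gamma> z where t: "t = (cur 0 h + av_scale G \<delta> (vir 0) + av_scale G \<kappa> cen_k + av_scale G \<gamma> cen_c + z,
       lam h + \<delta> * l + \<kappa> * k + \<gamma> * c)" "h \<in> csa G" "z \<in> av_pos G"
    unfolding av_borel_character_def mem_Collect_eq by (elim exE conjE)
  obtain f p where z: "z = (f, p, 0, 0)" "Poly_Mapping.lookup f 0 \<in> nil_pos G" "Poly_Mapping.keys f \<subseteq> {0..}" "Poly_Mapping.keys p \<subseteq> {1..}"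
    using t(3) unfolding av_pos_def mem_Collect_eq by (elim exE conjE)
  have b: "cur 0 h + av_scale G \<delta> (vir 0) + av_scale G \<kappa> cen_k + av_scale G \<gamma> cen_c + z =
      (Poly_Mapping.single 0 h + f, Poly_Mapping.single 0 \<delta> + p, \<kappa>, \<gamma>)"
    by (simp add: z cur_def vir_def cen_k_def cen_c_def av_scale_eq del: single_one)
  have p0: "Poly_Mapping.lookup p 0 = 0" using z(4) by (auto simp: in_keys_iff)
  have "Poly_Mapping.keys (Poly_Mapping.single (0::int) h + f) \<subseteq> {0..}"
    by (rule keys_plus) (use z in auto)
  moreover have "Poly_Mapping.keys (Poly_Mapping.single (0::int) \<delta> + p) \<subseteq> {0..}"
    by (rule keys_plus) (use z(4) in auto)
  ultimately have "(Poly_Mapping.single 0 h + f, Poly_Mapping.single 0 \<delta> + p, \<kappa>, \<gamma>) \<in> borel"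
    unfolding borel_def using t(2) z(2) by (auto simp: lookup_add)
  moreover have "borel_char lam l k c (Poly_Mapping.single 0 h + f, Poly_Mapping.single 0 \<delta> + p, \<kappa>, \<gamma>) =
      lam h + \<delta> * l + \<kappa> * k + \<gamma> * c"
    using t(2) z(2) p0 by (simp add: borel_char_def lookup_add csa_part)
  ultimately show "t \<in> {(b, borel_char lam l k c b) | b. b \<in> borel}" using t(1) b by auto
next
  fix t assume "t \<in> {(b, borel_char lam l k c b) | b. b \<in> borel}"
  then obtain f p \<kappa> \<gamma> h z where t: "t = ((f, p, \<kappa>, \<gamma>), borel_char lam l k c (f, p, \<kappa>, \<gamma>))"
    and h: "h \<in> csa G" "z \<in> nil_pos G" "Poly_Mapping.lookup f 0 = h + z"
    and keys: "Poly_Mapping.keys f \<subseteq> {0..}" "Poly_Mapping.keys p \<subseteq> {0..}"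
    unfolding borel_def by auto
  let ?\<delta> = "Poly_Mapping.lookup p 0"
  let ?z = "(f - Poly_Mapping.single 0 h, p - Poly_Mapping.single 0 ?\<delta>, 0, 0) :: 'g affvir"
  have "Poly_Mapping.keys (f - Poly_Mapping.single 0 h) \<subseteq> {0..}"
    by (rule keys_minus) (use keys in auto)
  moreover have "Poly_Mapping.keys (p - Poly_Mapping.single 0 ?\<delta>) \<subseteq> {1..}"
  proof
    fix m assume "m \<in> Poly_Mapping.keys (p - Poly_Mapping.single 0 ?\<delta>)"
    then have "m \<noteq> 0" "m \<in> Poly_Mapping.keys p"
      by (auto simp: in_keys_iff lookup_minus lookup_single when_def split: if_splits)
    then show "m \<in> {1..}" using keys(2) by force
  qed
  ultimately have z: "?z \<in> av_pos G" unfolding av_pos_def using h by (auto simp: lookup_minus)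
  have "(f, p, \<kappa>, \<gamma>) = cur 0 h + av_scale G ?\<delta> (vir 0) + av_scale G \<kappa> cen_k + av_scale G \<gamma> cen_c + ?z"
    by (simp add: cur_def vir_def cen_k_def cen_c_def av_scale_eq del: single_one)
  moreover have "borel_char lam l k c (f, p, \<kappa>, \<gamma>) = lam h + ?\<delta> * l + \<kappa> * k + \<gamma> * c"
    using h by (simp add: borel_char_def csa_part)
  ultimately show "t \<in> av_borel_character G lam l k c"
    unfolding t av_borel_character_def mem_Collect_eq
    by (intro exI conjI) (rule arg_cong2[where f = Pair], assumption+, rule h(1), rule z)
qed

text \<open>Without negative modes, only the zero modes of the factors contribute to the zero mode of a
  product.\<close>

lemma lookup_graded_sum:
  fixes v :: "int \<Rightarrow> int \<Rightarrow> 'a::ab_group_add \<Rightarrow> 'b::ab_group_add \<Rightarrow> 'c::ab_group_add"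
  assumes "biadditive \<beta>" and \<beta>: "\<And>m n x y. \<beta> m n x y = Poly_Mapping.single (m + n) (v m n x y)"
    and f: "Poly_Mapping.keys f \<subseteq> {0..}" and g: "Poly_Mapping.keys g \<subseteq> {0..}"
  shows "Poly_Mapping.lookup (biadditive_sum \<beta> f g) 0 = v 0 0 (Poly_Mapping.lookup f 0) (Poly_Mapping.lookup g 0)"
    "Poly_Mapping.keys (biadditive_sum \<beta> f g) \<subseteq> {0..}"
proof -
  interpret biadditive \<beta> by (rule assms(1))
  let ?A = "insert 0 (Poly_Mapping.keys f)" and ?B = "insert 0 (Poly_Mapping.keys g)"
  have s: "biadditive_sum \<beta> f g = (\<Sum>m\<in>?A. \<Sum>n\<in>?B. \<beta> m n (Poly_Mapping.lookup f m) (Poly_Mapping.lookup g n))"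
    by (rule superset) auto
  have "Poly_Mapping.lookup (biadditive_sum \<beta> f g) 0 =
      (\<Sum>m\<in>?A. \<Sum>n\<in>?B. if m = 0 then (if n = 0 then v 0 0 (Poly_Mapping.lookup f 0) (Poly_Mapping.lookup g 0) else 0) else 0)"
    unfolding s lookup_sum \<beta> lookup_single when_def
    by (intro sum.cong refl) (use f g in \<open>auto dest!: subsetD\<close>)
  also have "\<dots> = (\<Sum>m\<in>?A. if m = 0 then (\<Sum>n\<in>?B. if n = 0 then v 0 0 (Poly_Mapping.lookup f 0) (Poly_Mapping.lookup g 0) else 0) else 0)"
    by (intro sum.cong refl) auto
  also have "\<dots> = v 0 0 (Poly_Mapping.lookup f 0) (Poly_Mapping.lookup g 0)"
    by (simp only: sum.delta finite_insert finite_keys insertI1 if_True)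
  finally show "Poly_Mapping.lookup (biadditive_sum \<beta> f g) 0 = v 0 0 (Poly_Mapping.lookup f 0) (Poly_Mapping.lookup g 0)" .
  show "Poly_Mapping.keys (biadditive_sum \<beta> f g) \<subseteq> {0..}"
  proof
    fix j assume "j \<in> Poly_Mapping.keys (biadditive_sum \<beta> f g)"
    then have "Poly_Mapping.lookup (biadditive_sum \<beta> f g) j \<noteq> 0" by (simp add: in_keys_iff)
    then obtain m n where "m \<in> ?A" "n \<in> ?B" "Poly_Mapping.lookup (\<beta> m n (Poly_Mapping.lookup f m) (Poly_Mapping.lookup g n)) j \<noteq> 0"
      unfolding s lookup_sum by (meson sum.not_neutral_contains_not_neutral)
    then have "m \<ge> 0" "n \<ge> 0" "j = m + n" using f g by (auto simp: \<beta> lookup_single when_def split: if_splits)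
    then show "j \<in> {0..}" by simp
  qed
qed

text \<open>A central term pairs a mode \<open>m \<noteq> 0\<close> with the mode \<open>- m\<close>, one of which is negative.\<close>

lemma nonneg_central_zero:
  assumes f: "Poly_Mapping.keys f \<subseteq> {0..}" and g: "Poly_Mapping.keys g \<subseteq> {0..}"
    and \<beta>: "\<And>m n x y. n \<noteq> - m \<or> m = 0 \<Longrightarrow> \<beta> m n x y = (0::complex)"
  shows "biadditive_sum \<beta> f g = 0"
  unfolding biadditive_sum_def
proof (intro sum.neutral ballI)
  fix m n assume "m \<in> Poly_Mapping.keys f" "n \<in> Poly_Mapping.keys g"
  then have "m \<ge> 0" "n \<ge> 0" using f g by auto
  then show "\<beta> m n (Poly_Mapping.lookup f m) (Poly_Mapping.lookup g n) = 0" by (intro \<beta>) auto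
qed

text \<open>Brackets of elements of the Borel subalgebra have no component in \<open>\<hh> + \<complex>d\<^sub>0 + \<complex>k + \<complex>c\<close>, so the
  functional that defines the Verma module vanishes on them.\<close>

lemma borel_bracket:
  assumes "x \<in> borel" "y \<in> borel"
  obtains f p where "av_bracket G x y = (f, p, 0, 0)" "Poly_Mapping.lookup f 0 \<in> nil_pos G"
    "Poly_Mapping.lookup p 0 = 0" "Poly_Mapping.keys f \<subseteq> {0..}" "Poly_Mapping.keys p \<subseteq> {0..}"
proof -
  obtain f p \<kappa> \<gamma> h z where x: "x = (f, p, \<kappa>, \<gamma>)"
    and h: "h \<in> csa G" "z \<in> nil_pos G" "Poly_Mapping.lookup f 0 = h + z"
    and keys: "Poly_Mapping.keys f \<subseteq> {0..}" "Poly_Mapping.keys p \<subseteq> {0..}"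
    using assms(1) unfolding borel_def by auto
  obtain f' p' \<kappa>' \<gamma>' h' z' where y: "y = (f', p', \<kappa>', \<gamma>')"
    and h': "h' \<in> csa G" "z' \<in> nil_pos G" "Poly_Mapping.lookup f' 0 = h' + z'"
    and keys': "Poly_Mapping.keys f' \<subseteq> {0..}" "Poly_Mapping.keys p' \<subseteq> {0..}"
    using assms(2) unfolding borel_def by auto
  note B = lookup_graded_sum[OF brk.biadditive_axioms \<beta>_brk_def keys(1) keys'(1)]
  have d: "\<beta>_der n m a x = Poly_Mapping.single (n + m) (scl G (of_int m * a) x)" for n m a x
    by (simp add: \<beta>_der_def add.commute)
  note D = lookup_graded_sum[OF der.biadditive_axioms d keys(2) keys'(1)]
  note D' = lookup_graded_sum[OF der.biadditive_axioms d keys'(2) keys(1)]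
  note W = lookup_graded_sum[OF vir.biadditive_axioms \<beta>_vir_def keys(2) keys'(2)]
  show ?thesis
  proof (rule that)
    show "av_bracket G x y = (biadditive_sum \<beta>_brk f f' + biadditive_sum \<beta>_der p f' - biadditive_sum \<beta>_der p' f,
        biadditive_sum \<beta>_vir p p', 0, 0)"
    proof -
      have "biadditive_sum \<beta>_form f f' = 0" by (rule nonneg_central_zero[OF keys(1) keys'(1)]) (auto simp: \<beta>_form_def)
      moreover have "biadditive_sum \<beta>_cocycle p p' = 0"
        by (rule nonneg_central_zero[OF keys(2) keys'(2)]) (auto simp: \<beta>_cocycle_def)
      ultimately show ?thesis unfolding x y av_bracket_eq by simp
    qed
    have "brk G (h + z) (h' + z') = brk G h h' + brk G h z' - brk G h' z + brk G z z'"
      using brk_antisym[of z h'] by (simp add: g.bracket_add_left g.bracket_add_right)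
    also have "\<dots> \<in> nil_pos G"
      using h h' brk_csa_nil_pos brk_nil_pos csa_abelian nil_pos_subspace
      by (simp add: g.subspace_add g.subspace_diff g.subspace_neg)
    finally show "Poly_Mapping.lookup (biadditive_sum \<beta>_brk f f' + biadditive_sum \<beta>_der p f' - biadditive_sum \<beta>_der p' f) 0 \<in> nil_pos G"
      by (simp add: lookup_add lookup_minus B(1) D(1) D'(1) h h')
    show "Poly_Mapping.lookup (biadditive_sum \<beta>_vir p p') 0 = 0" by (simp add: W(1))
    show "Poly_Mapping.keys (biadditive_sum \<beta>_brk f f' + biadditive_sum \<beta>_der p f' - biadditive_sum \<beta>_der p' f) \<subseteq> {0..}"
      by (intro keys_minus keys_plus B D D')
  qed (rule W(2))
qed

lemma verma_vector_nonzero: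
  assumes lam: "lam \<in> csa_dual G"
  shows "basis_vec [] \<notin> free_span (enveloping_relations (av_scale G) (av_bracket G) \<union>
    induced_relations (av_borel_character G lam l k c))"
  unfolding borel_character_graph
proof (rule induced_rep_nonzero)
  show "lie_algebra (av_scale G) (av_bracket G)" by unfold_locales
  have csa0: "0 \<in> csa G" using g.subspace_0[OF csa_subspace] .
  have lam0: "lam 0 = 0" using csa_dualD(4)[OF lam] .
  have add: "x + y \<in> borel \<and> borel_char lam l k c (x + y) = borel_char lam l k c x + borel_char lam l k c y"
    if xy: "x \<in> borel" "y \<in> borel" for x y
  proof -
    obtain f p \<kappa> \<gamma> h z where x: "x = (f, p, \<kappa>, \<gamma>)"
      and h: "h \<in> csa G" "z \<in> nil_pos G" "Poly_Mapping.lookup f 0 = h + z"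
      and keys: "Poly_Mapping.keys f \<subseteq> {0..}" "Poly_Mapping.keys p \<subseteq> {0..}"
      using xy(1) unfolding borel_def by auto
    obtain f' p' \<kappa>' \<gamma>' h' z' where y: "y = (f', p', \<kappa>', \<gamma>')"
      and h': "h' \<in> csa G" "z' \<in> nil_pos G" "Poly_Mapping.lookup f' 0 = h' + z'"
      and keys': "Poly_Mapping.keys f' \<subseteq> {0..}" "Poly_Mapping.keys p' \<subseteq> {0..}"
      using xy(2) unfolding borel_def by auto
    have s: "h + h' \<in> csa G" "z + z' \<in> nil_pos G" "Poly_Mapping.lookup (f + f') 0 = (h + h') + (z + z')"
      using h h' csa_subspace nil_pos_subspace by (auto simp: g.subspace_add lookup_add)
    have "x + y = (f + f', p + p', \<kappa> + \<kappa>', \<gamma> + \<gamma>')" by (simp add: x y)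
    moreover have "\<dots> \<in> borel"
      unfolding borel_def using s keys_plus[OF keys(1) keys'(1)] keys_plus[OF keys(2) keys'(2)] by blast
    moreover have "borel_char lam l k c (f + f', p + p', \<kappa> + \<kappa>', \<gamma> + \<gamma>') = borel_char lam l k c x + borel_char lam l k c y"
      unfolding x y borel_char_def case_prod_conv s(3) h(3) h'(3) csa_part[OF s(1,2)] csa_part[OF h(1,2)]
        csa_part[OF h'(1,2)] lookup_add[of p p'] csa_dualD(1)[OF lam h(1) h'(1)]
      by (simp add: algebra_simps)
    ultimately show ?thesis by simp
  qed
  have scale: "av_scale G r x \<in> borel \<and> borel_char lam l k c (av_scale G r x) = r * borel_char lam l k c x"
    if xy: "x \<in> borel" for r x
  proof -
    obtain f p \<kappa> \<gamma> h z where x: "x = (f, p, \<kappa>, \<gamma>)"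
      and h: "h \<in> csa G" "z \<in> nil_pos G" "Poly_Mapping.lookup f 0 = h + z"
      and keys: "Poly_Mapping.keys f \<subseteq> {0..}" "Poly_Mapping.keys p \<subseteq> {0..}"
      using xy unfolding borel_def by auto
    have s: "scl G r h \<in> csa G" "scl G r z \<in> nil_pos G"
        "Poly_Mapping.lookup (Poly_Mapping.map (scl G r) f) 0 = scl G r h + scl G r z"
      using h csa_subspace nil_pos_subspace by (auto simp: g.subspace_scale lookup_map_scl g.scale_right_distrib)
    have "(Poly_Mapping.map (scl G r) f, fscale r p, r * \<kappa>, r * \<gamma>) \<in> borel"
      unfolding borel_def using s order_trans[OF keys_map_scl keys(1)] order_trans[OF keys_fscale keys(2)] by blast
    moreover have "borel_char lam l k c (Poly_Mapping.map (scl G r) f, fscale r p, r * \<kappa>, r * \<gamma>) = r * borel_char lam l k c x"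
      unfolding x borel_char_def case_prod_conv s(3) h(3) csa_part[OF s(1,2)] csa_part[OF h(1,2)]
        lookup_fscale csa_dualD(2)[OF lam h(1)]
      by (simp add: algebra_simps)
    ultimately show ?thesis by (simp add: x av_scale_eq)
  qed
  have "(0, 0, 0, 0) \<in> borel" using csa0 nil_pos_0 unfolding borel_def by force
  then have "0 \<in> borel" by (simp add: zero_prod_def)
  then show "module.subspace (av_scale G) borel"
    using add scale by (auto simp: av.subspace_def)
  show "borel_char lam l k c (x + y) = borel_char lam l k c x + borel_char lam l k c y" if "x \<in> borel" "y \<in> borel" for x y
    using add that by blast
  show "borel_char lam l k c (av_scale G r x) = r * borel_char lam l k c x" if "x \<in> borel" for r x
    using scale that by blast
  show "av_bracket G x y \<in> borel" if xy: "x \<in> borel" "y \<in> borel" for x y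
  proof -
    obtain f p where fp: "av_bracket G x y = (f, p, 0, 0)" "Poly_Mapping.lookup f 0 \<in> nil_pos G"
      "Poly_Mapping.lookup p 0 = 0" "Poly_Mapping.keys f \<subseteq> {0..}" "Poly_Mapping.keys p \<subseteq> {0..}"
      by (rule borel_bracket[OF xy])
    have "Poly_Mapping.lookup f 0 = 0 + Poly_Mapping.lookup f 0" by simp
    then show ?thesis unfolding fp(1) borel_def using fp(2-5) csa0 by blast
  qed
  show "borel_char lam l k c (av_bracket G x y) = 0" if xy: "x \<in> borel" "y \<in> borel" for x y
  proof -
    obtain f p where fp: "av_bracket G x y = (f, p, 0, 0)" "Poly_Mapping.lookup f 0 \<in> nil_pos G"
      "Poly_Mapping.lookup p 0 = 0" "Poly_Mapping.keys f \<subseteq> {0..}" "Poly_Mapping.keys p \<subseteq> {0..}"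
      by (rule borel_bracket[OF xy])
    then show ?thesis using csa_part[OF csa0 fp(2)] by (simp add: borel_char_def lam0)
  qed
qed

end

section \<open>Induced modules and their irreducible quotients\<close>

lemma lin_ext_0 [simp]: "lin_ext \<alpha> 0 = 0"
  by (simp add: lin_ext_def)

lemma lin_ext_in_subspace:
  assumes "free_vs.subspace S" "\<And>i. i \<in> Poly_Mapping.keys f \<Longrightarrow> \<alpha> i \<in> S"
  shows "lin_ext \<alpha> f \<in> S"
  unfolding lin_ext_def using assms by (intro free_vs.subspace_sum free_vs.subspace_scale)

lemma lin_ext_fun_add: "lin_ext (\<lambda>i. \<alpha> i + \<beta> i) f = lin_ext \<alpha> f + lin_ext \<beta> f"
  by (simp add: lin_ext_def free_vs.scale_right_distrib sum.distrib)

lemma lin_ext_fun_diff: "lin_ext (\<lambda>i. \<alpha> i - \<beta> i) f = lin_ext \<alpha> f - lin_ext \<beta> f"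
  by (simp add: lin_ext_def free_vs.scale_right_diff_distrib sum_subtractf)

lemma lin_ext_fun_scale: "lin_ext (\<lambda>i. fscale r (\<alpha> i)) f = fscale r (lin_ext \<alpha> f)"
  by (simp add: lin_ext_def free_vs.scale_sum_right mult.commute)

lemma lin_ext_sum: "lin_ext \<alpha> (\<Sum>i\<in>I. f i) = (\<Sum>i\<in>I. lin_ext \<alpha> (f i))"
  by (induction I rule: infinite_finite_induct) (auto simp: lin_ext_add)

lemma lin_ext_lin_ext: "lin_ext \<alpha> (lin_ext \<beta> f) = lin_ext (\<lambda>i. lin_ext \<alpha> (\<beta> i)) f"
  unfolding lin_ext_def[of \<beta>] lin_ext_def[of _ f] by (simp add: lin_ext_sum lin_ext_scale)

lemma free_rep_simps [simp]:
  "carrier (free_rep A \<alpha>) = {f. Poly_Mapping.keys f \<subseteq> A}" "f \<oplus>\<^bsub>free_rep A \<alpha>\<^esub> g = f + g"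
  "\<zero>\<^bsub>free_rep A \<alpha>\<^esub> = 0" "r \<odot>\<^bsub>free_rep A \<alpha>\<^esub> f = fscale r f" "act (free_rep A \<alpha>) x = lin_ext (\<alpha> x)"
  by (simp_all add: free_rep_def)

lemma keys_fscale_subset: "Poly_Mapping.keys (fscale r f) \<subseteq> Poly_Mapping.keys f"
  by (auto simp: in_keys_iff)

lemma free_rep_module: "Module.module complex_field (free_rep A \<alpha>)"
proof (rule complex_moduleI)
  show "abelian_group (free_rep A \<alpha>)"
  proof (rule abelian_groupI)
    fix f assume "f \<in> carrier (free_rep A \<alpha>)"
    then show "\<exists>g\<in>carrier (free_rep A \<alpha>). g \<oplus>\<^bsub>free_rep A \<alpha>\<^esub> f = \<zero>\<^bsub>free_rep A \<alpha>\<^esub>"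
      by (intro bexI[of _ "- f"]) auto
  qed (use Poly_Mapping.keys_add in \<open>fastforce simp: algebra_simps\<close>)+
next
  fix r f assume "f \<in> carrier (free_rep A \<alpha>)"
  then show "r \<odot>\<^bsub>free_rep A \<alpha>\<^esub> f \<in> carrier (free_rep A \<alpha>)"
    using keys_fscale_subset[of r f] by auto
qed (simp_all add: free_vs.scale_left_distrib free_vs.scale_right_distrib)

lemma free_rep_uminus:
  assumes "f \<in> carrier (free_rep A \<alpha>)"
  shows "\<ominus>\<^bsub>free_rep A \<alpha>\<^esub> f = - f"
proof -
  interpret Module.module complex_field "free_rep A \<alpha>" by (rule free_rep_module)
  show ?thesis using assms by (intro minus_equality) auto
qed

lemma free_rep_minus:
  assumes "g \<in> carrier (free_rep A \<alpha>)"
  shows "f \<ominus>\<^bsub>free_rep A \<alpha>\<^esub> g = f - g"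
  unfolding a_minus_def free_rep_uminus[OF assms] by simp

lemma free_rep_submodule:
  assumes S: "free_vs.subspace S" and sub: "S \<subseteq> carrier (free_rep A \<alpha>)"
  shows "submodule S complex_field (free_rep A \<alpha>)"
proof -
  interpret Module.module complex_field "free_rep A \<alpha>" by (rule free_rep_module)
  have neg: "\<ominus>\<^bsub>free_rep A \<alpha>\<^esub> f \<in> S" if "f \<in> S" for f
  proof -
    have "f \<in> carrier (free_rep A \<alpha>)" using that sub by auto
    then show ?thesis using that by (simp only: free_rep_uminus free_vs.subspace_neg[OF S])
  qed
  show ?thesis
    by (rule submoduleI[OF sub])
      (use free_vs.subspace_0[OF S] free_vs.subspace_add[OF S] free_vs.subspace_scale[OF S] neg in auto)
qed

lemma enveloping_relations_in:
  fixes sc br \<chi>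
  defines "S \<equiv> free_span (enveloping_relations sc br \<union> induced_relations \<chi>)"
  shows "basis_vec ((x + y) # w) - (basis_vec (x # w) + basis_vec (y # w)) \<in> S"
    "basis_vec (sc r x # w) - fscale r (basis_vec (x # w)) \<in> S"
    "basis_vec (br x y # w) - (basis_vec (x # y # w) - basis_vec (y # x # w)) \<in> S"
    "(b, s) \<in> \<chi> \<Longrightarrow> basis_vec [b] - fscale s (basis_vec []) \<in> S"
proof -
  show "basis_vec ((x + y) # w) - (basis_vec (x # w) + basis_vec (y # w)) \<in> S"
    using env_add[of "[]" x y w sc br] unfolding S_def
    by (intro free_vs.span_base) (simp add: diff_diff_add)
  show "basis_vec (sc r x # w) - fscale r (basis_vec (x # w)) \<in> S"
    using env_scale[of "[]" sc r x w br] unfolding S_def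
    by (intro free_vs.span_base) simp
  have "basis_vec (x # y # w) - basis_vec (y # x # w) - basis_vec (br x y # w) \<in> S"
    using env_bracket[of "[]" x y w br sc] unfolding S_def
    by (intro free_vs.span_base) simp
  then have "- (basis_vec (x # y # w) - basis_vec (y # x # w) - basis_vec (br x y # w)) \<in> S"
    unfolding S_def by (rule free_vs.span_neg)
  then show "basis_vec (br x y # w) - (basis_vec (x # y # w) - basis_vec (y # x # w)) \<in> S"
    by (simp only: minus_diff_eq)
  show "basis_vec [b] - fscale s (basis_vec []) \<in> S" if "(b, s) \<in> \<chi>"
  proof -
    have "basis_vec ([] @ [b]) - fscale s (basis_vec []) \<in> induced_relations \<chi>"
      unfolding induced_relations_def using that by blast
    then show ?thesis unfolding S_def by (intro free_vs.span_base) simp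
  qed
qed

locale induced_module =
  fixes sc :: "complex \<Rightarrow> 'l::ab_group_add \<Rightarrow> 'l" and br :: "'l \<Rightarrow> 'l \<Rightarrow> 'l" and \<chi> :: "('l \<times> complex) set"
begin

abbreviation "rels \<equiv> free_span (enveloping_relations sc br \<union> induced_relations \<chi>)"
abbreviation "words \<equiv> free_rep UNIV (\<lambda>(x::'l) w. basis_vec (x # w))"

sublocale quot: module_quotient words rels
  by (intro module_quotient.intro module_quotient_axioms.intro free_rep_module free_rep_submodule) auto

lemma induced_rep_eq: "induced_rep sc br \<chi> = quotient_rep words rels"
  by (simp add: induced_rep_def)

lemma induced_lie_module: "lie_module sc br (induced_rep sc br \<chi>)"
  unfolding induced_rep_eq
proof (rule quot.quotient_lie_module)
  have diff: "f \<ominus>\<^bsub>words\<^esub> g = f - g" for f g by (rule free_rep_minus) simp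
  show "act words x v \<in> rels" if "v \<in> rels" for x v
    using left_mult_relations[OF that] by simp
  show "act words (x + y) v \<ominus>\<^bsub>words\<^esub> (act words x v \<oplus>\<^bsub>words\<^esub> act words y v) \<in> rels" for x y v
    unfolding diff free_rep_simps lin_ext_fun_add[symmetric] lin_ext_fun_diff[symmetric]
    by (intro lin_ext_in_subspace enveloping_relations_in free_vs.subspace_span)
  show "act words (sc r x) v \<ominus>\<^bsub>words\<^esub> r \<odot>\<^bsub>words\<^esub> act words x v \<in> rels" for r x v
    unfolding diff free_rep_simps lin_ext_fun_scale[symmetric] lin_ext_fun_diff[symmetric]
    by (intro lin_ext_in_subspace enveloping_relations_in free_vs.subspace_span)
  show "act words (br x y) v \<ominus>\<^bsub>words\<^esub> (act words x (act words y v) \<ominus>\<^bsub>words\<^esub> act words y (act words x v)) \<in> rels" for x y v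
    unfolding diff free_rep_simps lin_ext_lin_ext lin_ext_basis lin_ext_fun_diff[symmetric]
    by (intro lin_ext_in_subspace enveloping_relations_in free_vs.subspace_span)
qed (simp_all add: lin_ext_add lin_ext_scale)

abbreviation "generator \<equiv> quot.coset (basis_vec [])"

lemma act_coset: "act (induced_rep sc br \<chi>) x (quot.coset f) = quot.coset (lin_ext (\<lambda>w. basis_vec (x # w)) f)"
proof -
  have "act (quotient_rep words rels) x (quot.coset f) = quot.coset (act words x f)"
    by (rule quot.quotient_act) (simp_all add: lin_ext_add left_mult_relations)
  then show ?thesis by (simp add: induced_rep_eq)
qed

lemma generator_in: "generator \<in> carrier (induced_rep sc br \<chi>)"
  unfolding induced_rep_eq quot.quotient_carrier by simp

lemma act_generator:
  assumes "(b, s) \<in> \<chi>"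
  shows "act (induced_rep sc br \<chi>) b generator = s \<odot>\<^bsub>induced_rep sc br \<chi>\<^esub> generator"
proof -
  have "basis_vec [b] \<ominus>\<^bsub>words\<^esub> fscale s (basis_vec []) \<in> rels"
    using enveloping_relations_in(4)[OF assms, of sc br] by (subst free_rep_minus) auto
  then have "quot.coset (basis_vec [b]) = quot.coset (fscale s (basis_vec []))"
    by (subst quot.coset_eq) auto
  moreover have "s \<odot>\<^bsub>induced_rep sc br \<chi>\<^esub> generator = quot.coset (fscale s (basis_vec []))"
    unfolding induced_rep_eq by (subst quot.quotient_smult) auto
  ultimately show ?thesis by (simp add: act_coset)
qed

lemma generator_zero_iff: "generator = \<zero>\<^bsub>induced_rep sc br \<chi>\<^esub> \<longleftrightarrow> basis_vec [] \<in> rels"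
proof -
  have "basis_vec [] \<ominus>\<^bsub>words\<^esub> 0 = (basis_vec [] :: 'l list \<Rightarrow>\<^sub>0 complex)"
    by (subst free_rep_minus) auto
  then show ?thesis
    unfolding induced_rep_eq quot.quotient_zero by (subst quot.coset_eq) auto
qed

lemma generator_cyclic:
  assumes N: "lie_submodule N (induced_rep sc br \<chi>)" and u: "generator \<in> N"
  shows "N = carrier (induced_rep sc br \<chi>)"
proof -
  let ?M = "induced_rep sc br \<chi>"
  interpret M: Module.module complex_field ?M
    using induced_lie_module by (simp add: lie_module_def)
  have sN: "submodule N complex_field ?M" using N by (simp add: lie_submodule_def)
  note N' = M.submoduleE[OF sN]
  have words: "quot.coset (basis_vec w) \<in> N" for w
  proof (induction w)
    case (Cons x w)
    then have "act ?M x (quot.coset (basis_vec w)) \<in> N" using N by (simp add: lie_submodule_def)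
    then show ?case by (simp add: act_coset)
  qed (rule u)
  have "quot.coset (\<Sum>w\<in>W. fscale (r w) (basis_vec w)) \<in> N" for W r
  proof (induction W rule: infinite_finite_induct)
    case (insert w W)
    have "quot.coset (fscale (r w) (basis_vec w)) \<in> N"
      using N'(4)[OF _ words, of "r w" w] quot.quotient_smult[of "basis_vec w" "r w"]
      by (simp add: induced_rep_eq)
    with insert have "quot.coset (fscale (r w) (basis_vec w)) \<oplus>\<^bsub>?M\<^esub> quot.coset (\<Sum>w\<in>W. fscale (r w) (basis_vec w)) \<in> N"
      by (intro N'(5))
    then show ?case using insert by (simp add: induced_rep_eq quot.quotient_add)
  qed (use N'(4)[OF _ u, of 0] quot.quotient_smult[of "basis_vec []" 0] in \<open>simp_all add: induced_rep_eq\<close>)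
  note sums = this
  have "quot.coset f \<in> N" for f
  proof -
    have f: "(\<Sum>w\<in>Poly_Mapping.keys f. fscale (Poly_Mapping.lookup f w) (basis_vec w)) = f"
      using lin_ext_basis_vec[of f] by (simp only: lin_ext_def)
    show ?thesis using sums[of "Poly_Mapping.lookup f" "Poly_Mapping.keys f"] unfolding f .
  qed
  then have "carrier ?M \<subseteq> N" unfolding induced_rep_eq quot.quotient_carrier by blast
  then show ?thesis using N'(1) by auto
qed

end

text \<open>The hypotheses on the generator in \<open>highest_weight_action\<close>, for a module record.\<close>

definition highest_weight_vector ::
  "('l \<Rightarrow> int) \<Rightarrow> 'l set \<Rightarrow> 'l \<Rightarrow> complex \<Rightarrow> ('l, 'v) lie_rep \<Rightarrow> 'v \<Rightarrow> bool" where
  "highest_weight_vector deg A D d M u \<longleftrightarrow> u \<in> carrier M \<and> u \<noteq> \<zero>\<^bsub>M\<^esub> \<and> act M D u = d \<odot>\<^bsub>M\<^esub> u \<and>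
     (\<forall>a\<in>A. deg a = 0 \<longrightarrow> (\<exists>r. act M a u = r \<odot>\<^bsub>M\<^esub> u)) \<and> (\<forall>a\<in>A. deg a > 0 \<longrightarrow> act M a u = \<zero>\<^bsub>M\<^esub>)"

context embedded_module
begin

lemma highest_weight_actionI:
  assumes gr: "graded_lie_algebra lsc br D A deg" and hw: "highest_weight_vector deg A D d M u"
    and cyc: "\<And>N. lie_submodule N M \<Longrightarrow> u \<in> N \<Longrightarrow> N = carrier M"
  shows "highest_weight_action lsc br fscale image_space image_act D A deg (\<iota> u) d"
proof -
  interpret gr: graded_lie_algebra lsc br D A deg by (rule gr)
  note u = hw[unfolded highest_weight_vector_def]
  show ?thesis
  proof
    show "\<iota> u \<in> image_space" "\<iota> u \<noteq> 0" using u emb_eq_0_iff by auto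
    show "image_act D (\<iota> u) = fscale d (\<iota> u)" using u by (simp add: emb_scale)
    show "image_act a (\<iota> u) \<in> module.span fscale {\<iota> u}" if a: "a \<in> A" "deg a = 0" for a
    proof -
      obtain r where "act M a u = r \<odot>\<^bsub>M\<^esub> u" using u a by blast
      then show ?thesis unfolding free_span_def[symmetric]
        using u by (simp add: emb_scale free_vs.span_base free_vs.span_scale)
    qed
    show "image_act a (\<iota> u) = 0" if "a \<in> A" "deg a > 0" for a using u that by simp
    show "N' = image_space" if i: "invariant N'" and uN: "\<iota> u \<in> N'" for N'
    proof -
      obtain N where N: "N' = \<iota> ` N" "N \<subseteq> carrier M" using invariantD(2)[OF i] by (meson subset_imageE)
      then have l: "lie_submodule N M" using i submodule_iff_invariant by blast
      obtain v where "v \<in> N" "\<iota> v = \<iota> u" using uN N(1) by auto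
      then have "u \<in> N" using N(2) u emb_eq_iff by auto
      then show ?thesis using cyc[OF l] N(1) by simp
    qed
  qed
qed

text \<open>The submodules with irreducible quotient are the maximal proper ones. Since a proper submodule does
  not contain \<open>u\<close>, the largest submodule avoiding \<open>u\<close> is the only one of them, so the definite
  description in \<open>irreducible_quotient\<close> denotes it.\<close>

lemma irreducible_quotient_exists:
  assumes gr: "graded_lie_algebra lsc br D A deg" and hw: "highest_weight_vector deg A D d M u"
    and cyc: "\<And>N. lie_submodule N M \<Longrightarrow> u \<in> N \<Longrightarrow> N = carrier M"
  obtains N where "lie_submodule N M" "u \<notin> N" "irreducible_rep (quotient_rep M N)"
    "irreducible_quotient M = quotient_rep M N"
proof -
  interpret H: highest_weight_action lsc br fscale image_space image_act D A deg "\<iota> u" d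
    by (rule highest_weight_actionI[OF assms])
  have u: "u \<in> carrier M" using hw by (simp add: highest_weight_vector_def)
  obtain N' where N': "invariant N'" "\<iota> u \<notin> N'" "\<forall>P. invariant P \<longrightarrow> \<iota> u \<notin> P \<longrightarrow> P \<subseteq> N'"
    by (rule H.largest_proper_invariant) blast
  obtain N where N: "N' = \<iota> ` N" "N \<subseteq> carrier M" using invariantD(2)[OF N'(1)] by (meson subset_imageE)
  have sub: "lie_submodule N M" using N N'(1) submodule_iff_invariant by blast
  have uN: "u \<notin> N" using N'(2) N(1) by auto
  have largest: "P \<subseteq> N" if P: "lie_submodule P M" "P \<noteq> carrier M" for P
  proof -
    have PM: "P \<subseteq> carrier M" by (rule lie_submodule_sub[OF P(1)])
    have "u \<notin> P" using cyc P by blast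
    then have "\<iota> u \<notin> \<iota> ` P" using emb_eq_iff u PM by auto
    then have "\<iota> ` P \<subseteq> \<iota> ` N" using N'(3) submodule_iff_invariant[OF PM] P(1) N(1) by auto
    then show ?thesis
    proof (intro subsetI)
      fix v assume v: "v \<in> P"
      then obtain n where n: "n \<in> N" "\<iota> v = \<iota> n" using \<open>\<iota> ` P \<subseteq> \<iota> ` N\<close> by blast
      then have "v = n" using emb_eq_iff[of v n] v PM N(2) by auto
      then show "v \<in> N" using n by simp
    qed
  qed
  have NM: "N \<noteq> carrier M" using uN u by auto
  have irr: "irreducible_rep (quotient_rep M N)"
    unfolding quotient_irreducible_iff[OF sub] using NM largest by blast
  have "(THE N. lie_submodule N M \<and> irreducible_rep (quotient_rep M N)) = N"
  proof (rule the_equality)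
    show "lie_submodule N M \<and> irreducible_rep (quotient_rep M N)" using sub irr by simp
    fix P assume P: "lie_submodule P M \<and> irreducible_rep (quotient_rep M P)"
    then have "P \<noteq> carrier M" and max: "\<And>Q. lie_submodule Q M \<Longrightarrow> P \<subseteq> Q \<Longrightarrow> Q = P \<or> Q = carrier M"
      using quotient_irreducible_iff[of P] by auto
    then have "P \<subseteq> N" using P largest by blast
    then show "P = N" using max[OF sub] NM by blast
  qed
  then have "irreducible_quotient M = quotient_rep M N" by (simp add: irreducible_quotient_def)
  with sub uN irr show ?thesis by (rule that)
qed

end

context simple_lie_data
begin

definition av_hw_vector ::
  "('g \<Rightarrow> complex) \<Rightarrow> complex \<Rightarrow> complex \<Rightarrow> complex \<Rightarrow> ('g affvir, 'v) lie_rep \<Rightarrow> 'v \<Rightarrow> bool" where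
  "av_hw_vector lam l k c V u \<longleftrightarrow> u \<in> carrier V \<and> u \<noteq> \<zero>\<^bsub>V\<^esub> \<and> (\<forall>x\<in>av_pos G. act V x u = \<zero>\<^bsub>V\<^esub>) \<and>
     (\<forall>h\<in>csa G. act V (cur 0 h) u = lam h \<odot>\<^bsub>V\<^esub> u) \<and> act V (vir 0) u = l \<odot>\<^bsub>V\<^esub> u \<and>
     act V cen_k u = k \<odot>\<^bsub>V\<^esub> u \<and> act V cen_c u = c \<odot>\<^bsub>V\<^esub> u"

lemma av_grading_eq: "av_grading = cur 0 h0 + av_scale G (of_int level_weight) (vir 0)"
  by (simp add: av_grading_def cur_def vir_def av_scale_eq del: single_one)

lemma av_hw_vectorD:
  assumes V: "lie_module (av_scale G) (av_bracket G) V" and u: "av_hw_vector lam l k c V u"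
  shows "highest_weight_vector av_degree av_letters av_grading (lam h0 + of_int level_weight * l) V u"
proof -
  interpret V: Module.module complex_field V using V by (simp add: lie_module_def)
  note u = u[unfolded av_hw_vector_def]
  have ax: "act V (x + y) u = act V x u \<oplus>\<^bsub>V\<^esub> act V y u" "act V (av_scale G r x) u = r \<odot>\<^bsub>V\<^esub> act V x u" for x y r
    using V u unfolding lie_module_def by blast+
  have "act V av_grading u = lam h0 \<odot>\<^bsub>V\<^esub> u \<oplus>\<^bsub>V\<^esub> of_int level_weight \<odot>\<^bsub>V\<^esub> (l \<odot>\<^bsub>V\<^esub> u)"
    unfolding av_grading_eq ax using u h0 by simp
  also have "\<dots> = (lam h0 + of_int level_weight * l) \<odot>\<^bsub>V\<^esub> u"
    using u by (simp add: V.smult_l_distr[simplified] V.smult_assoc1[simplified])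
  finally have D: "act V av_grading u = (lam h0 + of_int level_weight * l) \<odot>\<^bsub>V\<^esub> u" .
  moreover have "\<exists>r. act V a u = r \<odot>\<^bsub>V\<^esub> u" if "a \<in> av_letters" "av_degree a = 0" for a
    using that by (cases rule: av_zero_letter) (use u in blast)+
  moreover have "act V a u = \<zero>\<^bsub>V\<^esub>" if "a \<in> av_letters" "av_degree a > 0" for a
    using av_positive_letter[OF that] u by blast
  ultimately show ?thesis using u by (simp add: highest_weight_vector_def)
qed

lemma av_irreducible_highest_weight:
  assumes lam: "lam \<in> csa_dual G"
  shows "lie_module (av_scale G) (av_bracket G) (av_irreducible G lam l k c)"
    "irreducible_rep (av_irreducible G lam l k c)"
    "\<exists>u. av_hw_vector lam l k c (av_irreducible G lam l k c) u"
proof -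
  let ?M = "av_verma G lam l k c"
  let ?\<chi> = "av_borel_character G lam l k c"
  interpret I: induced_module "av_scale G" "av_bracket G" ?\<chi> .
  have M_eq: "?M = induced_rep (av_scale G) (av_bracket G) ?\<chi>" by (simp add: av_verma_def)
  note lm = I.induced_lie_module[folded M_eq]
  have la: "lie_algebra (av_scale G) (av_bracket G)" by unfold_locales
  obtain \<iota> where "embedded_module (av_scale G) (av_bracket G) ?M \<iota>"
    by (rule embedded_module_exists[OF la lm])
  then interpret E: embedded_module "av_scale G" "av_bracket G" ?M \<iota> .
  let ?u = "I.generator"
  have gen: "act ?M b ?u = s \<odot>\<^bsub>?M\<^esub> ?u" if "(b, s) \<in> ?\<chi>" for b s
    using I.act_generator[OF that] by (simp only: M_eq)
  have csa0: "0 \<in> csa G" using g.subspace_0[OF csa_subspace] .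
  have lam0: "lam 0 = 0" using csa_dualD(4)[OF lam] .
  have cur0: "cur 0 (0::'g) = 0" by (simp add: cur_def zero_prod_def)
  have pos0: "0 \<in> av_pos G" using nil_pos_0 by (auto simp: av_pos_def zero_prod_def)
  have char: "(cur 0 h + av_scale G \<delta> (vir 0) + av_scale G \<kappa> cen_k + av_scale G \<gamma> cen_c + z,
       lam h + \<delta> * l + \<kappa> * k + \<gamma> * c) \<in> ?\<chi>" if "h \<in> csa G" "z \<in> av_pos G" for h \<delta> \<kappa> \<gamma> z
    unfolding av_borel_character_def using that by blast
  have u_in: "?u \<in> carrier ?M" using I.generator_in by (simp only: M_eq)
  have u: "av_hw_vector lam l k c ?M ?u"
    unfolding av_hw_vector_def
  proof (intro conjI ballI)
    show "?u \<noteq> \<zero>\<^bsub>?M\<^esub>"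
      unfolding M_eq I.generator_zero_iff by (rule verma_vector_nonzero[OF lam])
    show "act ?M x ?u = \<zero>\<^bsub>?M\<^esub>" if "x \<in> av_pos G" for x
      using gen[OF char[OF csa0 that, of 0 0 0]] u_in E.M.smult_l_null[OF u_in] by (simp add: cur0 lam0)
    show "act ?M (cur 0 h) ?u = lam h \<odot>\<^bsub>?M\<^esub> ?u" if "h \<in> csa G" for h
      using gen[OF char[OF that pos0, of 0 0 0]] by simp
    show "act ?M (vir 0) ?u = l \<odot>\<^bsub>?M\<^esub> ?u"
      using gen[OF char[OF csa0 pos0, of 1 0 0]] by (simp add: cur0 lam0)
    show "act ?M cen_k ?u = k \<odot>\<^bsub>?M\<^esub> ?u"
      using gen[OF char[OF csa0 pos0, of 0 1 0]] by (simp add: cur0 lam0)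
    show "act ?M cen_c ?u = c \<odot>\<^bsub>?M\<^esub> ?u"
      using gen[OF char[OF csa0 pos0, of 0 0 1]] by (simp add: cur0 lam0)
  qed (rule u_in)
  obtain N where N: "lie_submodule N ?M" "?u \<notin> N" "irreducible_rep (quotient_rep ?M N)"
      "irreducible_quotient ?M = quotient_rep ?M N"
    by (rule E.irreducible_quotient_exists[OF graded_av av_hw_vectorD[OF lm u]])
      (rule I.generator_cyclic[folded M_eq])
  have V_eq: "av_irreducible G lam l k c = quotient_rep ?M N" by (simp add: av_irreducible_def N(4))
  show "lie_module (av_scale G) (av_bracket G) (av_irreducible G lam l k c)"
    unfolding V_eq by (rule E.lie_module_quotient[OF N(1)])
  show "irreducible_rep (av_irreducible G lam l k c)" unfolding V_eq by (rule N(3))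
  interpret Q: module_quotient ?M N by (rule module_quotientI[OF lm N(1)])
  have act: "act (quotient_rep ?M N) x (Q.coset ?u) = Q.coset (act ?M x ?u)" for x
  proof (rule Q.quotient_act[OF u_in])
    show "act ?M x v \<in> N" if "v \<in> N" for v using N(1) that unfolding lie_submodule_def by blast
  qed (simp_all only: E.act_in E.lie_mod_axioms(1))
  have smult: "r \<odot>\<^bsub>quotient_rep ?M N\<^esub> Q.coset ?u = Q.coset (r \<odot>\<^bsub>?M\<^esub> ?u)" for r
    by (rule Q.quotient_smult[OF u_in])
  have "?u \<ominus>\<^bsub>?M\<^esub> \<zero>\<^bsub>?M\<^esub> = ?u"
    using u_in by (metis E.M.a_inv_closed E.M.minus_eq E.M.r_zero E.M.l_neg E.M.zero_closed)
  then have "Q.coset ?u \<noteq> \<zero>\<^bsub>quotient_rep ?M N\<^esub>"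
    unfolding Q.quotient_zero using N(2) u_in by (simp add: Q.coset_eq)
  moreover have "Q.coset ?u \<in> carrier (quotient_rep ?M N)" unfolding Q.quotient_carrier using u_in by simp
  ultimately have "av_hw_vector lam l k c (quotient_rep ?M N) (Q.coset ?u)"
    using u unfolding av_hw_vector_def act smult by (simp add: Q.quotient_zero)
  then show "\<exists>u. av_hw_vector lam l k c (av_irreducible G lam l k c) u" unfolding V_eq by blast
qed

end

section \<open>Highest weight modules of the affine-Virasoro algebra\<close>

text \<open>The embedding \<open>emV\<close> and the vector \<open>u\<close> are parameters, as both are obtained from existence
  statements.\<close>

locale av_hw_module = simple_lie_data G + V: embedded_module "av_scale G" "av_bracket G" V emV
  for G :: "'g::ab_group_add lie_data" and V :: "('g affvir, 'v) lie_rep" and emV +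
  fixes lam :: "'g \<Rightarrow> complex" and l k c :: complex and u :: 'v
  assumes V_irreducible: "irreducible_rep V" and u: "av_hw_vector lam l k c V u"
begin

lemma u_in [simp]: "u \<in> carrier V" and u_nonzero: "u \<noteq> \<zero>\<^bsub>V\<^esub>"
  using u by (auto simp: av_hw_vector_def)

sublocale V: highest_weight_action "av_scale G" "av_bracket G" fscale "V.image_space" "V.image_act"
  av_grading av_letters av_degree "emV u" "lam h0 + of_int level_weight * l"
proof (rule V.highest_weight_actionI[OF graded_av av_hw_vectorD[OF V.lie_mod u]])
  fix N assume "lie_submodule N V" "u \<in> N"
  then show "N = carrier V" using V_irreducible u_nonzero unfolding irreducible_rep_def by auto
qed

lemma V_irreducible': "V.irreducible"
  using V_irreducible V.irreducible_iff by simp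

lemma act_eigen:
  assumes "v \<in> carrier V" "act V (vir 0) v = s \<odot>\<^bsub>V\<^esub> v"
  shows "act V (vir 0) (act V (cur m x) v) = (s + of_int m) \<odot>\<^bsub>V\<^esub> act V (cur m x) v"
    "act V (vir 0) (act V (vir m) v) = (s + of_int m) \<odot>\<^bsub>V\<^esub> act V (vir m) v"
proof -
  have br: "av_bracket G (vir 0) (cur m x) = av_scale G (of_int m) (cur m x)"
    "av_bracket G (vir 0) (vir m) = av_scale G (of_int m) (vir m)"
    by (simp_all add: cur_def vir_def av_bracket_homogeneous av_scale_eq del: single_one)
  have *: "act V (vir 0) (act V y v) = (s + of_int m) \<odot>\<^bsub>V\<^esub> act V y v"
    if "av_bracket G (vir 0) y = av_scale G (of_int m) y" for y
  proof -
    have "V.image_act (vir 0) (V.image_act y (emV v)) = V.image_act y (V.image_act (vir 0) (emV v)) + V.image_act (av_bracket G (vir 0) y) (emV v)"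
      using assms by (intro V.act_swap) auto
    also have "\<dots> = fscale (s + of_int m) (emV (act V y v))"
      using assms by (simp add: that V.lie_mod_axioms V.emb_scale V.act_scale free_vs.scale_left_distrib)
    finally show ?thesis
      using assms by (simp flip: V.emb_scale add: V.emb_eq_iff)
  qed
  show "act V (vir 0) (act V (cur m x) v) = (s + of_int m) \<odot>\<^bsub>V\<^esub> act V (cur m x) v"
    "act V (vir 0) (act V (vir m) v) = (s + of_int m) \<odot>\<^bsub>V\<^esub> act V (vir m) v"
    by (rule *[OF br(1)], rule *[OF br(2)])
qed

abbreviation "spectrum \<equiv> {l - of_nat n | n. True}"

text \<open>\<open>u\<close> has eigenvalue \<open>l\<close>, and no letter of negative degree in the principal gradation raises the
  eigenvalue of \<open>d\<^sub>0\<close>.\<close>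

lemma V_spectrum: "V.image_space \<subseteq> V.eigenspan (vir 0) spectrum"
proof -
  have "\<exists>v n. y = emV v \<and> v \<in> carrier V \<and> act V (vir 0) v = (l - of_nat n) \<odot>\<^bsub>V\<^esub> v" if "y \<in> V.lowered {emV u}" for y
    using that
  proof induction
    case (base z)
    then show ?case using u by (intro exI[of _ u] exI[of _ 0]) (auto simp: av_hw_vector_def)
  next
    case (step a y)
    then obtain v n where v: "y = emV v" "v \<in> carrier V" "act V (vir 0) v = (l - of_nat n) \<odot>\<^bsub>V\<^esub> v" by blast
    have "\<exists>m\<ge>0. act V (vir 0) (act V a v) = (l - of_nat n + of_int (- m)) \<odot>\<^bsub>V\<^esub> act V a v"
      using step(1)
    proof (cases rule: av_letters_cases)
      case (1 m r)
      then have "\<not> height r + level_weight * m > 0" using step(2) by (simp add: av_degree)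
      then have "m \<le> 0" using level_weight_sign(1)[OF 1(1), of m] by auto
      then show ?thesis using act_eigen(1)[OF v(2,3), of m r] 1 by (intro exI[of _ "- m"]) simp
    next
      case (2 m)
      then have "m < 0" using step(2) level_weight(2) by (simp add: av_degree mult_less_0_iff)
      then show ?thesis using act_eigen(2)[OF v(2,3), of m] 2 by (intro exI[of _ "- m"]) simp
    qed (use step(2) in \<open>auto simp: av_degree\<close>)
    then obtain m where m: "m \<ge> 0" "act V (vir 0) (act V a v) = (l - of_nat n + of_int (- m)) \<odot>\<^bsub>V\<^esub> act V a v" by blast
    have eq: "l - of_nat n + of_int (- m) = l - of_nat (n + nat m)" using m(1) by simp
    show ?case
      by (intro exI[of _ "act V a v"] exI[of _ "n + nat m"] conjI)
        (use v m(2)[unfolded eq] in \<open>simp_all only: V.image_act V.act_in\<close>)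
  qed
  then have "V.lowered {emV u} \<subseteq> {y \<in> V.image_space. \<exists>c\<in>spectrum. V.image_act (vir 0) y = fscale c y}"
    by (fastforce simp: V.emb_scale)
  then have "module.span fscale (V.lowered {emV u}) \<subseteq> V.eigenspan (vir 0) spectrum"
    unfolding V.eigenspan_def by (rule free_vs.span_mono[unfolded free_span_def])
  then show ?thesis using V.X_lowered by simp
qed

lemma eigenvalue_in_spectrum:
  assumes "v \<in> carrier V" "act V (vir 0) v = s \<odot>\<^bsub>V\<^esub> v" "v \<noteq> \<zero>\<^bsub>V\<^esub>"
  shows "\<exists>n::nat. s = l - of_nat n"
proof (rule ccontr)
  assume "\<not> ?thesis"
  then have "s \<notin> spectrum" by auto
  then have "emV v = 0"
    using assms V_spectrum by (intro V.eigenvector_in_eigenspan[of _ "vir 0" spectrum s]) (auto simp: V.emb_scale)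
  then show False using assms V.emb_eq_0_iff by auto
qed

text \<open>Otherwise \<open>l - n + m\<close>, which exceeds \<open>l\<close>, would be an eigenvalue.\<close>

lemma eigenvector_killed:
  assumes v: "v \<in> carrier V" "act V (vir 0) v = (l - of_nat n) \<odot>\<^bsub>V\<^esub> v" and m: "m > int n"
  shows "act V (cur m x) v = \<zero>\<^bsub>V\<^esub>" "act V (vir m) v = \<zero>\<^bsub>V\<^esub>"
proof -
  have no: "l - of_nat n + of_int m \<noteq> l - of_nat j" for j
  proof
    assume "l - of_nat n + of_int m = l - of_nat j"
    then have "(of_int (m + int j) :: complex) = of_int (int n)" by (simp add: algebra_simps)
    then have "m + int j = int n" by (simp only: of_int_eq_iff)
    then show False using m by simp
  qed
  show "act V (cur m x) v = \<zero>\<^bsub>V\<^esub>"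
    using eigenvalue_in_spectrum[OF _ act_eigen(1)[OF v]] no v(1) by (meson V.act_in)
  show "act V (vir m) v = \<zero>\<^bsub>V\<^esub>"
    using eigenvalue_in_spectrum[OF _ act_eigen(2)[OF v]] no v(1) by (meson V.act_in)
qed

text \<open>This separates the factors of the tensor product: on a given vector, modes of large degree act
  only on the second factor.\<close>

lemma locally_nilpotent:
  assumes "v \<in> carrier V"
  shows "\<exists>N. \<forall>m\<ge>N. \<forall>x. act V (cur m x) v = \<zero>\<^bsub>V\<^esub> \<and> act V (vir m) v = \<zero>\<^bsub>V\<^esub>"
proof -
  have "y \<in> V.image_space \<and> (\<exists>N. \<forall>m\<ge>N. \<forall>x. V.image_act (cur m x) y = 0 \<and> V.image_act (vir m) y = 0)"
    if "y \<in> V.eigenspan (vir 0) spectrum" for y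
    using that unfolding V.eigenspan_def free_span_def[symmetric]
  proof (induction rule: free_vs.span_induct_alt)
    case base
    have "0 \<in> V.image_space" using V.emb_zero by force
    then show ?case by simp
  next
    case (step s y z)
    then obtain v n where v: "y = emV v" "v \<in> carrier V" "V.image_act (vir 0) y = fscale (l - of_nat n) y" by blast
    then have "act V (vir 0) v = (l - of_nat n) \<odot>\<^bsub>V\<^esub> v" by (simp flip: V.emb_scale add: V.emb_eq_iff)
    then have 1: "V.image_act (cur m x) y = 0 \<and> V.image_act (vir m) y = 0" if "m \<ge> int n + 1" for m x
      using eigenvector_killed[OF v(2), of n m] that v by simp
    obtain N where 2: "\<forall>m\<ge>N. \<forall>x. V.image_act (cur m x) z = 0 \<and> V.image_act (vir m) z = 0" using step by blast
    have yX: "y \<in> V.image_space" "z \<in> V.image_space" using step by auto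
    show ?case
    proof (intro conjI exI[of _ "max N (int n + 1)"] allI impI)
      show "fscale s y + z \<in> V.image_space"
        using yX V.X by (simp add: free_vs.subspace_add free_vs.subspace_scale)
    qed (use 1 2 yX V.X in \<open>simp_all add: V.act_add V.act_scale free_vs.subspace_scale\<close>)
  qed
  then obtain N where "\<forall>m\<ge>N. \<forall>x. V.image_act (cur m x) (emV v) = 0 \<and> V.image_act (vir m) (emV v) = 0"
    using V_spectrum assms by blast
  then show ?thesis using assms V.emb_eq_0_iff by (auto intro!: exI[of _ N])
qed

lemma V_singular:
  assumes v: "v \<in> carrier V" and kill: "\<And>m x. m > 0 \<Longrightarrow> act V (cur m x) v = \<zero>\<^bsub>V\<^esub>" "\<And>m. m > 0 \<Longrightarrow> act V (vir m) v = \<zero>\<^bsub>V\<^esub>"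
    "\<And>x. x \<in> nil_pos G \<Longrightarrow> act V (cur 0 x) v = \<zero>\<^bsub>V\<^esub>"
  shows "\<exists>r. v = r \<odot>\<^bsub>V\<^esub> u"
proof -
  have "\<exists>r. emV v = fscale r (emV u)"
  proof (rule V.singular_vector[OF V_irreducible'])
    fix y assume y: "y \<in> av_letters" "av_degree y > 0"
    have "act V y v = \<zero>\<^bsub>V\<^esub>"
      using y(1)
    proof (cases rule: av_letters_cases)
      case (1 m r)
      then have "m > 0 \<or> m = 0 \<and> height r > 0" using y(2) level_weight_sign(1)[OF 1(1), of m] by (simp add: av_degree)
      then show ?thesis using 1 kill height(3)[OF 1(1)] by auto
    next
      case (2 m)
      then have "m > 0" using y(2) level_weight(2) by (simp add: av_degree zero_less_mult_iff)
      then show ?thesis using 2 kill by simp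
    qed (use y(2) in \<open>auto simp: av_degree\<close>)
    then show "V.image_act y (emV v) = 0" using v by simp
  qed (use v in simp)
  then obtain r where "emV v = emV (r \<odot>\<^bsub>V\<^esub> u)" by (auto simp: V.emb_scale)
  then show ?thesis using v V.emb_eq_iff[of v "r \<odot>\<^bsub>V\<^esub> u"] by auto
qed

end

section \<open>Highest weight modules of the simple Lie algebra\<close>

locale g_hw_module = simple_lie_data G + W: embedded_module "scl G" "brk G" W emW
  for G :: "'g::ab_group_add lie_data" and W :: "('g, 'w) lie_rep" and emW +
  fixes \<mu> :: "'g \<Rightarrow> complex" and w0 :: 'w
  assumes W_irreducible: "irreducible_rep W"
    and w0: "w0 \<in> carrier W" "w0 \<noteq> \<zero>\<^bsub>W\<^esub>" "\<And>x. x \<in> nil_pos G \<Longrightarrow> act W x w0 = \<zero>\<^bsub>W\<^esub>"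
      "\<And>h. h \<in> csa G \<Longrightarrow> act W h w0 = \<mu> h \<odot>\<^bsub>W\<^esub> w0"
begin

lemma W_hw: "highest_weight_vector height R h0 (\<mu> h0) W w0"
  using w0 h0 height(2,3) by (auto simp: highest_weight_vector_def)

sublocale W: highest_weight_action "scl G" "brk G" fscale "W.image_space" "W.image_act"
  h0 R height "emW w0" "\<mu> h0"
proof (rule W.highest_weight_actionI[OF graded_g W_hw])
  fix N assume "lie_submodule N W" "w0 \<in> N"
  then show "N = carrier W" using W_irreducible w0(2) unfolding irreducible_rep_def by auto
qed

lemma W_irreducible': "W.irreducible"
  using W_irreducible W.irreducible_iff by simp

lemma W_singular:
  assumes "w \<in> carrier W" "\<And>x. x \<in> nil_pos G \<Longrightarrow> act W x w = \<zero>\<^bsub>W\<^esub>"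
  shows "\<exists>r. w = r \<odot>\<^bsub>W\<^esub> w0"
proof -
  have "\<exists>r. emW w = fscale r (emW w0)"
    by (rule W.singular_vector[OF W_irreducible']) (use assms height(3) in auto)
  then show ?thesis using assms(1) w0(1) by (auto simp flip: W.emb_scale simp: W.emb_eq_iff)
qed

end

section \<open>The tensor product modules\<close>

locale tensor_module = av_hw_module G V emV lam l k c u + g_hw_module G W emW \<mu> w0
  for G :: "'g::ab_group_add lie_data" and V :: "('g affvir, 'v) lie_rep" and emV lam l k c u
    and W :: "('g, 'w) lie_rep" and emW \<mu> w0 +
  fixes a b :: complex
begin

abbreviation "triples \<equiv> carrier V \<times> carrier W \<times> (UNIV :: int set)"
abbreviation "F \<equiv> free_rep triples (tensor_action V W l k c a b)"
abbreviation "S \<equiv> free_span (tensor_relations V W)"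
abbreviation "T \<equiv> quotient_rep F S"

lemma basis_in_F: "v \<in> carrier V \<Longrightarrow> w \<in> carrier W \<Longrightarrow> basis_vec (v, w, n) \<in> carrier F"
  by simp

lemma F_subspace: "free_vs.subspace (carrier F)"
proof -
  have "0 \<in> carrier F" by simp
  moreover have "f + g \<in> carrier F" if "f \<in> carrier F" "g \<in> carrier F" for f g
    using keys_plus[of f triples g] that by simp
  moreover have "fscale r f \<in> carrier F" if "f \<in> carrier F" for r f
    using keys_fscale_subset[of r f] that by auto
  ultimately show ?thesis unfolding free_vs.subspace_def by blast
qed

lemma S_sub: "S \<subseteq> carrier F"
proof (rule free_vs.span_minimal[OF _ F_subspace])
  have d: "f - g \<in> carrier F" if "f \<in> carrier F" "g \<in> carrier F" for f g
    using free_vs.subspace_diff[OF F_subspace that] .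
  have s: "fscale r f \<in> carrier F" if "f \<in> carrier F" for r f
    using free_vs.subspace_scale[OF F_subspace that] .
  show "tensor_relations V W \<subseteq> carrier F"
    unfolding tensor_relations_def by (auto intro!: d s basis_in_F simp del: free_rep_simps(1) fscale_single)
qed

sublocale Q: module_quotient F S
  by (intro module_quotient.intro module_quotient_axioms.intro free_rep_module free_rep_submodule S_sub) simp

text \<open>A linear map with kernel \<open>S\<close>, so that the quotient by \<open>S\<close> is realized by actual vectors of a free
  vector space instead of cosets; \<open>ten\<close> gives the pure tensors, \<open>Z\<close> their span, and \<open>emT\<close> identifies the
  module \<open>T\<close> with \<open>Z\<close>.\<close>

definition proj :: "('v \<times> 'w \<times> int \<Rightarrow>\<^sub>0 complex) \<Rightarrow> ('v \<times> 'w \<times> int \<Rightarrow>\<^sub>0 complex)" where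
  "proj = (SOME p. (\<forall>f g. p (f + g) = p f + p g) \<and> (\<forall>r f. p (fscale r f) = fscale r (p f)) \<and> (\<forall>f. p f = 0 \<longleftrightarrow> f \<in> S))"

lemma proj: "proj (f + g) = proj f + proj g" "proj (fscale r f) = fscale r (proj f)" "proj f = 0 \<longleftrightarrow> f \<in> S"
proof -
  have "free_vs.subspace S" by simp
  then obtain p :: "('v \<times> 'w \<times> int \<Rightarrow>\<^sub>0 complex) \<Rightarrow> ('v \<times> 'w \<times> int \<Rightarrow>\<^sub>0 complex)"
    where p: "\<forall>f g. p (f + g) = p f + p g" "\<forall>r f. p (fscale r f) = fscale r (p f)" "\<forall>f. p f = 0 \<longleftrightarrow> f \<in> S"
    by (rule free_vs.projection_along)
  then have "\<exists>p::('v \<times> 'w \<times> int \<Rightarrow>\<^sub>0 complex) \<Rightarrow> ('v \<times> 'w \<times> int \<Rightarrow>\<^sub>0 complex). (\<forall>f g. p (f + g) = p f + p g) \<and> (\<forall>r f. p (fscale r f) = fscale r (p f)) \<and> (\<forall>f. p f = 0 \<longleftrightarrow> f \<in> S)"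
    by (intro exI conjI)
  from someI_ex[OF this]
  show "proj (f + g) = proj f + proj g" "proj (fscale r f) = fscale r (proj f)" "proj f = 0 \<longleftrightarrow> f \<in> S"
    by (simp_all add: proj_def)
qed

lemma proj_diff: "proj (f - g) = proj f - proj g"
  using proj(1)[of "f - g" g] by simp

lemma proj_0 [simp]: "proj 0 = 0"
  using proj(2)[of 0 0] by simp

lemma proj_eq_iff: "proj f = proj g \<longleftrightarrow> f - g \<in> S"
  using proj(3)[of "f - g"] by (simp add: proj_diff)

definition ten :: "'v \<Rightarrow> 'w \<Rightarrow> int \<Rightarrow> ('v \<times> 'w \<times> int \<Rightarrow>\<^sub>0 complex)" where
  "ten v w n = proj (basis_vec (v, w, n))"

lemma ten_bilinear:
  assumes "v \<in> carrier V" "w \<in> carrier W"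
  shows "v' \<in> carrier V \<Longrightarrow> ten (v \<oplus>\<^bsub>V\<^esub> v') w n = ten v w n + ten v' w n"
    "ten (r \<odot>\<^bsub>V\<^esub> v) w n = fscale r (ten v w n)"
    "w' \<in> carrier W \<Longrightarrow> ten v (w \<oplus>\<^bsub>W\<^esub> w') n = ten v w n + ten v w' n"
    "ten v (r \<odot>\<^bsub>W\<^esub> w) n = fscale r (ten v w n)"
proof -
  have *: "f - g \<in> tensor_relations V W \<Longrightarrow> proj f = proj g" for f g
    unfolding proj_eq_iff by (rule free_vs.span_base)
  have **: "f - g - h \<in> tensor_relations V W \<Longrightarrow> proj f = proj g + proj h" for f g h
    unfolding proj(1)[symmetric] by (rule *) (simp add: diff_diff_add)
  show "ten (v \<oplus>\<^bsub>V\<^esub> v') w n = ten v w n + ten v' w n" if "v' \<in> carrier V"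
    unfolding ten_def by (rule **) (use assms that in \<open>simp only: tensor_relations_def, blast\<close>)
  show "ten (r \<odot>\<^bsub>V\<^esub> v) w n = fscale r (ten v w n)"
    unfolding ten_def proj(2)[symmetric] by (rule *) (use assms in \<open>simp only: tensor_relations_def, blast\<close>)
  show "ten v (w \<oplus>\<^bsub>W\<^esub> w') n = ten v w n + ten v w' n" if "w' \<in> carrier W"
    unfolding ten_def by (rule **) (use assms that in \<open>simp only: tensor_relations_def, blast\<close>)
  show "ten v (r \<odot>\<^bsub>W\<^esub> w) n = fscale r (ten v w n)"
    unfolding ten_def proj(2)[symmetric] by (rule *) (use assms in \<open>simp only: tensor_relations_def, blast\<close>)
qed

lemma ten_zero:
  "w \<in> carrier W \<Longrightarrow> ten \<zero>\<^bsub>V\<^esub> w n = 0" "v \<in> carrier V \<Longrightarrow> ten v \<zero>\<^bsub>W\<^esub> n = 0"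
  using ten_bilinear(1)[of "\<zero>\<^bsub>V\<^esub>" w "\<zero>\<^bsub>V\<^esub>" n] ten_bilinear(3)[of v "\<zero>\<^bsub>W\<^esub>" "\<zero>\<^bsub>W\<^esub>" n] by auto

definition Z :: "('v \<times> 'w \<times> int \<Rightarrow>\<^sub>0 complex) set" where
  "Z = free_span {ten v w n | v w n. v \<in> carrier V \<and> w \<in> carrier W}"

lemma proj_sum: "proj (\<Sum>i\<in>I. h i) = (\<Sum>i\<in>I. proj (h i))"
  by (induction I rule: infinite_finite_induct) (auto simp: proj(1))

lemma proj_lin_ext_general: "proj (lin_ext \<alpha> f) = lin_ext (\<lambda>i. proj (\<alpha> i)) f"
  by (simp add: lin_ext_def proj_sum proj(2))

lemma proj_lin_ext: "proj f = lin_ext (\<lambda>(v, w, n). ten v w n) f"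
proof -
  have "(\<lambda>i. proj (basis_vec i)) = (\<lambda>(v, w, n). ten v w n)" by (auto simp: ten_def fun_eq_iff)
  then show ?thesis using proj_lin_ext_general[of basis_vec f] by (simp only: lin_ext_basis_vec)
qed

lemma ten_in_Z: "v \<in> carrier V \<Longrightarrow> w \<in> carrier W \<Longrightarrow> ten v w n \<in> Z"
  unfolding Z_def by (rule free_vs.span_base) blast

lemma Z_subspace: "free_vs.subspace Z"
  unfolding Z_def by simp

lemma proj_F: "proj ` carrier F = Z"
proof
  show "proj ` carrier F \<subseteq> Z"
  proof
    fix z assume "z \<in> proj ` carrier F"
    then obtain f where f: "f \<in> carrier F" "z = proj f" by blast
    show "z \<in> Z" unfolding f(2) proj_lin_ext
      by (rule lin_ext_in_subspace[OF Z_subspace]) (use f(1) ten_in_Z in auto)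
  qed
  have "0 \<in> proj ` carrier F" by (rule image_eqI[of _ _ 0]) auto
  moreover have "proj f + proj g \<in> proj ` carrier F" if "f \<in> carrier F" "g \<in> carrier F" for f g
    unfolding proj(1)[symmetric] by (rule imageI) (rule free_vs.subspace_add[OF F_subspace that])
  moreover have "fscale r (proj f) \<in> proj ` carrier F" if "f \<in> carrier F" for r f
    unfolding proj(2)[symmetric] by (rule imageI) (rule free_vs.subspace_scale[OF F_subspace that])
  ultimately have "free_vs.subspace (proj ` carrier F)" unfolding free_vs.subspace_def by blast
  then show "Z \<subseteq> proj ` carrier F"
    unfolding Z_def by (rule free_vs.span_minimal[rotated]) (auto simp: ten_def)
qed

definition emT :: "('v \<times> 'w \<times> int \<Rightarrow>\<^sub>0 complex) set \<Rightarrow> ('v \<times> 'w \<times> int \<Rightarrow>\<^sub>0 complex)" where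
  "emT t = proj (SOME f. f \<in> carrier F \<and> t = Q.coset f)"

lemma coset_proj: "f \<in> carrier F \<Longrightarrow> g \<in> carrier F \<Longrightarrow> Q.coset f = Q.coset g \<longleftrightarrow> proj f = proj g"
  by (simp only: Q.coset_eq free_rep_minus proj_eq_iff)

lemma emT: "f \<in> carrier F \<Longrightarrow> emT (Q.coset f) = proj f"
proof -
  assume f: "f \<in> carrier F"
  let ?g = "SOME g. g \<in> carrier F \<and> Q.coset f = Q.coset g"
  have g: "?g \<in> carrier F \<and> Q.coset f = Q.coset ?g" by (rule someI[of _ f]) (use f in \<open>simp only: simp_thms\<close>)
  then show "emT (Q.coset f) = proj f" unfolding emT_def using coset_proj[OF f, of ?g] by metis
qed

lemma emT_bij: "bij_betw emT (carrier T) Z"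
  unfolding bij_betw_def Q.quotient_carrier
proof
  show "inj_on emT (Q.coset ` carrier F)" by (rule inj_onI) (elim imageE, simp only: emT coset_proj)
  show "emT ` Q.coset ` carrier F = Z"
    unfolding proj_F[symmetric] image_image by (rule image_cong) (simp_all only: emT)
qed

lemma emT_linear:
  assumes "s \<in> carrier T" "t \<in> carrier T"
  shows "emT (s \<oplus>\<^bsub>T\<^esub> t) = emT s + emT t" "emT (r \<odot>\<^bsub>T\<^esub> s) = fscale r (emT s)"
    "s \<oplus>\<^bsub>T\<^esub> t \<in> carrier T" "r \<odot>\<^bsub>T\<^esub> s \<in> carrier T"
proof -
  obtain f g where fg: "f \<in> carrier F" "g \<in> carrier F" "s = Q.coset f" "t = Q.coset g"
    using assms unfolding Q.quotient_carrier by blast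
  have c: "f + g \<in> carrier F" "fscale r f \<in> carrier F"
    using free_vs.subspace_add[OF F_subspace fg(1,2)] free_vs.subspace_scale[OF F_subspace fg(1)] by blast+
  have q: "s \<oplus>\<^bsub>T\<^esub> t = Q.coset (f + g)" "r \<odot>\<^bsub>T\<^esub> s = Q.coset (fscale r f)"
    unfolding fg(3,4) Q.quotient_add[OF fg(1,2)] Q.quotient_smult[OF fg(1)] by simp_all
  show "emT (s \<oplus>\<^bsub>T\<^esub> t) = emT s + emT t" "emT (r \<odot>\<^bsub>T\<^esub> s) = fscale r (emT s)"
    unfolding q emT[OF c(1)] emT[OF c(2)] unfolding fg(3,4) emT[OF fg(1)] emT[OF fg(2)] by (rule proj)+
  show "s \<oplus>\<^bsub>T\<^esub> t \<in> carrier T" "r \<odot>\<^bsub>T\<^esub> s \<in> carrier T"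
    unfolding q Q.quotient_carrier using c by blast+
qed

abbreviation action_generators :: "'g affvir set" where
  "action_generators \<equiv> {cur m x | m x. True} \<union> range vir \<union> {cen_k, cen_c}"

text \<open>The case distinction is necessary: \<open>cur m 0\<close> is the zero element and acts by 0 on the free vector space,
  whereas \<open>cur_action V W m 0\<close> is zero only modulo \<open>S\<close>.\<close>

lemma tensor_action_simps:
  "tensor_action V W l k c a b (cur m x) e = (if x = 0 then 0 else cur_action V W m x e)"
  "tensor_action V W l k c a b (vir m) e = vir_action V l a b m e"
  "tensor_action V W l k c a b cen_k e = fscale k (basis_vec e)"
  "tensor_action V W l k c a b cen_c e = fscale c (basis_vec e)"
  by (simp_all add: tensor_action_def cur_def vir_def cen_k_def cen_c_def del: single_one)

definition projected_action :: "'g affvir \<Rightarrow> 'v \<times> 'w \<times> int \<Rightarrow> ('v \<times> 'w \<times> int \<Rightarrow>\<^sub>0 complex)" where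
  "projected_action x e = proj (tensor_action V W l k c a b x e)"

text \<open>The first factor of \<open>d\<^sub>m (v \<otimes> w \<otimes> t\<^sup>n)\<close>.\<close>

definition vir_shift :: "int \<Rightarrow> int \<Rightarrow> 'v \<Rightarrow> 'v" where
  "vir_shift m n v = (act V (vir m) v \<oplus>\<^bsub>V\<^esub> (a + of_int n + b * of_int m) \<odot>\<^bsub>V\<^esub> v) \<ominus>\<^bsub>V\<^esub> degree_op V l v"

lemma cur_zero_act: "v \<in> carrier V \<Longrightarrow> act V (cur m 0) v = \<zero>\<^bsub>V\<^esub>" "w \<in> carrier W \<Longrightarrow> act W 0 w = \<zero>\<^bsub>W\<^esub>"
proof -
  have cur0: "cur m (0::'g) = 0" by (simp add: cur_def zero_prod_def)
  show "act V (cur m 0) v = \<zero>\<^bsub>V\<^esub>" if "v \<in> carrier V"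
    unfolding cur0 using V.zero_act[of "emV v"] that V.emb_eq_0_iff[of "act V 0 v"] by simp
  show "act W 0 w = \<zero>\<^bsub>W\<^esub>" if "w \<in> carrier W"
    using W.zero_act[of "emW w"] that W.emb_eq_0_iff[of "act W 0 w"] by simp
qed

lemma projected_action_simps:
  assumes "v \<in> carrier V" "w \<in> carrier W"
  shows "projected_action (cur m x) (v, w, n) = ten (act V (cur m x) v) w (m + n) + ten v (act W x w) (m + n)"
    "projected_action (vir m) (v, w, n) = ten (vir_shift m n v) w (m + n)"
    "projected_action cen_k (v, w, n) = fscale k (ten v w n)"
    "projected_action cen_c (v, w, n) = fscale c (ten v w n)"
  using assms
  by (auto simp: projected_action_def tensor_action_simps cur_action_def vir_action_def vir_shift_def proj(1,2)
      ten_def[symmetric] cur_zero_act ten_zero simp del: fscale_single)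

lemma vir_shift_in: "v \<in> carrier V \<Longrightarrow> vir_shift m n v \<in> carrier V"
  by (simp add: degree_op_def vir_shift_def)

lemma emV_vir_shift:
  "v \<in> carrier V \<Longrightarrow> emV (vir_shift m n v) = V.image_act (vir m) (emV v) + fscale (a + of_int n + b * of_int m + l) (emV v)
     - V.image_act (vir 0) (emV v)"
  by (simp add: vir_shift_def degree_op_def V.emb_diff V.emb_add V.emb_scale free_vs.scale_left_distrib)

lemma vir_shift_linear:
  assumes v: "v \<in> carrier V"
  shows "v' \<in> carrier V \<Longrightarrow> vir_shift m n (v \<oplus>\<^bsub>V\<^esub> v') = vir_shift m n v \<oplus>\<^bsub>V\<^esub> vir_shift m n v'"
    "vir_shift m n (r \<odot>\<^bsub>V\<^esub> v) = r \<odot>\<^bsub>V\<^esub> vir_shift m n v"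
proof -
  show "vir_shift m n (v \<oplus>\<^bsub>V\<^esub> v') = vir_shift m n v \<oplus>\<^bsub>V\<^esub> vir_shift m n v'" if v': "v' \<in> carrier V"
  proof -
    have "emV (vir_shift m n (v \<oplus>\<^bsub>V\<^esub> v')) = emV (vir_shift m n v) + emV (vir_shift m n v')"
      unfolding emV_vir_shift[OF v] emV_vir_shift[OF v'] emV_vir_shift[OF V.M.a_closed[OF v v']] V.emb_add[OF v v']
        V.act_add[OF imageI[OF v] imageI[OF v']] free_vs.scale_right_distrib by simp
    then have "emV (vir_shift m n (v \<oplus>\<^bsub>V\<^esub> v')) = emV (vir_shift m n v \<oplus>\<^bsub>V\<^esub> vir_shift m n v')"
      by (simp only: V.emb_add vir_shift_in v v')
    then show ?thesis by (simp only: V.emb_eq_iff vir_shift_in V.M.a_closed v v')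
  qed
  have "emV (vir_shift m n (r \<odot>\<^bsub>V\<^esub> v)) = fscale r (emV (vir_shift m n v))"
    unfolding emV_vir_shift[OF v] emV_vir_shift[OF V.smult_in[OF v]] V.emb_scale[OF v] V.act_scale[OF imageI[OF v]]
      free_vs.scale_right_distrib free_vs.scale_right_diff_distrib by (simp add: mult.commute)
  then have "emV (vir_shift m n (r \<odot>\<^bsub>V\<^esub> v)) = emV (r \<odot>\<^bsub>V\<^esub> vir_shift m n v)"
    by (simp only: V.emb_scale vir_shift_in v)
  then show "vir_shift m n (r \<odot>\<^bsub>V\<^esub> v) = r \<odot>\<^bsub>V\<^esub> vir_shift m n v"
    by (simp only: V.emb_eq_iff vir_shift_in V.smult_in v)
qed

lemma proj_action: "proj (lin_ext (tensor_action V W l k c a b x) f) = lin_ext (projected_action x) f"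
  by (simp add: proj_lin_ext_general projected_action_def[abs_def])

lemma action_generator_cases:
  assumes "x \<in> action_generators"
  obtains m y where "x = cur m y" | m where "x = vir m" | "x = cen_k" | "x = cen_c"
  using assms by blast

lemma projected_action_linear:
  assumes x: "x \<in> action_generators" and v: "v \<in> carrier V" and w: "w \<in> carrier W"
  shows "v' \<in> carrier V \<Longrightarrow> projected_action x (v \<oplus>\<^bsub>V\<^esub> v', w, n) = projected_action x (v, w, n) + projected_action x (v', w, n)"
    "projected_action x (r \<odot>\<^bsub>V\<^esub> v, w, n) = fscale r (projected_action x (v, w, n))"
    "w' \<in> carrier W \<Longrightarrow> projected_action x (v, w \<oplus>\<^bsub>W\<^esub> w', n) = projected_action x (v, w, n) + projected_action x (v, w', n)"
    "projected_action x (v, r \<odot>\<^bsub>W\<^esub> w, n) = fscale r (projected_action x (v, w, n))"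
proof -
  note [simp] = projected_action_simps V.lie_mod_axioms(1,2) W.lie_mod_axioms(1,2) ten_bilinear
    vir_shift_in vir_shift_linear free_vs.scale_right_distrib mult.commute V.M.a_closed W.M.a_closed
    V.smult_in W.smult_in
  show "projected_action x (v \<oplus>\<^bsub>V\<^esub> v', w, n) = projected_action x (v, w, n) + projected_action x (v', w, n)" if "v' \<in> carrier V"
    using x by (cases rule: action_generator_cases) (use v w that in simp_all)
  show "projected_action x (r \<odot>\<^bsub>V\<^esub> v, w, n) = fscale r (projected_action x (v, w, n))"
    using x by (cases rule: action_generator_cases) (use v w in simp_all)
  show "projected_action x (v, w \<oplus>\<^bsub>W\<^esub> w', n) = projected_action x (v, w, n) + projected_action x (v, w', n)" if "w' \<in> carrier W"
    using x by (cases rule: action_generator_cases) (use v w that in simp_all)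
  show "projected_action x (v, r \<odot>\<^bsub>W\<^esub> w, n) = fscale r (projected_action x (v, w, n))"
    using x by (cases rule: action_generator_cases) (use v w in simp_all)
qed

text \<open>The universal property of the tensor product, in one direction.\<close>

lemma lin_ext_relations:
  assumes \<alpha>: "\<And>v v' w n. v \<in> carrier V \<Longrightarrow> v' \<in> carrier V \<Longrightarrow> w \<in> carrier W \<Longrightarrow> \<alpha> (v \<oplus>\<^bsub>V\<^esub> v', w, n) = \<alpha> (v, w, n) + \<alpha> (v', w, n)"
    "\<And>v w r n. v \<in> carrier V \<Longrightarrow> w \<in> carrier W \<Longrightarrow> \<alpha> (r \<odot>\<^bsub>V\<^esub> v, w, n) = fscale r (\<alpha> (v, w, n))"
    "\<And>v w w' n. v \<in> carrier V \<Longrightarrow> w \<in> carrier W \<Longrightarrow> w' \<in> carrier W \<Longrightarrow> \<alpha> (v, w \<oplus>\<^bsub>W\<^esub> w', n) = \<alpha> (v, w, n) + \<alpha> (v, w', n)"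
    "\<And>v w r n. v \<in> carrier V \<Longrightarrow> w \<in> carrier W \<Longrightarrow> \<alpha> (v, r \<odot>\<^bsub>W\<^esub> w, n) = fscale r (\<alpha> (v, w, n))"
    and f: "f \<in> S"
  shows "lin_ext \<alpha> f = 0"
  using f
proof (induction rule: free_vs.span_induct_alt)
  case (step r g h)
  have "lin_ext \<alpha> g = 0"
    using step(1) unfolding tensor_relations_def
    by (elim UnE CollectE exE conjE) (simp_all add: lin_ext_diff lin_ext_scale \<alpha> del: fscale_single)
  then show ?case using step(2) by (simp add: lin_ext_add lin_ext_scale)
qed simp

lemma projected_action_stable:
  assumes x: "x \<in> action_generators" and f: "f \<in> S"
  shows "lin_ext (projected_action x) f = 0"
  by (rule lin_ext_relations[OF projected_action_linear[OF x] f])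

lemma tensor_action_closed:
  assumes f: "f \<in> carrier F"
  shows "lin_ext (tensor_action V W l k c a b x) f \<in> carrier F"
proof (rule lin_ext_in_subspace[OF F_subspace])
  fix e assume "e \<in> Poly_Mapping.keys f"
  then obtain v w n where e: "e = (v, w, n)" "v \<in> carrier V" "w \<in> carrier W" using f by auto
  obtain p q \<kappa> \<gamma> where x: "x = (p, q, \<kappa>, \<gamma>)" by (cases x)
  have b: "basis_vec (v', w', n') \<in> carrier F" if "v' \<in> carrier V" "w' \<in> carrier W" for v' w' n'
    using that by (rule basis_in_F)
  note sub = free_vs.subspace_add[OF F_subspace] free_vs.subspace_sum[OF F_subspace] free_vs.subspace_scale[OF F_subspace]
  have cv: "cur_action V W m y e \<in> carrier F" "vir_action V l a b m e \<in> carrier F" "basis_vec e \<in> carrier F" for m y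
    unfolding cur_action_def vir_action_def e(1) prod.case vir_shift_def[symmetric]
    by (intro sub(1) b V.act_in W.act_in vir_shift_in e(2,3))+
  have eq: "tensor_action V W l k c a b x e =
      (\<Sum>m\<in>Poly_Mapping.keys p. cur_action V W m (Poly_Mapping.lookup p m) e) +
      (\<Sum>m\<in>Poly_Mapping.keys q. fscale (Poly_Mapping.lookup q m) (vir_action V l a b m e)) +
      fscale (\<kappa> * k + \<gamma> * c) (basis_vec e)"
    by (simp only: tensor_action_def x prod.case)
  show "tensor_action V W l k c a b x e \<in> carrier F"
    unfolding eq by (intro sub cv)
qed

lemma emT_act:
  assumes x: "x \<in> action_generators" and f: "f \<in> carrier F"
  shows "emT (act T x (Q.coset f)) = lin_ext (projected_action x) f" "act T x (Q.coset f) \<in> carrier T"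
proof -
  have "act T x (Q.coset f) = Q.coset (act F x f)"
  proof (rule Q.quotient_act[OF f])
    show "act F x v \<in> carrier F" if "v \<in> carrier F" for v
      unfolding free_rep_simps(5) by (rule tensor_action_closed[OF that])
    show "act F x v \<in> S" if "v \<in> S" for v
      unfolding free_rep_simps(5) proj(3)[symmetric] proj_action by (rule projected_action_stable[OF x that])
  qed (simp only: free_rep_simps lin_ext_add)
  then have *: "act T x (Q.coset f) = Q.coset (lin_ext (tensor_action V W l k c a b x) f)" by simp
  show "act T x (Q.coset f) \<in> carrier T"
    unfolding * Q.quotient_carrier by (rule imageI) (rule tensor_action_closed[OF f])
  show "emT (act T x (Q.coset f)) = lin_ext (projected_action x) f"
    unfolding * emT[OF tensor_action_closed[OF f]] by (rule proj_action)
qed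

text \<open>The action on \<open>T\<close> transported to \<open>Z\<close>. It is used only for the generators \<open>x(m)\<close>, \<open>d\<^sub>m\<close> and the central
  elements.\<close>

definition actZ :: "'g affvir \<Rightarrow> ('v \<times> 'w \<times> int \<Rightarrow>\<^sub>0 complex) \<Rightarrow> ('v \<times> 'w \<times> int \<Rightarrow>\<^sub>0 complex)" where
  "actZ x z = lin_ext (projected_action x) (SOME f. f \<in> carrier F \<and> proj f = z)"

lemma actZ_proj:
  assumes "x \<in> action_generators" "f \<in> carrier F"
  shows "actZ x (proj f) = lin_ext (projected_action x) f"
proof -
  let ?g = "SOME g. g \<in> carrier F \<and> proj g = proj f"
  have g: "?g \<in> carrier F \<and> proj ?g = proj f" by (rule someI[of _ f]) (use assms(2) in \<open>simp only: simp_thms\<close>)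
  then have "?g - f \<in> S" by (simp only: proj_eq_iff)
  then have "lin_ext (projected_action x) (?g - f) = 0" by (rule projected_action_stable[OF assms(1)])
  then show ?thesis by (simp add: actZ_def lin_ext_diff)
qed

lemma actZ_ten:
  assumes "v \<in> carrier V" "w \<in> carrier W"
  shows "actZ (cur m x) (ten v w n) = ten (act V (cur m x) v) w (m + n) + ten v (act W x w) (m + n)"
    "actZ (vir m) (ten v w n) = ten (vir_shift m n v) w (m + n)"
    "actZ cen_k (ten v w n) = fscale k (ten v w n)"
    "actZ cen_c (ten v w n) = fscale c (ten v w n)"
proof -
  have b: "basis_vec (v, w, n) \<in> carrier F" using assms by (rule basis_in_F)
  have *: "actZ x (ten v w n) = projected_action x (v, w, n)" if "x \<in> action_generators" for x
    unfolding ten_def actZ_proj[OF that b] by simp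
  show "actZ (cur m x) (ten v w n) = ten (act V (cur m x) v) w (m + n) + ten v (act W x w) (m + n)"
    by (subst *) (use assms in \<open>auto simp: projected_action_simps\<close>)
  show "actZ (vir m) (ten v w n) = ten (vir_shift m n v) w (m + n)"
    by (subst *) (use assms in \<open>auto simp: projected_action_simps\<close>)
  show "actZ cen_k (ten v w n) = fscale k (ten v w n)"
    by (subst *) (use assms in \<open>auto simp: projected_action_simps\<close>)
  show "actZ cen_c (ten v w n) = fscale c (ten v w n)"
    by (subst *) (use assms in \<open>auto simp: projected_action_simps\<close>)
qed

lemma actZ_in: "x \<in> action_generators \<Longrightarrow> z \<in> Z \<Longrightarrow> actZ x z \<in> Z"
proof -
  assume gen: "x \<in> action_generators" and z: "z \<in> Z"
  obtain f where f: "f \<in> carrier F" "z = proj f" using z unfolding proj_F[symmetric] by blast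
  show ?thesis unfolding f(2) actZ_proj[OF gen f(1)] proj_action[symmetric] proj_F[symmetric]
    by (rule imageI) (rule tensor_action_closed[OF f(1)])
qed

lemma actZ_linear:
  assumes x: "x \<in> action_generators" and z: "z \<in> Z" and y: "y \<in> Z"
  shows "actZ x (fscale r z + y) = fscale r (actZ x z) + actZ x y"
proof -
  obtain f g where fg: "f \<in> carrier F" "g \<in> carrier F" "z = proj f" "y = proj g"
    using z y unfolding proj_F[symmetric] by blast
  have "fscale r f + g \<in> carrier F"
    using free_vs.subspace_add[OF F_subspace free_vs.subspace_scale[OF F_subspace fg(1)] fg(2)] .
  from actZ_proj[OF x this] show ?thesis
    unfolding fg(3,4) proj actZ_proj[OF x fg(1)] actZ_proj[OF x fg(2)] lin_ext_add lin_ext_scale .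
qed

lemma emT_actZ:
  assumes x: "x \<in> action_generators" and t: "t \<in> carrier T"
  shows "emT (act T x t) = actZ x (emT t)" "act T x t \<in> carrier T"
proof -
  obtain f where f: "f \<in> carrier F" "t = Q.coset f" using t unfolding Q.quotient_carrier by blast
  show "emT (act T x t) = actZ x (emT t)"
    unfolding f(2) emT[OF f(1)] emT_act[OF x f(1)] actZ_proj[OF x f(1)] ..
  show "act T x t \<in> carrier T" unfolding f(2) by (rule emT_act[OF x f(1)])
qed

section \<open>Coordinates in the tensor product\<close>

definition V_basis :: "('v \<Rightarrow>\<^sub>0 complex) set" where
  "V_basis = (SOME B. B \<subseteq> V.image_space \<and> free_vs.independent B \<and> V.image_space \<subseteq> free_span B)"

lemma V_basis: "V_basis \<subseteq> V.image_space" "free_vs.independent V_basis" "V.image_space \<subseteq> free_span V_basis"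
proof -
  obtain B where "B \<subseteq> V.image_space" "free_vs.independent B" "V.image_space \<subseteq> free_span B"
    by (rule free_vs.maximal_independent_subset)
  then have "\<exists>B. B \<subseteq> V.image_space \<and> free_vs.independent B \<and> V.image_space \<subseteq> free_span B" by blast
  from someI_ex[OF this] show "V_basis \<subseteq> V.image_space" "free_vs.independent V_basis" "V.image_space \<subseteq> free_span V_basis"
    by (simp_all add: V_basis_def)
qed

definition coordV :: "('v \<Rightarrow>\<^sub>0 complex) \<Rightarrow> ('v \<Rightarrow>\<^sub>0 complex) \<Rightarrow> complex" where
  "coordV \<beta> x = free_vs.representation V_basis x \<beta>"

lemma emV_span: "v \<in> carrier V \<Longrightarrow> emV v \<in> free_span V_basis"
  using V_basis(3) by auto

lemma coordV_linear:
  "x \<in> free_span V_basis \<Longrightarrow> y \<in> free_span V_basis \<Longrightarrow> coordV \<beta> (x + y) = coordV \<beta> x + coordV \<beta> y"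
  "x \<in> free_span V_basis \<Longrightarrow> coordV \<beta> (fscale r x) = r * coordV \<beta> x"
  using V_basis(2) by (simp_all add: coordV_def free_vs.representation_add free_vs.representation_scale)

lemma coordV_basis: "\<beta> \<in> V_basis \<Longrightarrow> \<gamma> \<in> V_basis \<Longrightarrow> coordV \<beta> \<gamma> = (if \<beta> = \<gamma> then 1 else 0)"
  using V_basis(2) by (simp add: coordV_def free_vs.representation_basis)

lemma coordV_finite: "finite {\<beta>. coordV \<beta> x \<noteq> 0}"
  by (simp add: coordV_def free_vs.finite_representation)

lemma coordV_nonzero: "coordV \<beta> x \<noteq> 0 \<Longrightarrow> \<beta> \<in> V_basis"
  by (simp add: coordV_def free_vs.representation_ne_zero)

lemma coordV_expand:
  assumes "x \<in> free_span V_basis" "finite B" "{\<beta>. coordV \<beta> x \<noteq> 0} \<subseteq> B"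
  shows "x = (\<Sum>\<beta>\<in>B. fscale (coordV \<beta> x) \<beta>)"
proof -
  have "x = (\<Sum>\<beta> | coordV \<beta> x \<noteq> 0. fscale (coordV \<beta> x) \<beta>)"
    unfolding coordV_def using free_vs.sum_nonzero_representation_eq[OF V_basis(2) assms(1)] by simp
  also have "\<dots> = (\<Sum>\<beta>\<in>B. fscale (coordV \<beta> x) \<beta>)"
    by (rule sum.mono_neutral_left) (use assms(2,3) in auto)
  finally show ?thesis .
qed

definition coord_elem :: "('v \<Rightarrow>\<^sub>0 complex) \<Rightarrow> int \<Rightarrow> 'v \<times> 'w \<times> int \<Rightarrow> ('w \<Rightarrow>\<^sub>0 complex)" where
  "coord_elem \<beta> n = (\<lambda>(v, w, m). if m = n then fscale (coordV \<beta> (emV v)) (emW w) else 0)"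

lemma coord_elem_relations: "f \<in> S \<Longrightarrow> lin_ext (coord_elem \<beta> n) f = 0"
  by (rule lin_ext_relations)
    (auto simp: coord_elem_def V.emb_add V.emb_scale W.emb_add W.emb_scale coordV_linear emV_span
      free_vs.scale_left_distrib free_vs.scale_right_distrib mult.commute)

text \<open>With respect to the basis of the first factor and the powers of \<open>t\<close>, a vector of the tensor product has
  coordinates in the second factor.\<close>

definition tcoord :: "('v \<Rightarrow>\<^sub>0 complex) \<Rightarrow> int \<Rightarrow> ('v \<times> 'w \<times> int \<Rightarrow>\<^sub>0 complex) \<Rightarrow> ('w \<Rightarrow>\<^sub>0 complex)" where
  "tcoord \<beta> n z = lin_ext (coord_elem \<beta> n) (SOME f. f \<in> carrier F \<and> proj f = z)"

lemma tcoord_proj: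
  assumes "f \<in> carrier F"
  shows "tcoord \<beta> n (proj f) = lin_ext (coord_elem \<beta> n) f"
proof -
  let ?g = "SOME g. g \<in> carrier F \<and> proj g = proj f"
  have g: "?g \<in> carrier F \<and> proj ?g = proj f" by (rule someI[of _ f]) (use assms in \<open>simp only: simp_thms\<close>)
  then have "?g - f \<in> S" by (simp only: proj_eq_iff)
  then have "lin_ext (coord_elem \<beta> n) (?g - f) = 0" by (rule coord_elem_relations)
  then show ?thesis by (simp add: tcoord_def lin_ext_diff)
qed

lemma tcoord_ten:
  "v \<in> carrier V \<Longrightarrow> w \<in> carrier W \<Longrightarrow>
    tcoord \<beta> n (ten v w m) = (if m = n then fscale (coordV \<beta> (emV v)) (emW w) else 0)"
  unfolding ten_def tcoord_proj[OF basis_in_F] by (simp add: coord_elem_def)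

lemma tcoord_linear:
  assumes z: "z \<in> Z" and y: "y \<in> Z"
  shows "tcoord \<beta> n (fscale r z + y) = fscale r (tcoord \<beta> n z) + tcoord \<beta> n y"
proof -
  obtain f g where fg: "f \<in> carrier F" "g \<in> carrier F" "z = proj f" "y = proj g"
    using z y unfolding proj_F[symmetric] by blast
  have "fscale r f + g \<in> carrier F"
    using free_vs.subspace_add[OF F_subspace free_vs.subspace_scale[OF F_subspace fg(1)] fg(2)] .
  from tcoord_proj[OF this] show ?thesis
    unfolding fg(3,4) proj tcoord_proj[OF fg(1)] tcoord_proj[OF fg(2)] lin_ext_add lin_ext_scale .
qed

lemma tcoord_0: "tcoord \<beta> n 0 = 0"
  using tcoord_proj[of 0 \<beta> n] by simp

lemma tcoord_scale: "z \<in> Z \<Longrightarrow> tcoord \<beta> n (fscale r z) = fscale r (tcoord \<beta> n z)"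
  using tcoord_linear[of z 0] free_vs.subspace_0[OF Z_subspace] tcoord_0 by simp

lemma tcoord_diff: "z \<in> Z \<Longrightarrow> y \<in> Z \<Longrightarrow> tcoord \<beta> n (z - y) = tcoord \<beta> n z - tcoord \<beta> n y"
  using tcoord_linear[of y z \<beta> n "- 1"] by simp

lemma Z_induct [consumes 1, case_names zero step]:
  assumes "z \<in> Z" "P 0"
    "\<And>r v w n y. v \<in> carrier V \<Longrightarrow> w \<in> carrier W \<Longrightarrow> y \<in> Z \<Longrightarrow> P y \<Longrightarrow> P (fscale r (ten v w n) + y)"
  shows "P z"
proof -
  have "z \<in> Z \<and> P z"
    using assms(1) unfolding Z_def
  proof (induction rule: free_vs.span_induct_alt)
    case base
    then show ?case using assms(2) by (simp add: free_vs.span_zero)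
  next
    case (step r x y)
    then obtain v w n where x: "x = ten v w n" "v \<in> carrier V" "w \<in> carrier W" by blast
    show ?case
      using step assms(3)[OF x(2,3), of y r n] ten_in_Z[OF x(2,3)] free_vs.subspace_add[OF Z_subspace]
        free_vs.subspace_scale[OF Z_subspace] unfolding x(1) Z_def[symmetric] by blast
  qed
  then show ?thesis by simp
qed

lemma tcoord_in: "z \<in> Z \<Longrightarrow> tcoord \<beta> n z \<in> W.image_space"
proof (induction rule: Z_induct)
  case zero
  show ?case using free_vs.subspace_0[OF W.X] by (simp add: tcoord_0)
next
  case (step r v w m y)
  have "tcoord \<beta> n (ten v w m) \<in> W.image_space"
    using step free_vs.subspace_0[OF W.X] free_vs.subspace_scale[OF W.X] by (simp add: tcoord_ten)
  then show ?case using step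
    by (simp add: tcoord_linear ten_in_Z free_vs.subspace_add[OF W.X] free_vs.subspace_scale[OF W.X])
qed

lemma tcoord_finite: "z \<in> Z \<Longrightarrow> finite {\<beta>. tcoord \<beta> n z \<noteq> 0}"
proof (induction rule: Z_induct)
  case (step r v w m y)
  have "{\<beta>. tcoord \<beta> n (fscale r (ten v w m) + y) \<noteq> 0} \<subseteq> {\<beta>. coordV \<beta> (emV v) \<noteq> 0} \<union> {\<beta>. tcoord \<beta> n y \<noteq> 0}"
    using step by (auto simp: tcoord_linear ten_in_Z tcoord_ten)
  then show ?case using step(4) coordV_finite by (meson finite_UnI finite_subset)
qed (simp add: tcoord_0)

lemma tcoord_nonzero_basis: "z \<in> Z \<Longrightarrow> \<beta> \<notin> V_basis \<Longrightarrow> tcoord \<beta> n z = 0"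
proof (induction rule: Z_induct)
  case (step r v w m y)
  then show ?case using coordV_nonzero[of \<beta> "emV v"] by (auto simp: tcoord_linear ten_in_Z tcoord_ten)
qed (simp add: tcoord_0)

text \<open>Modes of large degree act on the coordinates through the second factor alone.\<close>

lemma tcoord_large:
  "z \<in> Z \<Longrightarrow> \<exists>N. \<forall>m\<ge>N. \<forall>x \<beta> n. tcoord \<beta> (m + n) (actZ (cur m x) z) = W.image_act x (tcoord \<beta> n z)"
proof (induction rule: Z_induct)
  case zero
  have "actZ (cur m x) 0 = 0" for m x
    using actZ_linear[of "cur m x" 0 0 "- 1"] free_vs.subspace_0[OF Z_subspace] by auto
  then show ?case by (simp add: tcoord_0)
next
  case (step r v w n' y)
  obtain N1 where N1: "\<forall>m\<ge>N1. \<forall>x. act V (cur m x) v = \<zero>\<^bsub>V\<^esub>" using locally_nilpotent[OF step(1)] by blast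
  obtain N2 where N2: "\<forall>m\<ge>N2. \<forall>x \<beta> n. tcoord \<beta> (m + n) (actZ (cur m x) y) = W.image_act x (tcoord \<beta> n y)"
    using step by blast
  show ?case
  proof (intro exI[of _ "max N1 N2"] allI impI)
    fix m x \<beta> n assume m: "max N1 N2 \<le> m"
    have gen: "cur m x \<in> action_generators" by auto
    have t: "actZ (cur m x) (ten v w n') = ten v (act W x w) (m + n')"
      using step(1,2) N1 m by (simp add: actZ_ten ten_zero)
    have tZ: "ten v w n' \<in> Z" "ten v (act W x w) (m + n') \<in> Z" using step by (auto intro: ten_in_Z)
    have yZ: "actZ (cur m x) y \<in> Z" by (rule actZ_in[OF gen step(3)])
    have "tcoord \<beta> (m + n) (actZ (cur m x) (fscale r (ten v w n') + y)) =
        fscale r (tcoord \<beta> (m + n) (ten v (act W x w) (m + n'))) + W.image_act x (tcoord \<beta> n y)"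
      unfolding actZ_linear[OF gen tZ(1) step(3)] t tcoord_linear[OF tZ(2) yZ] using N2 m by simp
    also have "tcoord \<beta> (m + n) (ten v (act W x w) (m + n')) = W.image_act x (tcoord \<beta> n (ten v w n'))"
      using step by (auto simp: tcoord_ten W.act_scale)
    also have "fscale r \<dots> + W.image_act x (tcoord \<beta> n y) = W.image_act x (tcoord \<beta> n (fscale r (ten v w n') + y))"
      using tcoord_in[OF tZ(1)] tcoord_in[OF step(3)]
      by (simp add: tcoord_linear[OF tZ(1) step(3)] W.act_add W.act_scale free_vs.subspace_scale[OF W.X])
    finally show "tcoord \<beta> (m + n) (actZ (cur m x) (fscale r (ten v w n') + y)) =
        W.image_act x (tcoord \<beta> n (fscale r (ten v w n') + y))" .
  qed
qed

lemma vir_shift_0: "v \<in> carrier V \<Longrightarrow> vir_shift 0 n v = (l + a + of_int n) \<odot>\<^bsub>V\<^esub> v"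
proof -
  assume v: "v \<in> carrier V"
  have "emV (vir_shift 0 n v) = emV ((l + a + of_int n) \<odot>\<^bsub>V\<^esub> v)"
    unfolding emV_vir_shift[OF v] V.emb_scale[OF v] by (simp add: algebra_simps)
  then show ?thesis by (simp only: V.emb_eq_iff vir_shift_in V.smult_in v)
qed

text \<open>The degree operator has been subtracted in the action of \<open>d\<^sub>0\<close>, so its eigenvalue depends only on the
  power of \<open>t\<close>.\<close>

lemma tcoord_vir0: "z \<in> Z \<Longrightarrow> tcoord \<beta> n (actZ (vir 0) z) = fscale (l + a + of_int n) (tcoord \<beta> n z)"
proof -
  have gen: "vir 0 \<in> action_generators" by auto
  assume "z \<in> Z"
  then have "actZ (vir 0) z \<in> Z \<and> tcoord \<beta> n (actZ (vir 0) z) = fscale (l + a + of_int n) (tcoord \<beta> n z)"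
  proof (induction rule: Z_induct)
    case zero
    have "actZ (vir 0) 0 = 0"
      using actZ_linear[OF gen, of 0 0 "- 1"] free_vs.subspace_0[OF Z_subspace] by auto
    then show ?case using free_vs.subspace_0[OF Z_subspace] by (simp add: tcoord_0)
  next
    case (step r v w m y)
    have t: "actZ (vir 0) (ten v w m) = fscale (l + a + of_int m) (ten v w m)"
      using step by (simp add: actZ_ten vir_shift_0 ten_bilinear)
    have tZ: "ten v w m \<in> Z" "fscale (l + a + of_int m) (ten v w m) \<in> Z"
      using step ten_in_Z free_vs.subspace_scale[OF Z_subspace] by auto
    have yZ: "actZ (vir 0) y \<in> Z" using step by simp
    have "tcoord \<beta> n (fscale (l + a + of_int m) (ten v w m)) = fscale (l + a + of_int n) (tcoord \<beta> n (ten v w m))"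
      using step by (simp add: tcoord_scale[OF tZ(1)] tcoord_ten)
    then show ?case
      using step(4) free_vs.subspace_add[OF Z_subspace free_vs.subspace_scale[OF Z_subspace tZ(2)] yZ]
      by (simp only: actZ_linear[OF gen tZ(1) step(3)] t tcoord_linear[OF tZ(2) yZ] tcoord_linear[OF tZ(1) step(3)]
          free_vs.scale_right_distrib free_vs.scale_left_commute simp_thms)
  qed
  then show ?thesis by simp
qed

abbreviation "invV \<equiv> the_inv_into (carrier V) emV"
abbreviation "invW \<equiv> the_inv_into (carrier W) emW"

lemma invV: "v \<in> carrier V \<Longrightarrow> invV (emV v) = v" and invW: "w \<in> carrier W \<Longrightarrow> invW (emW w) = w"
  by (simp_all add: the_inv_into_f_f V.inj W.inj)

lemma additive_sum:
  assumes X: "free_vs.subspace X"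
    and h: "\<And>x y. x \<in> X \<Longrightarrow> y \<in> X \<Longrightarrow> h (x + y) = h x + h y" "\<And>r x. x \<in> X \<Longrightarrow> h (fscale r x) = fscale r (h x)"
    and f: "\<And>i. i \<in> I \<Longrightarrow> f i \<in> X"
  shows "h (\<Sum>i\<in>I. fscale (r i) (f i)) = (\<Sum>i\<in>I. fscale (r i) (h (f i)))"
proof -
  have h0: "h 0 = 0" using h(2)[of 0 0] free_vs.subspace_0[OF X] by simp
  show ?thesis
    using f
  proof (induction I rule: infinite_finite_induct)
    case (insert i I)
    have "(\<Sum>i\<in>I. fscale (r i) (f i)) \<in> X" using insert by (intro free_vs.subspace_sum[OF X] free_vs.subspace_scale[OF X]) auto
    then show ?case using insert by (simp add: h free_vs.subspace_scale[OF X])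
  qed (simp_all add: h0)
qed

lemma ten_expand:
  assumes v: "v \<in> carrier V" and w: "w \<in> carrier W" and B: "finite B" "{\<beta>. coordV \<beta> (emV v) \<noteq> 0} \<subseteq> B" "B \<subseteq> V_basis"
  shows "ten v w n = (\<Sum>\<beta>\<in>B. fscale (coordV \<beta> (emV v)) (ten (invV \<beta>) w n))"
proof -
  define h where "h x = ten (invV x) w n" for x
  have "h (\<Sum>\<beta>\<in>B. fscale (coordV \<beta> (emV v)) \<beta>) = (\<Sum>\<beta>\<in>B. fscale (coordV \<beta> (emV v)) (h \<beta>))"
  proof (rule additive_sum[OF V.X])
    fix x y assume "x \<in> V.image_space" "y \<in> V.image_space"
    then obtain p q where "p \<in> carrier V" "q \<in> carrier V" "x = emV p" "y = emV q" by blast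
    then show "h (x + y) = h x + h y"
      using invV[of "p \<oplus>\<^bsub>V\<^esub> q"] w by (simp add: h_def invV ten_bilinear V.emb_add)
  next
    fix r x assume "x \<in> V.image_space"
    then obtain p where "p \<in> carrier V" "x = emV p" by blast
    then show "h (fscale r x) = fscale r (h x)"
      using invV[of "r \<odot>\<^bsub>V\<^esub> p"] w by (simp add: h_def invV ten_bilinear V.emb_scale)
  qed (use B(3) V_basis(1) in auto)
  moreover have "(\<Sum>\<beta>\<in>B. fscale (coordV \<beta> (emV v)) \<beta>) = emV v"
    using coordV_expand[OF emV_span[OF v] B(1,2)] by simp
  ultimately show ?thesis using v by (simp add: h_def invV)
qed

text \<open>A vector is recovered from its coordinates as the sum of the tensors of \<open>\<beta>\<close>, the coordinate and
  \<open>t\<^sup>n\<close>, extended over the finitely many \<open>\<beta>\<close> and \<open>n\<close> that occur in a representative.\<close>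

lemma tcoord_injective:
  assumes z: "z \<in> Z" and zero: "\<And>\<beta> n. tcoord \<beta> n z = 0"
  shows "z = 0"
proof -
  obtain f where f: "f \<in> carrier F" "z = proj f" using z unfolding proj_F[symmetric] by blast
  define B where "B = (\<Union>(v, w, n)\<in>Poly_Mapping.keys f. {\<beta>. coordV \<beta> (emV v) \<noteq> 0})"
  define M where "M = (\<lambda>(v, w, n). n) ` Poly_Mapping.keys f"
  have fin: "finite B" "finite M" unfolding B_def M_def using coordV_finite by auto
  have BV: "B \<subseteq> V_basis" unfolding B_def using coordV_nonzero by auto
  define P where "P \<beta> n y = ten (invV \<beta>) (invW y) n" for \<beta> n y
  have \<beta>V: "invV \<beta> \<in> carrier V" if b: "\<beta> \<in> V_basis" for \<beta>
  proof -
    obtain v where "v \<in> carrier V" "\<beta> = emV v" using subsetD[OF V_basis(1) b] by (elim imageE)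
    then show ?thesis by (simp add: invV)
  qed
  have P: "P \<beta> n (x + y) = P \<beta> n x + P \<beta> n y" "P \<beta> n (fscale r x) = fscale r (P \<beta> n x)"
    if xy: "x \<in> W.image_space" "y \<in> W.image_space" "\<beta> \<in> V_basis" for \<beta> n x y r
  proof -
    obtain p q where pq: "p \<in> carrier W" "q \<in> carrier W" "x = emW p" "y = emW q"
      using xy(1,2) by (elim imageE)
    show "P \<beta> n (x + y) = P \<beta> n x + P \<beta> n y"
      using invW[of "p \<oplus>\<^bsub>W\<^esub> q"] pq \<beta>V[OF xy(3)] by (simp add: P_def invW ten_bilinear W.emb_add)
    show "P \<beta> n (fscale r x) = fscale r (P \<beta> n x)"
      using invW[of "r \<odot>\<^bsub>W\<^esub> p"] pq \<beta>V[OF xy(3)] by (simp add: P_def invW ten_bilinear W.emb_scale)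
  qed
  have W0: "0 \<in> W.image_space" using free_vs.subspace_0[OF W.X] .
  have P0: "P \<beta> n 0 = 0" if "\<beta> \<in> V_basis" for \<beta> n using P(2)[OF W0 W0 that, of n 0] by simp
  have elem: "(case e of (v, w, n) \<Rightarrow> ten v w n) = (\<Sum>\<beta>\<in>B. \<Sum>n\<in>M. P \<beta> n (coord_elem \<beta> n e))"
    and elem_in: "coord_elem \<beta> n e \<in> W.image_space" if e: "e \<in> Poly_Mapping.keys f" for e \<beta> n
  proof -
    obtain v w m where vw: "e = (v, w, m)" "v \<in> carrier V" "w \<in> carrier W" using e f(1) by auto
    have m: "m \<in> M" using e vw(1) by (force simp: M_def)
    have wX: "emW w \<in> W.image_space" using vw by simp
    show "coord_elem \<beta> n e \<in> W.image_space"
      using vw W0 free_vs.subspace_scale[OF W.X wX] by (simp add: coord_elem_def)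
    have "(\<Sum>n\<in>M. P \<beta> n (coord_elem \<beta> n e)) = fscale (coordV \<beta> (emV v)) (ten (invV \<beta>) w m)" if "\<beta> \<in> B" for \<beta>
    proof -
      have \<beta>: "\<beta> \<in> V_basis" using that BV by auto
      have "(\<Sum>n\<in>M. P \<beta> n (coord_elem \<beta> n e)) =
          (\<Sum>n\<in>M. if n = m then P \<beta> m (fscale (coordV \<beta> (emV v)) (emW w)) else 0)"
        by (intro sum.cong refl) (auto simp: vw coord_elem_def P0[OF \<beta>])
      also have "\<dots> = P \<beta> m (fscale (coordV \<beta> (emV v)) (emW w))" using fin m by simp
      also have "\<dots> = fscale (coordV \<beta> (emV v)) (ten (invV \<beta>) w m)"
        using P(2)[OF wX wX \<beta>] vw by (simp add: P_def invW)
      finally show ?thesis .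
    qed
    then have "(\<Sum>\<beta>\<in>B. \<Sum>n\<in>M. P \<beta> n (coord_elem \<beta> n e)) = (\<Sum>\<beta>\<in>B. fscale (coordV \<beta> (emV v)) (ten (invV \<beta>) w m))"
      by (rule sum.cong[OF refl])
    also have "\<dots> = ten v w m"
      by (rule ten_expand[OF vw(2,3) fin(1) _ BV, symmetric]) (use e vw(1) in \<open>auto simp: B_def\<close>)
    finally show "(case e of (v, w, n) \<Rightarrow> ten v w n) = (\<Sum>\<beta>\<in>B. \<Sum>n\<in>M. P \<beta> n (coord_elem \<beta> n e))"
      using vw(1) by simp
  qed
  have "z = (\<Sum>e\<in>Poly_Mapping.keys f. fscale (Poly_Mapping.lookup f e) (\<Sum>\<beta>\<in>B. \<Sum>n\<in>M. P \<beta> n (coord_elem \<beta> n e)))"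
    unfolding f(2) proj_lin_ext lin_ext_def by (rule sum.cong[OF refl]) (simp only: elem)
  also have "\<dots> = (\<Sum>e\<in>Poly_Mapping.keys f. \<Sum>\<beta>\<in>B. \<Sum>n\<in>M. fscale (Poly_Mapping.lookup f e) (P \<beta> n (coord_elem \<beta> n e)))"
    by (simp only: free_vs.scale_sum_right)
  also have "\<dots> = (\<Sum>\<beta>\<in>B. \<Sum>e\<in>Poly_Mapping.keys f. \<Sum>n\<in>M. fscale (Poly_Mapping.lookup f e) (P \<beta> n (coord_elem \<beta> n e)))"
    by (rule sum.swap)
  also have "\<dots> = (\<Sum>\<beta>\<in>B. \<Sum>n\<in>M. \<Sum>e\<in>Poly_Mapping.keys f. fscale (Poly_Mapping.lookup f e) (P \<beta> n (coord_elem \<beta> n e)))"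
    by (rule sum.cong[OF refl]) (rule sum.swap)
  also have "\<dots> = (\<Sum>\<beta>\<in>B. \<Sum>n\<in>M. P \<beta> n (tcoord \<beta> n z))"
  proof (intro sum.cong refl)
    fix \<beta> n assume "\<beta> \<in> B"
    then have \<beta>: "\<beta> \<in> V_basis" using BV by auto
    have "P \<beta> n (\<Sum>e\<in>Poly_Mapping.keys f. fscale (Poly_Mapping.lookup f e) (coord_elem \<beta> n e)) =
        (\<Sum>e\<in>Poly_Mapping.keys f. fscale (Poly_Mapping.lookup f e) (P \<beta> n (coord_elem \<beta> n e)))"
      by (rule additive_sum[OF W.X]) (use P \<beta> elem_in in auto)
    then show "(\<Sum>e\<in>Poly_Mapping.keys f. fscale (Poly_Mapping.lookup f e) (P \<beta> n (coord_elem \<beta> n e))) = P \<beta> n (tcoord \<beta> n z)"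
      unfolding f(2) tcoord_proj[OF f(1)] lin_ext_def by simp
  qed
  also have "\<dots> = 0" using BV by (intro sum.neutral ballI) (auto simp: zero P0)
  finally show ?thesis .
qed

lemma ten_eq_zero:
  assumes "v \<in> carrier V" "w \<in> carrier W" "w \<noteq> \<zero>\<^bsub>W\<^esub>" "ten v w n = 0"
  shows "v = \<zero>\<^bsub>V\<^esub>"
proof -
  have "fscale (coordV \<beta> (emV v)) (emW w) = 0" for \<beta>
    using tcoord_ten[OF assms(1,2), of \<beta> n n] assms(4) by (simp add: tcoord_0)
  moreover have "emW w \<noteq> 0" using assms(2,3) W.emb_eq_0_iff by simp
  ultimately have "coordV \<beta> (emV v) = 0" for \<beta> by (metis free_vs.scale_eq_0_iff)
  then have "emV v = 0" using coordV_expand[OF emV_span[OF assms(1)], of "{}"] by simp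
  then show ?thesis using assms(1) V.emb_eq_0_iff by simp
qed

lemma ten_cancel:
  assumes "v \<in> carrier V" "v' \<in> carrier V" "w \<in> carrier W" "w \<noteq> \<zero>\<^bsub>W\<^esub>" "ten v w n = ten v' w n"
  shows "v = v'"
proof -
  have "v \<ominus>\<^bsub>V\<^esub> v' \<in> carrier V" using assms by simp
  have e: "v \<ominus>\<^bsub>V\<^esub> v' \<oplus>\<^bsub>V\<^esub> v' = v" using assms by (simp add: a_minus_def V.M.a_assoc V.M.l_neg)
  then have "ten (v \<ominus>\<^bsub>V\<^esub> v') w n = 0"
    using ten_bilinear(1)[of "v \<ominus>\<^bsub>V\<^esub> v'" w v' n] assms by simp
  then have "v \<ominus>\<^bsub>V\<^esub> v' = \<zero>\<^bsub>V\<^esub>" using ten_eq_zero assms by simp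
  then show ?thesis using e assms by simp
qed

lemma pure_tensor:
  assumes z: "z \<in> Z" and w: "w \<in> carrier W" and off: "\<And>\<beta> n'. n' \<noteq> n \<Longrightarrow> tcoord \<beta> n' z = 0"
    and on: "\<And>\<beta>. \<exists>r. tcoord \<beta> n z = fscale r (emW w)"
  obtains v where "v \<in> carrier V" "z = ten v w n"
proof -
  define B where "B = {\<beta>. tcoord \<beta> n z \<noteq> 0}"
  have fin: "finite B" unfolding B_def by (rule tcoord_finite[OF z])
  have BV: "B \<subseteq> V_basis" unfolding B_def using tcoord_nonzero_basis[OF z] by auto
  have "\<exists>r. \<forall>\<beta>. tcoord \<beta> n z = fscale (r \<beta>) (emW w)" using on by metis
  then obtain r where r: "\<And>\<beta>. tcoord \<beta> n z = fscale (r \<beta>) (emW w)" by blast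
  define x where "x = (\<Sum>\<beta>\<in>B. fscale (r \<beta>) \<beta>)"
  have "x \<in> V.image_space" unfolding x_def
    using BV V_basis(1) by (intro free_vs.subspace_sum[OF V.X] free_vs.subspace_scale[OF V.X]) auto
  then obtain v where v: "v \<in> carrier V" "emV v = x" by auto
  have s: "coordV \<beta> x = (\<Sum>\<gamma>\<in>B. r \<gamma> * coordV \<beta> \<gamma>)" for \<beta>
  proof -
    have "coordV \<beta> (\<Sum>\<gamma>\<in>C. fscale (r \<gamma>) \<gamma>) = (\<Sum>\<gamma>\<in>C. r \<gamma> * coordV \<beta> \<gamma>)" if "finite C" "C \<subseteq> V_basis" for C
      using that
    proof (induction C rule: finite_induct)
      case empty
      show ?case using coordV_linear(2)[of 0 \<beta> 0] by (simp add: free_vs.span_zero)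
    next
      case (insert \<gamma> C)
      have "\<gamma> \<in> free_span V_basis" using insert by (simp add: free_vs.span_base)
      moreover have "(\<Sum>\<gamma>\<in>C. fscale (r \<gamma>) \<gamma>) \<in> free_span V_basis"
        using insert by (intro free_vs.span_sum free_vs.span_scale free_vs.span_base) auto
      ultimately show ?case using insert by (simp add: coordV_linear free_vs.span_scale)
    qed
    then show ?thesis unfolding x_def using fin BV by blast
  qed
  have c: "fscale (coordV \<beta> x) (emW w) = tcoord \<beta> n z" for \<beta>
  proof (cases "\<beta> \<in> B")
    case True
    have "(\<Sum>\<gamma>\<in>B. r \<gamma> * coordV \<beta> \<gamma>) = (\<Sum>\<gamma>\<in>B. if \<gamma> = \<beta> then r \<gamma> else 0)"
    proof (intro sum.cong refl)
      fix \<gamma> assume "\<gamma> \<in> B"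
      then show "r \<gamma> * coordV \<beta> \<gamma> = (if \<gamma> = \<beta> then r \<gamma> else 0)"
        using coordV_basis[OF subsetD[OF BV True] subsetD[OF BV]] by simp
    qed
    then show ?thesis unfolding s r using True fin by simp
  next
    case False
    have "(\<Sum>\<gamma>\<in>B. r \<gamma> * coordV \<beta> \<gamma>) = 0"
    proof (intro sum.neutral ballI)
      fix \<gamma> assume "\<gamma> \<in> B"
      then show "r \<gamma> * coordV \<beta> \<gamma> = 0"
        using False BV coordV_nonzero[of \<beta> \<gamma>] coordV_basis[of \<beta> \<gamma>] by (metis mult_zero_right subsetD)
    qed
    then show ?thesis unfolding s using False by (simp add: B_def)
  qed
  have tZ: "ten v w n \<in> Z" by (rule ten_in_Z[OF v(1) w])
  have "z - ten v w n = 0"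
  proof (rule tcoord_injective)
    show "z - ten v w n \<in> Z" by (rule free_vs.subspace_diff[OF Z_subspace z tZ])
    show "tcoord \<beta> n' (z - ten v w n) = 0" for \<beta> n'
      using off[of n' \<beta>] c[of \<beta>] by (cases "n' = n") (auto simp: tcoord_diff[OF z tZ] tcoord_ten[OF v(1) w] v(2))
  qed
  then show ?thesis using v(1) by (intro that[of v]) auto
qed

section \<open>Isomorphisms of tensor product modules\<close>

lemma u_facts:
  "h \<in> csa G \<Longrightarrow> act V (cur 0 h) u = lam h \<odot>\<^bsub>V\<^esub> u" "x \<in> nil_pos G \<Longrightarrow> act V (cur 0 x) u = \<zero>\<^bsub>V\<^esub>"
  "m > 0 \<Longrightarrow> act V (cur m x) u = \<zero>\<^bsub>V\<^esub>" "m > 0 \<Longrightarrow> act V (vir m) u = \<zero>\<^bsub>V\<^esub>"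
  "act V (vir 0) u = l \<odot>\<^bsub>V\<^esub> u"
proof -
  note * = u[unfolded av_hw_vector_def]
  show "h \<in> csa G \<Longrightarrow> act V (cur 0 h) u = lam h \<odot>\<^bsub>V\<^esub> u" and d0: "act V (vir 0) u = l \<odot>\<^bsub>V\<^esub> u" using * by blast+
  show "x \<in> nil_pos G \<Longrightarrow> act V (cur 0 x) u = \<zero>\<^bsub>V\<^esub>"
  proof -
    assume "x \<in> nil_pos G"
    then have "cur 0 x \<in> av_pos G" by (auto simp: av_pos_def cur_def lookup_single)
    then show ?thesis using * by blast
  qed
  show "m > 0 \<Longrightarrow> act V (cur m x) u = \<zero>\<^bsub>V\<^esub>" "m > 0 \<Longrightarrow> act V (vir m) u = \<zero>\<^bsub>V\<^esub>"
    using eigenvector_killed[of u 0 m] d0 by simp_all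
qed

text \<open>The equations that an isomorphism transports to the other module.\<close>

lemma actZ_vacuum:
  "h \<in> csa G \<Longrightarrow> m > 0 \<Longrightarrow> actZ (cur m h) (ten u w0 n) = fscale (\<mu> h) (ten u w0 (m + n))"
  "h \<in> csa G \<Longrightarrow> actZ (cur 0 h) (ten u w0 n) = fscale (lam h + \<mu> h) (ten u w0 n)"
  "x \<in> nil_pos G \<Longrightarrow> m \<ge> 0 \<Longrightarrow> actZ (cur m x) (ten u w0 n) = 0"
  "m > 0 \<Longrightarrow> actZ (vir m) (ten u w0 n) = fscale (a + of_int n + b * of_int m) (ten u w0 (m + n))"
proof -
  show "h \<in> csa G \<Longrightarrow> m > 0 \<Longrightarrow> actZ (cur m h) (ten u w0 n) = fscale (\<mu> h) (ten u w0 (m + n))"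
    "h \<in> csa G \<Longrightarrow> actZ (cur 0 h) (ten u w0 n) = fscale (lam h + \<mu> h) (ten u w0 n)"
    by (simp_all add: actZ_ten w0 u_facts ten_zero ten_bilinear free_vs.scale_left_distrib)
  show "x \<in> nil_pos G \<Longrightarrow> m \<ge> 0 \<Longrightarrow> actZ (cur m x) (ten u w0 n) = 0"
    by (cases "m = 0") (simp_all add: actZ_ten w0 u_facts ten_zero)
  assume m: "m > 0"
  have "emV (vir_shift m n u) = emV ((a + of_int n + b * of_int m) \<odot>\<^bsub>V\<^esub> u)"
    using m by (simp add: emV_vir_shift u_facts V.emb_scale free_vs.scale_left_distrib)
  then have "vir_shift m n u = (a + of_int n + b * of_int m) \<odot>\<^bsub>V\<^esub> u"
    by (simp only: V.emb_eq_iff vir_shift_in V.smult_in u_in)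
  then show "actZ (vir m) (ten u w0 n) = fscale (a + of_int n + b * of_int m) (ten u w0 (m + n))"
    by (simp add: actZ_ten w0 ten_bilinear)
qed

end

text \<open>An isomorphism between two tensor products, expressed through the models of the two modules by
  subspaces.\<close>

locale tensor_iso = A: tensor_module G V emV lam l k c u W emW \<mu> w0 a b +
    B: tensor_module G V' emV' lam' l' k' c' u' W' emW' \<mu>' w0' a' b'
  for G :: "'g::ab_group_add lie_data"
    and V :: "('g affvir, 'v) lie_rep" and emV lam l k c u and W :: "('g, 'w) lie_rep" and emW \<mu> w0 a b
    and V' :: "('g affvir, 'v2) lie_rep" and emV' lam' l' k' c' u' and W' :: "('g, 'w2) lie_rep" and emW' \<mu>' w0' a' b' +
  fixes \<Phi>
  assumes bij: "bij_betw \<Phi> A.Z B.Z"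
    and lin: "z \<in> A.Z \<Longrightarrow> y \<in> A.Z \<Longrightarrow> \<Phi> (fscale r z + y) = fscale r (\<Phi> z) + \<Phi> y"
    and hom: "x \<in> A.action_generators \<Longrightarrow> z \<in> A.Z \<Longrightarrow> \<Phi> (A.actZ x z) = B.actZ x (\<Phi> z)"
    and weights: "\<mu> \<in> csa_dual G" "\<mu>' \<in> csa_dual G" "\<mu> \<noteq> zero_weight G"
begin

lemma Phi_in: "z \<in> A.Z \<Longrightarrow> \<Phi> z \<in> B.Z"
  using bij by (auto simp: bij_betw_def)

lemma Phi_0: "\<Phi> 0 = 0"
  using lin[of 0 0 "- 1"] free_vs.subspace_0[OF A.Z_subspace] by simp

lemma Phi_scale: "z \<in> A.Z \<Longrightarrow> \<Phi> (fscale r z) = fscale r (\<Phi> z)"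
  using lin[of z 0 r] Phi_0 free_vs.subspace_0[OF A.Z_subspace] by simp

lemma Phi_nonzero: "z \<in> A.Z \<Longrightarrow> z \<noteq> 0 \<Longrightarrow> \<Phi> z \<noteq> 0"
  using bij Phi_0 free_vs.subspace_0[OF A.Z_subspace] unfolding bij_betw_def by (metis inj_onD)

abbreviation "vac n \<equiv> A.ten u w0 n"

lemma vac: "vac n \<in> A.Z" "vac n \<noteq> 0"
  using A.ten_in_Z A.w0 A.ten_eq_zero[of u w0 n] A.u_nonzero by auto

text \<open>Transport of \<open>x(m) (u \<otimes> w\<^sub>0 \<otimes> t\<^sup>n) = 0\<close>, for \<open>m\<close> so large that \<open>x(m)\<close> acts on the coordinates of the
  image through \<open>W'\<close>.\<close>

lemma image_singular:
  assumes "x \<in> nil_pos G"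
  shows "B.W.image_act x (B.tcoord \<beta> n' (\<Phi> (vac n))) = 0"
proof -
  obtain N where N: "\<forall>m\<ge>N. \<forall>x \<beta> n'. B.tcoord \<beta> (m + n') (B.actZ (cur m x) (\<Phi> (vac n))) = B.W.image_act x (B.tcoord \<beta> n' (\<Phi> (vac n)))"
    using B.tcoord_large[OF Phi_in[OF vac(1)]] by blast
  have "B.actZ (cur (max N 0) x) (\<Phi> (vac n)) = \<Phi> (A.actZ (cur (max N 0) x) (vac n))"
    by (rule hom[symmetric]) (use vac in auto)
  also have "\<dots> = 0" using A.actZ_vacuum(3)[OF assms, of "max N 0" n] by (simp add: Phi_0)
  finally have "B.tcoord \<beta> (max N 0 + n') (B.actZ (cur (max N 0) x) (\<Phi> (vac n))) = 0"
    by (simp add: B.tcoord_0)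
  then show ?thesis using N by (metis max.cobounded1)
qed

lemma image_coord: "\<exists>r. B.tcoord \<beta> n' (\<Phi> (vac n)) = fscale r (emW' w0')"
proof -
  obtain w where w: "w \<in> carrier W'" "B.tcoord \<beta> n' (\<Phi> (vac n)) = emW' w"
    using B.tcoord_in[OF Phi_in[OF vac(1)], of \<beta> n' n] by (elim imageE)
  have "act W' x w = \<zero>\<^bsub>W'\<^esub>" if "x \<in> nil_pos G" for x
    using image_singular[OF that, of \<beta> n' n] w by (simp add: B.W.emb_eq_0_iff)
  then obtain r where "w = r \<odot>\<^bsub>W'\<^esub> w0'" using B.W_singular[OF w(1)] by blast
  then show ?thesis using w(2) B.w0(1) by (auto simp: B.W.emb_scale)
qed

lemma image_level: "l + a + of_int n \<noteq> l' + a' + of_int n' \<Longrightarrow> B.tcoord \<beta> n' (\<Phi> (vac n)) = 0"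
proof -
  assume ne: "l + a + of_int n \<noteq> l' + a' + of_int n'"
  have "A.actZ (vir 0) (vac n) = fscale (l + a + of_int n) (vac n)"
    using A.w0 by (simp add: A.actZ_ten A.vir_shift_0 A.ten_bilinear)
  then have "B.actZ (vir 0) (\<Phi> (vac n)) = fscale (l + a + of_int n) (\<Phi> (vac n))"
    using hom[OF _ vac(1), of "vir 0" n] by (simp add: Phi_scale vac)
  then have "fscale (l' + a' + of_int n') (B.tcoord \<beta> n' (\<Phi> (vac n))) = fscale (l + a + of_int n) (B.tcoord \<beta> n' (\<Phi> (vac n)))"
    using B.tcoord_vir0[OF Phi_in[OF vac(1)], of \<beta> n' n] by (auto simp: B.tcoord_scale Phi_in vac)
  then show ?thesis using ne by (metis free_vs.scale_cancel_right)
qed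

text \<open>The exponent shift \<open>s\<close> is read off from one nonzero coordinate at \<open>n = 0\<close>; it then works for all \<open>n\<close>.\<close>

lemma image_vacuum:
  obtains s :: int and y where "l + a = l' + a' + of_int s"
    "\<forall>n. y n \<in> carrier V' \<and> y n \<noteq> \<zero>\<^bsub>V'\<^esub> \<and> \<Phi> (vac n) = B.ten (y n) w0' (n + s)"
proof -
  have "\<exists>\<beta> n'. B.tcoord \<beta> n' (\<Phi> (vac 0)) \<noteq> 0"
    using B.tcoord_injective[OF Phi_in[OF vac(1)]] Phi_nonzero[OF vac] by blast
  then obtain s where "l + a + of_int 0 = l' + a' + of_int s" using image_level by blast
  then have s: "l + a = l' + a' + of_int s" by simp
  have "\<exists>y. y \<in> carrier V' \<and> y \<noteq> \<zero>\<^bsub>V'\<^esub> \<and> \<Phi> (vac n) = B.ten y w0' (n + s)" for n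
  proof -
    have "B.tcoord \<beta> n' (\<Phi> (vac n)) = 0" if "n' \<noteq> n + s" for \<beta> n'
    proof (rule image_level)
      have "(of_int n' :: complex) \<noteq> of_int (n + s)" using that by (simp only: of_int_eq_iff simp_thms)
      then show "l + a + of_int n \<noteq> l' + a' + of_int n'" unfolding s by (auto simp: algebra_simps)
    qed
    then obtain y where y: "y \<in> carrier V'" "\<Phi> (vac n) = B.ten y w0' (n + s)"
      using B.pure_tensor[OF Phi_in[OF vac(1)] B.w0(1) _ image_coord] by metis
    have "y \<noteq> \<zero>\<^bsub>V'\<^esub>" using y Phi_nonzero[OF vac, of n] B.ten_zero(1) B.w0(1) by auto
    then show ?thesis using y by blast
  qed
  then have "\<exists>y. \<forall>n. y n \<in> carrier V' \<and> y n \<noteq> \<zero>\<^bsub>V'\<^esub> \<and> \<Phi> (vac n) = B.ten (y n) w0' (n + s)" by metis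
  then show ?thesis using that s by blast
qed

text \<open>Only the images of the vectors \<open>u \<otimes> w\<^sub>0 \<otimes> t\<^sup>n\<close> are used. Pure tensors with the common factor \<open>w\<^sub>0'\<close> can
  be compared in \<open>V'\<close>.\<close>

lemma parameters_determined:
  obtains s :: int and y where "l + a = l' + a' + of_int s" "\<mu> = \<mu>'" "b = b'" "k = k'" "c = c'"
    "\<exists>n::nat. l = l' - of_nat n"
    "y \<in> carrier V'" "y \<noteq> \<zero>\<^bsub>V'\<^esub>" "act V' (vir 0) y = l \<odot>\<^bsub>V'\<^esub> y"
    "\<forall>h\<in>csa G. act V' (cur 0 h) y = lam h \<odot>\<^bsub>V'\<^esub> y" "\<forall>x\<in>nil_pos G. act V' (cur 0 x) y = \<zero>\<^bsub>V'\<^esub>"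
proof -
  obtain s y where s: "l + a = l' + a' + of_int s"
    and y0: "\<forall>n. y n \<in> carrier V' \<and> y n \<noteq> \<zero>\<^bsub>V'\<^esub> \<and> \<Phi> (vac n) = B.ten (y n) w0' (n + s)"
    by (rule image_vacuum)
  have y: "y n \<in> carrier V'" "y n \<noteq> \<zero>\<^bsub>V'\<^esub>" "emV' (y n) \<noteq> 0" "\<Phi> (vac n) = B.ten (y n) w0' (n + s)" for n
    using y0 B.V.emb_eq_0_iff by auto
  have cancel: "emV' v = emV' v'" if "v \<in> carrier V'" "v' \<in> carrier V'" "B.ten v w0' n = B.ten v' w0' n" for v v' n
    using B.ten_cancel[OF that(1,2) B.w0(1,2) that(3)] by simp
  \<comment> \<open>\<open>h(m)\<close> with large \<open>m\<close> multiplies \<open>vac n\<close> by \<open>\<mu> h\<close> and its image by \<open>\<mu>' h\<close>, and shifts the exponent by \<open>m\<close>.\<close>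
  have shift: "\<exists>N. \<forall>m\<ge>N. \<forall>h\<in>csa G. fscale (\<mu> h) (emV' (y (m + n))) = fscale (\<mu>' h) (emV' (y n))" for n
  proof -
    obtain N where N: "\<forall>m\<ge>N. \<forall>x. act V' (cur m x) (y n) = \<zero>\<^bsub>V'\<^esub> \<and> act V' (vir m) (y n) = \<zero>\<^bsub>V'\<^esub>"
      using B.locally_nilpotent[OF y(1)] by blast
    show ?thesis
    proof (intro exI[of _ "max N 1"] allI impI ballI)
      fix m h assume m: "max N 1 \<le> m" and h: "h \<in> csa G"
      have "\<Phi> (A.actZ (cur m h) (vac n)) = B.actZ (cur m h) (\<Phi> (vac n))"
        by (rule hom) (use vac in auto)
      then have "B.ten (\<mu> h \<odot>\<^bsub>V'\<^esub> y (m + n)) w0' (m + n + s) = B.ten (\<mu>' h \<odot>\<^bsub>V'\<^esub> y n) w0' (m + n + s)"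
        using m h N A.actZ_vacuum(1)[OF h, of m n]
        by (simp add: Phi_scale vac y B.actZ_ten B.w0 B.ten_zero B.ten_bilinear add.assoc)
      from cancel[OF _ _ this] show "fscale (\<mu> h) (emV' (y (m + n))) = fscale (\<mu>' h) (emV' (y n))"
        using y by (simp add: B.V.emb_scale)
    qed
  qed
  have "\<exists>h\<in>csa G. \<mu> h \<noteq> 0"
  proof (rule ccontr)
    assume "\<not> ?thesis"
    then have "\<mu> = zero_weight G"
      by (intro A.csa_dual_eqI[OF weights(1) A.zero_weight_dual]) (auto simp: zero_weight_def)
    then show False using weights(3) by simp
  qed
  then obtain h1 where h1: "h1 \<in> csa G" "\<mu> h1 \<noteq> 0" by blast
  have "\<mu>' h1 \<noteq> 0"
  proof
    assume "\<mu>' h1 = 0"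
    obtain N where "\<forall>m\<ge>N. \<forall>h\<in>csa G. fscale (\<mu> h) (emV' (y (m + 0))) = fscale (\<mu>' h) (emV' (y 0))"
      using shift[of 0] by blast
    then have "fscale (\<mu> h1) (emV' (y N)) = fscale 0 (emV' (y 0))"
      using h1(1) \<open>\<mu>' h1 = 0\<close> by fastforce
    then show False using h1(2) y(3)[of N] by simp
  qed
  \<comment> \<open>Both \<open>y n\<close> and \<open>y 0\<close> are compared with \<open>y m\<close> for one large \<open>m\<close>.\<close>
  have same: "emV' (y n) = emV' (y 0)" for n
  proof -
    obtain N1 N2 where N: "\<forall>m\<ge>N1. \<forall>h\<in>csa G. fscale (\<mu> h) (emV' (y (m + n))) = fscale (\<mu>' h) (emV' (y n))"
      "\<forall>m\<ge>N2. \<forall>h\<in>csa G. fscale (\<mu> h) (emV' (y (m + 0))) = fscale (\<mu>' h) (emV' (y 0))"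
      using shift[of n] shift[of 0] by blast
    define m where "m = max (N1 + n) N2"
    have "fscale (\<mu> h1) (emV' (y (m - n + n))) = fscale (\<mu>' h1) (emV' (y n))"
      by (rule N(1)[rule_format]) (use h1(1) in \<open>simp_all add: m_def\<close>)
    moreover have "fscale (\<mu> h1) (emV' (y (m + 0))) = fscale (\<mu>' h1) (emV' (y 0))"
      by (rule N(2)[rule_format]) (use h1(1) in \<open>simp_all add: m_def\<close>)
    ultimately have "fscale (\<mu>' h1) (emV' (y n)) = fscale (\<mu>' h1) (emV' (y 0))" by simp
    then show ?thesis using \<open>\<mu>' h1 \<noteq> 0\<close> by (simp only: free_vs.scale_cancel_left simp_thms)
  qed
  define y' where "y' = y 0"
  have y': "y' \<in> carrier V'" "y' \<noteq> \<zero>\<^bsub>V'\<^esub>" "emV' y' \<noteq> 0" using y by (simp_all add: y'_def)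
  have yn: "y n = y'" for n using same[of n] y(1) B.V.emb_eq_iff by (simp add: y'_def)
  have im: "\<Phi> (vac n) = B.ten y' w0' (n + s)" for n using y(4)[of n] by (simp only: yn)
  have "\<mu> = \<mu>'"
  proof (rule A.csa_dual_eqI[OF weights(1,2)])
    fix h assume h: "h \<in> csa G"
    obtain N where "\<forall>m\<ge>N. \<forall>h\<in>csa G. fscale (\<mu> h) (emV' (y (m + 0))) = fscale (\<mu>' h) (emV' (y 0))"
      using shift[of 0] by blast
    then have "fscale (\<mu> h) (emV' y') = fscale (\<mu>' h) (emV' y')" using h by (auto simp: yn)
    then show "\<mu> h = \<mu>' h" using y'(3) by (simp only: free_vs.scale_cancel_right simp_thms)
  qed
  have csa: "act V' (cur 0 h) y' = lam h \<odot>\<^bsub>V'\<^esub> y'" if h: "h \<in> csa G" for h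
  proof -
    have "\<Phi> (A.actZ (cur 0 h) (vac 0)) = B.actZ (cur 0 h) (\<Phi> (vac 0))"
      by (rule hom) (use vac in auto)
    then have "B.ten ((lam h + \<mu> h) \<odot>\<^bsub>V'\<^esub> y') w0' s = B.ten (act V' (cur 0 h) y' \<oplus>\<^bsub>V'\<^esub> \<mu> h \<odot>\<^bsub>V'\<^esub> y') w0' s"
      using h A.actZ_vacuum(2)[OF h, of 0] y'
      by (simp add: Phi_scale vac im B.actZ_ten B.w0 B.ten_bilinear \<open>\<mu> = \<mu>'\<close>)
    from cancel[OF _ _ this] have "emV' (act V' (cur 0 h) y') = emV' (lam h \<odot>\<^bsub>V'\<^esub> y')"
      using y' by (simp add: B.V.emb_scale B.V.emb_add free_vs.scale_left_distrib)
    then show ?thesis using y' by (simp only: B.V.emb_eq_iff B.V.act_in B.V.smult_in)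
  qed
  have nil: "act V' (cur 0 x) y' = \<zero>\<^bsub>V'\<^esub>" if x: "x \<in> nil_pos G" for x
  proof -
    have "\<Phi> (A.actZ (cur 0 x) (vac 0)) = B.actZ (cur 0 x) (\<Phi> (vac 0))"
      by (rule hom) (use vac in auto)
    then have "B.ten (act V' (cur 0 x) y') w0' s = 0"
      using A.actZ_vacuum(3)[OF x, of 0 0] y' x by (simp add: Phi_0 im B.actZ_ten B.w0 B.ten_zero)
    then show ?thesis using B.ten_eq_zero B.w0 y' by simp
  qed
  obtain N where N: "\<forall>m\<ge>N. \<forall>x. act V' (cur m x) y' = \<zero>\<^bsub>V'\<^esub> \<and> act V' (vir m) y' = \<zero>\<^bsub>V'\<^esub>"
    using B.locally_nilpotent[OF y'(1)] by blast
  \<comment> \<open>\<open>d\<^sub>0\<close> enters the action of \<open>d\<^sub>m\<close> through the degree operator, which is how its eigenvalue on \<open>y'\<close> is found.\<close>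
  have d: "emV' (act V' (vir 0) y') = fscale (l + (b' - b) * of_int m) (emV' y')" if m: "m \<ge> max N 1" for m
  proof -
    have "\<Phi> (A.actZ (vir m) (vac 0)) = B.actZ (vir m) (\<Phi> (vac 0))"
      by (rule hom) (use vac in auto)
    then have "B.ten ((a + b * of_int m) \<odot>\<^bsub>V'\<^esub> y') w0' (m + s) = B.ten (B.vir_shift m s y') w0' (m + s)"
      using A.actZ_vacuum(4)[of m 0] y' m by (simp add: Phi_scale vac im B.actZ_ten B.w0 B.ten_bilinear)
    from cancel[OF _ _ this]
    have "fscale (a + b * of_int m) (emV' y') = fscale (a' + of_int s + b' * of_int m + l') (emV' y') - emV' (act V' (vir 0) y')"
      using y' m N by (simp add: B.vir_shift_in B.emV_vir_shift B.V.emb_scale)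
    then have "emV' (act V' (vir 0) y') = fscale (a' + of_int s + b' * of_int m + l' - (a + b * of_int m)) (emV' y')"
      by (simp only: free_vs.scale_left_diff_distrib) (simp add: algebra_simps)
    also have "a' + of_int s + b' * of_int m + l' - (a + b * of_int m) = l + (b' - b) * of_int m"
    proof -
      have "l' + a' + of_int s = l + a" using s ..
      then have "l' + of_int s + a' = l + a" by (simp add: algebra_simps)
      then show ?thesis by (simp add: algebra_simps)
    qed
    finally show ?thesis .
  qed
  \<comment> \<open>The eigenvalue cannot depend on \<open>m\<close>; two consecutive values of \<open>m\<close> show that \<open>b = b'\<close>.\<close>
  define m where "m = max N 1"
  have "fscale (l + (b' - b) * of_int m) (emV' y') = fscale (l + (b' - b) * of_int (m + 1)) (emV' y')"
    using d[of m] d[of "m + 1"] by (simp only: m_def)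
  then have "l + (b' - b) * of_int m = l + (b' - b) * of_int (m + 1)"
    using y'(3) by (simp only: free_vs.scale_cancel_right simp_thms)
  then have "b = b'" by (simp add: distrib_left)
  have "emV' (act V' (vir 0) y') = emV' (l \<odot>\<^bsub>V'\<^esub> y')" using d[of m] y' by (simp add: m_def \<open>b = b'\<close> B.V.emb_scale)
  then have d0: "act V' (vir 0) y' = l \<odot>\<^bsub>V'\<^esub> y'" using y' by (simp only: B.V.emb_eq_iff B.V.act_in B.V.smult_in)
  have central: "\<Phi> (A.actZ cen_k (vac 0)) = B.actZ cen_k (\<Phi> (vac 0))" "\<Phi> (A.actZ cen_c (vac 0)) = B.actZ cen_c (\<Phi> (vac 0))"
    by (rule hom; use vac in auto)+
  have nz: "B.ten y' w0' s \<noteq> 0" using B.ten_eq_zero[OF y'(1) B.w0(1,2)] y'(2) by blast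
  have "fscale k (B.ten y' w0' s) = fscale k' (B.ten y' w0' s)" "fscale c (B.ten y' w0' s) = fscale c' (B.ten y' w0' s)"
    using central y' by (simp_all add: A.actZ_ten A.w0 B.actZ_ten B.w0 im Phi_scale vac)
  then have "k = k'" "c = c'" using nz by (simp_all only: free_vs.scale_cancel_right simp_thms)
  then show ?thesis
    using that[OF s \<open>\<mu> = \<mu>'\<close> \<open>b = b'\<close> _ _ B.eigenvalue_in_spectrum[OF y'(1) d0 y'(2)] y'(1,2) d0] csa nil by blast
qed

lemma tensor_iso_sym:
  assumes "\<mu>' \<noteq> zero_weight G"
  shows "tensor_iso G V' emV' lam' l' k' c' u' W' emW' \<mu>' w0' a' b' V emV lam l k c u W emW \<mu> w0 a b (the_inv_into A.Z \<Phi>)"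
proof -
  let ?\<Psi> = "the_inv_into A.Z \<Phi>"
  have inj: "inj_on \<Phi> A.Z" and im: "\<Phi> ` A.Z = B.Z" using bij by (auto simp: bij_betw_def)
  have inv: "?\<Psi> (\<Phi> z) = z" if "z \<in> A.Z" for z by (rule the_inv_into_f_f[OF inj that])
  have sub: "fscale r z + y \<in> A.Z" if "z \<in> A.Z" "y \<in> A.Z" for r z y
    using that by (intro free_vs.subspace_add[OF A.Z_subspace] free_vs.subspace_scale[OF A.Z_subspace])
  show ?thesis
  proof (intro tensor_iso.intro tensor_iso_axioms.intro B.tensor_module_axioms A.tensor_module_axioms weights assms)
    show "bij_betw ?\<Psi> B.Z A.Z" by (rule bij_betw_the_inv_into[OF bij])
    show "?\<Psi> (fscale r z + y) = fscale r (?\<Psi> z) + ?\<Psi> y" if zy: "z \<in> B.Z" "y \<in> B.Z" for r z y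
    proof -
      obtain p q where pq: "p \<in> A.Z" "q \<in> A.Z" "z = \<Phi> p" "y = \<Phi> q" using zy unfolding im[symmetric] by blast
      show ?thesis unfolding pq(3,4) lin[OF pq(1,2), symmetric] by (simp only: inv pq(1,2) sub)
    qed
    show "?\<Psi> (B.actZ x z) = A.actZ x (?\<Psi> z)" if xz: "x \<in> A.action_generators" "z \<in> B.Z" for x z
    proof -
      obtain p where p: "p \<in> A.Z" "z = \<Phi> p" using xz(2) unfolding im[symmetric] by blast
      show ?thesis unfolding p(2) hom[OF xz(1) p(1), symmetric] by (simp only: inv p(1) A.actZ_in[OF xz(1)])
    qed
  qed
qed

text \<open>By symmetry \<open>l\<close> and \<open>l'\<close> differ by a nonnegative integer in both directions, so they are equal. The
  vector \<open>y\<close> then belongs to the top eigenvalue of \<open>d\<^sub>0\<close>, which makes it a highest weight vector.\<close>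

lemma parameters_equal:
  assumes \<mu>': "\<mu>' \<noteq> zero_weight G" and lam: "lam \<in> csa_dual G" "lam' \<in> csa_dual G"
    and Re: "0 \<le> Re a" "Re a < 1" "0 \<le> Re a'" "Re a' < 1"
  shows "(lam, l, k, c, \<mu>, a, b) = (lam', l', k', c', \<mu>', a', b')"
proof -
  obtain s y where p: "l + a = l' + a' + of_int s" "\<mu> = \<mu>'" "b = b'" "k = k'" "c = c'" "\<exists>n::nat. l = l' - of_nat n"
    and y: "y \<in> carrier V'" "y \<noteq> \<zero>\<^bsub>V'\<^esub>" "act V' (vir 0) y = l \<odot>\<^bsub>V'\<^esub> y"
    and y': "\<forall>h\<in>csa G. act V' (cur 0 h) y = lam h \<odot>\<^bsub>V'\<^esub> y" "\<forall>x\<in>nil_pos G. act V' (cur 0 x) y = \<zero>\<^bsub>V'\<^esub>"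
    by (rule parameters_determined)
  obtain n' :: nat where n': "l' = l - of_nat n'"
    using tensor_iso.parameters_determined[OF tensor_iso_sym[OF \<mu>']] by metis
  obtain n :: nat where n: "l = l' - of_nat n" using p(6) by blast
  have "of_nat n + of_nat n' = (0 :: complex)" using n n' by (simp add: algebra_simps)
  then have "n = 0" by (metis add_is_0 of_nat_add of_nat_eq_0_iff)
  then have "l = l'" using n by simp
  then have as: "a = a' + of_int s" using p(1) by simp
  then have "Re a = Re a' + of_int s" by simp
  then have "s = 0" using Re by linarith
  then have "a = a'" using as by simp
  have "act V' (vir 0) y = (l' - of_nat 0) \<odot>\<^bsub>V'\<^esub> y" using y(3) \<open>l = l'\<close> by simp
  then have "act V' (cur m x) y = \<zero>\<^bsub>V'\<^esub>" "act V' (vir m) y = \<zero>\<^bsub>V'\<^esub>" if "m > 0" for m x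
    using B.eigenvector_killed[OF y(1), of 0 m] that by simp_all
  then obtain r where r: "y = r \<odot>\<^bsub>V'\<^esub> u'" using B.V_singular[OF y(1)] y'(2) by blast
  have "lam = lam'"
  proof (rule A.csa_dual_eqI[OF lam])
    fix h assume h: "h \<in> csa G"
    have "act V' (cur 0 h) y = lam' h \<odot>\<^bsub>V'\<^esub> y"
      using B.u_facts(1)[OF h] by (simp add: r B.V.lie_mod_axioms flip: B.V.M.smult_assoc1[simplified]) (simp add: mult.commute)
    then have "fscale (lam h) (emV' y) = fscale (lam' h) (emV' y)"
      using y'(1) h y(1) by (metis B.V.emb_scale)
    moreover have "emV' y \<noteq> 0" using y B.V.emb_eq_0_iff by simp
    ultimately show "lam h = lam' h" by (metis free_vs.scale_cancel_right)
  qed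
  then show ?thesis using p \<open>l = l'\<close> \<open>a = a'\<close> by simp
qed

end

text \<open>An isomorphism of the module records is transported along the identifications \<open>emT\<close>.\<close>

lemma tensor_iso_exists:
  fixes G :: "'g::ab_group_add lie_data"
    and V :: "('g affvir, 'v) lie_rep" and W :: "('g, 'w) lie_rep"
    and V' :: "('g affvir, 'v2) lie_rep" and W' :: "('g, 'w2) lie_rep"
  assumes A: "tensor_module G V emV lam l k c u W emW \<mu> w0"
    and B: "tensor_module G V' emV' lam' l' k' c' u' W' emW' \<mu>' w0'"
    and iso: "isomorphic_reps
      (quotient_rep (free_rep (carrier V \<times> carrier W \<times> UNIV) (tensor_action V W l k c a b)) (free_span (tensor_relations V W)))
      (quotient_rep (free_rep (carrier V' \<times> carrier W' \<times> UNIV) (tensor_action V' W' l' k' c' a' b')) (free_span (tensor_relations V' W')))"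
    and weights: "\<mu> \<in> csa_dual G" "\<mu>' \<in> csa_dual G" "\<mu> \<noteq> zero_weight G"
  shows "\<exists>\<Phi>. tensor_iso G V emV lam l k c u W emW \<mu> w0 a b V' emV' lam' l' k' c' u' W' emW' \<mu>' w0' a' b' \<Phi>"
proof -
  interpret A: tensor_module G V emV lam l k c u W emW \<mu> w0 a b by (rule A)
  interpret B: tensor_module G V' emV' lam' l' k' c' u' W' emW' \<mu>' w0' a' b' by (rule B)
  obtain \<phi> where \<phi>: "bij_betw \<phi> (carrier A.T) (carrier B.T)"
    "\<And>v w. v \<in> carrier A.T \<Longrightarrow> w \<in> carrier A.T \<Longrightarrow> \<phi> (v \<oplus>\<^bsub>A.T\<^esub> w) = \<phi> v \<oplus>\<^bsub>B.T\<^esub> \<phi> w"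
    "\<And>r v. v \<in> carrier A.T \<Longrightarrow> \<phi> (r \<odot>\<^bsub>A.T\<^esub> v) = r \<odot>\<^bsub>B.T\<^esub> \<phi> v"
    "\<And>x v. v \<in> carrier A.T \<Longrightarrow> \<phi> (act A.T x v) = act B.T x (\<phi> v)"
    using iso unfolding isomorphic_reps_def by metis
  define \<Phi> where "\<Phi> = B.emT \<circ> \<phi> \<circ> the_inv_into (carrier A.T) A.emT"
  have inj: "inj_on A.emT (carrier A.T)" and im: "A.Z = A.emT ` carrier A.T"
    using A.emT_bij by (auto simp: bij_betw_def)
  have \<Phi>: "\<Phi> (A.emT t) = B.emT (\<phi> t)" if "t \<in> carrier A.T" for t
    using the_inv_into_f_f[OF inj that] by (simp add: \<Phi>_def)
  have in_B: "\<phi> t \<in> carrier B.T" if "t \<in> carrier A.T" for t using \<phi>(1) that by (auto simp: bij_betw_def)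
  have "bij_betw \<Phi> A.Z B.Z"
    unfolding \<Phi>_def by (intro bij_betw_trans[OF bij_betw_the_inv_into[OF A.emT_bij]] bij_betw_trans[OF \<phi>(1)] B.emT_bij)
  moreover have "\<Phi> (fscale r z + y) = fscale r (\<Phi> z) + \<Phi> y" if zy: "z \<in> A.Z" "y \<in> A.Z" for r z y
  proof -
    obtain s t where st: "s \<in> carrier A.T" "t \<in> carrier A.T" "z = A.emT s" "y = A.emT t"
      using zy unfolding im by (elim imageE)
    note rs = A.emT_linear(4)[OF st(1) st(1), of r]
    note rB = B.emT_linear(4)[OF in_B[OF st(1)] in_B[OF st(1)], of r]
    have "\<Phi> (fscale r z + y) = \<Phi> (A.emT (r \<odot>\<^bsub>A.T\<^esub> s \<oplus>\<^bsub>A.T\<^esub> t))"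
      unfolding st(3,4) A.emT_linear(1)[OF rs st(2)] A.emT_linear(2)[OF st(1) st(1)] ..
    also have "\<dots> = B.emT (r \<odot>\<^bsub>B.T\<^esub> \<phi> s \<oplus>\<^bsub>B.T\<^esub> \<phi> t)"
      unfolding \<Phi>[OF A.emT_linear(3)[OF rs st(2)]] \<phi>(2)[OF rs st(2)] \<phi>(3)[OF st(1)] ..
    also have "\<dots> = fscale r (\<Phi> z) + \<Phi> y"
      unfolding B.emT_linear(1)[OF rB in_B[OF st(2)]] B.emT_linear(2)[OF in_B[OF st(1)] in_B[OF st(1)]] st(3,4) \<Phi>[OF st(1)] \<Phi>[OF st(2)] ..
    finally show ?thesis .
  qed
  moreover have "\<Phi> (A.actZ x z) = B.actZ x (\<Phi> z)" if xz: "x \<in> A.action_generators" "z \<in> A.Z" for x z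
  proof -
    obtain t where t: "t \<in> carrier A.T" "z = A.emT t" using xz(2) unfolding im by (elim imageE)
    show ?thesis
      unfolding t(2) A.emT_actZ(1)[OF xz(1) t(1), symmetric] \<Phi>[OF A.emT_actZ(2)[OF xz(1) t(1)]] \<phi>(4)[OF t(1)]
        B.emT_actZ(1)[OF xz(1) in_B[OF t(1)]] \<Phi>[OF t(1)] ..
  qed
  ultimately show ?thesis
    by (intro exI tensor_iso.intro tensor_iso_axioms.intro weights A B)
qed

section \<open>Independence of the realization of the finite-dimensional module\<close>

lemma same_highest_weight_isomorphic:
  fixes G :: "'g::ab_group_add lie_data" and W :: "('g, 'w) lie_rep" and W' :: "('g, 'w2) lie_rep"
  assumes A: "g_hw_module G W emW \<mu> w0" and B: "g_hw_module G W' emW' \<mu> w0'"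
  obtains \<theta> where "bij_betw \<theta> (carrier W) (carrier W')"
    "\<forall>v\<in>carrier W. \<forall>w\<in>carrier W. \<theta> (v \<oplus>\<^bsub>W\<^esub> w) = \<theta> v \<oplus>\<^bsub>W'\<^esub> \<theta> w"
    "\<forall>r. \<forall>v\<in>carrier W. \<theta> (r \<odot>\<^bsub>W\<^esub> v) = r \<odot>\<^bsub>W'\<^esub> \<theta> v"
    "\<forall>x. \<forall>v\<in>carrier W. \<theta> (act W x v) = act W' x (\<theta> v)"
proof -
  interpret A: g_hw_module G W emW \<mu> w0 by (rule A)
  interpret B: g_hw_module G W' emW' \<mu> w0' by (rule B)
  have "\<exists>\<theta>. bij_betw \<theta> A.W.image_space B.W.image_space \<and>
      (\<forall>v\<in>A.W.image_space. \<forall>w\<in>A.W.image_space. \<theta> (v + w) = \<theta> v + \<theta> w) \<and>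
      (\<forall>r. \<forall>v\<in>A.W.image_space. \<theta> (fscale r v) = fscale r (\<theta> v)) \<and>
      (\<forall>x. \<forall>v\<in>A.W.image_space. \<theta> (A.W.image_act x v) = B.W.image_act x (\<theta> v))"
  proof (rule irreducible_highest_weight_unique[OF A.W.highest_weight_action_axioms A.W_irreducible'
        B.W.highest_weight_action_axioms B.W_irreducible'])
    fix x assume "x \<in> A.R" "A.height x = 0"
    then have "x \<in> csa G" using A.height by blast
    then show "\<exists>r. A.W.image_act x (emW w0) = fscale r (emW w0) \<and> B.W.image_act x (emW' w0') = fscale r (emW' w0')"
      using A.w0 B.w0 by (intro exI[of _ "\<mu> x"]) (simp add: A.W.emb_scale B.W.emb_scale)
  qed
  then obtain \<theta> where bij: "bij_betw \<theta> A.W.image_space B.W.image_space"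
    and \<theta>: "\<forall>v\<in>A.W.image_space. \<forall>w\<in>A.W.image_space. \<theta> (v + w) = \<theta> v + \<theta> w"
      "\<forall>r. \<forall>v\<in>A.W.image_space. \<theta> (fscale r v) = fscale r (\<theta> v)"
      "\<forall>x. \<forall>v\<in>A.W.image_space. \<theta> (A.W.image_act x v) = B.W.image_act x (\<theta> v)" by (elim exE conjE)
  have b1: "bij_betw emW (carrier W) A.W.image_space" and b2: "bij_betw emW' (carrier W') B.W.image_space"
    using A.W.inj B.W.inj by (auto simp: bij_betw_def)
  define \<eta> where "\<eta> = the_inv_into (carrier W') emW' \<circ> (\<theta> \<circ> emW)"
  have e\<eta>: "emW' (\<eta> v) = \<theta> (emW v)" and \<eta>_in: "\<eta> v \<in> carrier W'" if v: "v \<in> carrier W" for v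
  proof -
    have "\<theta> (emW v) \<in> B.W.image_space" using bij v by (auto simp: bij_betw_def)
    then obtain w where w: "w \<in> carrier W'" "\<theta> (emW v) = emW' w" by (elim imageE)
    then have "\<eta> v = w" by (simp add: \<eta>_def the_inv_into_f_f[OF B.W.inj])
    then show "emW' (\<eta> v) = \<theta> (emW v)" "\<eta> v \<in> carrier W'" using w by simp_all
  qed
  have eq: "v = w" if "v \<in> carrier W'" "w \<in> carrier W'" "emW' v = emW' w" for v w
    using that B.W.emb_eq_iff by simp
  show ?thesis
  proof (rule that[of \<eta>])
    show "bij_betw \<eta> (carrier W) (carrier W')"
      unfolding \<eta>_def by (intro bij_betw_trans[OF bij_betw_trans[OF b1 bij]] bij_betw_the_inv_into[OF b2])
    show "\<forall>v\<in>carrier W. \<forall>w\<in>carrier W. \<eta> (v \<oplus>\<^bsub>W\<^esub> w) = \<eta> v \<oplus>\<^bsub>W'\<^esub> \<eta> w"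
      by (intro ballI eq) (simp_all add: \<eta>_in e\<eta> A.W.emb_add B.W.emb_add \<theta>(1))
    show "\<forall>r. \<forall>v\<in>carrier W. \<eta> (r \<odot>\<^bsub>W\<^esub> v) = r \<odot>\<^bsub>W'\<^esub> \<eta> v"
      by (intro ballI allI eq) (simp_all add: \<eta>_in e\<eta> A.W.emb_scale B.W.emb_scale \<theta>(2))
    show "\<forall>x. \<forall>v\<in>carrier W. \<eta> (act W x v) = act W' x (\<eta> v)"
      by (intro ballI allI eq) (simp_all add: \<eta>_in e\<eta> \<theta>(3) flip: A.W.image_act B.W.image_act)
  qed
qed

text \<open>Two realizations \<open>W\<close> and \<open>W'\<close> of the second factor with an isomorphism between them. The map on
  free vector spaces that it induces is bijective and preserves the relations, since the inverse
  isomorphism induces the inverse map.\<close>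

locale tensor_pair = A: tensor_module G V emV lam l k c u W emW \<mu> w0 a b +
    B: tensor_module G V emV lam l k c u W' emW' \<mu> w0' a b
  for G :: "'g::ab_group_add lie_data"
    and V :: "('g affvir, 'v) lie_rep" and emV lam l k c u and W :: "('g, 'w) lie_rep" and emW \<mu> w0 a b
    and W' :: "('g, 'w2) lie_rep" and emW' w0' +
  fixes \<theta>
  assumes bij: "bij_betw \<theta> (carrier W) (carrier W')"
    and hom: "\<forall>v\<in>carrier W. \<forall>w\<in>carrier W. \<theta> (v \<oplus>\<^bsub>W\<^esub> w) = \<theta> v \<oplus>\<^bsub>W'\<^esub> \<theta> w"
      "\<forall>r. \<forall>v\<in>carrier W. \<theta> (r \<odot>\<^bsub>W\<^esub> v) = r \<odot>\<^bsub>W'\<^esub> \<theta> v"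
      "\<forall>x. \<forall>v\<in>carrier W. \<theta> (act W x v) = act W' x (\<theta> v)"
begin

abbreviation "tmap \<equiv> lin_ext (\<lambda>(v, w, n). basis_vec (v, \<theta> w, n :: int))"

lemma theta_in: "w \<in> carrier W \<Longrightarrow> \<theta> w \<in> carrier W'"
  using bij by (auto simp: bij_betw_def)

lemma tmap_in: "f \<in> carrier A.F \<Longrightarrow> tmap f \<in> carrier B.F"
proof (unfold lin_ext_def, intro free_vs.subspace_sum[OF B.F_subspace] free_vs.subspace_scale[OF B.F_subspace])
  fix e assume f: "f \<in> carrier A.F" and e: "e \<in> Poly_Mapping.keys f"
  obtain v w n where "e = (v, w, n)" "v \<in> carrier V" "w \<in> carrier W" using f e by auto
  then show "(case e of (v, w, n) \<Rightarrow> basis_vec (v, \<theta> w, n)) \<in> carrier B.F"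
    using B.basis_in_F[of v "\<theta> w" n] theta_in by simp
qed

lemma tmap_relations: "f \<in> A.S \<Longrightarrow> tmap f \<in> B.S"
proof -
  assume f: "f \<in> A.S"
  have "B.proj (tmap f) = lin_ext (\<lambda>(v, w, n). B.ten v (\<theta> w) n) f"
    unfolding B.proj_lin_ext_general by (rule arg_cong[of _ _ "\<lambda>\<alpha>. lin_ext \<alpha> f"]) (auto simp: fun_eq_iff B.ten_def)
  also have "\<dots> = 0"
    by (rule A.lin_ext_relations[OF _ _ _ _ f]) (simp_all add: B.ten_bilinear theta_in hom(1,2))
  finally show "tmap f \<in> B.S" by (simp only: B.proj)
qed

lemma lin_ext_cong: "(\<And>e. e \<in> Poly_Mapping.keys f \<Longrightarrow> \<alpha> e = \<beta> e) \<Longrightarrow> lin_ext \<alpha> f = lin_ext \<beta> f"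
  by (simp add: lin_ext_def)

lemma tmap_action:
  assumes f: "f \<in> carrier A.F"
  shows "tmap (lin_ext (tensor_action V W l k c a b x) f) = lin_ext (tensor_action V W' l k c a b x) (tmap f)"
  unfolding lin_ext_lin_ext
proof (rule lin_ext_cong)
  fix e assume "e \<in> Poly_Mapping.keys f"
  then obtain v w n where e: "e = (v, w, n)" "v \<in> carrier V" "w \<in> carrier W" using f by auto
  obtain p q \<kappa> \<gamma> where x: "x = (p, q, \<kappa>, \<gamma>)" by (cases x)
  show "tmap (tensor_action V W l k c a b x e) =
      lin_ext (tensor_action V W' l k c a b x) (case e of (v, w, n) \<Rightarrow> basis_vec (v, \<theta> w, n))"
    unfolding e(1) x using e(2,3) hom(3)
    by (simp add: tensor_action_def cur_action_def vir_action_def lin_ext_add lin_ext_sum lin_ext_scale del: A.fscale_single)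
qed

end

lemma tensor_pair_isomorphic:
  assumes "tensor_pair G V emV lam l k c u W emW \<mu> w0 W' emW' w0' \<theta>"
  shows "isomorphic_reps
      (quotient_rep (free_rep (carrier V \<times> carrier W \<times> UNIV) (tensor_action V W l k c a b)) (free_span (tensor_relations V W)))
      (quotient_rep (free_rep (carrier V \<times> carrier W' \<times> UNIV) (tensor_action V W' l k c a b)) (free_span (tensor_relations V W')))"
proof -
  interpret P: tensor_pair G V emV lam l k c u W emW \<mu> w0 a b W' emW' w0' \<theta> by (rule assms)
  let ?\<eta> = "the_inv_into (carrier W) \<theta>"
  have inj: "inj_on \<theta> (carrier W)" and im: "\<theta> ` carrier W = carrier W'"
    using P.bij by (auto simp: bij_betw_def)
  have inv1: "?\<eta> (\<theta> w) = w" if "w \<in> carrier W" for w by (rule the_inv_into_f_f[OF inj that])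
  have inv2: "\<theta> (?\<eta> w) = w" if "w \<in> carrier W'" for w using f_the_inv_into_f[OF inj] that im by simp
  have inv_hom: "?\<eta> (\<theta> v \<oplus>\<^bsub>W'\<^esub> \<theta> w) = v \<oplus>\<^bsub>W\<^esub> w" "?\<eta> (r \<odot>\<^bsub>W'\<^esub> \<theta> v) = r \<odot>\<^bsub>W\<^esub> v" "?\<eta> (act W' x (\<theta> v)) = act W x v"
    if "v \<in> carrier W" "w \<in> carrier W" for v w r x
    using that inv1[of "v \<oplus>\<^bsub>W\<^esub> w"] inv1[of "r \<odot>\<^bsub>W\<^esub> v"] inv1[of "act W x v"] P.hom by simp_all
  interpret Q: tensor_pair G V emV lam l k c u W' emW' \<mu> w0' a b W emW w0 ?\<eta>
  proof (intro tensor_pair.intro tensor_pair_axioms.intro P.A.tensor_module_axioms P.B.tensor_module_axioms)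
    show "bij_betw ?\<eta> (carrier W') (carrier W)" by (rule bij_betw_the_inv_into[OF P.bij])
  qed (auto simp: inv1 inv_hom simp flip: im)
  have QP: "Q.tmap (P.tmap f) = f" if f: "f \<in> carrier P.A.F" for f
  proof -
    have "Q.tmap (P.tmap f) = lin_ext basis_vec f"
      unfolding lin_ext_lin_ext by (rule P.lin_ext_cong) (use f inv1 in auto)
    then show ?thesis by (simp only: lin_ext_basis_vec)
  qed
  have PQ: "P.tmap (Q.tmap f) = f" if f: "f \<in> carrier P.B.F" for f
  proof -
    have "P.tmap (Q.tmap f) = lin_ext basis_vec f"
      unfolding lin_ext_lin_ext by (rule P.lin_ext_cong) (use f inv2 in auto)
    then show ?thesis by (simp only: lin_ext_basis_vec)
  qed
  show ?thesis
  proof (rule isomorphic_quotients[where \<Phi> = P.tmap])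
    show "bij_betw P.tmap (carrier P.A.F) (carrier P.B.F)"
      by (rule bij_betw_byWitness[where f' = Q.tmap]) (use QP PQ P.tmap_in Q.tmap_in in blast)+
    show "P.A.S \<subseteq> carrier P.A.F" by (rule P.A.S_sub)
    show "P.tmap ` P.A.S = P.B.S"
    proof
      show "P.tmap ` P.A.S \<subseteq> P.B.S" using P.tmap_relations by blast
      show "P.B.S \<subseteq> P.tmap ` P.A.S"
      proof
        fix f assume f: "f \<in> P.B.S"
        show "f \<in> P.tmap ` P.A.S"
        proof (rule image_eqI)
          show "f = P.tmap (Q.tmap f)" by (rule PQ[OF subsetD[OF P.B.S_sub f], symmetric])
          show "Q.tmap f \<in> P.A.S" by (rule Q.tmap_relations[OF f])
        qed
      qed
    qed
    fix f g r x assume f: "f \<in> carrier P.A.F" and g: "g \<in> carrier P.A.F"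
    show "f \<oplus>\<^bsub>P.A.F\<^esub> g \<in> carrier P.A.F"
      unfolding free_rep_simps(2) by (rule free_vs.subspace_add[OF P.A.F_subspace f g])
    show "P.tmap (f \<oplus>\<^bsub>P.A.F\<^esub> g) = P.tmap f \<oplus>\<^bsub>P.B.F\<^esub> P.tmap g"
      unfolding free_rep_simps(2) by (rule lin_ext_add)
  next
    fix f r assume f: "f \<in> carrier P.A.F"
    show "r \<odot>\<^bsub>P.A.F\<^esub> f \<in> carrier P.A.F"
      unfolding free_rep_simps(4) by (rule free_vs.subspace_scale[OF P.A.F_subspace f])
    show "P.tmap (r \<odot>\<^bsub>P.A.F\<^esub> f) = r \<odot>\<^bsub>P.B.F\<^esub> P.tmap f"
      unfolding free_rep_simps(4) by (rule lin_ext_scale)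
  next
    fix f x assume f: "f \<in> carrier P.A.F"
    show "P.tmap (act P.A.F x f) = act P.B.F x (P.tmap f)"
      unfolding free_rep_simps(5) by (rule P.tmap_action[OF f])
    show "act P.A.F x f \<in> carrier P.A.F"
      unfolding free_rep_simps(5) by (rule P.A.tensor_action_closed[OF f])
  qed
qed

section \<open>The isomorphism classification\<close>

context simple_lie_data
begin

lemma fd_irreducible_hw_module:
  assumes "is_fd_irreducible G \<mu> W"
  obtains emW w0 where "g_hw_module G W emW \<mu> w0"
proof -
  have W: "lie_module (scl G) (brk G) W" "irreducible_rep W" using assms by (simp_all add: is_fd_irreducible_def)
  obtain w0 where w0: "w0 \<in> carrier W" "w0 \<noteq> \<zero>\<^bsub>W\<^esub>" "\<forall>x\<in>nil_pos G. act W x w0 = \<zero>\<^bsub>W\<^esub>"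
    "\<forall>h\<in>csa G. act W h w0 = \<mu> h \<odot>\<^bsub>W\<^esub> w0"
    using assms unfolding is_fd_irreducible_def by blast
  have la: "lie_algebra (scl G) (brk G)" by unfold_locales
  obtain emW where emW: "embedded_module (scl G) (brk G) W emW"
    by (rule embedded_module_exists[OF la W(1)])
  have "g_hw_module G W emW \<mu> w0"
    by (intro g_hw_module.intro g_hw_module_axioms.intro emW simple_lie_data_axioms W(2))
      (use w0 in auto)
  then show ?thesis by (rule that)
qed

lemma av_irreducible_hw_module:
  assumes lam: "lam \<in> csa_dual G"
  obtains emV u where "av_hw_module G (av_irreducible G lam l k c) emV lam l k c u"
proof -
  note V = av_irreducible_highest_weight[OF lam, of l k c]
  obtain u where u: "av_hw_vector lam l k c (av_irreducible G lam l k c) u" using V(3) by blast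
  have la: "lie_algebra (av_scale G) (av_bracket G)" by unfold_locales
  obtain emV where emV: "embedded_module (av_scale G) (av_bracket G) (av_irreducible G lam l k c) emV"
    by (rule embedded_module_exists[OF la V(1)])
  have "av_hw_module G (av_irreducible G lam l k c) emV lam l k c u"
    by (intro av_hw_module.intro av_hw_module_axioms.intro emV simple_lie_data_axioms V(2) u)
  then show ?thesis by (rule that)
qed

end

theorem theorem5p1:
  fixes G :: "'g::ab_group_add lie_data"
    and lam lam' \<mu> \<mu>' :: "'g \<Rightarrow> complex"
    and k c l a b k' c' l' a' b' :: complex
    and W :: "('g, 'w) lie_rep" and W' :: "('g, 'v) lie_rep"
  assumes "simple_lie_algebra G" and "finite_dimensional G"
    and "cartan_subalgebra G" and "simple_root_system G" and "triangular_decomposition G"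
    and "normalized_killing_form G"
    and "lam \<in> csa_dual G" and "lam' \<in> csa_dual G"
    and "\<mu> \<in> dominant_integral_weights G - {zero_weight G}"
    and "\<mu>' \<in> dominant_integral_weights G - {zero_weight G}"
    and "is_fd_irreducible G \<mu> W" and "is_fd_irreducible G \<mu>' W'"
    and "0 \<le> Re a" and "Re a < 1" and "0 \<le> Re a'" and "Re a' < 1"
  shows "isomorphic_reps (tensor_rep G lam l k c W a b) (tensor_rep G lam' l' k' c' W' a' b')
     \<longleftrightarrow> (lam, l, k, c, \<mu>, a, b) = (lam', l', k', c', \<mu>', a', b')"
proof
  interpret simple_lie_data G by (intro simple_lie_data.intro assms)
  have weights: "\<mu> \<in> csa_dual G" "\<mu>' \<in> csa_dual G" "\<mu> \<noteq> zero_weight G" "\<mu>' \<noteq> zero_weight G"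
    using assms(9,10) by (auto simp: dominant_integral_weights_def)
  obtain emW w0 where W: "g_hw_module G W emW \<mu> w0" by (rule fd_irreducible_hw_module[OF assms(11)])
  obtain emW' w0' where W': "g_hw_module G W' emW' \<mu>' w0'" by (rule fd_irreducible_hw_module[OF assms(12)])
  obtain emV u where V: "av_hw_module G (av_irreducible G lam l k c) emV lam l k c u"
    by (rule av_irreducible_hw_module[OF assms(7)])
  obtain emV' u' where V': "av_hw_module G (av_irreducible G lam' l' k' c') emV' lam' l' k' c' u'"
    by (rule av_irreducible_hw_module[OF assms(8)])
  {
    assume "isomorphic_reps (tensor_rep G lam l k c W a b) (tensor_rep G lam' l' k' c' W' a' b')"
    then obtain \<Phi> where \<Phi>: "tensor_iso G (av_irreducible G lam l k c) emV lam l k c u W emW \<mu> w0 a b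
        (av_irreducible G lam' l' k' c') emV' lam' l' k' c' u' W' emW' \<mu>' w0' a' b' \<Phi>"
      unfolding tensor_rep_def Let_def
      using tensor_iso_exists[OF tensor_module.intro[OF V W] tensor_module.intro[OF V' W'] _ weights(1-3)] by blast
    show "(lam, l, k, c, \<mu>, a, b) = (lam', l', k', c', \<mu>', a', b')"
      by (rule tensor_iso.parameters_equal[OF \<Phi> weights(4) assms(7,8,13-16)])
  next
    assume "(lam, l, k, c, \<mu>, a, b) = (lam', l', k', c', \<mu>', a', b')"
    then have eq: "lam' = lam" "l' = l" "k' = k" "c' = c" "\<mu>' = \<mu>" "a' = a" "b' = b" by simp_all
    have W': "g_hw_module G W' emW' \<mu> w0'" using W' eq by simp
    obtain \<theta> where \<theta>: "bij_betw \<theta> (carrier W) (carrier W')"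
      "\<forall>v\<in>carrier W. \<forall>w\<in>carrier W. \<theta> (v \<oplus>\<^bsub>W\<^esub> w) = \<theta> v \<oplus>\<^bsub>W'\<^esub> \<theta> w"
      "\<forall>r. \<forall>v\<in>carrier W. \<theta> (r \<odot>\<^bsub>W\<^esub> v) = r \<odot>\<^bsub>W'\<^esub> \<theta> v"
      "\<forall>x. \<forall>v\<in>carrier W. \<theta> (act W x v) = act W' x (\<theta> v)"
      by (rule same_highest_weight_isomorphic[OF W W'])
    have "tensor_pair G (av_irreducible G lam l k c) emV lam l k c u W emW \<mu> w0 W' emW' w0' \<theta>"
      by (intro tensor_pair.intro tensor_pair_axioms.intro tensor_module.intro V W W' \<theta>)
    then show "isomorphic_reps (tensor_rep G lam l k c W a b) (tensor_rep G lam' l' k' c' W' a' b')"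
      unfolding tensor_rep_def Let_def eq by (rule tensor_pair_isomorphic)
  }
qed

end
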